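(* Let $L=\partial_t+A_1\partial_1+A_2\partial_2+A_3\partial_3$ be the Maxwell operator on $\mathbb R^{1+3}$ acting on $\mathbb C^3$-valued functions. Let $\sigma_j=\sigma_j(x_j)\in L^\infty(\mathbb R)$, $j=1,2,3$, vanish for $|x_j|\le L_j$, where $L_j>0$, and let $R:=\prod_j\{|x_j|\le L_j\}$. Then the system $$L(\partial_t,\partial_x)V+\Sigma^{(1)}V+\Sigma^{(2)}W=0,\qquad \partial_tW+\Sigma W-V=0$$ for $(V,W)$ valued in $\mathbb C^3\times\mathbb C^3$ is strongly well posed in $L^2(\mathbb R^3)$, and it is perfectly matched in the following sense: for sources $F$ supported in $\{t\ge0\}\times R$, if $(V,W)$ is the solution vanishing for $t<0$ of $LV+\Sigma^{(1)}V+\Sigma^{(2)}W=F$, $\partial_tW+\Sigma W-V=0$, then the function $U:=V-\Sigma W$ agrees in $\mathbb R_t\times R$ with the solution of Maxwell's equation $L\,\underline U=F$ vanishing for $t<0$.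
   Context: Maxwell matrices: $A_1=\begin{pmatrix}0&0&0\\0&0&-i\\0&i&0\end{pmatrix}$, $A_2=\begin{pmatrix}0&0&i\\0&0&0\\-i&0&0\end{pmatrix}$, $A_3=\begin{pmatrix}0&-i&0\\i&0&0\\0&0&0\end{pmatrix}$. The absorption coefficients satisfy $\sigma_j\ge 0$ and $\Sigma=\mathrm{diag}(\sigma_1,\sigma_2,\sigma_3)$, $\Sigma^{(1)}=\mathrm{diag}(\sigma_2+\sigma_3-\sigma_1,\ \sigma_3+\sigma_1-\sigma_2,\ \sigma_1+\sigma_2-\sigma_3)$, $\Sigma^{(2)}=\mathrm{diag}\big((\sigma_1-\sigma_2)(\sigma_1-\sigma_3),\ (\sigma_2-\sigma_1)(\sigma_2-\sigma_3),\ (\sigma_3-\sigma_1)(\sigma_3-\sigma_2)\big)$. Strongly well posed in $L^2$: there are $K,\alpha$ such that each initial value in $L^2(\mathbb R^3)$ yields a unique solution $(V,W)\in C([0,\infty[;L^2)$ with $\|(V,W)(t)\|_{L^2}\le Ke^{\alpha t}\|(V,W)(0)\|_{L^2}$ for $t\geq 0$. Sources are taken e.g. in $L^1_{loc}(\mathbb R_t;L^2(\mathbb R^3))$, with solutions in $C(\mathbb R_t;L^2(\mathbb R^3))$. *)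

theory Defs
  imports "HOL-Analysis.Analysis"
begin

text \<open>Elements of \<open>L\<^sup>2\<close> and \<open>L\<^sup>\<infinity>\<close> are represented by Borel functions; functions that agree
  almost everywhere represent the same element. For values in \<^typ>\<open>complex^3\<close> and
  \<^typ>\<open>(complex^3) \<times> (complex^3)\<close> the library norm is the Hermitian one.\<close>

definition Linfty :: "(real \<Rightarrow> real) \<Rightarrow> bool" where
  "Linfty f \<longleftrightarrow> f \<in> borel_measurable borel \<and> (\<exists>C. AE s in lborel. \<bar>f s\<bar> \<le> C)"

definition L2 :: "(real^3 \<Rightarrow> 'v::euclidean_space) \<Rightarrow> bool" where
  "L2 f \<longleftrightarrow> f \<in> borel_measurable borel \<and> integrable lborel (\<lambda>x. (norm (f x))\<^sup>2)"

definition L2_norm :: "(real^3 \<Rightarrow> 'v::euclidean_space) \<Rightarrow> real" where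
  "L2_norm f = sqrt (LINT x|lborel. (norm (f x))\<^sup>2)"

definition L2_continuous_on :: "real set \<Rightarrow> (real \<Rightarrow> real^3 \<Rightarrow> 'v::euclidean_space) \<Rightarrow> bool" where
  "L2_continuous_on I u \<longleftrightarrow>
     (\<forall>t\<in>I. L2 (u t)) \<and>
     (\<forall>t\<in>I. ((\<lambda>s. L2_norm (\<lambda>x. u s x - u t x)) \<longlongrightarrow> 0) (at t within I))"

text \<open>\<open>L\<^sup>1\<^sub>l\<^sub>o\<^sub>c(\<real>; L\<^sup>2)\<close>. Since \<open>L\<^sup>2\<close> is separable, every strongly measurable curve has
  a jointly measurable representative, and conversely.\<close>

definition L1_loc_L2 :: "(real \<Rightarrow> real^3 \<Rightarrow> 'v::euclidean_space) \<Rightarrow> bool" where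
  "L1_loc_L2 F \<longleftrightarrow>
     (\<lambda>(t, x). F t x) \<in> borel_measurable borel \<and>
     (AE t in lborel. L2 (F t)) \<and>
     (\<forall>a b. set_integrable lborel {a..b} (\<lambda>t. L2_norm (F t)))"

fun C_k :: "nat \<Rightarrow> (real \<times> (real^3) \<Rightarrow> real) \<Rightarrow> bool" where
  "C_k 0 f \<longleftrightarrow> continuous_on UNIV f"
| "C_k (Suc k) f \<longleftrightarrow>
     (\<forall>z. f differentiable (at z)) \<and> (\<forall>v. C_k k (\<lambda>z. frechet_derivative f (at z) v))"

definition test_functions :: "(real \<times> (real^3)) set \<Rightarrow> (real \<times> (real^3) \<Rightarrow> real) set" where
  "test_functions \<Omega> =
     {\<phi>. (\<forall>k. C_k k \<phi>) \<and> compact (closure {z. \<phi> z \<noteq> 0}) \<and> closure {z. \<phi> z \<noteq> 0} \<subseteq> \<Omega>}"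

text \<open>Vector-valued distributions, as functionals on real scalar test functions (complex test
  functions give nothing more, by linearity).\<close>

type_synonym distribution = "(real \<times> (real^3) \<Rightarrow> real) \<Rightarrow> complex^3"

text \<open>The integral is iterated because a curve in \<open>C(\<real>; L\<^sup>2)\<close>, given by a representative
  for each time, need not be jointly measurable.\<close>

definition distr_of :: "(real \<Rightarrow> real^3 \<Rightarrow> complex^3) \<Rightarrow> distribution" where
  "distr_of u \<phi> = (LINT t|lborel. (LINT x|lborel. \<phi> (t, x) *\<^sub>R u t x))"

definition dt :: "distribution \<Rightarrow> distribution" where
  "dt T \<phi> = - T (\<lambda>z. frechet_derivative \<phi> (at z) (1, 0))"

definition dx :: "3 \<Rightarrow> distribution \<Rightarrow> distribution" where
  "dx j T \<phi> = - T (\<lambda>z. frechet_derivative \<phi> (at z) (0, axis j 1))"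

definition A1 :: "complex^3^3" where
  "A1 = vector [vector [0, 0, 0], vector [0, 0, -\<i>], vector [0, \<i>, 0]]"

definition A2 :: "complex^3^3" where
  "A2 = vector [vector [0, 0, \<i>], vector [0, 0, 0], vector [-\<i>, 0, 0]]"

definition A3 :: "complex^3^3" where
  "A3 = vector [vector [0, -\<i>, 0], vector [\<i>, 0, 0], vector [0, 0, 0]]"

definition Maxwell_op :: "distribution \<Rightarrow> distribution" where
  "Maxwell_op T \<phi> = dt T \<phi> + A1 *v dx 1 T \<phi> + A2 *v dx 2 T \<phi> + A3 *v dx 3 T \<phi>"

definition diag3 :: "real \<Rightarrow> real \<Rightarrow> real \<Rightarrow> complex^3^3" where
  "diag3 a b c =
     vector [vector [of_real a, 0, 0], vector [0, of_real b, 0], vector [0, 0, of_real c]]"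

definition Sigma_mat :: "(3 \<Rightarrow> real \<Rightarrow> real) \<Rightarrow> real^3 \<Rightarrow> complex^3^3" where
  "Sigma_mat \<sigma> x = diag3 (\<sigma> 1 (x$1)) (\<sigma> 2 (x$2)) (\<sigma> 3 (x$3))"

definition Sigma1_mat :: "(3 \<Rightarrow> real \<Rightarrow> real) \<Rightarrow> real^3 \<Rightarrow> complex^3^3" where
  "Sigma1_mat \<sigma> x =
     (let s1 = \<sigma> 1 (x$1); s2 = \<sigma> 2 (x$2); s3 = \<sigma> 3 (x$3)
      in diag3 (s2 + s3 - s1) (s3 + s1 - s2) (s1 + s2 - s3))"

definition Sigma2_mat :: "(3 \<Rightarrow> real \<Rightarrow> real) \<Rightarrow> real^3 \<Rightarrow> complex^3^3" where
  "Sigma2_mat \<sigma> x =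
     (let s1 = \<sigma> 1 (x$1); s2 = \<sigma> 2 (x$2); s3 = \<sigma> 3 (x$3)
      in diag3 ((s1 - s2) * (s1 - s3)) ((s2 - s1) * (s2 - s3)) ((s3 - s1) * (s3 - s2)))"

text \<open>The two systems, in the sense of distributions on an open set \<open>\<Omega>\<close> of space-time. The unknown
  of the second one is \<open>u = (V, W)\<close>.\<close>

definition solves_Maxwell ::
  "(real \<times> (real^3)) set \<Rightarrow> (real \<Rightarrow> real^3 \<Rightarrow> complex^3) \<Rightarrow> (real \<Rightarrow> real^3 \<Rightarrow> complex^3) \<Rightarrow> bool" where
  "solves_Maxwell \<Omega> F U \<longleftrightarrow>
     (\<forall>\<phi>\<in>test_functions \<Omega>. Maxwell_op (distr_of U) \<phi> = distr_of F \<phi>)"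

definition solves_PML ::
  "(3 \<Rightarrow> real \<Rightarrow> real) \<Rightarrow> (real \<times> (real^3)) set \<Rightarrow> (real \<Rightarrow> real^3 \<Rightarrow> complex^3)
     \<Rightarrow> (real \<Rightarrow> real^3 \<Rightarrow> (complex^3) \<times> (complex^3)) \<Rightarrow> bool" where
  "solves_PML \<sigma> \<Omega> F u \<longleftrightarrow>
     (let V = (\<lambda>t x. fst (u t x)); W = (\<lambda>t x. snd (u t x))
      in \<forall>\<phi>\<in>test_functions \<Omega>.
           Maxwell_op (distr_of V) \<phi> + distr_of (\<lambda>t x. Sigma1_mat \<sigma> x *v V t x) \<phi>
             + distr_of (\<lambda>t x. Sigma2_mat \<sigma> x *v W t x) \<phi> = distr_of F \<phi> \<and>
           dt (distr_of W) \<phi> + distr_of (\<lambda>t x. Sigma_mat \<sigma> x *v W t x) \<phi> - distr_of V \<phi> = 0)"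

text \<open>The predicate \<open>S\<close> stands for an evolution system on \<open>t > 0\<close>. Uniqueness is in the whole
  class \<open>C([0,\<infinity>[; L\<^sup>2)\<close>, not only among solutions that satisfy the estimate.\<close>

definition strongly_well_posed_L2 ::
  "((real \<Rightarrow> real^3 \<Rightarrow> 'v::euclidean_space) \<Rightarrow> bool) \<Rightarrow> bool" where
  "strongly_well_posed_L2 S \<longleftrightarrow>
     (\<exists>K \<alpha>. \<forall>u0. L2 u0 \<longrightarrow>
        (\<exists>u. L2_continuous_on {0..} u \<and> S u \<and> (AE x in lborel. u 0 x = u0 x) \<and>
             (\<forall>t\<ge>0. L2_norm (u t) \<le> K * exp (\<alpha> * t) * L2_norm (u 0)) \<and>
             (\<forall>v. L2_continuous_on {0..} v \<and> S v \<and> (AE x in lborel. v 0 x = u0 x) \<longrightarrow>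
                  (\<forall>t\<ge>0. AE x in lborel. v t x = u t x))))"

definition causal_solution ::
  "((real \<Rightarrow> real^3 \<Rightarrow> 'v::euclidean_space) \<Rightarrow> bool) \<Rightarrow> (real \<Rightarrow> real^3 \<Rightarrow> 'v) \<Rightarrow> bool" where
  "causal_solution S u \<longleftrightarrow>
     L2_continuous_on UNIV u \<and> S u \<and> (\<forall>t<0. AE x in lborel. u t x = 0)"

text \<open>\<open>u\<close> represents \<^emph>\<open>the\<close> solution vanishing for \<open>t < 0\<close>.\<close>

definition is_the_causal_solution ::
  "((real \<Rightarrow> real^3 \<Rightarrow> 'v::euclidean_space) \<Rightarrow> bool) \<Rightarrow> (real \<Rightarrow> real^3 \<Rightarrow> 'v) \<Rightarrow> bool" where
  "is_the_causal_solution S u \<longleftrightarrow>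
     causal_solution S u \<and>
     (\<forall>v. causal_solution S v \<longrightarrow> (\<forall>t. AE x in lborel. v t x = u t x))"

definition region_R :: "(3 \<Rightarrow> real) \<Rightarrow> (real^3) set" where
  "region_R L = {x. \<forall>j. \<bar>x$j\<bar> \<le> L j}"

definition supported_in ::
  "(real \<times> (real^3)) set \<Rightarrow> (real \<Rightarrow> real^3 \<Rightarrow> complex^3) \<Rightarrow> bool" where
  "supported_in Z F \<longleftrightarrow> (AE z in lborel. z \<notin> Z \<longrightarrow> F (fst z) (snd z) = 0)"

text \<open>The first two conjuncts express that the definite descriptions in the third one denote.\<close>

definition perfectly_matched :: "(3 \<Rightarrow> real \<Rightarrow> real) \<Rightarrow> (3 \<Rightarrow> real) \<Rightarrow> bool" where
  "perfectly_matched \<sigma> L \<longleftrightarrow>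
     (\<forall>F. L1_loc_L2 F \<and> supported_in ({0..} \<times> region_R L) F \<longrightarrow>
        (\<exists>u. is_the_causal_solution (solves_PML \<sigma> UNIV F) u) \<and>
        (\<exists>U. is_the_causal_solution (solves_Maxwell UNIV F) U) \<and>
        (\<forall>u U. is_the_causal_solution (solves_PML \<sigma> UNIV F) u \<and>
               is_the_causal_solution (solves_Maxwell UNIV F) U \<longrightarrow>
           (\<forall>t. AE x in lborel. x \<in> region_R L \<longrightarrow>
                  fst (u t x) - Sigma_mat \<sigma> x *v snd (u t x) = U t x)))"

end

theory Submission
  imports Defs
begin

text \<open>The Maxwell operator and the split system are symmetric hyperbolic with constant coefficients, up to
  the bounded operator \<open>B\<close> that multiplies by the absorption matrices. Central differences approximate the
  spatial part by bounded skew operators, whose exponentials converge to a unitary group; Duhamel's formula with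
  \<open>B\<close> as perturbation then gives existence, the energy estimate and, by testing with tensor products, uniqueness
  of distributional solutions. For the matching property both solutions are Laplace transformed in time. At
  frequency \<open>\<tau>\<close> the stretched coordinates \<open>X\<^sub>j = x\<^sub>j + (1 / \<tau>) \<integral>\<^sub>0 \<sigma>\<^sub>j\<close> turn a solution \<open>\<psi>\<close> of the
  stationary Maxwell system into the solution \<open>V = diag (X\<^sub>j') \<psi> \<circ> X\<close>, \<open>W = (1 / \<tau>) \<psi> \<circ> X\<close> of the stationary
  split system; as \<open>X\<close> is the identity on the region without absorption, the transforms agree there for all large
  \<open>\<tau>\<close>, and injectivity of the Laplace transform concludes.\<close>

subsection \<open>Bounded operators as a Banach algebra\<close>

text \<open>The absorption coefficients are merely bounded, so a test function composed with X need
  not be smooth. The stretched field is therefore never differentiated: it is tested against tensor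
  products, where each integration by parts takes place in one variable and rests on the chain rule
  for the primitive of a bounded function. Such tests suffice because the span of tensor products is
  dense and the closure of the graph of the generator over it contains the orbits of that span. The
  stationary split system has at most one solution for \<tau> > \<open>norm B\<close>: a null
  solution y would give the evolution exp (\<tau> t) y, which grows too fast. This identifies the
  explicit stretched field with the transform of the causal solution. All \<tau> are real, so X is a
  real change of variables. Sources are only locally integrable in time, hence they are cut off
  after the time of interest before they are transformed, which alters nothing earlier. On the
  region without absorption \<Sigma> vanishes, so V - \<Sigma> W is V there.\<close>

typedef (overloaded) 'a endo = "UNIV :: ('a::real_normed_vector \<Rightarrow>\<^sub>L 'a) set"
  morphisms endo_blinfun Endo by simp

setup_lifting type_definition_endo

text \<open>Equal domain and codomain in one type constructor allow instances of
  \<open>real_normed_algebra_1\<close> and \<open>banach\<close>, and with them \<open>exp\<close>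
  of an operator.\<close>

instantiation endo :: (real_normed_vector) real_normed_vector
begin
lift_definition norm_endo :: "'a endo \<Rightarrow> real" is norm .
lift_definition zero_endo :: "'a endo" is 0 .
lift_definition plus_endo :: "'a endo \<Rightarrow> 'a endo \<Rightarrow> 'a endo" is "(+)" .
lift_definition minus_endo :: "'a endo \<Rightarrow> 'a endo \<Rightarrow> 'a endo" is "(-)" .
lift_definition uminus_endo :: "'a endo \<Rightarrow> 'a endo" is uminus .
lift_definition scaleR_endo :: "real \<Rightarrow> 'a endo \<Rightarrow> 'a endo" is scaleR .
definition dist_endo :: "'a endo \<Rightarrow> 'a endo \<Rightarrow> real" where "dist_endo a b = norm (a - b)"
definition sgn_endo :: "'a endo \<Rightarrow> 'a endo" where "sgn_endo x = scaleR (inverse (norm x)) x"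
definition uniformity_endo :: "('a endo \<times> 'a endo) filter" where
  "uniformity_endo = (INF e\<in>{0 <..}. principal {(x, y). dist x y < e})"
definition open_endo :: "'a endo set \<Rightarrow> bool" where
  "open_endo S = (\<forall>x\<in>S. \<forall>\<^sub>F (x', y) in uniformity. x' = x \<longrightarrow> y \<in> S)"
instance
  by standard
     (simp_all add: dist_endo_def sgn_endo_def uniformity_endo_def open_endo_def,
      (transfer; simp add: algebra_simps norm_triangle_ineq)+)
end

lift_definition ap :: "'a::real_normed_vector endo \<Rightarrow> 'a \<Rightarrow> 'a" is blinfun_apply .

lemma endo_eqI: "(\<And>v. ap x v = ap y v) \<Longrightarrow> x = y"
  by transfer (rule blinfun_eqI)

text \<open>\<open>perfect_space\<close> excludes the zero space, on which the identity would have
  norm 0.\<close>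

instantiation endo :: ("{real_normed_vector, perfect_space}") real_normed_algebra_1
begin
lift_definition one_endo :: "'a endo" is id_blinfun .
lift_definition times_endo :: "'a endo \<Rightarrow> 'a endo \<Rightarrow> 'a endo" is blinfun_compose .
instance
proof
  fix a b c :: "'a endo" and r :: real
  show "a * b * c = a * (b * c)" by transfer (simp add: blinfun_eqI)
  show "(a + b) * c = a * c + b * c" by transfer (simp add: blinfun_eqI blinfun.bilinear_simps)
  show "a * (b + c) = a * b + a * c" by transfer (simp add: blinfun_eqI blinfun.bilinear_simps)
  show "r *\<^sub>R a * b = r *\<^sub>R (a * b)" by transfer (simp add: blinfun_eqI blinfun.bilinear_simps)
  show "a * r *\<^sub>R b = r *\<^sub>R (a * b)" by transfer (simp add: blinfun_eqI blinfun.bilinear_simps)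
  show "1 * a = a" by transfer (simp add: blinfun_eqI)
  show "a * 1 = a" by transfer (simp add: blinfun_eqI)
  show "norm (1 :: 'a endo) = 1" by transfer simp
  show "norm (a * b) \<le> norm a * norm b" by transfer (rule norm_blinfun_compose)
  have "norm (1 :: 'a endo) = 1" by transfer simp
  thus "(0 :: 'a endo) \<noteq> 1" by (metis norm_zero zero_neq_one)
qed
end

instance endo :: (banach) banach
proof
  fix X :: "nat \<Rightarrow> 'a endo" assume X: "Cauchy X"
  have d: "dist (endo_blinfun x) (endo_blinfun y) = dist x y" for x y :: "'a endo"
    unfolding dist_norm by transfer simp
  have "Cauchy (\<lambda>n. endo_blinfun (X n))"
    using X unfolding Cauchy_def d .
  then obtain l where "(\<lambda>n. endo_blinfun (X n)) \<longlonglongrightarrow> l"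
    using Cauchy_convergent_iff convergent_def by blast
  hence "X \<longlonglongrightarrow> Endo l"
    unfolding tendsto_iff d[symmetric] by (simp add: Endo_inverse)
  thus "convergent X" by (rule convergentI)
qed

lemma ap_simps [simp]:
  "ap (x + y) v = ap x v + ap y v" "ap (x - y) v = ap x v - ap y v" "ap (- x) v = - ap x v"
  "ap 0 v = 0" "ap (r *\<^sub>R x) v = r *\<^sub>R ap x v"
  by (transfer; simp add: blinfun.bilinear_simps)+

lemma ap_mult [simp]: "ap (x * y) v = ap x (ap y v)"
  by transfer simp

lemma ap_one [simp]: "ap 1 v = v"
  by transfer simp

lemma norm_ap: "norm (ap x v) \<le> norm x * norm v"
  by transfer (rule norm_blinfun)

lemma bounded_linear_ap [simp]: "bounded_linear (ap x)"
  by transfer (rule blinfun.bounded_linear_right)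

lemma bounded_bilinear_ap: "bounded_bilinear ap"
proof
  show "\<exists>K. \<forall>a b. norm (ap a b) \<le> norm a * norm b * K" for a :: "'a"
    using norm_ap by (metis mult.right_neutral)
qed (simp_all add: linear_simps(1,5))

lemmas ap_linear [simp] = linear_simps[OF bounded_linear_ap]

lemma bounded_linear_ap_left: "bounded_linear (\<lambda>x. ap x v)"
  by (rule bounded_bilinear.bounded_linear_left[OF bounded_bilinear_ap])

lemma ap_sum: "ap (\<Sum>i\<in>I. f i) v = (\<Sum>i\<in>I. ap (f i) v)"
  by (induction I rule: infinite_finite_induct) auto
lemma tendsto_ap [tendsto_intros]: "(f \<longlongrightarrow> l) F \<Longrightarrow> ((\<lambda>n. ap x (f n)) \<longlongrightarrow> ap x l) F"
  by (rule bounded_linear.tendsto[OF bounded_linear_ap])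

definition op :: "('a::real_normed_vector \<Rightarrow> 'a) \<Rightarrow> 'a endo" where
  "op f = Endo (Blinfun f)"

lemma ap_op [simp]: "bounded_linear f \<Longrightarrow> ap (op f) = f"
  unfolding op_def by (simp add: ap.rep_eq Endo_inverse bounded_linear_Blinfun_apply)

lemma exp_commute:
  fixes A B :: "'a::{real_normed_algebra_1,banach}"
  assumes "B * A = A * B"
  shows "B * exp A = exp A * B"
proof -
  have p: "B * A ^ n = A ^ n * B" for n
    by (induction n) (simp_all add: assms power_commutes mult.assoc[symmetric], metis assms mult.assoc power_commutes)
  have "(\<lambda>n. B * (A^n /\<^sub>R fact n)) sums (B * exp A)"
    by (intro sums_mult exp_converges)
  moreover have "(\<lambda>n. (A^n /\<^sub>R fact n) * B) sums (exp A * B)"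
    by (intro sums_mult2 exp_converges)
  ultimately show ?thesis using p by (simp add: sums_unique2)
qed

subsection \<open>The unitary group\<close>

text \<open>\<open>D n j\<close> plays the role of a bounded skew approximation of the j-th partial
  derivative, \<open>S j\<close> that of the symmetric coefficient of this direction. Commutation
  across different n and m makes the difference of two approximate groups controllable by
  differences of \<open>D n j x\<close>. Invariance of \<open>core\<close> lets Taylor polynomials
  of the exponentials act on it.\<close>

locale skew_approx =
  fixes D :: "nat \<Rightarrow> 'j::finite \<Rightarrow> 'h::{real_inner,banach,second_countable_topology,perfect_space} endo"
    and S :: "'j \<Rightarrow> 'h endo" and core :: "'h set"
  assumes comm_T: "D n j * D m k = D m k * D n j"
    and comm_aT: "S j * D n k = D n k * S j"
    and skew_T: "ap (D n j) x \<bullet> y = - (x \<bullet> ap (D n j) y)"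
    and sym_a: "ap (S j) x \<bullet> y = x \<bullet> ap (S j) y"
    and subspace_core: "subspace core"
    and dense_core: "closure core = UNIV"
    and core_T: "x \<in> core \<Longrightarrow> ap (D n j) x \<in> core"
    and core_a: "x \<in> core \<Longrightarrow> ap (S j) x \<in> core"
    and core_conv: "x \<in> core \<Longrightarrow> convergent (\<lambda>n. ap (D n j) x)"
begin

definition A :: "nat \<Rightarrow> 'h endo" where "A n = - (\<Sum>j\<in>UNIV. S j * D n j)"

text \<open>Convergence is demanded for each direction separately and not only for
  \<open>A n x\<close>, because the estimate that compares two approximate groups is a sum over
  directions.\<close>

definition dom :: "'h set" where "dom = {x. \<forall>j. convergent (\<lambda>n. ap (D n j) x)}"

definition d :: "'j \<Rightarrow> 'h \<Rightarrow> 'h" where "d j x = lim (\<lambda>n. ap (D n j) x)"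

definition A0 :: "'h \<Rightarrow> 'h" where "A0 x = - (\<Sum>j\<in>UNIV. ap (S j) (d j x))"

definition E :: "nat \<Rightarrow> real \<Rightarrow> 'h \<Rightarrow> 'h" where "E n t = ap (exp (t *\<^sub>R A n))"

definition G :: "real \<Rightarrow> 'h \<Rightarrow> 'h" where "G t x = lim (\<lambda>n. E n t x)"

lemma core_dom: "x \<in> core \<Longrightarrow> x \<in> dom"
  using core_conv by (simp add: dom_def)

lemma D_tendsto: "x \<in> dom \<Longrightarrow> (\<lambda>n. ap (D n j) x) \<longlonglongrightarrow> d j x"
  unfolding dom_def d_def using convergent_LIMSEQ_iff by blast

lemma A_apply: "ap (A n) x = - (\<Sum>j\<in>UNIV. ap (S j) (ap (D n j) x))"
  by (simp add: A_def ap_sum)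

lemma A_tendsto: "x \<in> dom \<Longrightarrow> (\<lambda>n. ap (A n) x) \<longlonglongrightarrow> A0 x"
  unfolding A_apply A0_def by (intro tendsto_intros D_tendsto)

lemma dI: "(\<lambda>n. ap (D n j) x) \<longlonglongrightarrow> y \<Longrightarrow> d j x = y"
  unfolding d_def by (rule limI)

lemma domI: "(\<And>j. (\<lambda>n. ap (D n j) x) \<longlonglongrightarrow> y j) \<Longrightarrow> x \<in> dom"
  unfolding dom_def by (auto intro: convergentI)

text \<open>The product of a symmetric and a skew operator that commute is skew.\<close>

lemma skew_A: "ap (A n) x \<bullet> y = - (x \<bullet> ap (A n) y)"
proof -
  have "ap (S j) (ap (D n j) x) \<bullet> y = - (x \<bullet> ap (S j) (ap (D n j) y))" for j
  proof -
    have "ap (S j) (ap (D n j) x) \<bullet> y = - (x \<bullet> ap (D n j) (ap (S j) y))"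
      by (simp add: sym_a skew_T)
    also have "ap (D n j) (ap (S j) y) = ap (S j) (ap (D n j) y)"
      using comm_aT[of j n j] by (metis ap_mult)
    finally show ?thesis .
  qed
  thus ?thesis by (simp add: A_apply inner_sum_left inner_sum_right sum_negf)
qed

lemma skew_A0: "x \<in> dom \<Longrightarrow> y \<in> dom \<Longrightarrow> A0 x \<bullet> y = - (x \<bullet> A0 y)"
proof -
  assume x: "x \<in> dom" and y: "y \<in> dom"
  have "(\<lambda>n. ap (A n) x \<bullet> y) \<longlonglongrightarrow> A0 x \<bullet> y" by (intro tendsto_intros A_tendsto x)
  moreover have "(\<lambda>n. ap (A n) x \<bullet> y) \<longlonglongrightarrow> - (x \<bullet> A0 y)"
    unfolding skew_A by (intro tendsto_intros A_tendsto y)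
  ultimately show ?thesis by (rule LIMSEQ_unique)
qed

lemma comm_TA: "D m k * A n = A n * D m k"
proof -
  have "D m k * (S j * D n j) = (S j * D n j) * D m k" for j
    by (metis comm_T comm_aT mult.assoc)
  thus ?thesis by (simp add: A_def sum_distrib_left sum_distrib_right)
qed

lemma E_0 [simp]: "E n 0 x = x"
  by (simp add: E_def)

lemma E_add: "E n (s + t) x = E n s (E n t x)"
  unfolding E_def by (subst scaleR_add_left, subst exp_add_commuting) simp_all

lemma E_deriv: "((\<lambda>t. E n t x) has_vector_derivative E n t (ap (A n) x)) (at t)"
  using bounded_linear.has_vector_derivative[OF bounded_linear_ap_left
      exp_scaleR_has_vector_derivative_right[of "A n" t UNIV], of x]
  by (simp add: E_def)

lemma E_A: "E n t (ap (A n) x) = ap (A n) (E n t x)"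
  using exp_times_scaleR_commute[of t "A n"] unfolding E_def by (metis ap_mult)

lemma E_T: "E n t (ap (D m j) x) = ap (D m j) (E n t x)"
proof -
  have "D m j * exp (t *\<^sub>R A n) = exp (t *\<^sub>R A n) * D m j"
    by (rule exp_commute) (simp add: comm_TA)
  thus ?thesis unfolding E_def by (metis ap_mult)
qed

lemma E_inner: "E n t x \<bullet> E n t y = x \<bullet> y"
proof -
  have "((\<lambda>t. E n t x \<bullet> E n t y) has_real_derivative 0) (at s)" for s
    unfolding has_real_derivative_iff_has_vector_derivative
    by (rule has_vector_derivative_eq_rhs,
        rule bounded_bilinear.has_vector_derivative[OF bounded_bilinear_inner E_deriv E_deriv])
       (simp add: E_A skew_A)
  from DERIV_const_ratio_const2[of 0 t "\<lambda>t. E n t x \<bullet> E n t y", OF _ this] show ?thesis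
    by (cases "t = 0") auto
qed

lemma E_norm [simp]: "norm (E n t x) = norm x"
  by (simp add: norm_eq_sqrt_inner E_inner)

lemma bounded_linear_E: "bounded_linear (E n t)"
  by (simp add: E_def)

lemmas E_linear [simp] = linear_simps[OF bounded_linear_E]

text \<open>Duhamel comparison: along s the product of \<open>exp ((t - s) A n)\<close> and
  \<open>exp (s A m)\<close> moves from one group to the other, and its derivative contains
  \<open>A m - A n\<close>. The operators D commute with the groups, so they can be moved onto x;
  isometry then removes the groups, and no uniform bound on the norms of \<open>D n j\<close>
  enters.\<close>

lemma E_diff:
  "norm (E n t x - E m t x) \<le>
     \<bar>t\<bar> * (\<Sum>j\<in>UNIV. norm (S j) * norm (ap (D n j) x - ap (D m j) x))"
    (is "_ \<le> _ * ?B")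
proof -
  define r where "r s = exp ((t - s) *\<^sub>R A n) * exp (s *\<^sub>R A m)" for s
  have 1: "((\<lambda>s. exp ((t - s) *\<^sub>R A n)) has_vector_derivative - (exp ((t - s) *\<^sub>R A n) * A n)) (at s)" for s
  proof -
    have "((\<lambda>s. t - s) has_vector_derivative - 1) (at s)"
      by (auto intro!: derivative_eq_intros)
    from vector_diff_chain_at[OF this exp_scaleR_has_vector_derivative_right[of "A n" "t - s" UNIV]]
    show ?thesis by (simp add: o_def)
  qed
  have 2: "(r has_vector_derivative exp ((t - s) *\<^sub>R A n) * (A m - A n) * exp (s *\<^sub>R A m)) (at s)" for s
    unfolding r_def
    by (rule has_vector_derivative_eq_rhs, rule has_vector_derivative_mult[OF 1 exp_scaleR_has_vector_derivative_left])
       (simp add: algebra_simps)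
  have 3: "((\<lambda>s. ap (r s) x) has_vector_derivative E n (t - s) (ap (A m - A n) (E m s x))) (at s)" for s
    using bounded_linear.has_vector_derivative[OF bounded_linear_ap_left 2, of x s] by (simp add: E_def)
  have 4: "norm (E n (t - s) (ap (A m - A n) (E m s x))) \<le> ?B" for s
  proof -
    have "ap (A m - A n) (E m s x) = (\<Sum>j\<in>UNIV. ap (S j) (E m s (ap (D n j) x - ap (D m j) x)))"
      by (simp add: A_apply E_T sum_subtractf)
    also have "norm \<dots> \<le> ?B"
      by (rule order_trans[OF norm_sum], intro sum_mono, rule order_trans[OF norm_ap]) (metis E_norm order_refl)
    finally show ?thesis by (simp only: E_norm)
  qed
  have "norm (ap (r 0) x - ap (r t) x) \<le> ?B * norm (0 - t)"
  proof (rule differentiable_bound[where S = UNIV])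
    fix s
    show "((\<lambda>s. ap (r s) x) has_derivative (\<lambda>h. h *\<^sub>R E n (t - s) (ap (A m - A n) (E m s x)))) (at s within UNIV)"
      using 3 unfolding has_vector_derivative_def by blast
    have "norm (h *\<^sub>R E n (t - s) (ap (A m - A n) (E m s x))) \<le> ?B * norm h" for h
      using 4[of s] by (simp add: mult.commute mult_left_mono)
    thus "onorm (\<lambda>h. h *\<^sub>R E n (t - s) (ap (A m - A n) (E m s x))) \<le> ?B"
      by (rule onorm_bound[rotated]) (intro sum_nonneg, simp)
  qed simp_all
  thus ?thesis by (simp add: r_def E_def mult.commute)
qed

lemma E_convergent_dom: "x \<in> dom \<Longrightarrow> convergent (\<lambda>n. E n t x)"
proof -
  assume x: "x \<in> dom"
  define b where "b n m = \<bar>t\<bar> * (\<Sum>j\<in>UNIV. norm (S j) * norm (ap (D n j) x - ap (D m j) x))" for n m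
  have "Cauchy (\<lambda>n. E n t x)"
  proof (rule metric_CauchyI)
    fix e :: real assume e: "e > 0"
    have "\<forall>j. \<exists>N. \<forall>n\<ge>N. norm (ap (D n j) x - d j x) < e / (2 * (1 + \<bar>t\<bar>) * (1 + (\<Sum>j\<in>UNIV. norm (S j))))"
    proof
      fix j
      have s: "(\<Sum>j\<in>UNIV. norm (S j)) \<ge> 0" by (simp add: sum_nonneg)
      show "\<exists>N. \<forall>n\<ge>N. norm (ap (D n j) x - d j x) < e / (2 * (1 + \<bar>t\<bar>) * (1 + (\<Sum>j\<in>UNIV. norm (S j))))"
        using LIMSEQ_D[OF D_tendsto[OF x, of j]] e s by (simp add: add_pos_nonneg)
    qed
    then obtain N where N: "\<And>j n. n \<ge> N j \<Longrightarrow>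
       norm (ap (D n j) x - d j x) < e / (2 * (1 + \<bar>t\<bar>) * (1 + (\<Sum>j\<in>UNIV. norm (S j))))"
      by metis
    define M where "M = Max (range N)"
    have M: "N j \<le> M" for j unfolding M_def by simp
    define s where "s = (\<Sum>j\<in>UNIV. norm (S j))"
    have s: "s \<ge> 0" unfolding s_def by (simp add: sum_nonneg)
    \<comment> \<open>Each tolerance in the choice of N is half of this; the summands 1 keep the
      denominator positive when t or all \<open>S j\<close> vanish.\<close>
    define \<epsilon> where "\<epsilon> = e / ((1 + \<bar>t\<bar>) * (1 + s))"
    have \<epsilon>: "\<epsilon> > 0" unfolding \<epsilon>_def using e s by (simp add: add_pos_nonneg)
    have "dist (E m t x) (E n t x) < e" if "m \<ge> M" "n \<ge> M" for m n
    proof -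
      have "norm (ap (D m j) x - ap (D n j) x) \<le> \<epsilon>" for j
      proof -
        have "norm (ap (D m j) x - d j x) < \<epsilon> / 2" "norm (ap (D n j) x - d j x) < \<epsilon> / 2"
          using N[of j m] N[of j n] M[of j] that by (auto simp: \<epsilon>_def s_def mult.assoc field_simps)
        thus ?thesis by norm
      qed
      hence "(\<Sum>j\<in>UNIV. norm (S j) * norm (ap (D m j) x - ap (D n j) x)) \<le> s * \<epsilon>"
        unfolding s_def sum_distrib_right by (intro sum_mono mult_left_mono) auto
      hence "dist (E m t x) (E n t x) \<le> \<bar>t\<bar> * (s * \<epsilon>)"
        unfolding dist_norm by (intro order_trans[OF E_diff] mult_left_mono) auto
      also have "\<dots> < (1 + \<bar>t\<bar>) * (1 + s) * \<epsilon>"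
        using \<epsilon> s by (simp add: algebra_simps add_pos_nonneg)
      also have "\<dots> = e" using s by (simp add: \<epsilon>_def add_nonneg_eq_0_iff)
      finally show ?thesis .
    qed
    thus "\<exists>M. \<forall>m\<ge>M. \<forall>n\<ge>M. dist (E m t x) (E n t x) < e" by blast
  qed
  thus ?thesis by (simp add: Cauchy_convergent)
qed

lemma core_approx: "e > 0 \<Longrightarrow> \<exists>y\<in>core. norm (x - y) < e"
  using closure_approachable[of x core] by (simp add: dense_core) (metis dist_commute dist_norm)

text \<open>All \<open>E n t\<close> are isometries, so convergence on the dense core carries over
  to every x.\<close>

lemma E_tendsto: "(\<lambda>n. E n t x) \<longlonglongrightarrow> G t x"
proof -
  have "Cauchy (\<lambda>n. E n t x)"
  proof (rule metric_CauchyI)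
    fix e :: real assume e: "e > 0"
    obtain y where y: "y \<in> core" "norm (x - y) < e / 4" using core_approx[of "e/4" x] e by force
    obtain M where M: "\<And>m n. m \<ge> M \<Longrightarrow> n \<ge> M \<Longrightarrow> dist (E m t y) (E n t y) < e / 4"
      using convergent_Cauchy[OF E_convergent_dom[OF core_dom[OF y(1)], of t]] e
      unfolding Cauchy_def by (metis divide_pos_pos zero_less_numeral)
    have "dist (E m t x) (E n t x) < e" if "m \<ge> M" "n \<ge> M" for m n
    proof -
      have "norm (E m t x - E m t y) < e / 4" "norm (E n t x - E n t y) < e / 4"
        using y(2) by (metis E_linear(2) E_norm)+
      moreover have "norm (E m t y - E n t y) < e / 4" using M[OF that] by (simp add: dist_norm)
      ultimately show ?thesis unfolding dist_norm by norm
    qed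
    thus "\<exists>M. \<forall>m\<ge>M. \<forall>n\<ge>M. dist (E m t x) (E n t x) < e" by blast
  qed
  thus ?thesis unfolding G_def by (simp add: Cauchy_convergent convergent_LIMSEQ_iff[symmetric])
qed

text \<open>Isometry makes the limit insensitive to replacing x by arguments that converge to
  it.\<close>

lemma E_tendsto_seq: "y \<longlonglongrightarrow> x \<Longrightarrow> (\<lambda>n. E n t (y n)) \<longlonglongrightarrow> G t x"
proof -
  assume y: "y \<longlonglongrightarrow> x"
  have "(\<lambda>n. norm (y n - x)) \<longlonglongrightarrow> 0" using y by (simp add: LIM_zero tendsto_norm_zero)
  hence "(\<lambda>n. norm (E n t (y n) - E n t x)) \<longlonglongrightarrow> 0" by (simp flip: E_linear)
  hence "(\<lambda>n. E n t (y n) - E n t x + E n t x) \<longlonglongrightarrow> 0 + G t x"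
    by (intro tendsto_add E_tendsto) (rule tendsto_norm_zero_cancel)
  thus ?thesis by simp
qed

lemma G_inner: "G t x \<bullet> G t y = x \<bullet> y"
  using tendsto_inner[OF E_tendsto[of t x] E_tendsto[of t y]] by (simp add: E_inner LIMSEQ_const_iff)

lemma G_norm [simp]: "norm (G t x) = norm x"
  by (simp add: norm_eq_sqrt_inner G_inner)

lemma G_0 [simp]: "G 0 x = x"
  using E_tendsto[of 0 x] by (simp add: LIMSEQ_const_iff)

lemma G_add: "G (s + t) x = G s (G t x)"
proof -
  have "(\<lambda>n. E n s (E n t x)) \<longlonglongrightarrow> G s (G t x)" by (rule E_tendsto_seq[OF E_tendsto])
  thus ?thesis using E_tendsto[of "s + t" x] by (simp add: E_add LIMSEQ_unique)
qed

lemma bounded_linear_G: "bounded_linear (G t)"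
proof (rule bounded_linear_intro[where K = 1])
  fix x y and r :: real
  show "G t (x + y) = G t x + G t y"
    using E_tendsto[of t "x + y"] tendsto_add[OF E_tendsto[of t x] E_tendsto[of t y]]
    by (simp add: LIMSEQ_unique)
  show "G t (r *\<^sub>R x) = r *\<^sub>R G t x"
    using E_tendsto[of t "r *\<^sub>R x"] tendsto_scaleR[OF tendsto_const[of r] E_tendsto[of t x]]
    by (simp add: LIMSEQ_unique)
qed simp

lemmas G_linear [simp] = linear_simps[OF bounded_linear_G]

lemma G_inverse [simp]: "G (- t) (G t x) = x" "G t (G (- t) x) = x"
  by (simp_all flip: G_add)

lemma G_adj: "G t x \<bullet> y = x \<bullet> G (- t) y"
  by (metis G_inner G_inverse(2))

lemma E_lipschitz: "norm (E n t x - E n s x) \<le> norm (ap (A n) x) * \<bar>t - s\<bar>"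
proof -
  have "norm (E n t x - E n s x) \<le> norm (ap (A n) x) * norm (t - s)"
  proof (rule differentiable_bound[where S = UNIV])
    fix r
    show "((\<lambda>s. E n s x) has_derivative (\<lambda>h. h *\<^sub>R E n r (ap (A n) x))) (at r within UNIV)"
      using E_deriv unfolding has_vector_derivative_def by blast
    show "onorm (\<lambda>h. h *\<^sub>R E n r (ap (A n) x)) \<le> norm (ap (A n) x)"
      by (rule onorm_bound) (simp_all add: mult.commute)
  qed simp_all
  thus ?thesis by simp
qed

lemma G_lipschitz: "x \<in> dom \<Longrightarrow> norm (G t x - G s x) \<le> norm (A0 x) * \<bar>t - s\<bar>"
  by (rule tendsto_le[OF _ tendsto_mult_right[OF tendsto_norm[OF A_tendsto]]
      tendsto_norm[OF tendsto_diff[OF E_tendsto E_tendsto]]])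
     (auto intro: always_eventually E_lipschitz)

text \<open>The group is isometric in x and, on the core, Lipschitz in time with constant
  \<open>norm (A0 y)\<close>; hence x is first replaced by a nearby y of the core.\<close>

lemma continuous_G: "continuous_on UNIV (\<lambda>z. G (fst z) (snd z))"
proof -
  have "\<exists>\<delta>>0. \<forall>z. dist z (t, x) < \<delta> \<longrightarrow> dist (G (fst z) (snd z)) (G t x) < e" if e: "e > 0" for t x and e :: real
  proof -
    obtain y where y: "y \<in> core" "norm (x - y) < e / 8" using core_approx[of "e/8" x] e by force
    define \<delta> where "\<delta> = min (e / 8) (e / (8 * (1 + norm (A0 y))))"
    have \<delta>: "\<delta> > 0" using e by (simp add: \<delta>_def add_pos_nonneg)
    have "dist (G (fst z) (snd z)) (G t x) < e" if z: "dist z (t, x) < \<delta>" for z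
    proof -
      obtain s w where [simp]: "z = (s, w)" by fastforce
      have "\<bar>s - t\<bar> < \<delta>" using dist_fst_le[of z "(t, x)"] z by (simp add: dist_real_def)
      hence s: "norm (A0 y) * \<bar>s - t\<bar> \<le> e / 8"
      proof -
        have "norm (A0 y) * \<bar>s - t\<bar> \<le> (1 + norm (A0 y)) * (e / (8 * (1 + norm (A0 y))))"
          using \<open>\<bar>s - t\<bar> < \<delta>\<close> by (intro mult_mono) (auto simp: \<delta>_def)
        also have "\<dots> = e / 8"
          using norm_ge_zero[of "A0 y"] by (simp add: field_simps add_nonneg_eq_0_iff)
        finally show ?thesis .
      qed
      have "norm (w - x) < e / 8" using dist_snd_le[of z "(t, x)"] z by (simp add: dist_norm \<delta>_def)
      hence "norm (w - y) < e / 4" using y(2) by norm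
      hence "norm (G s w - G s y) < e / 4" by (metis G_linear(2) G_norm)
      moreover have "norm (G s y - G t y) \<le> e / 8"
        using G_lipschitz[OF core_dom[OF y(1)], of s t] s by linarith
      moreover have "norm (G t x - G t y) < e / 8" using y(2) by (metis G_linear(2) G_norm)
      ultimately show ?thesis unfolding dist_norm using e by simp norm
    qed
    thus ?thesis using \<delta> by blast
  qed
  thus ?thesis unfolding continuous_on_iff by (metis UNIV_I prod.collapse)
qed

lemma continuous_on_G [continuous_intros]:
  "continuous_on X \<tau> \<Longrightarrow> continuous_on X f \<Longrightarrow> continuous_on X (\<lambda>t. G (\<tau> t) (f t))"
  using continuous_on_compose2[OF continuous_G continuous_on_Pair[of X \<tau> f]] by simp

lemma measurable_G [measurable (raw)]:
  "\<tau> \<in> borel_measurable M \<Longrightarrow> f \<in> borel_measurable M \<Longrightarrow> (\<lambda>t. G (\<tau> t) (f t)) \<in> borel_measurable M"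
  using borel_measurable_continuous_Pair[of \<tau> M f "\<lambda>x y. G x y"] continuous_G by (simp add: case_prod_beta')

lemma G_dom:
  assumes x: "x \<in> dom" 
  shows "(\<lambda>n. E n t (ap (A n) x)) \<longlonglongrightarrow> G t (A0 x)" "G t (A0 x) = - (\<Sum>j\<in>UNIV. ap (S j) (G t (d j x)))"
proof -
  show 1: "(\<lambda>n. E n t (ap (A n) x)) \<longlonglongrightarrow> G t (A0 x)"
    by (rule E_tendsto_seq[OF A_tendsto[OF x]])
  have "E n t (ap (A n) x) = - (\<Sum>j\<in>UNIV. ap (S j) (E n t (ap (D n j) x)))" for n
    unfolding E_A unfolding A_apply E_T ..
  moreover have "(\<lambda>n. - (\<Sum>j\<in>UNIV. ap (S j) (E n t (ap (D n j) x)))) \<longlonglongrightarrow> - (\<Sum>j\<in>UNIV. ap (S j) (G t (d j x)))"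
    by (intro tendsto_intros E_tendsto_seq D_tendsto x)
  ultimately show "G t (A0 x) = - (\<Sum>j\<in>UNIV. ap (S j) (G t (d j x)))"
    using 1 LIMSEQ_unique by simp
qed

text \<open>Each partial sum of the exponential series of \<open>t A n\<close> maps the core into
  itself and commutes with all \<open>D m j\<close>, hence with \<open>d j\<close>. The limits in
  the number of terms and then in n stay in the closed graph. This later permits orbits of core
  elements as test vectors in weak identities that are assumed on the core only.\<close>

lemma G_graph:
  assumes x: "x \<in> core"
  shows "(G t x, G t (A0 x)) \<in> closure ((\<lambda>y. (y, A0 y)) ` core)" (is "_ \<in> closure ?\<Gamma>")
proof -
  note xd = core_dom[OF x]
  define P where "P n N = (\<Sum>k<N. (t *\<^sub>R A n) ^ k /\<^sub>R fact k)" for n N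
  have A_core: "ap (A n) y \<in> core" if "y \<in> core" for n y
    unfolding A_apply using that
    by (intro subspace_neg subspace_sum subspace_core core_a core_T)
  have Ak: "ap ((t *\<^sub>R A n) ^ k) x \<in> core" for n k
  proof (induction k)
    case 0 thus ?case using x by simp
  next
    case (Suc k)
    have "ap ((t *\<^sub>R A n) ^ Suc k) x = t *\<^sub>R ap (A n) (ap ((t *\<^sub>R A n) ^ k) x)"
      by (simp only: power_Suc ap_mult ap_simps)
    thus ?case using subspace_scale[OF subspace_core A_core[OF Suc]] by (simp only:)
  qed
  have P_core: "ap (P n N) x \<in> core" for n N
    unfolding P_def ap_sum ap_simps by (intro subspace_sum subspace_scale subspace_core Ak)
  have TP: "D m j * P n N = P n N * D m j" for m j n N
  proof -
    have c: "D m j * (t *\<^sub>R A n) = (t *\<^sub>R A n) * D m j" by (simp add: comm_TA)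
    have "D m j * (t *\<^sub>R A n) ^ k = (t *\<^sub>R A n) ^ k * D m j" for k
    proof (induction k)
      case (Suc k)
      have "D m j * (t *\<^sub>R A n) ^ Suc k = (D m j * (t *\<^sub>R A n)) * (t *\<^sub>R A n) ^ k"
        by (simp only: power_Suc mult.assoc)
      also have "\<dots> = (t *\<^sub>R A n) * (D m j * (t *\<^sub>R A n) ^ k)"
        by (simp only: c mult.assoc)
      finally show ?case by (simp only: Suc power_Suc mult.assoc)
    qed simp
    thus ?thesis unfolding P_def sum_distrib_left sum_distrib_right
      by (simp only: mult_scaleR_left mult_scaleR_right)
  qed
  have dP: "d j (ap (P n N) x) = ap (P n N) (d j x)" for j n N
  proof (rule dI)
    have "ap (D m j) (ap (P n N) x) = ap (P n N) (ap (D m j) x)" for m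
      using TP by (metis ap_mult)
    thus "(\<lambda>m. ap (D m j) (ap (P n N) x)) \<longlonglongrightarrow> ap (P n N) (d j x)"
      by (simp) (intro tendsto_intros D_tendsto xd)
  qed
  have 1: "(ap (P n N) x, - (\<Sum>j\<in>UNIV. ap (S j) (ap (P n N) (d j x)))) \<in> closure ?\<Gamma>" for n N
  proof -
    have "(ap (P n N) x, A0 (ap (P n N) x)) \<in> closure ?\<Gamma>"
      using P_core by (intro subsetD[OF closure_subset] imageI)
    thus ?thesis by (simp only: A0_def dP)
  qed
  have P_tendsto: "(\<lambda>N. ap (P n N) y) \<longlonglongrightarrow> E n t y" for n y
    using bounded_linear.tendsto[OF bounded_linear_ap_left exp_converges[unfolded sums_def]]
    unfolding P_def E_def .
  have 2: "(E n t x, - (\<Sum>j\<in>UNIV. ap (S j) (E n t (d j x)))) \<in> closure ?\<Gamma>" for n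
    by (rule Lim_in_closed_set[where f = "\<lambda>N. (ap (P n N) x, - (\<Sum>j\<in>UNIV. ap (S j) (ap (P n N) (d j x))))",
          OF closed_closure _ sequentially_bot])
       (rule always_eventually, rule allI, rule 1, intro tendsto_intros P_tendsto)
  have "(G t x, - (\<Sum>j\<in>UNIV. ap (S j) (G t (d j x)))) \<in> closure ?\<Gamma>"
    by (rule Lim_in_closed_set[where f = "\<lambda>n. (E n t x, - (\<Sum>j\<in>UNIV. ap (S j) (E n t (d j x))))",
          OF closed_closure _ sequentially_bot])
       (rule always_eventually, rule allI, rule 2, intro tendsto_intros E_tendsto)
  thus ?thesis using G_dom(2)[OF xd] by simp
qed

end

subsection \<open>Curves in a Hilbert space\<close>

abbreviation integ :: "real \<Rightarrow> real \<Rightarrow> (real \<Rightarrow> 'a::{banach,second_countable_topology}) \<Rightarrow> 'a" where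
  "integ a b k \<equiv> set_lebesgue_integral lborel {a..b} k"

abbreviation integable :: "real \<Rightarrow> real \<Rightarrow> (real \<Rightarrow> 'a::{banach,second_countable_topology}) \<Rightarrow> bool" where
  "integable a b k \<equiv> set_integrable lborel {a..b} k"

lemma vector_derivative_quotient:
  "(g has_vector_derivative g') (at t) \<longleftrightarrow> ((\<lambda>s. (g s - g t) /\<^sub>R (s - t)) \<longlongrightarrow> g') (at t)"
proof -
  have "norm ((g s - g t - (s - t) *\<^sub>R g') /\<^sub>R norm (s - t)) = norm ((g s - g t) /\<^sub>R (s - t) - g')"
    if "s \<noteq> t" for s
  proof -
    have "(g s - g t) /\<^sub>R (s - t) - g' = (g s - g t - (s - t) *\<^sub>R g') /\<^sub>R (s - t)"
      using that by (simp add: scaleR_diff_right)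
    thus ?thesis by (simp add: abs_inverse)
  qed
  hence *: "((\<lambda>s. norm ((g s - g t - (s - t) *\<^sub>R g') /\<^sub>R norm (s - t))) \<longlongrightarrow> 0) (at t) \<longleftrightarrow>
         ((\<lambda>s. norm ((g s - g t) /\<^sub>R (s - t) - g')) \<longlongrightarrow> 0) (at t)"
    by (intro filterlim_cong) (auto simp: eventually_at_filter simp del: norm_scaleR)
  show ?thesis
    unfolding has_vector_derivative_def has_derivative_at_within
    using * by (simp only: bounded_linear_scaleR_left tendsto_norm_zero_iff LIM_zero_iff simp_thms)
qed

lemma integable_subset: "integable a b k \<Longrightarrow> a \<le> c \<Longrightarrow> d \<le> b \<Longrightarrow> integable c d k"
  by (rule set_integrable_subset) auto

lemma continuous_integable:
  "continuous_on {a..b} k \<Longrightarrow> integable a b (k :: real \<Rightarrow> 'a::{banach,second_countable_topology})"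
  unfolding set_integrable_def by (rule borel_integrable_compact) auto

lemma integ_FTC:
  fixes F :: "real \<Rightarrow> real"
  assumes "a \<le> b" "continuous_on {a..b} F" "continuous_on {a..b} f"
    and "\<And>x. a < x \<Longrightarrow> x < b \<Longrightarrow> (F has_real_derivative f x) (at x)"
  shows "integ a b f = F b - F a"
proof -
  have "(f has_integral (F b - F a)) {a..b}"
    using assms by (intro fundamental_theorem_of_calculus_interior)
      (auto simp: has_real_derivative_iff_has_vector_derivative)
  thus ?thesis
    using set_borel_integral_eq_integral(2)[OF continuous_integable[OF assms(3)]] by (simp add: integral_unique)
qed

lemma integ_deriv:
  fixes f :: "real \<Rightarrow> real"
  assumes "continuous_on {a..b} f" "a < x" "x < b"
  shows "((\<lambda>t. integ a t f) has_real_derivative f x) (at x)"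
proof -
  have "((\<lambda>t. integral {a..t} f) has_vector_derivative f x) (at x within {a..b})"
    using assms by (intro integral_has_vector_derivative) auto
  hence "((\<lambda>t. integral {a..t} f) has_vector_derivative f x) (at x)"
    using assms by (simp add: at_within_Icc_at)
  hence "((\<lambda>t. integ a t f) has_vector_derivative f x) (at x)"
    by (rule has_vector_derivative_transform_within_open[where S = "{a<..<b}"])
       (use assms in \<open>auto intro!: set_borel_integral_eq_integral(2)[symmetric] continuous_integable
          continuous_on_subset[OF assms(1)]\<close>)
  thus ?thesis by (simp add: has_real_derivative_iff_has_vector_derivative)
qed

lemma integ_inner:
  fixes k :: "real \<Rightarrow> 'a::{real_inner,banach,second_countable_topology}"
  assumes "integable a b k"
  shows "integ a b k \<bullet> y = integ a b (\<lambda>s. k s \<bullet> y)" "integable a b (\<lambda>s. k s \<bullet> y)"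
  using assms integral_inner_left[of y lborel "\<lambda>s. indicator {a..b} s *\<^sub>R k s"]
    integrable_inner_left[of y lborel "\<lambda>s. indicator {a..b} s *\<^sub>R k s"]
  unfolding set_lebesgue_integral_def set_integrable_def by (cases "y = 0"; simp)+

lemma integ_norm_bound:
  assumes "integable a b k" "integable a b g" "\<And>s. a \<le> s \<Longrightarrow> s \<le> b \<Longrightarrow> norm (k s) \<le> g s"
  shows "norm (integ a b k) \<le> integ a b g"
proof -
  have "norm (integ a b k) \<le> (LINT s|lborel. norm (indicator {a..b} s *\<^sub>R k s))"
    unfolding set_lebesgue_integral_def by (rule integral_norm_bound)
  also have "\<dots> \<le> integ a b g"
    unfolding set_lebesgue_integral_def
    by (rule integral_mono[OF integrable_norm[OF assms(1)[unfolded set_integrable_def]] assms(2)[unfolded set_integrable_def]])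
       (use assms(3) in \<open>auto simp: indicator_def\<close>)
  finally show ?thesis .
qed

lemma integ_refl: "integ a a k = 0"
proof -
  have "AE s in lborel. indicator {a..a} s *\<^sub>R k s = 0"
    using AE_lborel_singleton[of a] by eventually_elim auto
  thus ?thesis unfolding set_lebesgue_integral_def by (rule integral_eq_zero_AE)
qed

lemma integ_split:
  assumes "integable a c k" "a \<le> b" "b \<le> c"
  shows "integ a c k = integ a b k + integ b c k"
proof -
  have "integ a c k = set_lebesgue_integral lborel ({a..b} \<union> {b<..c}) k"
    using assms by (simp add: ivl_disj_un)
  also have "\<dots> = integ a b k + set_lebesgue_integral lborel {b<..c} k"
    using assms by (intro set_integral_Un set_integrable_subset[OF assms(1)]) auto
  also have "set_lebesgue_integral lborel {b<..c} k = integ b c k"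
    unfolding set_lebesgue_integral_def
  proof (rule integral_cong_AE)
    have "integable b c k" using assms by (intro integable_subset[OF assms(1)]) auto
    hence m: "(\<lambda>x. indicator {b..c} x *\<^sub>R k x) \<in> borel_measurable lborel"
      unfolding set_integrable_def by auto
    show "(\<lambda>x. indicator {b..c} x *\<^sub>R k x) \<in> borel_measurable lborel" by (rule m)
    have "(\<lambda>x. indicator {b<..c} x *\<^sub>R (indicator {b..c} x *\<^sub>R k x)) \<in> borel_measurable lborel"
      using m by measurable
    thus "(\<lambda>x. indicator {b<..c} x *\<^sub>R k x) \<in> borel_measurable lborel"
      by (rule measurable_cong[THEN iffD1, rotated]) (auto simp: indicator_def)
    show "AE x in lborel. indicator {b<..c} x *\<^sub>R k x = indicator {b..c} x *\<^sub>R k x"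
      using AE_lborel_singleton[of b] by eventually_elim (auto simp: indicator_def)
  qed
  finally show ?thesis .
qed

text \<open>Dominated convergence: when the end points converge to t, the indicators of the
  intervals converge except possibly at the single point t.\<close>

lemma continuous_integ:
  fixes k :: "real \<Rightarrow> 'a::{banach,second_countable_topology}"
  assumes k: "\<And>T. integable 0 T k"
  shows "continuous_on {0..} (\<lambda>t. integ 0 t k)"
  unfolding continuous_on_sequentially
proof (intro allI impI ballI, elim conjE)
  fix x :: "nat \<Rightarrow> real" and t assume t: "t \<in> {0..}" and x: "\<forall>n. x n \<in> {0..}" "x \<longlonglongrightarrow> t"
  obtain C where C: "\<And>n. x n \<le> C"
    using convergent_imp_Bseq[OF convergentI[OF x(2)]] unfolding Bseq_def by (metis abs_le_D1 real_norm_def)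
  hence tC: "t \<le> C" using LIMSEQ_le_const2[OF x(2)] by blast
  show "((\<lambda>t. integ 0 t k) \<circ> x) \<longlonglongrightarrow> integ 0 t k"
    unfolding o_def set_lebesgue_integral_def
  proof (rule integral_dominated_convergence[where w = "\<lambda>s. norm (indicator {0..C} s *\<^sub>R k s)"])
    show "integrable lborel (\<lambda>s. norm (indicator {0..C} s *\<^sub>R k s))"
      using integrable_norm[OF k[of C, unfolded set_integrable_def]] .
    show "AE s in lborel. (\<lambda>n. indicator {0..x n} s *\<^sub>R k s) \<longlonglongrightarrow> indicator {0..t} s *\<^sub>R k s"
      using AE_lborel_singleton[of t]
    proof eventually_elim
      case (elim s)
      have "\<forall>\<^sub>F n in sequentially. indicator {0..x n} s *\<^sub>R k s = indicator {0..t} s *\<^sub>R k s"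
      proof (cases "s < t")
        case True
        hence "\<forall>\<^sub>F n in sequentially. s < x n" using order_tendstoD(1)[OF x(2)] by simp
        thus ?thesis by eventually_elim (use True in \<open>auto simp: indicator_def\<close>)
      next
        case False
        hence "\<forall>\<^sub>F n in sequentially. x n < s" using order_tendstoD(2)[OF x(2)] elim by simp
        thus ?thesis by eventually_elim (use False elim in \<open>auto simp: indicator_def\<close>)
      qed
      thus ?case by (rule tendsto_eventually)
    qed
    show "AE s in lborel. norm (indicator {0..x n} s *\<^sub>R k s) \<le> norm (indicator {0..C} s *\<^sub>R k s)" for n
      using C[of n] by (auto simp: indicator_def)
    show "(\<lambda>s. indicator {0..t} s *\<^sub>R k s) \<in> borel_measurable lborel"
      "(\<lambda>s. indicator {0..x n} s *\<^sub>R k s) \<in> borel_measurable lborel" for n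
      using k unfolding set_integrable_def by auto
  qed
qed

text \<open>The right-hand side I t, multiplied by exp (- K t), is nonincreasing.\<close>

lemma gronwall:
  fixes \<phi> :: "real \<Rightarrow> real"
  assumes T: "0 \<le> t" "t \<le> T" and c: "continuous_on {0..T} \<phi>" and K: "K \<ge> 0"
    and le: "\<And>t. 0 \<le> t \<Longrightarrow> t \<le> T \<Longrightarrow> \<phi> t \<le> c0 + K * integ 0 t \<phi>"
  shows "\<phi> t \<le> c0 * exp (K * t)"
proof -
  define I where "I t = c0 + K * integ 0 t \<phi>" for t
  \<comment> \<open>Continuation by the end values gives a continuous function on the whole line,
    since \<open>continuous_integ\<close> asks for integrability on every interval.\<close>
  define \<phi>' where "\<phi>' s = \<phi> (max 0 (min T s))" for s
  have c': "continuous_on UNIV \<phi>'"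
    unfolding \<phi>'_def using T by (intro continuous_on_compose2[OF c] continuous_intros) auto
  have eq: "integ 0 s \<phi> = integ 0 s \<phi>'" if "s \<le> T" for s
    by (rule set_lebesgue_integral_cong) (use that in \<open>auto simp: \<phi>'_def\<close>)
  have cI: "continuous_on {0..T} (\<lambda>s. integ 0 s \<phi>)"
  proof -
    have "continuous_on {0..} (\<lambda>t. integ 0 t \<phi>')"
      by (intro continuous_integ continuous_integable continuous_on_subset[OF c']) auto
    hence "continuous_on {0..T} (\<lambda>t. integ 0 t \<phi>')" by (rule continuous_on_subset) auto
    thus ?thesis by (rule continuous_on_eq) (simp add: eq)
  qed
  have "exp (- K * t) * I t \<le> exp (- K * 0) * I 0"
  proof (rule DERIV_nonpos_imp_decreasing_open[OF T(1)])
    fix x assume x: "0 < x" "x < t"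
    have "((\<lambda>s. exp (- K * s) * I s) has_real_derivative
        exp (- K * x) * (K * \<phi> x) + (exp (- K * x) * (- K)) * I x) (at x)"
      unfolding I_def using x T
      by (auto intro!: derivative_eq_intros integ_deriv[OF c])
    moreover have "exp (- K * x) * (K * \<phi> x) + (exp (- K * x) * (- K)) * I x = exp (- K * x) * K * (\<phi> x - I x)"
      by (simp add: algebra_simps)
    moreover have "\<dots> \<le> 0" using le[of x] x T K unfolding I_def
      by (intro mult_nonneg_nonpos) auto
    ultimately show "\<exists>y. ((\<lambda>s. exp (- K * s) * I s) has_real_derivative y) (at x) \<and> y \<le> 0" by metis
  next
    show "continuous_on {0..t} (\<lambda>s. exp (- K * s) * I s)"
      unfolding I_def using T by (intro continuous_intros continuous_on_subset[OF cI]) auto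
  qed
  moreover have "I 0 = c0" using integ_refl[of 0 \<phi>] by (simp add: I_def)
  ultimately have "I t \<le> c0 * exp (K * t)" by (simp add: exp_minus field_simps)
  thus ?thesis using le[of t] T by (simp add: I_def)
qed

text \<open>As k is only integrable, w need not be differentiable; the identity is Fubini over the
  triangle 0 \<le> s \<le> t \<le> T. It serves twice: for mild solutions pulled back by the group
  and for the stretched coordinates.\<close>

lemma integ_by_parts:
  fixes k :: "real \<Rightarrow> 'h::{real_inner,banach,second_countable_topology}"
  assumes T: "0 \<le> T" and k: "integable 0 T k"
    and p: "\<And>t. 0 \<le> t \<Longrightarrow> t \<le> T \<Longrightarrow> (p has_vector_derivative p' t) (at t)" and p': "continuous_on {0..T} p'"
    and w: "\<And>t. 0 \<le> t \<Longrightarrow> t \<le> T \<Longrightarrow> w t = w0 + integ 0 t k"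
  shows "integ 0 T (\<lambda>t. w t \<bullet> p' t) = w T \<bullet> p T - w0 \<bullet> p 0 - integ 0 T (\<lambda>s. k s \<bullet> p s)"
proof -
  have pc: "continuous_on {0..T} p"
    using p by (auto intro!: continuous_at_imp_continuous_on has_vector_derivative_continuous)
  have ftc: "integ a b (\<lambda>t. y \<bullet> p' t) = y \<bullet> p b - y \<bullet> p a" if "0 \<le> a" "a \<le> b" "b \<le> T" for a b y
  proof (rule integ_FTC[where F = "\<lambda>t. y \<bullet> p t"])
    show "((\<lambda>t. y \<bullet> p t) has_real_derivative y \<bullet> p' x) (at x)" if "a < x" "x < b" for x
      unfolding has_real_derivative_iff_has_vector_derivative
      by (rule bounded_linear.has_vector_derivative[OF bounded_linear_inner_right p])
         (use that \<open>0 \<le> a\<close> \<open>b \<le> T\<close> in auto)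
  qed (use that in \<open>auto intro!: continuous_intros continuous_on_subset[OF pc] continuous_on_subset[OF p']\<close>)
  \<comment> \<open>Off the triangle the integrand is 0, so both iterated integrals can run over the
    whole line.\<close>
  define h where "h s t = (if 0 \<le> s \<and> s \<le> t \<and> t \<le> T then k s \<bullet> p' t else 0)" for s t
  define k1 where "k1 s = indicator {0..T} s *\<^sub>R k s" for s
  define p1 where "p1 s = indicator {0..T} s *\<^sub>R p' s" for s
  have k1: "integrable lborel k1" using k unfolding k1_def set_integrable_def .
  have p1: "integrable lborel p1"
    using continuous_integable[OF p'] unfolding p1_def set_integrable_def .
  have [measurable]: "k1 \<in> borel_measurable borel" "p1 \<in> borel_measurable borel"
    using k1 p1 by auto
  have h_eq: "h s t = (if s \<le> t then k1 s \<bullet> p1 t else 0)" for s t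
    by (auto simp: h_def k1_def p1_def indicator_def)
  have int: "integrable (lborel \<Otimes>\<^sub>M lborel) (\<lambda>(s, t). h s t)"
  proof (rule Bochner_Integration.integrable_bound)
    show "integrable (lborel \<Otimes>\<^sub>M lborel) (\<lambda>(s, t). norm (k1 s) * norm (p1 t))"
      using k1 p1 by (intro lborel_pair.Fubini_integrable) (auto simp: case_prod_beta')
    show "(\<lambda>(s, t). h s t) \<in> borel_measurable (lborel \<Otimes>\<^sub>M lborel)"
      unfolding h_eq by measurable
    show "AE x in lborel \<Otimes>\<^sub>M lborel. norm (case x of (s, t) \<Rightarrow> h s t) \<le> norm (case x of (s, t) \<Rightarrow> norm (k1 s) * norm (p1 t))"
      by (auto simp: h_eq Cauchy_Schwarz_ineq2)
  qed
  have "(LINT t|lborel. LINT s|lborel. h s t) = (LINT s|lborel. LINT t|lborel. h s t)"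
    by (rule lborel_pair.Fubini_integral[OF int])
  also have "(\<lambda>s. LINT t|lborel. h s t) = (\<lambda>s. indicator {0..T} s *\<^sub>R (k s \<bullet> p T - k s \<bullet> p s))"
  proof
    fix s
    show "(LINT t|lborel. h s t) = indicator {0..T} s *\<^sub>R (k s \<bullet> p T - k s \<bullet> p s)"
    proof (cases "0 \<le> s \<and> s \<le> T")
      case True
      have "(LINT t|lborel. h s t) = integ s T (\<lambda>t. k s \<bullet> p' t)"
        unfolding set_lebesgue_integral_def
        by (rule Bochner_Integration.integral_cong) (use True in \<open>auto simp: h_def indicator_def\<close>)
      thus ?thesis using ftc[of s T "k s"] True by simp
    next
      case False
      have "(\<lambda>t. h s t) = (\<lambda>t. 0)" using False by (auto simp: h_def)
      thus ?thesis using False by auto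
    qed
  qed
  also have "(\<lambda>t. LINT s|lborel. h s t) = (\<lambda>t. indicator {0..T} t *\<^sub>R (integ 0 t k \<bullet> p' t))"
  proof
    fix t
    show "(LINT s|lborel. h s t) = indicator {0..T} t *\<^sub>R (integ 0 t k \<bullet> p' t)"
    proof (cases "0 \<le> t \<and> t \<le> T")
      case True
      have "(LINT s|lborel. h s t) = integ 0 t (\<lambda>s. k s \<bullet> p' t)"
        unfolding set_lebesgue_integral_def
        by (rule Bochner_Integration.integral_cong) (use True in \<open>auto simp: h_def indicator_def\<close>)
      also have "\<dots> = integ 0 t k \<bullet> p' t"
        by (rule integ_inner(1)[symmetric], rule integable_subset[OF k]) (use True in auto)
      finally show ?thesis using True by simp
    next
      case False
      have "(\<lambda>s. h s t) = (\<lambda>t. 0)" using False by (auto simp: h_def)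
      thus ?thesis using False by auto
    qed
  qed
  finally have 1: "integ 0 T (\<lambda>t. integ 0 t k \<bullet> p' t) = integ 0 T (\<lambda>s. k s \<bullet> p T - k s \<bullet> p s)"
    by (simp add: set_lebesgue_integral_def)
  have kp: "integable 0 T (\<lambda>s. k s \<bullet> p s)"
  proof -
    obtain C where C: "\<And>s. s \<in> {0..T} \<Longrightarrow> norm (p s) \<le> C"
      using compact_imp_bounded[OF compact_continuous_image[OF pc compact_Icc]] unfolding bounded_iff by (meson imageI)
    define p2 where "p2 s = indicator {0..T} s *\<^sub>R p s" for s
    have [measurable]: "p2 \<in> borel_measurable borel"
      using continuous_integable[OF pc] unfolding p2_def set_integrable_def by auto
    have "integrable lborel (\<lambda>s. k1 s \<bullet> p2 s)"
    proof (rule Bochner_Integration.integrable_bound)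
      show "integrable lborel (\<lambda>s. C * norm (k1 s))" using k1 by simp
      show "AE s in lborel. norm (k1 s \<bullet> p2 s) \<le> norm (C * norm (k1 s))"
      proof (rule AE_I2)
        fix s
        have "\<bar>k1 s \<bullet> p2 s\<bar> \<le> norm (k1 s) * norm (p2 s)" by (rule Cauchy_Schwarz_ineq2)
        also have "\<dots> \<le> norm (k1 s) * \<bar>C\<bar>"
          by (intro mult_left_mono) (auto simp: p2_def indicator_def intro!: order_trans[OF C abs_ge_self])
        finally show "norm (k1 s \<bullet> p2 s) \<le> norm (C * norm (k1 s))" by (simp add: abs_mult mult.commute)
      qed
    qed measurable
    thus ?thesis unfolding set_integrable_def
      by (rule Bochner_Integration.integrable_cong[THEN iffD1, rotated 2]) (auto simp: k1_def p2_def indicator_def)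
  qed
  have c1: "integable 0 T (\<lambda>t. w0 \<bullet> p' t)"
    by (intro continuous_integable continuous_intros p')
  have c2: "integable 0 T (\<lambda>t. integ 0 t k \<bullet> p' t)"
  proof -
    have "integable 0 T' k1" for T'
      using integrable_mult_indicator[OF _ k1, of "{0..T'}"] unfolding set_integrable_def by simp
    from continuous_integ[OF this] have "continuous_on {0..T} (\<lambda>t. integ 0 t k1)"
      by (rule continuous_on_subset) auto
    moreover have "integ 0 t k1 = integ 0 t k" if "t \<in> {0..T}" for t
      by (rule set_lebesgue_integral_cong) (use that in \<open>auto simp: k1_def\<close>)
    ultimately have "continuous_on {0..T} (\<lambda>t. integ 0 t k)" by (metis (no_types, lifting) continuous_on_cong)
    thus ?thesis by (intro continuous_integable continuous_intros p')
  qed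
  have "integ 0 T (\<lambda>t. w t \<bullet> p' t) = integ 0 T (\<lambda>t. w0 \<bullet> p' t + integ 0 t k \<bullet> p' t)"
    by (rule set_lebesgue_integral_cong) (auto simp: w inner_add_left)
  also have "\<dots> = integ 0 T (\<lambda>t. w0 \<bullet> p' t) + integ 0 T (\<lambda>t. integ 0 t k \<bullet> p' t)"
    by (rule set_integral_add(2)[OF c1 c2])
  also have "integ 0 T (\<lambda>t. w0 \<bullet> p' t) = w0 \<bullet> p T - w0 \<bullet> p 0" using ftc[of 0 T w0] T by simp
  also have "integ 0 T (\<lambda>t. integ 0 t k \<bullet> p' t) = integ 0 T (\<lambda>s. k s \<bullet> p T) - integ 0 T (\<lambda>s. k s \<bullet> p s)"
    unfolding 1 by (rule set_integral_diff(2)[OF integ_inner(2)[OF k] kp])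
  also have "integ 0 T (\<lambda>s. k s \<bullet> p T) = integ 0 T k \<bullet> p T" by (rule integ_inner(1)[OF k, symmetric])
  finally show ?thesis using w[of T] T by (simp add: inner_add_left)
qed

subsection \<open>Linear Volterra equations\<close>

text \<open>Picard iteration: the n-th iterate \<delta> n is bounded by
  \<open>M T * (K' * t) ^ n / fact n\<close>, so the series converges uniformly on bounded
  intervals.\<close>

lemma volterra_exists:
  fixes C :: "real \<Rightarrow> 'h::{banach,second_countable_topology} \<Rightarrow> 'h"
  assumes lin: "\<And>s. bounded_linear (C s)" and K: "\<And>s x. norm (C s x) \<le> K * norm x"
    and cont: "continuous_on UNIV (\<lambda>z. C (fst z) (snd z))" and \<gamma>: "continuous_on {0..} \<gamma>"
  obtains w where "continuous_on {0..} w" "\<And>t. t \<ge> 0 \<Longrightarrow> w t = \<gamma> t + integ 0 t (\<lambda>s. C s (w s))"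
proof -
  define K' where "K' = \<bar>K\<bar>"
  have K': "norm (C s x) \<le> K' * norm x" "K' \<ge> 0" for s x
    unfolding K'_def by (rule order_trans[OF K], simp_all add: mult_right_mono)
  have Cc: "continuous_on S w \<Longrightarrow> continuous_on S (\<lambda>s. C s (w s))" for S w
    using continuous_on_compose2[OF cont continuous_on_Pair[of S "\<lambda>s. s" w]] by (simp add: continuous_on_id)
  define \<delta> where "\<delta> n = ((\<lambda>f t. integ 0 t (\<lambda>s. C s (f s))) ^^ n) \<gamma>" for n
  have \<delta>_0: "\<delta> 0 = \<gamma>" by (simp add: \<delta>_def)
  have \<delta>_Suc: "\<delta> (Suc n) t = integ 0 t (\<lambda>s. C s (\<delta> n s))" for n t by (simp add: \<delta>_def)
  have \<delta>_cont: "continuous_on {0..} (\<delta> n)" for n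
  proof (induction n)
    case (Suc n)
    have "integable 0 T (\<lambda>s. C s (\<delta> n s))" for T
      by (intro continuous_integable Cc continuous_on_subset[OF Suc]) auto
    thus ?case using continuous_integ[of "\<lambda>s. C s (\<delta> n s)"] by (simp add: \<delta>_Suc[abs_def])
  qed (simp add: \<delta>_0 \<gamma>)
  have \<delta>_int: "integable 0 T (\<lambda>s. C s (\<delta> n s))" for n T
    by (intro continuous_integable Cc continuous_on_subset[OF \<delta>_cont]) auto
  define M where "M T = (SUP t\<in>{0..T}. norm (\<gamma> t))" for T
  have M: "norm (\<gamma> t) \<le> M T" if "0 \<le> t" "t \<le> T" for t T
  proof -
    have "bdd_above ((\<lambda>t. norm (\<gamma> t)) ` {0..T})"
      by (intro bounded_imp_bdd_above compact_imp_bounded compact_continuous_image continuous_intros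
          continuous_on_subset[OF \<gamma>]) auto
    thus ?thesis unfolding M_def using that by (intro cSUP_upper) auto
  qed
  have bd: "norm (\<delta> n t) \<le> M T * (K' * t) ^ n / fact n" if "0 \<le> t" "t \<le> T" for n t T
    using that
  proof (induction n arbitrary: t)
    case (Suc n)
    have "norm (\<delta> (Suc n) t) \<le> integ 0 t (\<lambda>s. K' * (M T * (K' * s) ^ n / fact n))"
      unfolding \<delta>_Suc
    proof (rule integ_norm_bound[OF \<delta>_int])
      show "norm (C s (\<delta> n s)) \<le> K' * (M T * (K' * s) ^ n / fact n)" if "0 \<le> s" "s \<le> t" for s
        using Suc that K' by (intro order_trans[OF K'(1)] mult_left_mono) auto
    qed (intro continuous_integable continuous_intros, simp)
    also have "\<dots> = M T * (K' * t) ^ Suc n / fact (Suc n) - M T * (K' * 0) ^ Suc n / fact (Suc n)"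
    proof (rule integ_FTC[OF Suc.prems(1)])
      show "((\<lambda>s. M T * (K' * s) ^ Suc n / fact (Suc n)) has_real_derivative K' * (M T * (K' * x) ^ n / fact n)) (at x)" for x
        by (rule derivative_eq_intros refl | simp)+
    qed (auto intro!: continuous_intros)
    finally show ?case by simp
  qed (simp add: \<delta>_0 M)
  define w where "w t = (\<Sum>n. \<delta> n t)" for t
  have M0: "M T \<ge> 0" if "T \<ge> 0" for T using M[of 0 T] that norm_ge_zero order_trans by blast
  have bd': "norm (\<delta> n t) \<le> M T * ((K' * T) ^ n / fact n)" if "0 \<le> t" "t \<le> T" for n t T
  proof -
    have "M T * (K' * t) ^ n / fact n \<le> M T * ((K' * T) ^ n / fact n)"
      unfolding times_divide_eq_right
      using that K' M0[of T] by (intro divide_right_mono mult_left_mono power_mono) auto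
    thus ?thesis using bd[OF that, of n] by linarith
  qed
  have summ: "summable (\<lambda>n. M T * ((K' * T) ^ n / fact n))" for T
    using summable_exp[of "K' * T"] by (intro summable_mult) (simp add: field_simps)
  have unif: "uniform_limit {0..T} (\<lambda>N t. \<Sum>n<N. \<delta> n t) w sequentially" for T
    unfolding w_def by (rule Weierstrass_m_test[OF _ summ[of T]]) (use bd' in auto)
  have cw: "continuous_on {0..T} w" for T
    by (rule uniform_limit_theorem[OF _ unif])
       (auto intro!: always_eventually continuous_intros continuous_on_subset[OF \<delta>_cont])
  show thesis
  proof
    show cw': "continuous_on {0..} w"
      unfolding continuous_on_eq_continuous_within
    proof
      fix t :: real assume t: "t \<in> {0..}"
      have "continuous (at t within {0..t+1}) w" using cw[of "t+1"] t by (auto simp: continuous_on_eq_continuous_within)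
      moreover have "at t within {0..t+1} = at t within {0..}"
        by (rule at_within_nhd[where S = "{t-1<..<t+1}"]) (use t in auto)
      ultimately show "continuous (at t within {0..}) w" by (simp add: continuous_within)
    qed
    fix t :: real assume t: "t \<ge> 0"
    have 1: "(\<lambda>N. integ 0 t (\<lambda>s. C s (\<Sum>n<N. \<delta> n s))) \<longlonglongrightarrow> integ 0 t (\<lambda>s. C s (w s))"
      unfolding set_lebesgue_integral_def
    proof (rule integral_dominated_convergence[where w = "\<lambda>s. indicator {0..t} s *\<^sub>R (K' * (M t * exp (K' * t)))"])
      have "integable 0 t (\<lambda>s. C s (w s))" by (intro continuous_integable Cc continuous_on_subset[OF cw]) auto
      thus "(\<lambda>x. indicator {0..t} x *\<^sub>R C x (w x)) \<in> borel_measurable lborel" by (auto simp: set_integrable_def)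
      have "integable 0 t (\<lambda>s. C s (\<Sum>n<N. \<delta> n s))" for N
        by (intro continuous_integable Cc continuous_intros continuous_on_subset[OF \<delta>_cont]) auto
      thus "(\<lambda>x. indicator {0..t} x *\<^sub>R C x (\<Sum>n<N. \<delta> n x)) \<in> borel_measurable lborel" for N
        by (auto simp: set_integrable_def)
      show "integrable lborel (\<lambda>s. indicator {0..t} s *\<^sub>R (K' * (M t * exp (K' * t))))"
        using continuous_integable[of 0 t "\<lambda>s. K' * (M t * exp (K' * t))"] by (simp add: set_integrable_def)
      show "AE s in lborel. (\<lambda>N. indicator {0..t} s *\<^sub>R C s (\<Sum>n<N. \<delta> n s)) \<longlonglongrightarrow> indicator {0..t} s *\<^sub>R C s (w s)"
      proof (rule AE_I2)
        fix s show "(\<lambda>N. indicator {0..t} s *\<^sub>R C s (\<Sum>n<N. \<delta> n s)) \<longlonglongrightarrow> indicator {0..t} s *\<^sub>R C s (w s)"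
          by (cases "s \<in> {0..t}") (auto intro!: bounded_linear.tendsto[OF lin] tendsto_uniform_limitI[OF unif[of t]])
      qed
      show "AE s in lborel. norm (indicator {0..t} s *\<^sub>R C s (\<Sum>n<N. \<delta> n s)) \<le> indicator {0..t} s *\<^sub>R (K' * (M t * exp (K' * t)))" for N
      proof (rule AE_I2)
        fix s
        have "norm (C s (\<Sum>n<N. \<delta> n s)) \<le> K' * (M t * exp (K' * t))" if "s \<in> {0..t}"
        proof (rule order_trans[OF K'(1)], intro mult_left_mono K'(2))
          have "norm (\<Sum>n<N. \<delta> n s) \<le> (\<Sum>n<N. M t * ((K' * t) ^ n / fact n))"
            by (rule order_trans[OF norm_sum], intro sum_mono bd') (use that in auto)
          also have "\<dots> \<le> (\<Sum>n. M t * ((K' * t) ^ n / fact n))"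
            by (rule sum_le_suminf[OF summ]) (use M0[OF t] K' t in auto)
          also have "\<dots> = M t * exp (K' * t)"
            using summable_exp[of "K' * t"] by (subst suminf_mult) (simp_all add: exp_def field_simps)
          finally show "norm (\<Sum>n<N. \<delta> n s) \<le> M t * exp (K' * t)" .
        qed
        thus "norm (indicator {0..t} s *\<^sub>R C s (\<Sum>n<N. \<delta> n s)) \<le> indicator {0..t} s *\<^sub>R (K' * (M t * exp (K' * t)))"
          by (auto simp: indicator_def)
      qed
    qed
    have C_sum: "C s (\<Sum>n<N. \<delta> n s) = (\<Sum>n<N. C s (\<delta> n s))" for s N
      using linear_sum[OF bounded_linear.linear[OF lin]] .
    have 2: "integ 0 t (\<lambda>s. C s (\<Sum>n<N. \<delta> n s)) = (\<Sum>n<Suc N. \<delta> n t) - \<gamma> t" for N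
    proof -
      have "integ 0 t (\<lambda>s. C s (\<Sum>n<N. \<delta> n s)) = (\<Sum>n<N. integ 0 t (\<lambda>s. C s (\<delta> n s)))"
        unfolding C_sum set_lebesgue_integral_def scaleR_sum_right
        by (rule Bochner_Integration.integral_sum) (use \<delta>_int in \<open>simp add: set_integrable_def\<close>)
      also have "\<dots> = (\<Sum>n<Suc N. \<delta> n t) - \<gamma> t"
        unfolding sum.lessThan_Suc_shift by (simp add: \<delta>_Suc \<delta>_0)
      finally show ?thesis .
    qed
    have "(\<lambda>N. (\<Sum>n<Suc N. \<delta> n t) - \<gamma> t) \<longlonglongrightarrow> w t - \<gamma> t"
      by (intro tendsto_intros LIMSEQ_Suc tendsto_uniform_limitI[OF unif[of t]]) (use t in auto)
    with 1 have "integ 0 t (\<lambda>s. C s (w s)) = w t - \<gamma> t" unfolding 2 using LIMSEQ_unique by blast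
    thus "w t = \<gamma> t + integ 0 t (\<lambda>s. C s (w s))" by simp
  qed
qed

lemma subspace_closure:
  fixes S :: "'a::real_normed_vector set"
  assumes "subspace S" shows "subspace (closure S)"
  unfolding subspace_def
proof (intro conjI ballI allI)
  show "0 \<in> closure S" using assms closure_subset subspace_0 by blast
next
  fix x y assume "x \<in> closure S" "y \<in> closure S"
  then obtain f g where "\<forall>n. f n \<in> S" "f \<longlonglongrightarrow> x" "\<forall>n. g n \<in> S" "g \<longlonglongrightarrow> y"
    unfolding closure_sequential by blast
  thus "x + y \<in> closure S" unfolding closure_sequential
    by (intro exI[of _ "\<lambda>n. f n + g n"]) (auto intro!: tendsto_add subspace_add[OF assms])
next
  fix c x assume "x \<in> closure S"
  then obtain f where "\<forall>n. f n \<in> S" "f \<longlonglongrightarrow> x" unfolding closure_sequential by blast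
  thus "c *\<^sub>R x \<in> closure S" unfolding closure_sequential
    by (intro exI[of _ "\<lambda>n. c *\<^sub>R f n"]) (auto intro!: tendsto_scaleR subspace_scale[OF assms])
qed

lemma norm_diff_chain:
  fixes a :: "'a::real_normed_vector"
  shows "norm (a - e) \<le> norm (a - b) + norm (b - c) + norm (c - d) + norm (d - e)"
proof -
  have "a - e = (a - b) + (b - c) + (c - d) + (d - e)" by simp
  thus ?thesis by (smt (verit, del_insts) norm_triangle_ineq)
qed

lemma norm_diff4_le:
  fixes a :: "'a::real_normed_vector"
  shows "norm (a - b - c - d) \<le> norm a + norm b + norm c + norm d"
  using norm_triangle_ineq4[of "a - b - c" d] norm_triangle_ineq4[of "a - b" c] norm_triangle_ineq4[of a b]
  by linarith

text \<open>Riemann sums are finite linear combinations of values of g, so they lie in S, and so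
  does their limit. It will be applied to an orbit inside the closed graph of the generator.\<close>

lemma has_integral_in_subspace:
  fixes g :: "real \<Rightarrow> 'a::real_normed_vector"
  assumes "(g has_integral I) {a..b}" "subspace S" "closed S" "\<And>s. g s \<in> S"
  shows "I \<in> S"
proof -
  have "\<exists>y\<in>S. dist y I < e" if e: "e > 0" for e
  proof -
    obtain \<gamma> where \<gamma>: "gauge \<gamma>"
      "\<And>D. D tagged_division_of {a..b} \<Longrightarrow> \<gamma> fine D \<Longrightarrow> norm (sum (\<lambda>(x,k). measure lborel k *\<^sub>R g x) D - I) < e"
      using assms(1) e unfolding has_integral_real by metis
    obtain D where "D tagged_division_of {a..b}" "\<gamma> fine D" using fine_division_exists_real[OF \<gamma>(1)] by blast
    hence "norm (sum (\<lambda>(x,k). measure lborel k *\<^sub>R g x) D - I) < e" by (rule \<gamma>(2))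
    moreover have "sum (\<lambda>(x,k). measure lborel k *\<^sub>R g x) D \<in> S"
      by (intro subspace_sum assms) (auto intro!: subspace_scale assms)
    ultimately show ?thesis by (auto simp: dist_norm)
  qed
  thus ?thesis using assms(3) closed_approachable by blast
qed

section \<open>Derivatives of orbits, Duhamel's formula and weak solutions\<close>

context skew_approx
begin

lemma core_inner_eq:
  assumes "\<And>x. x \<in> core \<Longrightarrow> z \<bullet> x = 0" shows "z = 0"
proof -
  have "closed {x. z \<bullet> x = 0}" by (intro closed_Collect_eq continuous_intros)
  hence "closure core \<subseteq> {x. z \<bullet> x = 0}" by (rule closure_minimal[rotated]) (use assms in auto)
  thus ?thesis unfolding dense_core by (metis (mono_tags) UNIV_I inner_eq_zero_iff mem_Collect_eq subsetD)
qed

lemma d_add: "x \<in> dom \<Longrightarrow> y \<in> dom \<Longrightarrow> d j (x + y) = d j x + d j y"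
  by (rule dI) (simp only: ap_linear, intro tendsto_intros D_tendsto)

lemma d_scale: "x \<in> dom \<Longrightarrow> d j (c *\<^sub>R x) = c *\<^sub>R d j x"
  by (rule dI) (simp only: ap_linear, intro tendsto_intros D_tendsto)

lemma A0_add: "x \<in> dom \<Longrightarrow> y \<in> dom \<Longrightarrow> A0 (x + y) = A0 x + A0 y"
  by (simp add: A0_def d_add sum.distrib)

lemma A0_scale: "x \<in> dom \<Longrightarrow> A0 (c *\<^sub>R x) = c *\<^sub>R A0 x"
  by (simp add: A0_def d_scale scaleR_sum_right)

lemma A0_diff: "x \<in> dom \<Longrightarrow> y \<in> dom \<Longrightarrow> A0 (x - y) = A0 x - A0 y"
  using A0_add[of x "- y"] A0_scale[of y "-1"] domI[of "-y" "\<lambda>j. - d j y"] D_tendsto[of y]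
  by (simp add: tendsto_minus)

text \<open>The derivatives \<open>E n r (ap (A n) x)\<close> vary with n, so a continuity in r that
  is uniform in n is needed before the limit. It comes from approximating \<open>A0 x\<close> by a
  core element z: the orbits of z are Lipschitz with constants \<open>norm (ap (A n) z)\<close>,
  which are bounded because the sequence converges.\<close>

lemma G_deriv:
  assumes x: "x \<in> dom"
  shows "((\<lambda>t. G t x) has_vector_derivative G s (A0 x)) (at s)"
  unfolding has_vector_derivative_def has_derivative_at_alt
proof (intro conjI allI impI)
  show "bounded_linear (\<lambda>h. h *\<^sub>R G s (A0 x))" by (rule bounded_linear_scaleR_left)
  fix e :: real assume e: "e > 0"
  define y where "y = A0 x"
  obtain z where z: "z \<in> core" "norm (y - z) < e / 4" using core_approx[of "e/4" y] e by auto
  obtain C where C: "C > 0" "\<And>n. norm (ap (A n) z) \<le> C"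
    using convergent_imp_Bseq[OF convergentI[OF A_tendsto[OF core_dom[OF z(1)]]]] unfolding Bseq_def by blast
  show "\<exists>\<delta>>0. \<forall>t. norm (t - s) < \<delta> \<longrightarrow> norm (G t x - G s x - (t - s) *\<^sub>R G s (A0 x)) \<le> e * norm (t - s)"
  \<comment> \<open>Within this radius the orbits of z move by at most e / 2; the two replacements
    of y by z cost e / 4 each.\<close>
  proof (intro exI[of _ "e / (2 * C)"] conjI allI impI)
    show "e / (2 * C) > 0" using e C by simp
    fix t assume t: "norm (t - s) < e / (2 * C)"
    have "norm ((E n t x - t *\<^sub>R E n s y) - (E n s x - s *\<^sub>R E n s y)) \<le> (norm (ap (A n) x - y) + e) * norm (t - s)" for n
    proof (rule differentiable_bound[where S = "closed_segment s t"])
      fix r assume r: "r \<in> closed_segment s t"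
      have "((\<lambda>t. E n t x - t *\<^sub>R E n s y) has_vector_derivative E n r (ap (A n) x) - (r *\<^sub>R 0 + 1 *\<^sub>R E n s y)) (at r)"
        by (intro has_vector_derivative_diff E_deriv has_vector_derivative_scaleR DERIV_ident has_vector_derivative_const)
      thus "((\<lambda>t. E n t x - t *\<^sub>R E n s y) has_derivative (\<lambda>h. h *\<^sub>R (E n r (ap (A n) x) - E n s y))) (at r within closed_segment s t)"
        unfolding has_vector_derivative_def by (auto intro: has_derivative_at_withinI)
      have "\<bar>r - s\<bar> \<le> \<bar>t - s\<bar>" using r by (auto simp: closed_segment_eq_real_ivl split: if_splits)
      hence "C * \<bar>r - s\<bar> \<le> C * \<bar>t - s\<bar>" using C by simp
      moreover have "C * \<bar>t - s\<bar> \<le> e / 2" using t C by (simp add: field_simps)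
      ultimately have "C * \<bar>r - s\<bar> \<le> e / 2" by simp
      moreover have "norm (ap (A n) z) * \<bar>r - s\<bar> \<le> C * \<bar>r - s\<bar>" using C by (intro mult_right_mono) auto
      ultimately have "norm (E n r z - E n s z) \<le> e / 2" using E_lipschitz[of n r z s] by linarith
      moreover have "norm (E n r (ap (A n) x) - E n r y) = norm (ap (A n) x - y)"
        "norm (E n r y - E n r z) < e / 4" "norm (E n s y - E n s z) < e / 4"
        using z(2) by (simp_all only: E_norm flip: E_linear)
      ultimately have "norm (E n r (ap (A n) x) - E n s y) \<le> norm (ap (A n) x - y) + e"
        using norm_diff_chain[of "E n r (ap (A n) x)" "E n s y" "E n r y" "E n r z" "E n s z"]
          norm_minus_commute[of "E n s z" "E n s y"] by linarith
      hence "norm (h *\<^sub>R (E n r (ap (A n) x) - E n s y)) \<le> (norm (ap (A n) x - y) + e) * norm h" for h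
        by (simp add: mult.commute mult_left_mono)
      thus "onorm (\<lambda>h. h *\<^sub>R (E n r (ap (A n) x) - E n s y)) \<le> norm (ap (A n) x - y) + e"
        by (rule onorm_bound[rotated]) (use e in \<open>simp add: add_nonneg_nonneg\<close>)
    qed auto
    moreover have "(\<lambda>n. norm ((E n t x - t *\<^sub>R E n s y) - (E n s x - s *\<^sub>R E n s y)))
        \<longlonglongrightarrow> norm ((G t x - t *\<^sub>R G s y) - (G s x - s *\<^sub>R G s y))"
      by (intro tendsto_intros E_tendsto)
    moreover have "(\<lambda>n. (norm (ap (A n) x - y) + e) * norm (t - s)) \<longlonglongrightarrow> (norm (y - y) + e) * norm (t - s)"
      unfolding y_def by (intro tendsto_intros A_tendsto x)
    ultimately have "norm ((G t x - t *\<^sub>R G s y) - (G s x - s *\<^sub>R G s y)) \<le> (norm (y - y) + e) * norm (t - s)"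
      by (intro tendsto_le[OF sequentially_bot]) auto
    thus "norm (G t x - G s x - (t - s) *\<^sub>R G s (A0 x)) \<le> e * norm (t - s)"
      by (simp add: y_def algebra_simps)
  qed
qed

text \<open>Only strong continuity of the group is at hand, so the product is split:
  \<open>G (- s)\<close> acts on the fixed vector p t, and the difference quotient of p is handled
  by joint continuity.\<close>

lemma G_deriv_curve:
  assumes p: "(p has_vector_derivative p') (at t)" and dom: "p t \<in> dom"
  shows "((\<lambda>s. G (- s) (p s)) has_vector_derivative G (- t) (p' - A0 (p t))) (at t)"
proof -
  have "((\<lambda>s. - s) has_vector_derivative - 1) (at t)" by (auto intro!: derivative_eq_intros)
  from vector_diff_chain_at[OF this G_deriv[OF dom]]
  have 1: "((\<lambda>s. G (- s) (p t)) has_vector_derivative - G (- t) (A0 (p t))) (at t)" by (simp add: o_def)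
  have 2: "((\<lambda>s. G (- s) (p s - p t)) has_vector_derivative G (- t) p') (at t)"
    unfolding vector_derivative_quotient
  proof -
    have q: "((\<lambda>s. (p s - p t) /\<^sub>R (s - t)) \<longlongrightarrow> p') (at t)"
      using p unfolding vector_derivative_quotient .
    have "isCont (\<lambda>z. G (fst z) (snd z)) (- t, p')"
      using continuous_G by (simp add: continuous_on_eq_continuous_at)
    moreover have "((\<lambda>s. (- s, (p s - p t) /\<^sub>R (s - t))) \<longlongrightarrow> (- t, p')) (at t)"
      by (intro tendsto_intros q)
    ultimately have "((\<lambda>s. G (- s) ((p s - p t) /\<^sub>R (s - t))) \<longlongrightarrow> G (- t) p') (at t)"
      using isCont_tendsto_compose by fastforce
    thus "((\<lambda>s. (G (- s) (p s - p t) - G (- t) (p t - p t)) /\<^sub>R (s - t)) \<longlongrightarrow> G (- t) p') (at t)"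
      by simp
  qed
  have "((\<lambda>s. G (- s) (p t) + G (- s) (p s - p t)) has_vector_derivative - G (- t) (A0 (p t)) + G (- t) p') (at t)"
    by (rule has_vector_derivative_add[OF 1 2])
  thus ?thesis by simp
qed

lemma integable_G:
  assumes "integable r t f"
  shows "integable r t (\<lambda>s. G (- s) (f s))"
  unfolding set_integrable_def
proof (rule Bochner_Integration.integrable_bound)
  have eq: "indicator {r..t} s *\<^sub>R G (- s) (f s) = G (- s) (indicator {r..t} s *\<^sub>R f s)" for s by simp
  show "integrable lborel (\<lambda>s. indicator {r..t} s *\<^sub>R f s)" using assms by (simp add: set_integrable_def)
  hence [measurable]: "(\<lambda>s. indicator {r..t} s *\<^sub>R f s) \<in> borel_measurable lborel" by auto
  show "(\<lambda>s. indicator {r..t} s *\<^sub>R G (- s) (f s)) \<in> borel_measurable lborel"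
    unfolding eq by measurable
qed auto

text \<open>Pulled back by \<open>G (- t)\<close>, u becomes a primitive of an integrable function
  and p a continuously differentiable curve. After the integration by parts, isometry removes the
  group.\<close>

lemma mild_test:
  assumes T: "0 \<le> T" and f: "integable 0 T f"
    and u: "\<And>t. 0 \<le> t \<Longrightarrow> t \<le> T \<Longrightarrow> u t = G t (w0 + integ 0 t (\<lambda>s. G (- s) (f s)))"
    and p: "\<And>t. 0 \<le> t \<Longrightarrow> t \<le> T \<Longrightarrow> (p has_vector_derivative p' t) (at t)"
    and dom: "\<And>t. 0 \<le> t \<Longrightarrow> t \<le> T \<Longrightarrow> p t \<in> dom"
    and p': "continuous_on {0..T} p'" "continuous_on {0..T} (\<lambda>t. A0 (p t))"
  shows "integ 0 T (\<lambda>t. u t \<bullet> (p' t - A0 (p t))) = u T \<bullet> p T - w0 \<bullet> p 0 - integ 0 T (\<lambda>s. f s \<bullet> p s)"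
proof -
  have "integ 0 T (\<lambda>t. G (- t) (u t) \<bullet> G (- t) (p' t - A0 (p t))) =
     G (- T) (u T) \<bullet> G (- T) (p T) - w0 \<bullet> G (- 0) (p 0) - integ 0 T (\<lambda>s. G (- s) (f s) \<bullet> G (- s) (p s))"
  proof (rule integ_by_parts[OF T integable_G[OF f]])
    show "((\<lambda>t. G (- t) (p t)) has_vector_derivative G (- t) (p' t - A0 (p t))) (at t)" if "0 \<le> t" "t \<le> T" for t
      by (rule G_deriv_curve[OF p[OF that] dom[OF that]])
    show "continuous_on {0..T} (\<lambda>t. G (- t) (p' t - A0 (p t)))" by (intro continuous_intros p')
    show "G (- t) (u t) = w0 + integ 0 t (\<lambda>s. G (- s) (f s))" if "0 \<le> t" "t \<le> T" for t
      using u[OF that] by (simp del: G_linear)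
  qed
  thus ?thesis unfolding G_inner by simp
qed

text \<open>Testing with the moving vector \<open>G r x\<close> cancels the generator terms and
  leaves the derivative \<open>f t \<bullet> G t x\<close>, whose integral is Duhamel's formula.
  Since \<open>G r x\<close> is available only through the closed graph over the core, the identity
  is first extended to pairs in that closed graph.\<close>

lemma weak_imp_mild:
  assumes v: "continuous_on {0..} v" and f: "continuous_on {0..} f"
    and der: "\<And>\<psi> t. \<psi> \<in> core \<Longrightarrow> t > 0 \<Longrightarrow> ((\<lambda>t. v t \<bullet> \<psi>) has_real_derivative (f t \<bullet> \<psi> - v t \<bullet> A0 \<psi>)) (at t)"
    and t: "t \<ge> 0"
  shows "v t = G t (v 0 + integ 0 t (\<lambda>s. G (- s) (f s)))"
proof -
  let ?\<Gamma> = "(\<lambda>y. (y, A0 y)) ` core"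
  have iv: "integable r t v" and jf: "integable r t f" if "0 \<le> r" for r t
    using that by (auto intro!: continuous_integable continuous_on_subset[OF v] continuous_on_subset[OF f])
  \<comment> \<open>The integrated identity is a closed condition on the pair, which the
    differentiated one is not visibly; the next step differentiates again.\<close>
  have 1: "v t \<bullet> fst yz - v s \<bullet> fst yz = integ s t f \<bullet> fst yz - integ s t v \<bullet> snd yz"
    if yz: "yz \<in> closure ?\<Gamma>" and st: "0 < s" "s \<le> t" for yz s t
  proof -
    have "closed {yz. v t \<bullet> fst yz - v s \<bullet> fst yz = integ s t f \<bullet> fst yz - integ s t v \<bullet> snd yz}"
      by (intro closed_Collect_eq continuous_intros)
    moreover have "?\<Gamma> \<subseteq> {yz. v t \<bullet> fst yz - v s \<bullet> fst yz = integ s t f \<bullet> fst yz - integ s t v \<bullet> snd yz}"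
    proof clarsimp
      fix \<psi> assume \<psi>: "\<psi> \<in> core"
      have "integ s t (\<lambda>r. f r \<bullet> \<psi> - v r \<bullet> A0 \<psi>) = v t \<bullet> \<psi> - v s \<bullet> \<psi>"
        by (rule integ_FTC[where F = "\<lambda>r. v r \<bullet> \<psi>"])
           (use st in \<open>auto intro!: der[OF \<psi>] continuous_intros continuous_on_subset[OF v] continuous_on_subset[OF f]\<close>)
      moreover have "integ s t (\<lambda>r. f r \<bullet> \<psi> - v r \<bullet> A0 \<psi>) = integ s t f \<bullet> \<psi> - integ s t v \<bullet> A0 \<psi>"
        using st iv jf by (simp add: integ_inner set_integral_diff)
      ultimately show "v t \<bullet> \<psi> - v s \<bullet> \<psi> = integ s t f \<bullet> \<psi> - integ s t v \<bullet> A0 \<psi>" by simp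
    qed
    ultimately show ?thesis using closure_minimal yz by blast
  qed
  have 2: "((\<lambda>r. v r \<bullet> y) has_real_derivative f t \<bullet> y - v t \<bullet> z) (at t)"
    if yz: "(y, z) \<in> closure ?\<Gamma>" and t: "0 < t" for y z t
  proof -
    have c: "continuous_on {t/2..t+1} (\<lambda>r. f r \<bullet> y - v r \<bullet> z)"
      by (intro continuous_intros continuous_on_subset[OF v] continuous_on_subset[OF f]) (use t in auto)
    have "((\<lambda>r. v (t/2) \<bullet> y + integ (t/2) r (\<lambda>r. f r \<bullet> y - v r \<bullet> z)) has_real_derivative 0 + (f t \<bullet> y - v t \<bullet> z)) (at t)"
      by (intro DERIV_add DERIV_const integ_deriv[OF c]) (use t in auto)
    hence "((\<lambda>r. v (t/2) \<bullet> y + integ (t/2) r (\<lambda>r. f r \<bullet> y - v r \<bullet> z)) has_real_derivative f t \<bullet> y - v t \<bullet> z) (at t)" by simp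
    thus ?thesis
    proof (rule has_field_derivative_transform_within_open[where S = "{t/2<..<t+1}"])
      fix r assume r: "r \<in> {t/2<..<t+1}"
      have "integ (t/2) r (\<lambda>r. f r \<bullet> y - v r \<bullet> z) = integ (t/2) r f \<bullet> y - integ (t/2) r v \<bullet> z"
        using t iv jf by (simp add: integ_inner set_integral_diff)
      thus "v (t/2) \<bullet> y + integ (t/2) r (\<lambda>r. f r \<bullet> y - v r \<bullet> z) = v r \<bullet> y"
        using 1[OF yz, of "t/2" r] t r by simp
    qed (use t in auto)
  qed
  have 3: "((\<lambda>r. v r \<bullet> G r x) has_real_derivative f t \<bullet> G t x) (at t)" if x: "x \<in> core" and t: "0 < t" for x t
  proof -
    have a: "((\<lambda>r. v r \<bullet> G t x) has_real_derivative f t \<bullet> G t x - v t \<bullet> G t (A0 x)) (at t)"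
      by (rule 2[OF G_graph[OF x] t])
    have "((\<lambda>r. (G r x - G t x) /\<^sub>R (r - t)) \<longlongrightarrow> G t (A0 x)) (at t)"
      using G_deriv[OF core_dom[OF x]] unfolding vector_derivative_quotient .
    moreover have "(v \<longlongrightarrow> v t) (at t)"
    proof -
      have "continuous (at t within {0..}) v" using v t by (auto simp: continuous_on_eq_continuous_within)
      moreover have "at t within {0..} = at t" using t by (intro at_within_interior) simp
      ultimately show ?thesis by (simp add: continuous_within)
    qed
    ultimately have "((\<lambda>r. v r \<bullet> ((G r x - G t x) /\<^sub>R (r - t))) \<longlongrightarrow> v t \<bullet> G t (A0 x)) (at t)"
      by (intro tendsto_inner)
    hence b: "((\<lambda>r. v r \<bullet> (G r x - G t x)) has_real_derivative v t \<bullet> G t (A0 x)) (at t)"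
      unfolding has_field_derivative_iff by (simp add: divide_inverse mult.commute)
    have "((\<lambda>r. v r \<bullet> G t x + v r \<bullet> (G r x - G t x)) has_real_derivative
       (f t \<bullet> G t x - v t \<bullet> G t (A0 x)) + v t \<bullet> G t (A0 x)) (at t)"
      by (rule DERIV_add[OF a b])
    thus ?thesis by (simp add: inner_diff_right)
  qed
  have iG: "integable 0 t (\<lambda>s. G (- s) (f s))" by (rule integable_G[OF jf]) simp
  have "G (- t) (v t) - v 0 - integ 0 t (\<lambda>s. G (- s) (f s)) = 0"
  proof (rule core_inner_eq)
    fix x assume x: "x \<in> core"
    have "integ 0 t (\<lambda>s. f s \<bullet> G s x) = v t \<bullet> G t x - v 0 \<bullet> G 0 x"
      by (rule integ_FTC[where F = "\<lambda>r. v r \<bullet> G r x"])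
         (use t in \<open>auto intro!: 3[OF x] continuous_intros continuous_on_subset[OF v] continuous_on_subset[OF f]\<close>)
    moreover have "f s \<bullet> G s x = G (- s) (f s) \<bullet> x" for s
      using G_adj[of "- s" "f s" x] by simp
    ultimately have "integ 0 t (\<lambda>s. G (- s) (f s)) \<bullet> x = v t \<bullet> G t x - v 0 \<bullet> G 0 x"
      unfolding integ_inner(1)[OF iG, of x] by (simp only:)
    moreover have "v t \<bullet> G t x = G (- t) (v t) \<bullet> x" using G_adj[of "- t" "v t" x] by simp
    ultimately have "integ 0 t (\<lambda>s. G (- s) (f s)) \<bullet> x = G (- t) (v t) \<bullet> x - v 0 \<bullet> x" by (simp only: G_0)
    thus "(G (- t) (v t) - v 0 - integ 0 t (\<lambda>s. G (- s) (f s))) \<bullet> x = 0"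
      by (simp add: inner_diff_left)
  qed
  hence "G (- t) (v t) = v 0 + integ 0 t (\<lambda>s. G (- s) (f s))" by (simp add: algebra_simps)
  thus ?thesis by (metis G_inverse(2))
qed

subsection \<open>Bounded perturbations\<close>

text \<open>The group stands outside the integral, so that \<open>G (- t) (u t)\<close> is visibly a
  primitive. B takes up all terms of order zero.\<close>

definition mild :: "'h endo \<Rightarrow> (real \<Rightarrow> 'h) \<Rightarrow> 'h \<Rightarrow> real \<Rightarrow> (real \<Rightarrow> 'h) \<Rightarrow> bool" where
  "mild B F u0 T u \<longleftrightarrow> continuous_on {0..T} u \<and>
     (\<forall>t\<in>{0..T}. u t = G t (u0 + integ 0 t (\<lambda>s. G (- s) (ap B (u s) + F s))))"
lemma mild_0: "mild B F u0 T u \<Longrightarrow> 0 \<le> T \<Longrightarrow> u 0 = u0"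
  unfolding mild_def using integ_refl[of 0] by (auto dest!: bspec[of _ _ 0])

lemma integable_ap: "integable r t k \<Longrightarrow> integable r t (\<lambda>s. ap B (k s))"
  unfolding set_integrable_def
  using integrable_bounded_linear[OF bounded_linear_ap, of lborel "\<lambda>s. indicator {r..t} s *\<^sub>R k s" B] by simp

lemma mild_integable:
  assumes "mild B F u0 T u" "integable 0 T F"
  shows "integable 0 T (\<lambda>s. ap B (u s) + F s)"
  using assms unfolding mild_def
  by (intro set_integral_add(1) integable_ap continuous_integable[of _ _ u]) auto

text \<open>For w t = \<open>G (- t) (u t)\<close> the equation is of Volterra type with the kernel
  \<open>G (- s)\<close> B \<open>G s\<close>, which is bounded by \<open>norm B\<close>.\<close>

lemma mild_exists:
  assumes F: "\<And>T. integable 0 T F"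
  obtains u where "continuous_on {0..} u" "\<And>T. mild B F u0 T u"
proof -
  define C where "C s x = G (- s) (ap B (G s x))" for s x
  define \<gamma> where "\<gamma> t = u0 + integ 0 t (\<lambda>s. G (- s) (F s))" for t
  have FG: "integable 0 T (\<lambda>s. G (- s) (F s))" for T by (rule integable_G[OF F])
  have C_lin: "bounded_linear (C s)" for s
    unfolding C_def by (rule bounded_linear_compose[OF bounded_linear_G bounded_linear_compose[OF bounded_linear_ap bounded_linear_G]])
  have C_bd: "norm (C s x) \<le> norm B * norm x" for s x
    unfolding C_def using norm_ap[of B "G s x"] by simp
  have C_cont: "continuous_on X w \<Longrightarrow> continuous_on X \<tau> \<Longrightarrow> continuous_on X (\<lambda>z. C (\<tau> z) (w z))" for X :: "'z::topological_space set" and w \<tau>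
    unfolding C_def by (intro continuous_intros bounded_linear.continuous_on[OF bounded_linear_ap])
  have C_c: "continuous_on UNIV (\<lambda>z. C (fst z) (snd z))" by (intro C_cont continuous_intros)
  have \<gamma>_c: "continuous_on {0..} \<gamma>" unfolding \<gamma>_def by (intro continuous_intros continuous_integ FG)
  obtain w where w: "continuous_on {0..} w"
    "\<And>t. t \<ge> 0 \<Longrightarrow> w t = \<gamma> t + integ 0 t (\<lambda>s. C s (w s))"
    by (rule volterra_exists[OF C_lin C_bd C_c \<gamma>_c]) (rule that)
  define u where "u t = G t (w t)" for t
  have Cw: "integable 0 T (\<lambda>s. C s (w s))" for T
  proof -
    have "continuous_on {0..T} w" by (rule continuous_on_subset[OF w(1)]) auto
    thus ?thesis by (rule continuous_integable[OF C_cont[OF _ continuous_on_id]])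
  qed
  show thesis
  proof (rule that)
    show uc: "continuous_on {0..} u" unfolding u_def by (intro continuous_intros w)
    show "mild B F u0 T u" for T
      unfolding mild_def
    proof (intro conjI ballI)
      show "continuous_on {0..T} u" by (rule continuous_on_subset[OF uc]) auto
      fix t assume t: "t \<in> {0..T}"
      have "G (- s) (ap B (u s) + F s) = C s (w s) + G (- s) (F s)" for s by (simp add: u_def C_def)
      hence "integ 0 t (\<lambda>s. G (- s) (ap B (u s) + F s)) = integ 0 t (\<lambda>s. C s (w s)) + integ 0 t (\<lambda>s. G (- s) (F s))"
        by (simp only: set_integral_add(2)[OF Cw FG])
      thus "u t = G t (u0 + integ 0 t (\<lambda>s. G (- s) (ap B (u s) + F s)))"
        using w(2)[of t] t by (simp add: u_def \<gamma>_def algebra_simps)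
    qed
  qed
qed

text \<open>Isometry of the group leaves Gronwall's inequality with rate \<open>norm B\<close>; the
  source enters through its integral over all of [0, T], which does not depend on t.\<close>

lemma mild_bound:
  assumes u: "mild B F u0 T u" and F: "integable 0 T F" and t: "0 \<le> t" "t \<le> T"
  shows "norm (u t) \<le> (norm u0 + integ 0 T (\<lambda>s. norm (F s))) * exp (norm B * t)"
proof (rule gronwall[OF t _ norm_ge_zero])
  show c: "continuous_on {0..T} (\<lambda>t. norm (u t))" using u unfolding mild_def by (intro continuous_intros) auto
  fix t assume t: "0 \<le> t" "t \<le> T"
  have nF: "integable 0 T (\<lambda>s. norm (F s))" using F by (rule set_integrable_norm)
  have nu: "integable 0 t (\<lambda>s. norm B * norm (u s))"
    by (intro continuous_integable continuous_intros continuous_on_subset[OF c]) (use t in auto)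
  have i: "integable 0 t (\<lambda>s. ap B (u s) + F s)"
    by (rule integable_subset[OF mild_integable[OF u F]]) (use t in auto)
  have "u t = G t (u0 + integ 0 t (\<lambda>s. G (- s) (ap B (u s) + F s)))"
    using u t unfolding mild_def by simp
  hence "norm (u t) = norm (u0 + integ 0 t (\<lambda>s. G (- s) (ap B (u s) + F s)))" by (simp only: G_norm)
  also have "\<dots> \<le> norm u0 + norm (integ 0 t (\<lambda>s. G (- s) (ap B (u s) + F s)))" by (rule norm_triangle_ineq)
  also have "norm (integ 0 t (\<lambda>s. G (- s) (ap B (u s) + F s))) \<le> integ 0 t (\<lambda>s. norm B * norm (u s) + norm (F s))"
  proof (rule integ_norm_bound[OF integable_G[OF i]])
    show "integable 0 t (\<lambda>s. norm B * norm (u s) + norm (F s))"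
      by (intro set_integral_add(1) nu integable_subset[OF nF]) (use t in auto)
    show "norm (G (- s) (ap B (u s) + F s)) \<le> norm B * norm (u s) + norm (F s)" for s
      unfolding G_norm by (intro order_trans[OF norm_triangle_ineq] add_mono norm_ap order_refl)
  qed
  also have "\<dots> = norm B * integ 0 t (\<lambda>s. norm (u s)) + integ 0 t (\<lambda>s. norm (F s))"
    using set_integral_add(2)[OF nu integable_subset[OF nF]] t by simp
  also have "integ 0 t (\<lambda>s. norm (F s)) \<le> integ 0 T (\<lambda>s. norm (F s))"
    using nF t unfolding set_lebesgue_integral_def set_integrable_def
    by (intro integral_mono integable_subset[OF nF, unfolded set_integrable_def]) (auto simp: indicator_def)
  finally show "norm (u t) \<le> norm u0 + integ 0 T (\<lambda>s. norm (F s)) + norm B * integ 0 t (\<lambda>s. norm (u s))"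
    by simp
qed

lemma mild_diff:
  assumes u: "mild B F u0 T u" "integable 0 T F" and v: "mild B F' v0 T v" "integable 0 T F'"
  shows "mild B (\<lambda>s. F s - F' s) (u0 - v0) T (\<lambda>t. u t - v t)"
  unfolding mild_def
proof (intro conjI ballI)
  show "continuous_on {0..T} (\<lambda>t. u t - v t)" using u v unfolding mild_def by (intro continuous_intros) auto
  fix t assume t: "t \<in> {0..T}"
  have "integable 0 t (\<lambda>s. ap B (u s) + F s)" "integable 0 t (\<lambda>s. ap B (v s) + F' s)"
    using mild_integable[OF u] mild_integable[OF v] t by (auto intro: integable_subset)
  from set_integral_diff(2)[OF this[THEN integable_G]]
  have "integ 0 t (\<lambda>s. G (- s) (ap B (u s - v s) + (F s - F' s))) =
     integ 0 t (\<lambda>s. G (- s) (ap B (u s) + F s)) - integ 0 t (\<lambda>s. G (- s) (ap B (v s) + F' s))"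
    by (simp add: algebra_simps)
  moreover have "u t = G t (u0 + integ 0 t (\<lambda>s. G (- s) (ap B (u s) + F s)))"
    "v t = G t (v0 + integ 0 t (\<lambda>s. G (- s) (ap B (v s) + F' s)))"
    using u v t unfolding mild_def by auto
  ultimately show "u t - v t = G t (u0 - v0 + integ 0 t (\<lambda>s. G (- s) (ap B (u s - v s) + (F s - F' s))))"
    by simp
qed

text \<open>The sources are compared on [0, T] only. This is causality, which will allow a source to
  be cut off in the future.\<close>

lemma mild_unique:
  assumes u: "mild B F u0 T u" "integable 0 T F" and v: "mild B F' u0 T v" "integable 0 T F'"
    and eq: "\<And>s. 0 \<le> s \<Longrightarrow> s \<le> T \<Longrightarrow> F s = F' s" and t: "0 \<le> t" "t \<le> T"
  shows "u t = v t"
proof -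
  have "integ 0 T (\<lambda>s. norm (F s - F' s)) = integ 0 T (\<lambda>s. 0)"
    by (rule set_lebesgue_integral_cong) (use eq in auto)
  thus ?thesis
    using mild_bound[OF mild_diff[OF u v] set_integral_diff(1)[OF u(2) v(2)] t] by (simp add: set_lebesgue_integral_def)
qed

subsection \<open>The stationary problem\<close>

text \<open>A null solution y of \<tau> - A0 - B would make
  \<open>exp (\<tau> * t) *\<^sub>R y\<close> a mild solution without source, which contradicts the
  growth rate \<open>norm B\<close> already at t = 1.\<close>

lemma stationary_unique:
  assumes y: "\<And>\<psi>. \<psi> \<in> core \<Longrightarrow> \<tau> * (y \<bullet> \<psi>) = ap B y \<bullet> \<psi> - y \<bullet> A0 \<psi>" and \<tau>: "\<tau> > norm B"
  shows "y = 0"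
proof (rule ccontr)
  assume y0: "y \<noteq> 0"
  define v where "v t = exp (\<tau> * t) *\<^sub>R y" for t
  have v: "continuous_on X v" for X unfolding v_def by (intro continuous_intros)
  have "v t = G t (v 0 + integ 0 t (\<lambda>s. G (- s) (ap B (v s))))" if "t \<ge> 0" for t
  proof (rule weak_imp_mild[OF v _ _ that])
    show "continuous_on {0..} (\<lambda>s. ap B (v s))" by (rule bounded_linear.continuous_on[OF bounded_linear_ap v])
    fix \<psi> t assume \<psi>: "\<psi> \<in> core"
    have "((\<lambda>t. exp (\<tau> * t) * (y \<bullet> \<psi>)) has_real_derivative exp (\<tau> * t) * \<tau> * (y \<bullet> \<psi>)) (at t)"
      by (auto intro!: derivative_eq_intros)
    moreover have "exp (\<tau> * t) * \<tau> * (y \<bullet> \<psi>) = exp (\<tau> * t) * (ap B y \<bullet> \<psi> - y \<bullet> A0 \<psi>)"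
      by (simp add: y[OF \<psi>, symmetric])
    ultimately show "((\<lambda>t. v t \<bullet> \<psi>) has_real_derivative ap B (v t) \<bullet> \<psi> - v t \<bullet> A0 \<psi>) (at t)"
      by (simp only: v_def ap_linear inner_scaleR_left right_diff_distrib)
  qed
  moreover have "v 0 = y" by (simp add: v_def)
  ultimately have "mild B (\<lambda>_. 0) y 1 v"
    unfolding mild_def add_0_right by (intro conjI ballI v) (simp only: atLeastAtMost_iff)
  from mild_bound[OF this, of 1] have "norm (v 1) \<le> norm y * exp (norm B)"
    by (simp add: set_lebesgue_integral_def set_integrable_def)
  hence "exp \<tau> * norm y \<le> exp (norm B) * norm y" by (simp add: v_def mult.commute)
  thus False using y0 \<tau> by simp
qed

text \<open>The resolvent at z is the Laplace integral of its orbit. Cut off at T, this integral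
  stays in the closed graph over the core and solves the equation up to
  \<open>exp (- \<tau> * T) *\<^sub>R G T z\<close>; a core element close to it in graph norm is the
  witness.\<close>

lemma range_dense:
  assumes \<tau>: "\<tau> > 0" and e: "e > 0"
  shows "\<exists>\<psi>\<in>core. norm (\<tau> *\<^sub>R \<psi> - A0 \<psi> - x) < e"
proof -
  obtain z where z: "z \<in> core" "norm (x - z) < e / 3" using core_approx[of "e/3" x] e by auto
  let ?\<Gamma> = "(\<lambda>y. (y, A0 y)) ` core"
  have "subspace ?\<Gamma>"
    unfolding subspace_def
  proof (intro conjI ballI allI)
    have "A0 0 = 0" using A0_scale[of z 0] core_dom[OF z(1)] by simp
    thus "0 \<in> ?\<Gamma>" using subspace_0[OF subspace_core] by (auto simp: zero_prod_def image_iff)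
  next
    fix p q assume "p \<in> ?\<Gamma>" "q \<in> ?\<Gamma>"
    then obtain a b where "p = (a, A0 a)" "q = (b, A0 b)" "a \<in> core" "b \<in> core" by auto
    thus "p + q \<in> ?\<Gamma>" using A0_add[of a b] subspace_add[OF subspace_core, of a b] core_dom by auto
  next
    fix c p assume "p \<in> ?\<Gamma>"
    then obtain a where "p = (a, A0 a)" "a \<in> core" by auto
    thus "c *\<^sub>R p \<in> ?\<Gamma>" using A0_scale[of a c] subspace_scale[OF subspace_core, of a c] core_dom by auto
  qed
  hence sub: "subspace (closure ?\<Gamma>)" by (rule subspace_closure)
  \<comment> \<open>The orbit and its derivative are carried along as one pair, so that the integral
    lands in the closed graph.\<close>
  define g where "g s = exp (- \<tau> * s) *\<^sub>R (G s z, G s (A0 z))" for s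
  have g\<Gamma>: "g s \<in> closure ?\<Gamma>" for s
    unfolding g_def by (intro subspace_scale[OF sub] G_graph z)
  have "((\<lambda>s. exp (- \<tau> * s)) \<longlongrightarrow> 0) at_top"
    using \<tau> by (intro filterlim_compose[OF exp_at_bot] filterlim_tendsto_neg_mult_at_bot[OF tendsto_const] filterlim_ident) auto
  from tendsto_norm[OF tendsto_scaleR[OF this tendsto_const[of z]]]
  have "((\<lambda>s. norm (exp (- \<tau> * s) *\<^sub>R z)) \<longlongrightarrow> 0) at_top" by simp
  hence "\<forall>\<^sub>F s in at_top. norm (exp (- \<tau> * s) *\<^sub>R z) < e / 3"
    by (rule order_tendstoD(2)) (use e in simp)
  hence "\<forall>\<^sub>F s in at_top. norm (exp (- \<tau> * s) *\<^sub>R z) < e / 3 \<and> s \<ge> 0"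
    by (intro eventually_conj eventually_ge_at_top)
  then obtain T where T: "norm (exp (- \<tau> * T) *\<^sub>R z) < e / 3" "T \<ge> 0"
    by (auto simp: eventually_at_top_linorder)
  have "continuous_on {0..T} g" unfolding g_def by (intro continuous_intros)
  hence gI: "(g has_integral integral {0..T} g) {0..T}" by (intro integrable_integral integrable_continuous_interval)
  define I where "I = integral {0..T} g"
  have I\<Gamma>: "I \<in> closure ?\<Gamma>" unfolding I_def by (rule has_integral_in_subspace[OF gI sub closed_closure g\<Gamma>])
  have "((\<lambda>s. exp (- \<tau> * s) *\<^sub>R G s (A0 z) - (\<tau> * exp (- \<tau> * s)) *\<^sub>R G s z) has_integral
        exp (- \<tau> * T) *\<^sub>R G T z - exp (- \<tau> * 0) *\<^sub>R G 0 z) {0..T}"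
  proof (rule fundamental_theorem_of_calculus[OF T(2)])
    fix s
    have "((\<lambda>s. exp (- \<tau> * s)) has_field_derivative exp (- \<tau> * s) * (- \<tau>)) (at s)" by (auto intro!: derivative_eq_intros)
    from has_vector_derivative_scaleR[OF this G_deriv[OF core_dom[OF z(1)]]]
    show "((\<lambda>s. exp (- \<tau> * s) *\<^sub>R G s z) has_vector_derivative
       exp (- \<tau> * s) *\<^sub>R G s (A0 z) - (\<tau> * exp (- \<tau> * s)) *\<^sub>R G s z) (at s within {0..T})"
      by (rule has_vector_derivative_at_within[OF has_vector_derivative_eq_rhs]) (simp add: algebra_simps)
  qed
  moreover have "((\<lambda>s. snd (g s) - \<tau> *\<^sub>R fst (g s)) has_integral snd I - \<tau> *\<^sub>R fst I) {0..T}"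
    using has_integral_linear[OF gI[folded I_def] bounded_linear_sub[OF bounded_linear_snd bounded_linear_const_scaleR[OF bounded_linear_fst, of \<tau>]]]
    by (simp add: o_def)
  ultimately have I: "snd I - \<tau> *\<^sub>R fst I = exp (- \<tau> * T) *\<^sub>R G T z - z"
    by (intro has_integral_unique[of "\<lambda>s. snd (g s) - \<tau> *\<^sub>R fst (g s)"]) (auto simp: g_def)
  \<comment> \<open>The two components of an error in the graph enter \<tau> \<psi> - A0 \<psi> with
    weights \<tau> and 1.\<close>
  define \<epsilon> where "\<epsilon> = e / (3 * (1 + \<tau>))"
  have \<epsilon>: "\<epsilon> > 0" using e \<tau> by (simp add: \<epsilon>_def)
  then obtain \<psi> where \<psi>: "\<psi> \<in> core" "dist (\<psi>, A0 \<psi>) I < \<epsilon>"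
    using I\<Gamma> unfolding closure_approachable by auto
  have "norm (\<psi> - fst I) < \<epsilon>" "norm (A0 \<psi> - snd I) < \<epsilon>"
    using dist_fst_le[of "(\<psi>, A0 \<psi>)" I] dist_snd_le[of "(\<psi>, A0 \<psi>)" I] \<psi>(2) by (auto simp: dist_norm)
  hence "norm (\<tau> *\<^sub>R (\<psi> - fst I)) + norm (A0 \<psi> - snd I) < \<tau> * \<epsilon> + \<epsilon>"
    using \<tau> by (intro add_strict_mono) auto
  also have "\<tau> * \<epsilon> + \<epsilon> = (1 + \<tau>) * \<epsilon>" by (simp add: algebra_simps)
  also have "\<dots> = e / 3"
  proof -
    have "1 + \<tau> \<noteq> 0" using \<tau> by simp
    thus ?thesis unfolding \<epsilon>_def by (simp add: divide_simps)
  qed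
  finally have 1: "norm (\<tau> *\<^sub>R (\<psi> - fst I)) + norm (A0 \<psi> - snd I) < e / 3" .
  have eq: "\<tau> *\<^sub>R \<psi> - A0 \<psi> - x = \<tau> *\<^sub>R (\<psi> - fst I) - (A0 \<psi> - snd I) - (x - z) - exp (- \<tau> * T) *\<^sub>R G T z"
    using I by (simp add: algebra_simps)
  have "norm (exp (- \<tau> * T) *\<^sub>R G T z) < e / 3" using T(1) by simp
  hence "norm (\<tau> *\<^sub>R \<psi> - A0 \<psi> - x) < e" unfolding eq
    using 1 z(2) norm_diff4_le[of "\<tau> *\<^sub>R (\<psi> - fst I)" "A0 \<psi> - snd I" "x - z" "exp (- \<tau> * T) *\<^sub>R G T z"] by linarith
  thus ?thesis using \<psi>(1) by blast
qed

text \<open>Skewness bounds \<tau> times the norm of a core element by the norm of its image under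
  \<tau> - A0. Hence core elements whose images tend to F form a Cauchy sequence, and uniqueness
  identifies its limit with y. Identities that are verified on the core thereby pass to weak
  solutions.\<close>

lemma stationary_approx:
  assumes \<tau>: "\<tau> > 0" and y: "\<And>\<psi>. \<psi> \<in> core \<Longrightarrow> \<tau> * (y \<bullet> \<psi>) = F \<bullet> \<psi> - y \<bullet> A0 \<psi>"
  obtains \<psi> where "\<And>n. \<psi> n \<in> core" "\<psi> \<longlonglongrightarrow> y" "(\<lambda>n. \<tau> *\<^sub>R \<psi> n - A0 (\<psi> n)) \<longlonglongrightarrow> F"
proof -
  have "\<exists>\<psi>\<in>core. norm (\<tau> *\<^sub>R \<psi> - A0 \<psi> - F) < 1 / real (Suc n)" for n
    by (rule range_dense[OF \<tau>]) simp
  then obtain \<psi> where \<psi>: "\<And>n. \<psi> n \<in> core" "\<And>n. norm (\<tau> *\<^sub>R \<psi> n - A0 (\<psi> n) - F) < 1 / real (Suc n)" by metis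
  define R where "R n = \<tau> *\<^sub>R \<psi> n - A0 (\<psi> n)" for n
  have R: "R \<longlonglongrightarrow> F"
  proof (rule LIM_zero_cancel, rule Lim_null_comparison)
    show "\<forall>\<^sub>F n in sequentially. norm (R n - F) \<le> 1 / real (Suc n)"
      using \<psi>(2) unfolding R_def by (intro always_eventually allI less_imp_le)
    show "(\<lambda>n. 1 / real (Suc n)) \<longlonglongrightarrow> 0" by (rule LIMSEQ_Suc[OF lim_1_over_n])
  qed
  have coer: "\<tau> * norm z \<le> norm (\<tau> *\<^sub>R z - A0 z)" if "z \<in> core" for z
  proof (cases "z = 0")
    case False
    have "A0 z \<bullet> z = 0" using skew_A0[OF core_dom core_dom, OF that that] by (simp add: inner_commute)
    hence "(\<tau> *\<^sub>R z - A0 z) \<bullet> z = \<tau> * (norm z)\<^sup>2" by (simp add: inner_diff_left power2_norm_eq_inner)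
    hence "\<tau> * norm z * norm z \<le> norm (\<tau> *\<^sub>R z - A0 z) * norm z"
      by (metis norm_cauchy_schwarz power2_eq_square mult.assoc)
    thus ?thesis using False by simp
  qed simp
  have diff: "\<tau> * norm (\<psi> m - \<psi> n) \<le> norm (R m - R n)" for m n
    using coer[OF subspace_diff[OF subspace_core \<psi>(1) \<psi>(1)], of m n]
    by (simp add: R_def A0_diff core_dom \<psi>(1) algebra_simps)
  have "Cauchy \<psi>"
  proof (rule metric_CauchyI)
    fix e :: real assume "e > 0"
    then obtain M where M: "\<And>m n. m \<ge> M \<Longrightarrow> n \<ge> M \<Longrightarrow> dist (R m) (R n) < \<tau> * e"
      using LIMSEQ_imp_Cauchy[OF R] \<tau> unfolding Cauchy_def by (metis mult_pos_pos)
    show "\<exists>M. \<forall>m\<ge>M. \<forall>n\<ge>M. dist (\<psi> m) (\<psi> n) < e"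
    proof (intro exI[of _ M] allI impI)
      fix m n assume "m \<ge> M" "n \<ge> M"
      hence "\<tau> * norm (\<psi> m - \<psi> n) < \<tau> * e" using M[of m n] diff[of m n] by (simp add: dist_norm)
      thus "dist (\<psi> m) (\<psi> n) < e" using \<tau> by (simp add: dist_norm)
    qed
  qed
  then obtain y' where y': "\<psi> \<longlonglongrightarrow> y'" by (meson Cauchy_convergent_iff convergent_def)
  have "y - y' = 0"
  proof (rule stationary_unique[where B = 0 and \<tau> = \<tau>])
    fix \<eta> assume \<eta>: "\<eta> \<in> core"
    have "R n \<bullet> \<eta> = \<tau> * (\<psi> n \<bullet> \<eta>) + \<psi> n \<bullet> A0 \<eta>" for n
      using skew_A0[OF core_dom core_dom, OF \<psi>(1) \<eta>] by (simp add: R_def inner_diff_left)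
    moreover have "(\<lambda>n. R n \<bullet> \<eta>) \<longlonglongrightarrow> F \<bullet> \<eta>" by (intro tendsto_intros R)
    moreover have "(\<lambda>n. \<tau> * (\<psi> n \<bullet> \<eta>) + \<psi> n \<bullet> A0 \<eta>) \<longlonglongrightarrow> \<tau> * (y' \<bullet> \<eta>) + y' \<bullet> A0 \<eta>"
      by (intro tendsto_intros y')
    ultimately have "F \<bullet> \<eta> = \<tau> * (y' \<bullet> \<eta>) + y' \<bullet> A0 \<eta>" using LIMSEQ_unique by simp
    thus "\<tau> * ((y - y') \<bullet> \<eta>) = ap 0 (y - y') \<bullet> \<eta> - (y - y') \<bullet> A0 \<eta>"
      using y[OF \<eta>] by (simp add: inner_diff_left algebra_simps)
  qed (use \<tau> in simp)
  thus thesis using that[OF \<psi>(1)] y' R unfolding R_def by simp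
qed

end

subsection \<open>Laplace transforms\<close>

definition laplace :: "real \<Rightarrow> (real \<Rightarrow> 'a::{banach,second_countable_topology}) \<Rightarrow> 'a" where
  "laplace \<tau> u = set_lebesgue_integral lborel {0..} (\<lambda>t. exp (- \<tau> * t) *\<^sub>R u t)"

abbreviation laplaceable :: "real \<Rightarrow> (real \<Rightarrow> 'a::{banach,second_countable_topology}) \<Rightarrow> bool" where
  "laplaceable \<tau> u \<equiv> set_integrable lborel {0..} (\<lambda>t. exp (- \<tau> * t) *\<^sub>R u t)"

lemma laplaceable_1:
  assumes "a > 0" shows "laplaceable a (\<lambda>_. C :: real)"
proof -
  have m: "(\<lambda>x. indicator {0..} x *\<^sub>R exp (- a * x)) \<in> borel_measurable borel"
    by (intro borel_measurable_continuous_on_indicator continuous_intros) simp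
  have "(\<lambda>x. exp (- a * x)) integrable_on {0..}"
    using has_integral_exp_minus_to_infinity[OF assms, of 0] by (rule has_integral_integrable)
  hence "set_integrable lebesgue {0..} (\<lambda>x. exp (- a * x))"
    by (rule nonnegative_absolutely_integrable_1) simp
  hence "set_integrable lborel {0..} (\<lambda>x. exp (- a * x))"
    unfolding set_integrable_def using integrable_completion[of "\<lambda>x. indicator {0..} x *\<^sub>R exp (- a * x)" lborel] m by simp
  thus ?thesis using set_integrable_mult_left[of C lborel "{0..}" "\<lambda>x. exp (- a * x)"] by simp
qed

lemma laplaceable_continuous:
  assumes c: "continuous_on {0..} u" and bd: "\<And>t. t \<ge> 0 \<Longrightarrow> norm (u t) \<le> C * exp (K * t)" and \<tau>: "\<tau> > K"
  shows "laplaceable \<tau> u"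
  unfolding set_integrable_def
proof (rule Bochner_Integration.integrable_bound)
  show "integrable lborel (\<lambda>t. indicator {0..} t *\<^sub>R (exp (- (\<tau> - K) * t) *\<^sub>R C))"
    using laplaceable_1[of "\<tau> - K" C] \<tau> by (simp add: set_integrable_def)
  show "(\<lambda>x. indicator {0..} x *\<^sub>R exp (- \<tau> * x) *\<^sub>R u x) \<in> borel_measurable lborel"
    using borel_measurable_continuous_on_indicator[of "{0..}" "\<lambda>x. exp (- \<tau> * x) *\<^sub>R u x"] c
    by (simp add: continuous_intros)
  have "norm (exp (- \<tau> * t) *\<^sub>R u t) \<le> norm (exp (- (\<tau> - K) * t) *\<^sub>R C)" if "t \<ge> 0" for t
  proof -
    have "norm (exp (- \<tau> * t) *\<^sub>R u t) \<le> exp (- \<tau> * t) * (C * exp (K * t))"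
      using bd[OF that] by simp
    also have "\<dots> = exp (- (\<tau> - K) * t) * C" by (simp add: algebra_simps flip: exp_add)
    also have "\<dots> \<le> norm (exp (- (\<tau> - K) * t) *\<^sub>R C)" by simp
    finally show ?thesis .
  qed
  thus "AE t in lborel. norm (indicator {0..} t *\<^sub>R exp (- \<tau> * t) *\<^sub>R u t) \<le>
        norm (indicator {0..} t *\<^sub>R (exp (- (\<tau> - K) * t) *\<^sub>R C))"
    by (intro AE_I2) (auto simp: indicator_def)
qed

lemma laplace_bounded_linear:
  assumes f: "bounded_linear f" and u: "laplaceable \<tau> u"
  shows "laplace \<tau> (\<lambda>t. f (u t)) = f (laplace \<tau> u)" "laplaceable \<tau> (\<lambda>t. f (u t))"
proof -
  interpret f: bounded_linear f by (rule f)
  have eq: "f (indicator {0..} t *\<^sub>R exp (- \<tau> * t) *\<^sub>R u t) = indicator {0..} t *\<^sub>R exp (- \<tau> * t) *\<^sub>R f (u t)" for t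
    by (simp add: f.scaleR)
  show "laplace \<tau> (\<lambda>t. f (u t)) = f (laplace \<tau> u)"
    using integral_bounded_linear[OF f u[unfolded set_integrable_def]]
    unfolding laplace_def set_lebesgue_integral_def eq .
  show "laplaceable \<tau> (\<lambda>t. f (u t))"
    using integrable_bounded_linear[OF f u[unfolded set_integrable_def]] unfolding set_integrable_def eq .
qed

lemma laplace_add:
  assumes "laplaceable \<tau> u" "laplaceable \<tau> v"
  shows "laplace \<tau> (\<lambda>t. u t + v t) = laplace \<tau> u + laplace \<tau> v" "laplaceable \<tau> (\<lambda>t. u t + v t)"
  unfolding laplace_def using set_integral_add[OF assms] by (simp_all add: scaleR_add_right)

lemma laplace_diff:
  assumes "laplaceable \<tau> u" "laplaceable \<tau> v"
  shows "laplace \<tau> (\<lambda>t. u t - v t) = laplace \<tau> u - laplace \<tau> v"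
  unfolding laplace_def using set_integral_diff[OF assms] by (simp_all add: scaleR_diff_right)

text \<open>Weighted by a large power of \<open>exp (- t)\<close>, a function whose transform vanishes becomes,
  in the variable \<open>exp (- t)\<close>, a continuous function on \<open>[0, 1]\<close> that is orthogonal to all polynomials.\<close>

lemma laplace_injective_real:
  fixes z :: "real \<Rightarrow> real"
  assumes c: "continuous_on {0..} z" and bd: "\<And>t. t \<ge> 0 \<Longrightarrow> \<bar>z t\<bar> \<le> C * exp (K * t)"
    and 0: "\<And>\<tau>. \<tau> > \<tau>0 \<Longrightarrow> laplace \<tau> z = 0" and t0: "t0 \<ge> 0"
  shows "z t0 = 0"
proof -
  \<comment> \<open>The weight makes k decay like exp (- t), and m exceeds \<tau>0, so all
    transforms of z used below vanish.\<close>
  define m where "m = max (K + 1) (\<tau>0 + 1)"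
  define k where "k t = exp (- m * t) * z t" for t
  have C0: "C \<ge> 0" using bd[of 0] by simp
  have kbd: "\<bar>k t\<bar> \<le> C * exp (- t)" if "t \<ge> 0" for t
  proof -
    have "\<bar>k t\<bar> \<le> exp (- m * t) * (C * exp (K * t))"
      unfolding k_def abs_mult using bd[OF that] by simp
    also have "\<dots> = C * exp ((K - m) * t)" by (simp add: algebra_simps flip: exp_add)
    also have "\<dots> \<le> C * exp (- 1 * t)"
      using C0 that by (intro mult_left_mono exp_le_cancel_iff[THEN iffD2] mult_right_mono) (auto simp: m_def)
    finally show ?thesis by simp
  qed
  have kc: "continuous_on {0..} k" unfolding k_def by (intro continuous_intros c)
  have k_lap: "laplaceable s k" if "s > -1" for s
    by (rule laplaceable_continuous[OF kc, of C "-1"]) (use kbd that in auto)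
  \<comment> \<open>In the variable y = exp (- t) the point y = 0 stands for infinite time, where k
    tends to 0.\<close>
  define \<kappa> where "\<kappa> y = (if y \<le> 0 then 0 else k (- ln y))" for y
  have \<kappa>: "\<kappa> (exp (- t)) = k t" for t by (simp add: \<kappa>_def)
  have \<kappa>c: "continuous_on {0..1} \<kappa>"
    unfolding continuous_on_eq_continuous_within
  proof
    fix y :: real assume y: "y \<in> {0..1}"
    show "continuous (at y within {0..1}) \<kappa>"
    proof (cases "y = 0")
      case True
      have "(\<kappa> \<longlongrightarrow> 0) (at 0 within {0..1})"
      proof (rule Lim_null_comparison)
        show "\<forall>\<^sub>F x in at 0 within {0..1}. norm (\<kappa> x) \<le> C * x"
          unfolding eventually_at_filter
        proof (intro always_eventually allI impI)
          fix x :: real assume "x \<noteq> 0" "x \<in> {0..1}"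
          thus "norm (\<kappa> x) \<le> C * x" using kbd[of "- ln x"] by (simp add: \<kappa>_def)
        qed
        show "((\<lambda>x. C * x) \<longlongrightarrow> 0) (at 0 within {0..1})" by (auto intro!: tendsto_eq_intros)
      qed
      thus ?thesis using True by (simp add: continuous_within \<kappa>_def)
    next
      case False
      have "continuous_on {0<..1} (\<lambda>y. k (- ln y))"
        by (intro continuous_on_compose2[OF kc] continuous_intros) auto
      hence "continuous_on {0<..1} \<kappa>" by (rule continuous_on_eq) (auto simp: \<kappa>_def)
      hence "continuous (at y within {0<..1}) \<kappa>" using False y by (auto simp: continuous_on_eq_continuous_within)
      moreover have "at y within {0<..1} = at y within {0..1}"
        by (rule at_within_nhd[where S = "{0<..}"]) (use False y in auto)
      ultimately show ?thesis by (simp add: continuous_within)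
    qed
  qed
  \<comment> \<open>This is the integral of \<kappa> squared over [0, 1], written in the variable
    t.\<close>
  define J where "J = laplace 1 (\<lambda>t. (k t)\<^sup>2)"
  have k2_lap: "laplaceable 1 (\<lambda>t. (k t)\<^sup>2)"
  proof (rule laplaceable_continuous[where C = "C\<^sup>2" and K = 0])
    show "continuous_on {0..} (\<lambda>t. (k t)\<^sup>2)" by (intro continuous_intros kc)
    fix t :: real assume t: "t \<ge> 0"
    have "C * exp (- t) \<le> C * 1" using t C0 by (intro mult_left_mono) auto
    hence "\<bar>k t\<bar> \<le> C" using kbd[OF t] by simp
    hence "\<bar>k t\<bar>\<^sup>2 \<le> C\<^sup>2" by (intro power_mono) auto
    thus "norm ((k t)\<^sup>2) \<le> C\<^sup>2 * exp (0 * t)" by simp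
  qed simp
  have kabs: "laplaceable 1 (\<lambda>t. \<bar>k t\<bar>)"
    using set_integrable_norm[OF k_lap[of 1]] by (simp add: abs_mult)
  have J_le: "J \<le> e * laplace 1 (\<lambda>t. \<bar>k t\<bar>)" if e: "e > 0" for e
  proof -
    obtain p where p: "real_polynomial_function p" "\<And>y. y \<in> {0..1} \<Longrightarrow> \<bar>\<kappa> y - p y\<bar> < e"
      using Stone_Weierstrass_real_polynomial_function[OF compact_Icc \<kappa>c e] by blast
    obtain a n where pa: "p = (\<lambda>y. \<Sum>i\<le>n. a i * y ^ i)"
      using p(1) real_polynomial_function_iff_sum by blast
    \<comment> \<open>A factor \<open>exp (- t) ^ i\<close> shifts the transform variable, so each
      moment of k is a transform of z at a point above \<tau>0.\<close>
    have t1: "laplaceable 1 (\<lambda>t. k t * (a i * exp (- t) ^ i))"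
      and t2: "laplace 1 (\<lambda>t. k t * (a i * exp (- t) ^ i)) = 0" for i
    proof -
      have eq: "exp (- 1 * t) *\<^sub>R (k t * (a i * exp (- t) ^ i)) = a i *\<^sub>R (exp (- (m + 1 + real i) * t) *\<^sub>R z t)" for t
        by (simp add: k_def algebra_simps exp_of_nat_mult[symmetric] flip: exp_add)
      have eq2: "exp (- (1 + real i) * t) *\<^sub>R k t = exp (- (m + 1 + real i) * t) *\<^sub>R z t" for t
        by (simp add: k_def algebra_simps flip: exp_add)
      show "laplaceable 1 (\<lambda>t. k t * (a i * exp (- t) ^ i))"
        unfolding eq using set_integrable_scaleR_right[of "a i", OF k_lap[of "1 + real i", unfolded eq2]] by simp
      have "laplace (m + 1 + real i) z = 0" by (rule 0) (simp add: m_def)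
      thus "laplace 1 (\<lambda>t. k t * (a i * exp (- t) ^ i)) = 0"
        unfolding laplace_def eq by simp
    qed
    have p_lap: "laplaceable 1 (\<lambda>t. k t * p (exp (- t)))" and p0: "laplace 1 (\<lambda>t. k t * p (exp (- t))) = 0"
    proof -
      have "laplaceable 1 (\<lambda>t. \<Sum>i\<in>I. k t * (a i * exp (- t) ^ i)) \<and>
            laplace 1 (\<lambda>t. \<Sum>i\<in>I. k t * (a i * exp (- t) ^ i)) = 0" if "finite I" for I
        using that
      proof induction
        case empty thus ?case by (simp add: laplace_def set_integrable_def)
      next
        case (insert i I)
        thus ?case using laplace_add[OF t1[of i], of "\<lambda>t. \<Sum>i\<in>I. k t * (a i * exp (- t) ^ i)"] t2[of i] by simp
      qed
      from this[of "{..n}"] show "laplaceable 1 (\<lambda>t. k t * p (exp (- t)))" "laplace 1 (\<lambda>t. k t * p (exp (- t))) = 0"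
        unfolding pa sum_distrib_left by auto
    qed
    have "J = laplace 1 (\<lambda>t. (k t)\<^sup>2 - k t * p (exp (- t)))"
      using laplace_diff[OF k2_lap p_lap] p0 by (simp add: J_def)
    also have "\<dots> \<le> laplace 1 (\<lambda>t. e * \<bar>k t\<bar>)"
      unfolding laplace_def
    proof (rule set_integral_mono)
      show "laplaceable 1 (\<lambda>t. (k t)\<^sup>2 - k t * p (exp (- t)))"
        using set_integral_diff(1)[OF k2_lap p_lap] by (simp add: algebra_simps)
      show "laplaceable 1 (\<lambda>t. e * \<bar>k t\<bar>)"
        using set_integrable_mult_right[of e, OF kabs] by (simp add: mult.left_commute)
      fix t :: real assume t: "t \<in> {0..}"
      have "(k t)\<^sup>2 - k t * p (exp (- t)) = k t * (\<kappa> (exp (- t)) - p (exp (- t)))"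
        by (simp add: \<kappa> power2_eq_square algebra_simps)
      also have "\<dots> \<le> \<bar>k t\<bar> * \<bar>\<kappa> (exp (- t)) - p (exp (- t))\<bar>" by (metis abs_ge_self abs_mult)
      also have "\<dots> \<le> \<bar>k t\<bar> * e" using p(2)[of "exp (- t)"] t by (intro mult_left_mono) auto
      finally show "exp (- 1 * t) *\<^sub>R ((k t)\<^sup>2 - k t * p (exp (- t))) \<le> exp (- 1 * t) *\<^sub>R (e * \<bar>k t\<bar>)"
        by (simp add: mult.commute)
    qed
    also have "\<dots> = e * laplace 1 (\<lambda>t. \<bar>k t\<bar>)"
      unfolding laplace_def by (simp add: mult.left_commute)
    finally show ?thesis .
  qed
  have "J \<le> 0"
  proof (rule field_le_epsilon)
    fix e :: real assume e: "e > 0"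
    have L: "laplace 1 (\<lambda>t. \<bar>k t\<bar>) \<ge> 0" unfolding laplace_def set_lebesgue_integral_def by (rule Bochner_Integration.integral_nonneg) simp
    have "J \<le> e / (1 + laplace 1 (\<lambda>t. \<bar>k t\<bar>)) * laplace 1 (\<lambda>t. \<bar>k t\<bar>)"
      by (rule J_le) (use e L in auto)
    also have "\<dots> = e * (laplace 1 (\<lambda>t. \<bar>k t\<bar>) / (1 + laplace 1 (\<lambda>t. \<bar>k t\<bar>)))" by simp
    also have "\<dots> \<le> e * 1" using e L by (intro mult_left_mono) (auto simp: divide_le_eq_1)
    finally show "J \<le> 0 + e" by simp
  qed
  define f where "f t = exp (- t) * (k t)\<^sup>2" for t
  have fc: "continuous_on {0..t0+1} f" unfolding f_def by (intro continuous_intros continuous_on_subset[OF kc]) auto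
  have "integ 0 (t0+1) f \<le> J"
    unfolding J_def laplace_def set_lebesgue_integral_def
    by (rule integral_mono[OF continuous_integable[OF fc, unfolded set_integrable_def] k2_lap[unfolded set_integrable_def]])
       (auto simp: f_def indicator_def)
  hence "integral {0..t0+1} f \<le> 0"
    using \<open>J \<le> 0\<close> set_borel_integral_eq_integral(2)[OF continuous_integable[OF fc]] by simp
  moreover have "integral {0..t0+1} f \<ge> 0"
    by (rule Henstock_Kurzweil_Integration.integral_nonneg[OF integrable_continuous_interval[OF fc]]) (simp add: f_def)
  ultimately have "\<forall>x\<in>{0..t0+1}. f x = 0"
    using integral_eq_0_iff[OF fc] t0 by (simp add: f_def)
  hence "f t0 = 0" using t0 by simp
  thus ?thesis by (simp add: f_def k_def)
qed

text \<open>Pairing with the fixed vector \<open>z t0\<close> reduces to scalars, and at t0 the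
  pairing is the squared norm.\<close>

lemma laplace_injective:
  fixes z :: "real \<Rightarrow> 'h::{real_inner,banach,second_countable_topology}"
  assumes c: "continuous_on {0..} z" and bd: "\<And>t. t \<ge> 0 \<Longrightarrow> norm (z t) \<le> C * exp (K * t)"
    and 0: "\<And>\<tau>. \<tau> > \<tau>0 \<Longrightarrow> laplace \<tau> z = 0" and t0: "t0 \<ge> 0"
  shows "z t0 = 0"
proof -
  define y where "y = z t0"
  have "z t0 \<bullet> y = 0"
  proof (rule laplace_injective_real[where z = "\<lambda>t. z t \<bullet> y", OF _ _ _ t0])
    show "continuous_on {0..} (\<lambda>t. z t \<bullet> y)" by (intro continuous_intros c)
    show "\<bar>z t \<bullet> y\<bar> \<le> (C * norm y) * exp (K * t)" if "t \<ge> 0" for t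
    proof -
      have "\<bar>z t \<bullet> y\<bar> \<le> norm (z t) * norm y" by (rule Cauchy_Schwarz_ineq2)
      also have "\<dots> \<le> C * exp (K * t) * norm y" using bd[OF that] by (intro mult_right_mono) auto
      finally show ?thesis by (simp add: mult_ac)
    qed
    show "laplace \<tau> (\<lambda>t. z t \<bullet> y) = 0" if "\<tau> > max K \<tau>0" for \<tau>
      using laplace_bounded_linear(1)[OF bounded_linear_inner_left laplaceable_continuous[OF c bd]] 0[of \<tau>] that by simp
  qed
  thus ?thesis by (simp add: y_def)
qed

section \<open>Laplace transforms of mild solutions\<close>

context skew_approx
begin

text \<open>A source that vanishes after T0 has the same integral on all longer intervals, so the
  growth constant no longer depends on the time horizon.\<close>

lemma mild_growth:
  assumes u: "\<And>T. mild B F 0 T u" and F: "\<And>T. integable 0 T F" "\<And>t. t > T0 \<Longrightarrow> F t = 0" and T0: "T0 \<ge> 0" and t: "t \<ge> 0"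
  shows "norm (u t) \<le> integ 0 T0 (\<lambda>s. norm (F s)) * exp (norm B * t)"
proof -
  define T where "T = max t T0"
  have nF: "integable 0 T (\<lambda>s. norm (F s))" using F(1) by (rule set_integrable_norm)
  have "integ 0 T (\<lambda>s. norm (F s)) = integ 0 T0 (\<lambda>s. norm (F s)) + integ T0 T (\<lambda>s. norm (F s))"
    by (rule integ_split[OF nF T0]) (simp add: T_def)
  also have "integ T0 T (\<lambda>s. norm (F s)) = 0"
  proof -
    have "AE s in lborel. indicator {T0..T} s *\<^sub>R norm (F s) = 0"
      using AE_lborel_singleton[of T0] by eventually_elim (use F(2) in \<open>auto simp: indicator_def\<close>)
    thus ?thesis unfolding set_lebesgue_integral_def by (rule integral_eq_zero_AE)
  qed
  finally show ?thesis using mild_bound[OF u F(1), of t T] t by (simp add: T_def)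
qed

text \<open>The curve \<open>exp (- \<tau> * t) *\<^sub>R \<psi>\<close> is an admissible test curve
  on [0, T]. As T tends to infinity the boundary term vanishes because u grows at most at rate
  \<open>norm B\<close>.\<close>

lemma laplace_mild:
  assumes u: "\<And>T. mild B F 0 T u" and F: "\<And>T. integable 0 T F" "\<And>t. t > T0 \<Longrightarrow> F t = 0" and T0: "T0 \<ge> 0"
    and \<tau>: "\<tau> > norm B" and \<psi>: "\<psi> \<in> dom"
  shows "\<tau> * (laplace \<tau> u \<bullet> \<psi>) = (ap B (laplace \<tau> u) + laplace \<tau> F) \<bullet> \<psi> - laplace \<tau> u \<bullet> A0 \<psi>"
proof -
  have uc: "continuous_on {0..} u"
    unfolding continuous_on_eq_continuous_within
  proof
    fix t :: real assume t: "t \<in> {0..}"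
    have "continuous (at t within {0..t+1}) u" using u[of "t+1"] t by (auto simp: mild_def continuous_on_eq_continuous_within)
    moreover have "at t within {0..t+1} = at t within {0..}"
      by (rule at_within_nhd[where S = "{t-1<..<t+1}"]) (use t in auto)
    ultimately show "continuous (at t within {0..}) u" by (simp add: continuous_within)
  qed
  define C where "C = integ 0 T0 (\<lambda>s. norm (F s))"
  have bd: "norm (u t) \<le> C * exp (norm B * t)" if "t \<ge> 0" for t
    unfolding C_def by (rule mild_growth[OF u F T0 that])
  have \<tau>0: "\<tau> > 0" using \<tau> norm_ge_zero[of B] by linarith
  have ul: "laplaceable \<tau> u" by (rule laplaceable_continuous[OF uc bd \<tau>])
  have Fl: "laplaceable \<tau> F"
    unfolding set_integrable_def
  proof (rule Bochner_Integration.integrable_bound)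
    show i: "integrable lborel (\<lambda>t. indicator {0..T0} t *\<^sub>R F t)" using F(1) by (simp add: set_integrable_def)
    have eq: "indicator {0..} t *\<^sub>R exp (- \<tau> * t) *\<^sub>R F t = exp (- \<tau> * t) *\<^sub>R (indicator {0..T0} t *\<^sub>R F t)" for t
      using F(2)[of t] by (auto simp: indicator_def)
    have [measurable]: "(\<lambda>t. indicator {0..T0} t *\<^sub>R F t) \<in> borel_measurable lborel" using i by auto
    show "(\<lambda>t. indicator {0..} t *\<^sub>R exp (- \<tau> * t) *\<^sub>R F t) \<in> borel_measurable lborel"
      unfolding eq by measurable
    have "norm (exp (- \<tau> * t) *\<^sub>R (indicator {0..T0} t *\<^sub>R F t)) \<le> norm (indicator {0..T0} t *\<^sub>R F t)" for t
      using \<tau>0 by (auto simp: indicator_def intro!: mult_left_le_one_le)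
    thus "AE t in lborel. norm (indicator {0..} t *\<^sub>R exp (- \<tau> * t) *\<^sub>R F t) \<le> norm (indicator {0..T0} t *\<^sub>R F t)"
      unfolding eq by (intro AE_I2)
  qed
  define f where "f t = ap B (u t) + F t" for t
  have fl: "laplaceable \<tau> f" and f_eq: "laplace \<tau> f = ap B (laplace \<tau> u) + laplace \<tau> F"
    unfolding f_def using laplace_add[OF laplace_bounded_linear(2)[OF bounded_linear_ap ul] Fl]
      laplace_bounded_linear(1)[OF bounded_linear_ap ul] by auto
  have f_int: "integable 0 T f" for T unfolding f_def by (rule mild_integable[OF u F(1)])
  define p where "p t = exp (- \<tau> * t) *\<^sub>R \<psi>" for t
  have sub: "integable 0 T (\<lambda>t. exp (- \<tau> * t) *\<^sub>R g t)" if "laplaceable \<tau> g" for g :: "real \<Rightarrow> 'h" and T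
    by (rule set_integrable_subset[OF that]) auto
  have inn: "integ 0 T (\<lambda>t. g t \<bullet> (exp (- \<tau> * t) *\<^sub>R y)) = integ 0 T (\<lambda>t. exp (- \<tau> * t) *\<^sub>R g t) \<bullet> y"
    if "laplaceable \<tau> g" for g :: "real \<Rightarrow> 'h" and T y
    unfolding integ_inner(1)[OF sub[OF that]] by simp
  have id: "integ 0 T (\<lambda>t. exp (- \<tau> * t) *\<^sub>R u t) \<bullet> (- \<tau> *\<^sub>R \<psi> - A0 \<psi>) =
      (exp (- \<tau> * T) *\<^sub>R u T) \<bullet> \<psi> - integ 0 T (\<lambda>t. exp (- \<tau> * t) *\<^sub>R f t) \<bullet> \<psi>" if T: "T \<ge> 0" for T
  proof -
    have "integ 0 T (\<lambda>t. u t \<bullet> (exp (- \<tau> * t) *\<^sub>R (- \<tau> *\<^sub>R \<psi>) - A0 (p t))) = u T \<bullet> p T - 0 \<bullet> p 0 - integ 0 T (\<lambda>s. f s \<bullet> p s)"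
    proof (rule mild_test[OF T f_int])
      show "u t = G t (0 + integ 0 t (\<lambda>s. G (- s) (f s)))" if "0 \<le> t" "t \<le> T" for t
        using u[of T] that unfolding mild_def f_def by auto
      have "((\<lambda>s. exp (- \<tau> * s)) has_field_derivative exp (- \<tau> * t) * (- \<tau>)) (at t)" for t
        by (auto intro!: derivative_eq_intros)
      from has_vector_derivative_scaleR[OF this has_vector_derivative_const[of \<psi>]]
      show "(p has_vector_derivative exp (- \<tau> * t) *\<^sub>R (- \<tau> *\<^sub>R \<psi>)) (at t)" for t
        unfolding p_def by simp
      show "p t \<in> dom" for t
      proof (rule domI)
        show "(\<lambda>n. ap (D n j) (p t)) \<longlonglongrightarrow> exp (- \<tau> * t) *\<^sub>R d j \<psi>" for j
          unfolding p_def ap_linear by (intro tendsto_intros D_tendsto \<psi>)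
      qed
      show "continuous_on {0..T} (\<lambda>t. A0 (p t))"
        unfolding p_def A0_scale[OF \<psi>] by (intro continuous_intros)
    qed (intro continuous_intros)
    moreover have "(\<lambda>t. u t \<bullet> (exp (- \<tau> * t) *\<^sub>R (- \<tau> *\<^sub>R \<psi>) - A0 (p t))) =
        (\<lambda>t. u t \<bullet> (exp (- \<tau> * t) *\<^sub>R (- \<tau> *\<^sub>R \<psi> - A0 \<psi>)))"
      unfolding p_def A0_scale[OF \<psi>] by (simp add: scaleR_diff_right)
    ultimately have "integ 0 T (\<lambda>t. u t \<bullet> (exp (- \<tau> * t) *\<^sub>R (- \<tau> *\<^sub>R \<psi> - A0 \<psi>))) =
        u T \<bullet> p T - 0 \<bullet> p 0 - integ 0 T (\<lambda>s. f s \<bullet> p s)" by (simp only:)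
    thus ?thesis unfolding p_def inn[OF ul] inn[OF fl] by simp
  qed
  have lim: "((\<lambda>T. integ 0 T (\<lambda>t. exp (- \<tau> * t) *\<^sub>R g t)) \<longlongrightarrow> laplace \<tau> g) at_top" if "laplaceable \<tau> g" for g :: "real \<Rightarrow> 'h"
    unfolding laplace_def by (rule tendsto_set_lebesgue_integral_at_top[OF _ that]) simp
  have u0: "((\<lambda>T. exp (- \<tau> * T) *\<^sub>R u T) \<longlongrightarrow> 0) at_top"
  proof (rule Lim_null_comparison)
    have "norm (exp (- \<tau> * T) *\<^sub>R u T) \<le> C * exp (- (\<tau> - norm B) * T)" if "T \<ge> 0" for T
    proof -
      have "norm (exp (- \<tau> * T) *\<^sub>R u T) \<le> exp (- \<tau> * T) * (C * exp (norm B * T))" using bd[OF that] by simp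
      also have "\<dots> = C * exp (- (\<tau> - norm B) * T)" by (simp add: algebra_simps flip: exp_add)
      finally show ?thesis .
    qed
    thus "\<forall>\<^sub>F T in at_top. norm (exp (- \<tau> * T) *\<^sub>R u T) \<le> C * exp (- (\<tau> - norm B) * T)"
      by (intro eventually_mono[OF eventually_ge_at_top[of 0]])
    have "((\<lambda>T. exp (- (\<tau> - norm B) * T)) \<longlongrightarrow> 0) at_top"
      using \<tau> by (intro filterlim_compose[OF exp_at_bot] filterlim_tendsto_neg_mult_at_bot[OF tendsto_const] filterlim_ident) auto
    from tendsto_mult_left[OF this, of C] show "((\<lambda>T. C * exp (- (\<tau> - norm B) * T)) \<longlongrightarrow> 0) at_top" by simp
  qed
  have "((\<lambda>T. integ 0 T (\<lambda>t. exp (- \<tau> * t) *\<^sub>R u t) \<bullet> (- \<tau> *\<^sub>R \<psi> - A0 \<psi>)) \<longlongrightarrow> laplace \<tau> u \<bullet> (- \<tau> *\<^sub>R \<psi> - A0 \<psi>)) at_top"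
    by (intro tendsto_intros lim ul)
  moreover have "((\<lambda>T. integ 0 T (\<lambda>t. exp (- \<tau> * t) *\<^sub>R u t) \<bullet> (- \<tau> *\<^sub>R \<psi> - A0 \<psi>)) \<longlongrightarrow> 0 \<bullet> \<psi> - laplace \<tau> f \<bullet> \<psi>) at_top"
  proof (rule Lim_transform_eventually)
    show "((\<lambda>T. (exp (- \<tau> * T) *\<^sub>R u T) \<bullet> \<psi> - integ 0 T (\<lambda>t. exp (- \<tau> * t) *\<^sub>R f t) \<bullet> \<psi>) \<longlongrightarrow> 0 \<bullet> \<psi> - laplace \<tau> f \<bullet> \<psi>) at_top"
      by (intro tendsto_diff tendsto_inner tendsto_const u0 lim fl)
    show "\<forall>\<^sub>F T in at_top. (exp (- \<tau> * T) *\<^sub>R u T) \<bullet> \<psi> - integ 0 T (\<lambda>t. exp (- \<tau> * t) *\<^sub>R f t) \<bullet> \<psi> =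
        integ 0 T (\<lambda>t. exp (- \<tau> * t) *\<^sub>R u t) \<bullet> (- \<tau> *\<^sub>R \<psi> - A0 \<psi>)"
      using eventually_ge_at_top[of 0] by eventually_elim (rule id[symmetric])
  qed
  ultimately have "laplace \<tau> u \<bullet> (- \<tau> *\<^sub>R \<psi> - A0 \<psi>) = 0 \<bullet> \<psi> - laplace \<tau> f \<bullet> \<psi>"
    by (rule tendsto_unique[OF trivial_limit_at_top_linorder])
  thus ?thesis unfolding f_eq by (simp add: inner_diff_right algebra_simps)
qed

end

subsection \<open>The Hilbert space of square integrable functions\<close>

lemma L2_measurable [measurable_dest]: "L2 f \<Longrightarrow> f \<in> borel_measurable borel"
  by (simp add: L2_def)

lemma L2_integrable: "L2 f \<Longrightarrow> integrable lborel (\<lambda>x. (norm (f x))\<^sup>2)"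
  by (simp add: L2_def)

lemma L2_0 [simp]: "L2 (\<lambda>_. 0)"
  by (simp add: L2_def)

lemma L2_bound:
  assumes g: "g \<in> borel_measurable borel" and i: "integrable lborel h"
    and le: "AE x in lborel. (norm (g x))\<^sup>2 \<le> h x"
  shows "L2 g"
  unfolding L2_def
proof
  show "integrable lborel (\<lambda>x. (norm (g x))\<^sup>2)"
    by (rule Bochner_Integration.integrable_bound[OF i]) (use g le in \<open>auto elim!: eventually_mono\<close>)
qed (rule g)

lemma L2_add: assumes "L2 f" "L2 g" shows "L2 (\<lambda>x. f x + g x)"
proof (rule L2_bound)
  show "integrable lborel (\<lambda>x. 2 * (norm (f x))\<^sup>2 + 2 * (norm (g x))\<^sup>2)"
    using assms[THEN L2_integrable] by simp
  have "(norm (f x + g x))\<^sup>2 \<le> 2 * (norm (f x))\<^sup>2 + 2 * (norm (g x))\<^sup>2" for x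
  proof -
    have "(norm (f x + g x))\<^sup>2 \<le> (norm (f x) + norm (g x))\<^sup>2"
      by (intro power_mono norm_triangle_ineq) simp
    also have "\<dots> \<le> 2 * (norm (f x))\<^sup>2 + 2 * (norm (g x))\<^sup>2"
      using sum_squares_bound[of "norm (f x)" "norm (g x)"] by (simp add: power2_sum)
    finally show ?thesis .
  qed
  thus "AE x in lborel. (norm (f x + g x))\<^sup>2 \<le> 2 * (norm (f x))\<^sup>2 + 2 * (norm (g x))\<^sup>2" by simp
  show "(\<lambda>x. f x + g x) \<in> borel_measurable borel" using assms by measurable
qed

lemma L2_mult_bound:
  assumes g: "g \<in> borel_measurable borel" and f: "L2 f" and le: "AE x in lborel. norm (g x) \<le> K * norm (f x)"
  shows "L2 g"
proof (rule L2_bound[OF g])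
  show "integrable lborel (\<lambda>x. K\<^sup>2 * (norm (f x))\<^sup>2)" using L2_integrable[OF f] by simp
  show "AE x in lborel. (norm (g x))\<^sup>2 \<le> K\<^sup>2 * (norm (f x))\<^sup>2"
    using le by eventually_elim (metis norm_ge_zero power_mono power_mult_distrib)
qed

lemma L2_scaleR: "L2 f \<Longrightarrow> L2 (\<lambda>x. c *\<^sub>R f x)"
  by (rule L2_mult_bound[where f = f and K = "\<bar>c\<bar>"]) auto

lemma L2_diff: "L2 f \<Longrightarrow> L2 g \<Longrightarrow> L2 (\<lambda>x. f x - g x)"
  using L2_add[OF _ L2_scaleR[of g "-1"]] by simp
lemma L2_inner: assumes "L2 f" "L2 g" shows "integrable lborel (\<lambda>x. f x \<bullet> g x)"
proof (rule Bochner_Integration.integrable_bound)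
  show "integrable lborel (\<lambda>x. (norm (f x))\<^sup>2 + (norm (g x))\<^sup>2)"
    using assms[THEN L2_integrable] by simp
  have "norm (f x \<bullet> g x) \<le> norm ((norm (f x))\<^sup>2 + (norm (g x))\<^sup>2)" for x
  proof -
    have "\<bar>f x \<bullet> g x\<bar> \<le> norm (f x) * norm (g x)" by (rule Cauchy_Schwarz_ineq2)
    also have "\<dots> \<le> (norm (f x))\<^sup>2 + (norm (g x))\<^sup>2"
      using sum_squares_bound[of "norm (f x)" "norm (g x)"] mult_nonneg_nonneg[OF norm_ge_zero[of "f x"] norm_ge_zero[of "g x"]]
      by linarith
    also have "\<dots> = norm ((norm (f x))\<^sup>2 + (norm (g x))\<^sup>2)" by (simp only: real_norm_def abs_of_nonneg add_nonneg_nonneg zero_le_power2)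
    finally show ?thesis unfolding real_norm_def .
  qed
  thus "AE x in lborel. norm (f x \<bullet> g x) \<le> norm ((norm (f x))\<^sup>2 + (norm (g x))\<^sup>2)" by simp
qed (use assms in measurable)

definition l2rel :: "(real^3 \<Rightarrow> 'v::euclidean_space) \<Rightarrow> (real^3 \<Rightarrow> 'v) \<Rightarrow> bool" where
  "l2rel f g \<longleftrightarrow> L2 f \<and> L2 g \<and> (AE x in lborel. f x = g x)"

\<comment> \<open>The relation is reflexive exactly at the square integrable functions, so a partial
  quotient both selects these and identifies functions that agree almost everywhere.\<close>
quotient_type (overloaded) 'v l2 = "real^3 \<Rightarrow> 'v::euclidean_space" / partial: l2rel
proof (rule part_equivpI)
  show "\<exists>f::real^3 \<Rightarrow> 'v. l2rel f f" by (rule exI[of _ "\<lambda>_. 0"]) (simp add: l2rel_def)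
  show "symp (l2rel :: (real^3 \<Rightarrow> 'v) \<Rightarrow> _)"
    unfolding symp_def l2rel_def by (auto elim!: eventually_mono)
  show "transp (l2rel :: (real^3 \<Rightarrow> 'v) \<Rightarrow> _)"
    unfolding transp_def l2rel_def by (auto elim!: eventually_elim2)
qed

definition fn :: "'v::euclidean_space l2 \<Rightarrow> real^3 \<Rightarrow> 'v" where "fn = rep_l2"

text \<open>The default 0 makes the map total; a source in \<open>L1_loc_L2\<close> is square
  integrable in space at almost every time only.\<close>

definition cls :: "(real^3 \<Rightarrow> 'v::euclidean_space) \<Rightarrow> 'v l2" where
  "cls f = abs_l2 (if L2 f then f else (\<lambda>_. 0))"

lemma L2_fn [simp]: "L2 (fn u)"
  using Quotient_rep_reflp[OF Quotient_l2, of u] by (simp add: l2rel_def fn_def)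

lemma fn_measurable [measurable]: "fn u \<in> borel_measurable borel"
  using L2_fn L2_measurable by blast

lemma cls_fn [simp]: "cls (fn u) = u"
  by (simp add: cls_def) (simp add: fn_def Quotient_abs_rep[OF Quotient_l2])

lemma cls_eq_iff: "L2 f \<Longrightarrow> L2 g \<Longrightarrow> cls f = cls g \<longleftrightarrow> (AE x in lborel. f x = g x)"
  using Quotient_rel[OF Quotient_l2, of f g] by (auto simp: cls_def l2rel_def)

lemma fn_cls: "L2 f \<Longrightarrow> AE x in lborel. fn (cls f) x = f x"
  using cls_eq_iff[of "fn (cls f)" f] by simp

lemma l2_eq_iff: "u = v \<longleftrightarrow> (AE x in lborel. fn u x = fn v x)"
  using cls_eq_iff[of "fn u" "fn v"] by simp

lemma l2_eqI: "AE x in lborel. fn u x = fn v x \<Longrightarrow> u = v"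
  by (simp add: l2_eq_iff)

instantiation l2 :: (euclidean_space) real_inner
begin
definition "0 = cls (\<lambda>_. 0)"
definition "u + v = cls (\<lambda>x. fn u x + fn v x)"
definition "u - v = cls (\<lambda>x. fn u x - fn v x)"
definition "- u = cls (\<lambda>x. - fn u x)"
definition scaleR_l2 :: "real \<Rightarrow> 'a l2 \<Rightarrow> 'a l2" where "scaleR_l2 r u = cls (\<lambda>x. r *\<^sub>R fn u x)"
definition inner_l2 :: "'a l2 \<Rightarrow> 'a l2 \<Rightarrow> real" where "inner_l2 u v = (LINT x|lborel. fn u x \<bullet> fn v x)"
definition norm_l2 :: "'a l2 \<Rightarrow> real" where "norm_l2 u = sqrt (inner u u)"
definition dist_l2 :: "'a l2 \<Rightarrow> 'a l2 \<Rightarrow> real" where "dist_l2 u v = norm (u - v)"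
definition sgn_l2 :: "'a l2 \<Rightarrow> 'a l2" where "sgn_l2 u = scaleR (inverse (norm u)) u"
definition uniformity_l2 :: "('a l2 \<times> 'a l2) filter" where
  "uniformity_l2 = (INF e\<in>{0 <..}. principal {(x, y). dist x y < e})"
definition open_l2 :: "'a l2 set \<Rightarrow> bool" where
  "open_l2 S = (\<forall>x\<in>S. \<forall>\<^sub>F (x', y) in uniformity. x' = x \<longrightarrow> y \<in> S)"

lemma fn_zero: "AE x in lborel. fn (0 :: 'a l2) x = 0"
  unfolding zero_l2_def by (rule fn_cls) simp
lemma fn_add: "AE x in lborel. fn (u + v :: 'a l2) x = fn u x + fn v x"
  unfolding plus_l2_def by (rule fn_cls) (simp add: L2_add)
lemma fn_diff: "AE x in lborel. fn (u - v :: 'a l2) x = fn u x - fn v x"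
  unfolding minus_l2_def by (rule fn_cls) (simp add: L2_diff)
lemma fn_uminus: "AE x in lborel. fn (- u :: 'a l2) x = - fn u x"
  unfolding uminus_l2_def by (rule fn_cls) (use L2_scaleR[of "fn u" "-1"] in simp)
lemma fn_scaleR: "AE x in lborel. fn (r *\<^sub>R u :: 'a l2) x = r *\<^sub>R fn u x"
  unfolding scaleR_l2_def by (rule fn_cls) (simp add: L2_scaleR)

lemma l2_integral_cong:
  "AE x in lborel. fn u x = f x \<Longrightarrow> L2 f \<Longrightarrow> (LINT x|lborel. fn u x \<bullet> fn (w :: 'a l2) x) = (LINT x|lborel. f x \<bullet> fn w x)"
  by (rule integral_cong_AE) (auto elim!: eventually_mono)

instance
proof
  fix u v w :: "'a l2" and r s :: real
  show "u + v + w = u + (v + w)"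
    by (rule l2_eqI) (use fn_add[of u v] fn_add[of "u + v" w] fn_add[of v w] fn_add[of u "v + w"] in \<open>eventually_elim, simp add: algebra_simps\<close>)
  show "u + v = v + u"
    by (rule l2_eqI) (use fn_add[of u v] fn_add[of v u] in \<open>eventually_elim, simp add: algebra_simps\<close>)
  show "0 + u = u"
    by (rule l2_eqI) (use fn_add[of 0 u] fn_zero in \<open>eventually_elim, simp add: algebra_simps\<close>)
  show "- u + u = 0"
    by (rule l2_eqI) (use fn_add[of "- u" u] fn_uminus[of u] fn_zero in \<open>eventually_elim, simp add: algebra_simps\<close>)
  show "u - v = u + - v"
    by (rule l2_eqI) (use fn_diff[of u v] fn_add[of u "- v"] fn_uminus[of v] in \<open>eventually_elim, simp\<close>)
  show "r *\<^sub>R (u + v) = r *\<^sub>R u + r *\<^sub>R v"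
    by (rule l2_eqI) (use fn_scaleR[of r "u + v"] fn_add[of u v] fn_add[of "r *\<^sub>R u" "r *\<^sub>R v"] fn_scaleR[of r u] fn_scaleR[of r v] in \<open>eventually_elim, simp only: scaleR_add_right scaleR_add_left scaleR_scaleR scaleR_one\<close>)
  show "(r + s) *\<^sub>R u = r *\<^sub>R u + s *\<^sub>R u"
    by (rule l2_eqI) (use fn_scaleR[of "r + s" u] fn_add[of "r *\<^sub>R u" "s *\<^sub>R u"] fn_scaleR[of r u] fn_scaleR[of s u] in \<open>eventually_elim, simp only: scaleR_add_right scaleR_add_left scaleR_scaleR scaleR_one\<close>)
  show "r *\<^sub>R s *\<^sub>R u = (r * s) *\<^sub>R u"
    by (rule l2_eqI) (use fn_scaleR[of r "s *\<^sub>R u"] fn_scaleR[of s u] fn_scaleR[of "r * s" u] in \<open>eventually_elim, simp only: scaleR_add_right scaleR_add_left scaleR_scaleR scaleR_one\<close>)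
  show "1 *\<^sub>R u = u"
    by (rule l2_eqI) (use fn_scaleR[of 1 u] in \<open>eventually_elim, simp only: scaleR_add_right scaleR_add_left scaleR_scaleR scaleR_one\<close>)
  show "dist u v = norm (u - v)" by (rule dist_l2_def)
  show "sgn u = inverse (norm u) *\<^sub>R u" by (rule sgn_l2_def)
  show "uniformity = (INF e\<in>{0<..}. principal {(x, y :: 'a l2). dist x y < e})" by (rule uniformity_l2_def)
  show "open S = (\<forall>x\<in>S. \<forall>\<^sub>F (x', y) in uniformity. x' = x \<longrightarrow> y \<in> S)" for S :: "'a l2 set" by (rule open_l2_def)
  show "u \<bullet> v = v \<bullet> u" unfolding inner_l2_def by (simp add: inner_commute)
  have "(u + v) \<bullet> w = (LINT x|lborel. (fn u x + fn v x) \<bullet> fn w x)"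
    unfolding inner_l2_def by (rule l2_integral_cong[OF fn_add]) (simp add: L2_add)
  also have "\<dots> = u \<bullet> w + v \<bullet> w"
    unfolding inner_l2_def inner_add_left by (rule Bochner_Integration.integral_add) (simp_all add: L2_inner)
  finally show "(u + v) \<bullet> w = u \<bullet> w + v \<bullet> w" .
  have "r *\<^sub>R u \<bullet> v = (LINT x|lborel. (r *\<^sub>R fn u x) \<bullet> fn v x)"
    unfolding inner_l2_def by (rule l2_integral_cong[OF fn_scaleR]) (simp add: L2_scaleR)
  thus "r *\<^sub>R u \<bullet> v = r * (u \<bullet> v)" by (simp add: inner_l2_def)
  show "0 \<le> u \<bullet> u" unfolding inner_l2_def by (rule Bochner_Integration.integral_nonneg) simp
  have "u \<bullet> u = 0 \<longleftrightarrow> (AE x in lborel. fn u x \<bullet> fn u x = 0)"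
    unfolding inner_l2_def by (rule integral_nonneg_eq_0_iff_AE) (simp_all add: L2_inner)
  also have "\<dots> \<longleftrightarrow> (AE x in lborel. fn u x = fn 0 x)"
  proof
    assume "AE x in lborel. fn u x \<bullet> fn u x = 0"
    thus "AE x in lborel. fn u x = fn 0 x" using fn_zero by eventually_elim simp
  next
    assume "AE x in lborel. fn u x = fn 0 x"
    thus "AE x in lborel. fn u x \<bullet> fn u x = 0" using fn_zero by eventually_elim simp
  qed
  finally show "u \<bullet> u = 0 \<longleftrightarrow> u = 0" using l2_eq_iff by blast
  show "norm u = sqrt (u \<bullet> u)" by (rule norm_l2_def)
qed
end

lemma cls_add: assumes "L2 f" "L2 g" shows "cls (\<lambda>x. f x + g x) = cls f + cls g"
proof (rule l2_eqI)
  show "AE x in lborel. fn (cls (\<lambda>x. f x + g x)) x = fn (cls f + cls g) x"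
    using fn_cls[OF assms(1)] fn_cls[OF assms(2)] fn_cls[OF L2_add[OF assms]] fn_add[of "cls f" "cls g"]
    by eventually_elim simp
qed

lemma cls_scaleR: assumes "L2 f" shows "cls (\<lambda>x. c *\<^sub>R f x) = c *\<^sub>R cls f"
proof (rule l2_eqI)
  show "AE x in lborel. fn (cls (\<lambda>x. c *\<^sub>R f x)) x = fn (c *\<^sub>R cls f) x"
    using fn_cls[OF assms] fn_cls[OF L2_scaleR[OF assms, of c]] fn_scaleR[of c "cls f"]
    by eventually_elim simp
qed

lemma cls_diff: "L2 f \<Longrightarrow> L2 g \<Longrightarrow> cls (\<lambda>x. f x - g x) = cls f - cls g"
  using cls_add[OF _ L2_scaleR[of g "-1"], of f] cls_scaleR[of g "-1"] by simp

lemma cls_0: "cls (\<lambda>_. 0) = 0"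
  by (simp add: zero_l2_def)

lemma cls_cong: "AE x in lborel. f x = g x \<Longrightarrow> L2 f \<Longrightarrow> L2 g \<Longrightarrow> cls f = cls g"
  by (simp add: cls_eq_iff)

lemma inner_cls: assumes "L2 f" "L2 g" shows "cls f \<bullet> cls g = (LINT x|lborel. f x \<bullet> g x)"
  unfolding inner_l2_def
proof (rule integral_cong_AE)
  show "AE x in lborel. fn (cls f) x \<bullet> fn (cls g) x = f x \<bullet> g x"
    using fn_cls[OF assms(1)] fn_cls[OF assms(2)] by eventually_elim simp
qed (use assms in measurable)

lemma norm_cls: "L2 f \<Longrightarrow> norm (cls f) = L2_norm f"
  by (simp add: norm_eq_sqrt_inner inner_cls L2_norm_def power2_norm_eq_inner)

lemma norm_l2_nn: "ennreal ((norm u)\<^sup>2) = (\<integral>\<^sup>+x. ennreal ((norm (fn u x))\<^sup>2) \<partial>lborel)"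
proof -
  have "(norm u)\<^sup>2 = (LINT x|lborel. (norm (fn u x))\<^sup>2)"
    by (simp add: power2_norm_eq_inner inner_l2_def)
  thus ?thesis by (simp add: nn_integral_eq_integral[OF L2_integrable])
qed

text \<open>Dominated convergence for the squared distance, where 4 h dominates because (a + b)^2 is
  at most 2 a^2 + 2 b^2.\<close>

lemma L2_tendsto:
  assumes f: "\<And>n. L2 (f n)" and g: "g \<in> borel_measurable borel" and h: "integrable lborel h"
    and lim: "AE x in lborel. (\<lambda>n. f n x) \<longlonglongrightarrow> g x"
    and bd: "\<And>n. AE x in lborel. (norm (f n x))\<^sup>2 \<le> h x"
  shows "L2 g" "(\<lambda>n. cls (f n)) \<longlonglongrightarrow> cls g"
proof -
  have "AE x in lborel. \<forall>n. (norm (f n x))\<^sup>2 \<le> h x" using bd by (simp add: AE_all_countable)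
  with lim have gh: "AE x in lborel. (norm (g x))\<^sup>2 \<le> h x"
  proof eventually_elim
    case (elim x)
    have "(\<lambda>n. (norm (f n x))\<^sup>2) \<longlonglongrightarrow> (norm (g x))\<^sup>2" by (intro tendsto_intros elim)
    thus ?case by (rule LIMSEQ_le_const2) (use elim in auto)
  qed
  show gL: "L2 g" by (rule L2_bound[OF g h gh])
  have "(\<lambda>n. LINT x|lborel. (norm (f n x - g x))\<^sup>2) \<longlonglongrightarrow> (LINT x|(lborel :: (real^3) measure). 0)"
  proof (rule integral_dominated_convergence[where w = "\<lambda>x. 4 * h x"])
    show "integrable lborel (\<lambda>x. 4 * h x)" using h by simp
    show "AE x in lborel. (\<lambda>n. (norm (f n x - g x))\<^sup>2) \<longlonglongrightarrow> 0"
      using lim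
    proof eventually_elim
      case (elim x)
      have "(\<lambda>n. (norm (f n x - g x))\<^sup>2) \<longlonglongrightarrow> (norm (g x - g x))\<^sup>2" by (intro tendsto_intros elim)
      thus ?case by simp
    qed
    show "AE x in lborel. norm ((norm (f n x - g x))\<^sup>2) \<le> 4 * h x" for n
      using bd[of n] gh
    proof eventually_elim
      case (elim x)
      have "(norm (f n x - g x))\<^sup>2 \<le> (norm (f n x) + norm (g x))\<^sup>2"
        by (intro power_mono norm_triangle_ineq4) simp
      also have "\<dots> \<le> 2 * (norm (f n x))\<^sup>2 + 2 * (norm (g x))\<^sup>2"
        using sum_squares_bound[of "norm (f n x)" "norm (g x)"] by (simp add: power2_sum)
      finally show ?case using elim by simp
    qed
  qed (use f g in measurable)
  hence "(\<lambda>n. (norm (cls (f n) - cls g))\<^sup>2) \<longlonglongrightarrow> 0"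
    using f gL by (simp add: norm_cls L2_norm_def L2_diff flip: cls_diff)
  hence "(\<lambda>n. norm (cls (f n) - cls g)) \<longlonglongrightarrow> 0" by simp
  thus "(\<lambda>n. cls (f n)) \<longlonglongrightarrow> cls g" using LIM_zero_cancel tendsto_norm_zero_iff by blast
qed

text \<open>Riesz-Fischer: a rapidly convergent subsequence converges almost everywhere, and Fatou's
  lemma shows that its pointwise limit is also the limit in norm.\<close>

instance l2 :: (euclidean_space) banach
proof
  fix X :: "nat \<Rightarrow> 'a l2" assume X: "Cauchy X"
  have "\<exists>r. strict_mono r \<and> (\<forall>n. \<forall>m\<ge>r n. (norm (X m - X (r n)))\<^sup>2 \<le> (1 / 4) ^ n)"
  proof -
    have "\<exists>M. \<forall>m\<ge>M. \<forall>n\<ge>M. norm (X m - X n) < (1 / 2) ^ k" for k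
      using X unfolding Cauchy_def dist_norm by (metis half_gt_zero_iff zero_less_one zero_less_power)
    then obtain M where M: "\<And>k m n. m \<ge> M k \<Longrightarrow> n \<ge> M k \<Longrightarrow> norm (X m - X n) < (1 / 2) ^ k" by metis
    define r where "r n = (\<Sum>k\<le>n. M k) + n" for n
    have rM: "r n \<ge> M n" for n unfolding r_def using member_le_sum[of n "{..n}" M] by simp
    have "strict_mono r" unfolding strict_mono_Suc_iff r_def by simp
    moreover have "(norm (X m - X (r n)))\<^sup>2 \<le> (1 / 4) ^ n" if "m \<ge> r n" for m n
    proof -
      have "norm (X m - X (r n)) \<le> (1 / 2) ^ n" using M[of n m "r n"] rM[of n] that by simp
      hence "(norm (X m - X (r n)))\<^sup>2 \<le> ((1 / 2) ^ n)\<^sup>2" by (rule power_mono) simp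
      thus ?thesis by (simp add: power_mult_distrib[symmetric] power2_eq_square)
    qed
    ultimately show ?thesis by blast
  qed
  then obtain r where r: "strict_mono r" "\<And>n m. m \<ge> r n \<Longrightarrow> (norm (X m - X (r n)))\<^sup>2 \<le> (1 / 4) ^ n" by blast
  define f where "f n = fn (X (r n))" for n
  have [measurable]: "f n \<in> borel_measurable borel" for n unfolding f_def by measurable
  have nf: "(\<integral>\<^sup>+x. ennreal ((norm (f m x - f n x))\<^sup>2) \<partial>lborel) = ennreal ((norm (X (r m) - X (r n)))\<^sup>2)" for m n
    unfolding norm_l2_nn f_def
    by (rule nn_integral_cong_AE) (use fn_diff[of "X (r m)" "X (r n)"] in \<open>auto elim!: eventually_mono\<close>)
  have small: "(norm (X (r m) - X (r n)))\<^sup>2 \<le> (1 / 4) ^ n" if "m \<ge> n" for m n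
    using r(2)[of n "r m"] strict_mono_mono[OF r(1)] that by (auto dest: monoD)
  \<comment> \<open>The squared increments have integrals at most (1/4)^n, so their series converges
    almost everywhere even with the weight 2^n; that weight forces geometric decay of the increments
    at almost every point.\<close>
  have ae: "AE x in lborel. convergent (\<lambda>n. f n x)"
  proof -
    have "(\<integral>\<^sup>+x. (\<Sum>n. ennreal (2 ^ n * (norm (f (Suc n) x - f n x))\<^sup>2)) \<partial>lborel)
        = (\<Sum>n. \<integral>\<^sup>+x. ennreal (2 ^ n * (norm (f (Suc n) x - f n x))\<^sup>2) \<partial>lborel)"
      by (rule nn_integral_suminf) measurable
    also have "\<dots> \<le> (\<Sum>n. ennreal ((1 / 2) ^ n))"
    proof (rule suminf_le)
      fix n
      have "(\<integral>\<^sup>+x. ennreal (2 ^ n * (norm (f (Suc n) x - f n x))\<^sup>2) \<partial>lborel)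
         = ennreal (2 ^ n) * (\<integral>\<^sup>+x. ennreal ((norm (f (Suc n) x - f n x))\<^sup>2) \<partial>lborel)"
        by (simp add: ennreal_mult nn_integral_cmult)
      also have "\<dots> \<le> ennreal (2 ^ n) * ennreal ((1 / 4) ^ n)"
        unfolding nf by (intro mult_left_mono ennreal_leI small) auto
      also have "\<dots> = ennreal ((1 / 2) ^ n)"
        by (simp flip: ennreal_mult power_mult_distrib)
      finally show "(\<integral>\<^sup>+x. ennreal (2 ^ n * (norm (f (Suc n) x - f n x))\<^sup>2) \<partial>lborel) \<le> ennreal ((1 / 2) ^ n)" .
    qed auto
    also have "\<dots> < \<infinity>"
    proof -
      have "summable (\<lambda>n. (1 / 2 :: real) ^ n)" by (rule summable_geometric) simp
      hence "(\<Sum>n. ennreal ((1 / 2) ^ n)) = ennreal (\<Sum>n. (1 / 2) ^ n)"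
        by (intro suminf_ennreal2) auto
      thus ?thesis by (simp only: ennreal_less_top infinity_ennreal_def)
    qed
    finally have "AE x in lborel. (\<Sum>n. ennreal (2 ^ n * (norm (f (Suc n) x - f n x))\<^sup>2)) \<noteq> \<infinity>"
      by (intro nn_integral_PInf_AE) auto
    thus ?thesis
    proof eventually_elim
      case (elim x)
      define a where "a n = norm (f (Suc n) x - f n x)" for n
      have "summable (\<lambda>n. 2 ^ n * (a n)\<^sup>2)"
        by (rule summable_suminf_not_top) (use elim in \<open>auto simp: a_def\<close>)
      then obtain C where C: "\<And>n. 2 ^ n * (a n)\<^sup>2 \<le> C"
        using summable_imp_bounded[of "\<lambda>n. 2 ^ n * (a n)\<^sup>2"] unfolding bounded_iff by auto
      have a_le: "a n \<le> sqrt C * (sqrt (1 / 2)) ^ n" for n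
      proof -
        have "(a n)\<^sup>2 \<le> C * (1 / 2) ^ n" using C[of n] by (simp add: field_simps power_one_over)
        hence "sqrt ((a n)\<^sup>2) \<le> sqrt (C * (1 / 2) ^ n)" by (simp only: real_sqrt_le_iff)
        thus ?thesis by (simp add: a_def real_sqrt_mult real_sqrt_power)
      qed
      have "summable (\<lambda>n. sqrt C * (sqrt (1 / 2)) ^ n)"
        by (intro summable_mult summable_geometric) (simp add: real_sqrt_divide)
      hence "summable (\<lambda>n. f (Suc n) x - f n x)"
        by (rule summable_comparison_test') (use a_le in \<open>simp add: a_def\<close>)
      hence "convergent (\<lambda>n. \<Sum>k<n. f (Suc k) x - f k x)" by (simp add: summable_iff_convergent)
      hence "convergent (\<lambda>n. f n x - f 0 x)" unfolding sum_lessThan_telescope[of "\<lambda>n. f n x"] .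
      from convergent_add[OF this convergent_const[of "f 0 x"]] show ?case by simp
    qed
  qed
  define g where "g x = lim (\<lambda>n. f n x)" for x
  have [measurable]: "g \<in> borel_measurable borel" unfolding g_def by measurable
  have g: "AE x in lborel. (\<lambda>n. f n x) \<longlonglongrightarrow> g x" using ae by eventually_elim (simp add: g_def convergent_LIMSEQ_iff)
  have fatou: "(\<integral>\<^sup>+x. ennreal ((norm (g x - f n x))\<^sup>2) \<partial>lborel) \<le> ennreal ((1 / 4) ^ n)" for n
  proof -
    have "(\<integral>\<^sup>+x. ennreal ((norm (g x - f n x))\<^sup>2) \<partial>lborel)
       = (\<integral>\<^sup>+x. liminf (\<lambda>m. ennreal ((norm (f m x - f n x))\<^sup>2)) \<partial>lborel)"
    proof (rule nn_integral_cong_AE, use g in eventually_elim)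
      case (elim x)
      have "(\<lambda>m. ennreal ((norm (f m x - f n x))\<^sup>2)) \<longlonglongrightarrow> ennreal ((norm (g x - f n x))\<^sup>2)"
        by (intro tendsto_intros tendsto_ennrealI elim)
      thus ?case by (rule lim_imp_Liminf[symmetric, rotated]) simp
    qed
    also have "\<dots> \<le> liminf (\<lambda>m. \<integral>\<^sup>+x. ennreal ((norm (f m x - f n x))\<^sup>2) \<partial>lborel)"
      by (rule nn_integral_liminf) measurable
    also have "\<dots> \<le> ennreal ((1 / 4) ^ n)"
      unfolding nf
    proof (rule Liminf_le)
      show "\<forall>\<^sub>F m in sequentially. ennreal ((norm (X (r m) - X (r n)))\<^sup>2) \<le> ennreal ((1 / 4) ^ n)"
        using eventually_ge_at_top[of n] by eventually_elim (intro ennreal_leI small)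
    qed simp
    finally show ?thesis .
  qed
  have gf: "L2 (\<lambda>x. g x - f n x)" for n
    unfolding L2_def
    by (auto intro!: integrableI_bounded simp: order_le_less_trans[OF fatou])
  have gL: "L2 g" using L2_add[OF gf[of 0], of "f 0"] by (simp add: f_def)
  have le: "(norm (cls g - X (r n)))\<^sup>2 \<le> (1 / 4) ^ n" for n
  proof -
    have "ennreal ((norm (cls g - X (r n)))\<^sup>2) = (\<integral>\<^sup>+x. ennreal ((norm (g x - f n x))\<^sup>2) \<partial>lborel)"
      unfolding norm_l2_nn
      by (rule nn_integral_cong_AE) (use fn_diff[of "cls g" "X (r n)"] fn_cls[OF gL] in \<open>eventually_elim, simp add: f_def\<close>)
    also have "\<dots> \<le> ennreal ((1 / 4) ^ n)" by (rule fatou)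
    finally show ?thesis by (simp add: ennreal_le_iff)
  qed
  have "(\<lambda>n. (norm (X (r n) - cls g))\<^sup>2) \<longlonglongrightarrow> 0"
    by (rule Lim_null_comparison[OF _ LIMSEQ_realpow_zero[of "1 / 4"]]) (use le in \<open>auto simp: norm_minus_commute\<close>)
  hence "(\<lambda>n. norm (X (r n) - cls g)) \<longlonglongrightarrow> 0" by simp
  hence "(X \<circ> r) \<longlonglongrightarrow> cls g" unfolding o_def using LIM_zero_cancel tendsto_norm_zero_iff by blast
  thus "convergent X"
    using Cauchy_converges_subseq[OF X r(1)] convergentI by (auto simp: o_def)
qed

lemma measurable_indicator_scaleR [measurable]: "S \<in> sets borel \<Longrightarrow> (\<lambda>x. indicator S x *\<^sub>R (e :: 'v::euclidean_space)) \<in> borel_measurable borel"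
  by (intro borel_measurable_scaleR borel_measurable_indicator borel_measurable_const) auto

lemma L2_indicator:
  assumes [measurable]: "S \<in> sets borel" and "emeasure lborel S < \<infinity>"
  shows "L2 (\<lambda>x. indicator S x *\<^sub>R e)"
proof (rule L2_bound)
  show "integrable lborel (\<lambda>x. (norm e)\<^sup>2 * indicator S x :: real)"
    using assms by (intro integrable_mult_right integrable_real_indicator) auto
qed (auto simp: indicator_def)

lemma L2_indicator_subset:
  assumes "L2 (\<lambda>x. indicator S x *\<^sub>R e)" and [measurable]: "R \<in> sets borel" and "R \<subseteq> S"
  shows "L2 (\<lambda>x. indicator R x *\<^sub>R e)"
  by (rule L2_mult_bound[OF _ assms(1), where K = 1]) (use assms in \<open>auto simp: indicator_def\<close>)

lemma L2_box: "L2 (\<lambda>x. indicator (box a b) x *\<^sub>R e)"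
  by (rule L2_indicator) (auto simp: emeasure_lborel_box_eq)

text \<open>Inside a fixed cube, the sets whose indicators belong to M form a Dynkin system that
  contains the boxes, and boxes generate the Borel sets; simple functions then fill the space. Both
  separability and the density of tensor products rest on this.\<close>

lemma closed_subspace_UNIV:
  fixes M :: "'v::euclidean_space l2 set"
  assumes sub: "subspace M" and cl: "closed M"
    and box: "\<And>a b e. e \<in> Basis \<Longrightarrow> cls (\<lambda>x. indicator (box a b) x *\<^sub>R e) \<in> M"
  shows "M = UNIV"
proof -
  \<comment> \<open>Intersection with a bounded cube keeps the indicators of complements square
    integrable.\<close>
  define Q where "Q n = box (- real n *\<^sub>R One) (real n *\<^sub>R One :: real^3)" for n
  have Q_mem: "x \<in> Q n" if "norm x < real n" for x n
    unfolding Q_def mem_box using Basis_le_norm[of _ x] that by (force simp: abs_less_iff)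
  have [measurable]: "Q n \<in> sets borel" for n by (simp add: Q_def)
  have LQ: "L2 (\<lambda>x. indicator (S \<inter> Q n) x *\<^sub>R e)" if "S \<in> sets borel" for S n and e :: 'v
    by (rule L2_indicator_subset[OF L2_box]) (use that in \<open>auto simp: Q_def\<close>)
  have limM: "y \<in> M" if "f \<longlonglongrightarrow> y" "\<And>n. f n \<in> M" for f :: "nat \<Rightarrow> 'v l2" and y
    using cl that closed_sequentially by blast
  have A: "cls (\<lambda>x. indicator (S \<inter> Q n) x *\<^sub>R e) \<in> M" if e: "e \<in> Basis" and S: "S \<in> sets borel" for S n and e :: 'v
  proof -
    define P where "P S \<longleftrightarrow> cls (\<lambda>x. indicator (S \<inter> Q n) x *\<^sub>R e) \<in> M" for S
    have st: "Int_stable (range (\<lambda>(a, b). box a b :: (real^3) set))"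
      by (auto simp: Int_stable_def box_Int_box)
    have gen: "S \<in> sigma_sets UNIV (range (\<lambda>(a, b). box a b))"
      using S by (simp add: borel_eq_box)
    have "range (\<lambda>(a, b). box a b :: (real^3) set) \<subseteq> Pow UNIV" by simp
    from st this gen have "P S"
    proof (induction rule: sigma_sets_induct_disjoint)
      case (basic S)
      then obtain a b where "S = box a b" by auto
      thus ?case using box[OF e] by (simp add: P_def Q_def box_Int_box)
    next
      case empty
      show ?case using subspace_0[OF sub] by (simp add: P_def cls_0)
    next
      case (compl S)
      have "S \<in> sets borel" using compl(1) by (simp add: borel_eq_box)
      hence "cls (\<lambda>x. indicator (UNIV \<inter> Q n) x *\<^sub>R e) - cls (\<lambda>x. indicator (S \<inter> Q n) x *\<^sub>R e)
          = cls (\<lambda>x. indicator (UNIV \<inter> Q n) x *\<^sub>R e - indicator (S \<inter> Q n) x *\<^sub>R e)"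
        by (intro cls_diff[symmetric] LQ) auto
      also have "(\<lambda>x. indicator (UNIV \<inter> Q n) x *\<^sub>R e - indicator (S \<inter> Q n) x *\<^sub>R e) = (\<lambda>x. indicator ((UNIV - S) \<inter> Q n) x *\<^sub>R e)"
        by (auto simp: indicator_def)
      finally show ?case
        using subspace_diff[OF sub box[OF e, of "- real n *\<^sub>R One" "real n *\<^sub>R One"] compl(2)[unfolded P_def]]
        unfolding P_def by (simp add: Q_def)
    next
      case (union S)
      have S: "S i \<in> sets borel" for i using union(2) by (auto simp: borel_eq_box)
      have part: "cls (\<lambda>x. indicator ((\<Union>i<k. S i) \<inter> Q n) x *\<^sub>R e) \<in> M" for k
      proof (induction k)
        case 0 thus ?case using subspace_0[OF sub] by (simp add: cls_0)
      next
        case (Suc k)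
        have f: "(\<lambda>x. indicator ((\<Union>i<Suc k. S i) \<inter> Q n) x *\<^sub>R e) =
            (\<lambda>x. indicator ((\<Union>i<k. S i) \<inter> Q n) x *\<^sub>R e + indicator (S k \<inter> Q n) x *\<^sub>R e)"
        proof
          fix x
          have "S i \<inter> S k = {}" if "i < k" for i
            using union(1) that unfolding disjoint_family_on_def by (metis UNIV_I less_irrefl)
          hence "x \<in> S k \<Longrightarrow> x \<notin> (\<Union>i<k. S i)" by blast
          thus "indicator ((\<Union>i<Suc k. S i) \<inter> Q n) x *\<^sub>R e = indicator ((\<Union>i<k. S i) \<inter> Q n) x *\<^sub>R e + indicator (S k \<inter> Q n) x *\<^sub>R e"
            by (auto simp: indicator_def less_Suc_eq)
        qed
        have eq: "cls (\<lambda>x. indicator ((\<Union>i<Suc k. S i) \<inter> Q n) x *\<^sub>R e) =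
            cls (\<lambda>x. indicator ((\<Union>i<k. S i) \<inter> Q n) x *\<^sub>R e) + cls (\<lambda>x. indicator (S k \<inter> Q n) x *\<^sub>R e)"
          unfolding f by (intro cls_add LQ) (use S in auto)
        show ?case unfolding eq by (rule subspace_add[OF sub Suc union(3)[of k, unfolded P_def]])
      qed
      show ?case
        unfolding P_def
      proof (rule limM[where f = "\<lambda>k. cls (\<lambda>x. indicator ((\<Union>i<k. S i) \<inter> Q n) x *\<^sub>R e)", OF _ part])
        show "(\<lambda>k. cls (\<lambda>x. indicator ((\<Union>i<k. S i) \<inter> Q n) x *\<^sub>R e)) \<longlonglongrightarrow> cls (\<lambda>x. indicator ((\<Union>i. S i) \<inter> Q n) x *\<^sub>R e)"
        proof (rule L2_tendsto(2)[OF _ _ L2_integrable[OF LQ[of UNIV n e]]])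
          show "L2 (\<lambda>x. indicator ((\<Union>i<k. S i) \<inter> Q n) x *\<^sub>R e)" for k by (rule LQ) (use S in auto)
          show "(\<lambda>x. indicator ((\<Union>i. S i) \<inter> Q n) x *\<^sub>R e) \<in> borel_measurable borel"
            using S by (intro measurable_indicator_scaleR) auto
          show "AE x in lborel. (\<lambda>k. indicator ((\<Union>i<k. S i) \<inter> Q n) x *\<^sub>R e) \<longlonglongrightarrow> indicator ((\<Union>i. S i) \<inter> Q n) x *\<^sub>R e"
          proof (rule AE_I2)
            fix x
            show "(\<lambda>k. indicator ((\<Union>i<k. S i) \<inter> Q n) x *\<^sub>R e) \<longlonglongrightarrow> indicator ((\<Union>i. S i) \<inter> Q n) x *\<^sub>R e"
            proof (cases "\<exists>i. x \<in> S i")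
              case True
              then obtain i where i: "x \<in> S i" by blast
              show ?thesis
                by (rule tendsto_eventually, rule eventually_mono[OF eventually_gt_at_top[of i]])
                   (use i in \<open>auto simp: indicator_def\<close>)
            next
              case False
              thus ?thesis by (intro tendsto_eventually always_eventually) (auto simp: indicator_def)
            qed
          qed
          show "AE x in lborel. (norm (indicator ((\<Union>i<k. S i) \<inter> Q n) x *\<^sub>R e))\<^sup>2 \<le> (norm (indicator (UNIV \<inter> Q n) x *\<^sub>R e))\<^sup>2" for k
            by (auto simp: indicator_def)
        qed auto
      qed
    qed
    thus ?thesis by (simp add: P_def)
  qed
  have B: "cls (\<lambda>x. indicator S x *\<^sub>R e) \<in> M"
    if e: "e \<in> Basis" and S: "S \<in> sets borel" "L2 (\<lambda>x. indicator S x *\<^sub>R e)" for S and e :: 'v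
  proof (rule limM[where f = "\<lambda>n. cls (\<lambda>x. indicator (S \<inter> Q n) x *\<^sub>R e)"])
    show "cls (\<lambda>x. indicator (S \<inter> Q n) x *\<^sub>R e) \<in> M" for n by (rule A[OF e S(1)])
    show "(\<lambda>n. cls (\<lambda>x. indicator (S \<inter> Q n) x *\<^sub>R e)) \<longlonglongrightarrow> cls (\<lambda>x. indicator S x *\<^sub>R e)"
    proof (rule L2_tendsto(2)[OF LQ[OF S(1)] _ L2_integrable[OF S(2)]])
      show "(\<lambda>x. indicator S x *\<^sub>R e) \<in> borel_measurable borel" by (rule measurable_indicator_scaleR[OF S(1)])
      show "AE x in lborel. (\<lambda>n. indicator (S \<inter> Q n) x *\<^sub>R e) \<longlonglongrightarrow> indicator S x *\<^sub>R e"
      proof (rule AE_I2)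
        fix x :: "real^3"
        obtain N where N: "norm x < real N" using reals_Archimedean2 by blast
        have "\<forall>\<^sub>F n in sequentially. indicator (S \<inter> Q n) x *\<^sub>R e = indicator S x *\<^sub>R e"
          using eventually_ge_at_top[of N]
        proof eventually_elim
          case (elim n)
          hence "x \<in> Q n" using N by (intro Q_mem) simp
          thus ?case by (simp add: indicator_def)
        qed
        thus "(\<lambda>n. indicator (S \<inter> Q n) x *\<^sub>R e) \<longlonglongrightarrow> indicator S x *\<^sub>R e" by (rule tendsto_eventually)
      qed
      show "AE x in lborel. (norm (indicator (S \<inter> Q n) x *\<^sub>R e))\<^sup>2 \<le> (norm (indicator S x *\<^sub>R e))\<^sup>2" for n
        by (auto simp: indicator_def)
    qed
  qed
  have C: "cls (\<lambda>x. indicator S x *\<^sub>R y) \<in> M \<and> L2 (\<lambda>x. indicator S x *\<^sub>R y)"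
    if S: "S \<in> sets borel" "L2 (\<lambda>x. indicator S x *\<^sub>R y)" for S and y :: 'v
  proof -
    have Le: "L2 (\<lambda>x. indicator S x *\<^sub>R e)" if "e \<in> Basis" "y \<noteq> 0" for e :: 'v
      by (rule L2_mult_bound[OF _ S(2), where K = "1 / norm y"]) (use that S in \<open>auto simp: indicator_def\<close>)
    have "cls (\<lambda>x. indicator S x *\<^sub>R (\<Sum>e\<in>I. (y \<bullet> e) *\<^sub>R e)) \<in> M \<and> L2 (\<lambda>x. indicator S x *\<^sub>R (\<Sum>e\<in>I. (y \<bullet> e) *\<^sub>R e))"
      if "finite I" "I \<subseteq> Basis" "y \<noteq> 0" for I
      using that
    proof (induction I rule: finite_induct)
      case empty thus ?case using subspace_0[OF sub] by (simp add: cls_0)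
    next
      case (insert e I)
      have 1: "L2 (\<lambda>x. (y \<bullet> e) *\<^sub>R (indicator S x *\<^sub>R e))" by (intro L2_scaleR Le) (use insert in auto)
      have 2: "cls (\<lambda>x. (y \<bullet> e) *\<^sub>R (indicator S x *\<^sub>R e)) \<in> M"
        using insert by (subst cls_scaleR) (auto intro!: Le subspace_scale[OF sub] B S)
      have eq: "(\<lambda>x. indicator S x *\<^sub>R (\<Sum>e\<in>insert e I. (y \<bullet> e) *\<^sub>R e)) =
          (\<lambda>x. (y \<bullet> e) *\<^sub>R (indicator S x *\<^sub>R e) + indicator S x *\<^sub>R (\<Sum>e\<in>I. (y \<bullet> e) *\<^sub>R e))"
        using insert by (simp add: scaleR_add_right mult.commute)
      show ?case unfolding eq using insert 1 2 by (auto simp: cls_add intro: L2_add subspace_add[OF sub])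
    qed
    from this[of Basis] show ?thesis
      by (cases "y = 0") (auto simp: euclidean_representation cls_0 subspace_0[OF sub])
  qed
  have "u \<in> M" for u
  proof -
    obtain F where F': "\<forall>i. simple_function borel (F i)" "\<forall>x\<in>space borel. (\<lambda>i. F i x) \<longlonglongrightarrow> fn u x"
      "\<forall>i. \<forall>x\<in>space borel. dist (F i x) 0 \<le> 2 * dist (fn u x) 0"
      using borel_measurable_implies_sequence_metric[OF fn_measurable, of u 0] by blast
    have F: "simple_function borel (F i)" "(\<lambda>i. F i x) \<longlonglongrightarrow> fn u x" "norm (F i x) \<le> 2 * norm (fn u x)" for i x
      using F' by auto
    have Fm: "F i \<in> borel_measurable borel" for i by (rule borel_measurable_simple_function[OF F(1)])
    have LF: "L2 (F i)" for i
      by (rule L2_mult_bound[OF Fm L2_fn[of u], where K = 2]) (use F(3) in auto)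
    have FM: "cls (F i) \<in> M" for i
    proof -
      have fin: "finite (range (F i))" using simple_functionD(1)[OF F(1)[of i]] by simp
      have S: "F i -` {y} \<in> sets borel" for y using measurable_sets[OF Fm, of "{y}" i] by simp
      have "L2 (\<lambda>x. indicator (F i -` {y}) x *\<^sub>R y)" for y
        by (rule L2_mult_bound[OF measurable_indicator_scaleR[OF S] LF[of i], where K = 1]) (auto simp: indicator_def)
      note CS = C[OF S this]
      have sumM: "cls (\<lambda>x. \<Sum>y\<in>I. indicator (F i -` {y}) x *\<^sub>R y) \<in> M \<and> L2 (\<lambda>x. \<Sum>y\<in>I. indicator (F i -` {y}) x *\<^sub>R y)"
        if "finite I" for I
        using that
      proof (induction I rule: finite_induct)
        case empty thus ?case using subspace_0[OF sub] by (simp add: cls_0)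
      next
        case (insert y I)
        note a = CS[of y] and b = insert(3)
        show ?case
          unfolding sum.insert[OF insert(1,2)] cls_add[OF conjunct2[OF a] conjunct2[OF b]]
          by (intro conjI subspace_add[OF sub conjunct1[OF a] conjunct1[OF b]] L2_add[OF conjunct2[OF a] conjunct2[OF b]])
      qed
      have eq: "(\<lambda>x. \<Sum>y\<in>range (F i). indicator (F i -` {y}) x *\<^sub>R y) = F i"
      proof
        fix x
        have "(\<Sum>y\<in>range (F i). indicator (F i -` {y}) x *\<^sub>R y) = (\<Sum>y\<in>{F i x}. indicator (F i -` {y}) x *\<^sub>R y)"
          by (rule sum.mono_neutral_right[OF fin]) (auto simp: indicator_def)
        thus "(\<Sum>y\<in>range (F i). indicator (F i -` {y}) x *\<^sub>R y) = F i x" by simp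
      qed
      show ?thesis using sumM[OF fin] unfolding eq ..
    qed
    have "(\<lambda>i. cls (F i)) \<longlonglongrightarrow> cls (fn u)"
    proof (rule L2_tendsto(2)[OF LF fn_measurable])
      show "integrable lborel (\<lambda>x. 4 * (norm (fn u x))\<^sup>2)" using L2_integrable[OF L2_fn[of u]] by simp
      have "(norm (F i x))\<^sup>2 \<le> (2 * norm (fn u x))\<^sup>2" for i x by (intro power_mono F) simp
      thus "AE x in lborel. (norm (F i x))\<^sup>2 \<le> 4 * (norm (fn u x))\<^sup>2" for i by (simp add: power_mult_distrib)
    qed (use F in auto)
    thus ?thesis using limM[OF _ FM] by simp
  qed
  thus ?thesis by blast
qed

text \<open>Rational combinations of indicators of boxes with rational corners are countable in
  number; their closure is a closed subspace that contains all boxes.\<close>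

instance l2 :: (euclidean_space) second_countable_topology
proof
  define R3 where "R3 = range (\<lambda>(p, q, r). vector [of_rat p, of_rat q, of_rat r] :: real^3)"
  have R3: "x \<in> R3" if x: "\<forall>i. x $ i \<in> \<rat>" for x
  proof -
    obtain p where p: "x $ 1 = of_rat p" using x[rule_format, of 1] by (auto elim: Rats_cases)
    obtain q where q: "x $ 2 = of_rat q" using x[rule_format, of 2] by (auto elim: Rats_cases)
    obtain r where r: "x $ 3 = of_rat r" using x[rule_format, of 3] by (auto elim: Rats_cases)
    from p q r have "x = vector [of_rat p, of_rat q, of_rat r]" by (simp only: vec_eq_iff forall_3 vector_3)
    thus ?thesis unfolding R3_def by (auto intro!: image_eqI[of _ _ "(p, q, r)"])
  qed
  define S0 where "S0 = (\<lambda>((a, b), e). cls (\<lambda>x. indicator (box a b) x *\<^sub>R e) :: 'a l2) ` ((R3 \<times> R3) \<times> Basis)"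
  have cS0: "countable S0" unfolding S0_def R3_def
    by (intro countable_image countable_SIGMA countable_finite[OF finite_Basis] countableI_type)
  define f where "f l = (\<Sum>(q, s)\<leftarrow>l. of_rat q *\<^sub>R s)" for l :: "(rat \<times> 'a l2) list"
  define Qs where "Qs = f ` lists (UNIV \<times> S0)"
  have cQs: "countable Qs" unfolding Qs_def
    by (rule countable_image[OF countable_lists[OF countable_SIGMA[OF countableI_type cS0]]])
  have Qs_add: "x + y \<in> Qs" if xy: "x \<in> Qs" "y \<in> Qs" for x y
  proof -
    obtain l m where "l \<in> lists (UNIV \<times> S0)" "m \<in> lists (UNIV \<times> S0)" "x = f l" "y = f m"
      using xy unfolding Qs_def by blast
    thus ?thesis unfolding Qs_def by (intro image_eqI[of _ _ "l @ m"]) (auto simp: f_def)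
  qed
  have Qs_scale: "of_rat q *\<^sub>R x \<in> Qs" if x: "x \<in> Qs" for x q
  proof -
    obtain l where l: "l \<in> lists (UNIV \<times> S0)" "x = f l" using x unfolding Qs_def by blast
    have "of_rat q *\<^sub>R f l = f (map (\<lambda>(r, s). (q * r, s)) l)"
      by (induction l) (auto simp: f_def scaleR_add_right of_rat_mult)
    moreover have "map (\<lambda>(r, s). (q * r, s)) l \<in> lists (UNIV \<times> S0)" using l(1) by (induction l) auto
    ultimately show ?thesis using l unfolding Qs_def by blast
  qed
  have Qs_0: "0 \<in> Qs" unfolding Qs_def by (intro image_eqI[of _ _ "[]"]) (auto simp: f_def)
  have sub: "subspace (closure Qs)"
    unfolding subspace_def
  proof (intro conjI ballI allI)
    show "0 \<in> closure Qs" using Qs_0 closure_subset by blast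
    fix x assume "x \<in> closure Qs"
    then obtain g where g: "\<forall>n. g n \<in> Qs" "g \<longlonglongrightarrow> x" unfolding closure_sequential by blast
    show "x + y \<in> closure Qs" if "y \<in> closure Qs" for y
    proof -
      obtain h where "\<forall>n. h n \<in> Qs" "h \<longlonglongrightarrow> y" using \<open>y \<in> closure Qs\<close> unfolding closure_sequential by blast
      thus ?thesis using g unfolding closure_sequential
        by (intro exI[of _ "\<lambda>n. g n + h n"]) (auto intro!: tendsto_add Qs_add)
    qed
    show "c *\<^sub>R x \<in> closure Qs" for c
    proof -
      have "\<exists>q. c < of_rat q \<and> of_rat q < c + 1 / real (Suc n)" for n by (rule of_rat_dense) simp
      then obtain q where q: "\<And>n. c < of_rat (q n) \<and> of_rat (q n) < c + 1 / real (Suc n)" by metis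
      have "(\<lambda>n. of_rat (q n)) \<longlonglongrightarrow> c"
      proof (rule tendsto_sandwich[where f = "\<lambda>_. c" and h = "\<lambda>n. c + 1 / real (Suc n)"])
        show "(\<lambda>n. c + 1 / real (Suc n)) \<longlonglongrightarrow> c"
          using tendsto_add[OF tendsto_const[of c] LIMSEQ_Suc[OF lim_1_over_n]] by simp
      qed (use q in \<open>auto intro!: always_eventually less_imp_le\<close>)
      thus ?thesis using g unfolding closure_sequential
        by (intro exI[of _ "\<lambda>n. of_rat (q n) *\<^sub>R g n"]) (auto intro!: tendsto_scaleR Qs_scale)
    qed
  qed
  have "closure Qs = UNIV"
  proof (rule closed_subspace_UNIV[OF sub closed_closure])
    fix a b :: "real^3" and e :: 'a assume e: "e \<in> Basis"
    \<comment> \<open>The corners are approached from inside the box, so its indicator dominates all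
      the approximating ones.\<close>
    have "\<forall>n i. \<exists>q. q \<in> \<rat> \<and> a $ i < q \<and> q < a $ i + 1 / real (Suc n)"
      using Rats_dense_in_real[of "a $ i" "a $ i + 1 / real (Suc n)" for n i] by (auto simp: Bex_def)
    then obtain p where "\<forall>n i. p n i \<in> \<rat> \<and> a $ i < p n i \<and> p n i < a $ i + 1 / real (Suc n)"
      unfolding choice_iff by blast
    hence p: "p n i \<in> \<rat> \<and> a $ i < p n i \<and> p n i < a $ i + 1 / real (Suc n)" for n i by blast
    have "\<forall>n i. \<exists>q. q \<in> \<rat> \<and> b $ i - 1 / real (Suc n) < q \<and> q < b $ i"
      using Rats_dense_in_real[of "b $ i - 1 / real (Suc n)" "b $ i" for n i] by (auto simp: Bex_def)
    then obtain r where "\<forall>n i. r n i \<in> \<rat> \<and> b $ i - 1 / real (Suc n) < r n i \<and> r n i < b $ i"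
      unfolding choice_iff by blast
    hence r: "r n i \<in> \<rat> \<and> b $ i - 1 / real (Suc n) < r n i \<and> r n i < b $ i" for n i by blast
    have mem: "cls (\<lambda>x. indicator (box (\<chi> i. p n i) (\<chi> i. r n i)) x *\<^sub>R e) \<in> closure Qs" for n
    proof -
      have s: "cls (\<lambda>x. indicator (box (\<chi> i. p n i) (\<chi> i. r n i)) x *\<^sub>R e) \<in> S0" (is "?s \<in> S0")
        unfolding S0_def using p r e
        by (intro image_eqI[of _ _ "((\<chi> i. p n i, \<chi> i. r n i), e)"]) (auto intro!: R3)
      have "?s = f [(1, ?s)]" by (simp add: f_def)
      hence "?s \<in> Qs" unfolding Qs_def using s by (intro image_eqI[of _ _ "[(1, ?s)]"]) auto
      thus ?thesis using closure_subset by blast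
    qed
    have lim: "(\<lambda>n. 1 / real (Suc n)) \<longlonglongrightarrow> 0" by (rule LIMSEQ_Suc[OF lim_1_over_n])
    have pl: "(\<lambda>n. p n i) \<longlonglongrightarrow> a $ i" for i
    proof (rule tendsto_sandwich[where f = "\<lambda>_. a $ i" and h = "\<lambda>n. a $ i + 1 / real (Suc n)"])
      show "(\<lambda>n. a $ i + 1 / real (Suc n)) \<longlonglongrightarrow> a $ i" using tendsto_add[OF tendsto_const lim] by simp
    qed (use p in \<open>auto intro!: always_eventually less_imp_le\<close>)
    have rl: "(\<lambda>n. r n i) \<longlonglongrightarrow> b $ i" for i
    proof (rule tendsto_sandwich[where f = "\<lambda>n. b $ i - 1 / real (Suc n)" and h = "\<lambda>_. b $ i"])
      show "(\<lambda>n. b $ i - 1 / real (Suc n)) \<longlonglongrightarrow> b $ i" using tendsto_diff[OF tendsto_const lim] by simp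
    qed (use r in \<open>auto intro!: always_eventually less_imp_le\<close>)
    have "(\<lambda>n. cls (\<lambda>x. indicator (box (\<chi> i. p n i) (\<chi> i. r n i)) x *\<^sub>R e)) \<longlonglongrightarrow> cls (\<lambda>x. indicator (box a b) x *\<^sub>R e)"
    proof (rule L2_tendsto(2)[OF L2_box _ L2_integrable[OF L2_box[of a b e]]])
      show "AE x in lborel. (\<lambda>n. indicator (box (\<chi> i. p n i) (\<chi> i. r n i)) x *\<^sub>R e) \<longlonglongrightarrow> indicator (box a b) x *\<^sub>R e"
      proof (rule AE_I2)
        fix x :: "real^3"
        have "\<forall>\<^sub>F n in sequentially. indicator (box (\<chi> i. p n i) (\<chi> i. r n i)) x *\<^sub>R e = indicator (box a b) x *\<^sub>R e"
        proof (cases "x \<in> box a b")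
          case True
          hence "\<forall>\<^sub>F n in sequentially. \<forall>i. p n i < x $ i \<and> x $ i < r n i"
            unfolding mem_box_cart
            by (intro eventually_all_finite eventually_conj order_tendstoD[OF pl] order_tendstoD[OF rl]) auto
          thus ?thesis by eventually_elim (use True in \<open>simp add: indicator_def mem_box_cart\<close>)
        next
          case False
          have "x \<notin> box (\<chi> i. p n i) (\<chi> i. r n i)" for n
            using False p[of n] r[of n] unfolding mem_box_cart by (metis less_trans vec_lambda_beta)
          thus ?thesis using False by simp
        qed
        thus "(\<lambda>n. indicator (box (\<chi> i. p n i) (\<chi> i. r n i)) x *\<^sub>R e) \<longlonglongrightarrow> indicator (box a b) x *\<^sub>R e"
          by (rule tendsto_eventually)
      qed
      show "AE x in lborel. (norm (indicator (box (\<chi> i. p n i) (\<chi> i. r n i)) x *\<^sub>R e))\<^sup>2 \<le> (norm (indicator (box a b) x *\<^sub>R e))\<^sup>2" for n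
      proof (rule AE_I2)
        fix x
        have "x \<in> box (\<chi> i. p n i) (\<chi> i. r n i) \<Longrightarrow> x \<in> box a b"
          using p[of n] r[of n] unfolding mem_box_cart by (metis less_trans vec_lambda_beta)
        thus "(norm (indicator (box (\<chi> i. p n i) (\<chi> i. r n i)) x *\<^sub>R e))\<^sup>2 \<le> (norm (indicator (box a b) x *\<^sub>R e))\<^sup>2"
          by (auto simp: indicator_def)
      qed
    qed measurable
    thus "cls (\<lambda>x. indicator (box a b) x *\<^sub>R e) \<in> closure Qs"
      using closed_sequentially[OF closed_closure, of "\<lambda>n. cls (\<lambda>x. indicator (box (\<chi> i. p n i) (\<chi> i. r n i)) x *\<^sub>R e)"] mem by blast
  qed
  hence dense: "\<exists>y\<in>Qs. dist y x < e" if "e > 0" for x e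
    using that closure_approachable by (metis UNIV_I)
  define B where "B = (\<lambda>(x, n). ball x (1 / real (Suc n))) ` (Qs \<times> UNIV)"
  have "topological_basis B"
  proof (rule topological_basisI)
    show "open b" if "b \<in> B" for b using that by (auto simp: B_def)
    fix O' :: "'a l2 set" and x assume "open O'" "x \<in> O'"
    then obtain e where e: "e > 0" "ball x e \<subseteq> O'" by (meson open_contains_ball)
    obtain n where n: "1 / real (Suc n) < e / 2" using e(1) by (metis half_gt_zero_iff nat_approx_posE)
    obtain y where y: "y \<in> Qs" "dist y x < 1 / real (Suc n)" using dense[of "1 / real (Suc n)" x] by auto
    have "ball y (1 / real (Suc n)) \<subseteq> ball x e"
    proof
      fix z assume "z \<in> ball y (1 / real (Suc n))"
      thus "z \<in> ball x e" using y(2) n dist_triangle[of x z y] by (simp add: dist_commute)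
    qed
    moreover have "ball y (1 / real (Suc n)) \<in> B" unfolding B_def using y(1) by (intro image_eqI[of _ _ "(y, n)"]) auto
    moreover have "x \<in> ball y (1 / real (Suc n))" using y(2) by simp
    ultimately show "\<exists>B'\<in>B. x \<in> B' \<and> B' \<subseteq> O'" using e(2) by blast
  qed
  moreover have "countable B" unfolding B_def
    by (rule countable_image[OF countable_SIGMA[OF cQs countableI_type]])
  ultimately show "\<exists>B::'a l2 set set. countable B \<and> open = generate_topology B"
    using topological_basis_imp_subbasis by blast
qed

text \<open>\<open>endo\<close> asks this of its underlying space; a nonzero element is all that it
  takes.\<close>

instance l2 :: (euclidean_space) perfect_space
proof
  fix x :: "'a l2"
  obtain e :: 'a where e: "e \<in> Basis" using nonempty_Basis by blast
  define z where "z = cls (\<lambda>x. indicator (box 0 One) x *\<^sub>R e)"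
  have "(norm z)\<^sup>2 = (LINT x|lborel. indicator (box 0 (One :: real^3)) x)"
    unfolding power2_norm_eq_inner z_def inner_cls[OF L2_box L2_box]
    by (rule Bochner_Integration.integral_cong) (use e in \<open>auto simp: indicator_def inner_Basis\<close>)
  also have "\<dots> = 1" by (simp add: measure_lborel_box)
  finally have z: "norm z \<noteq> 0" by (metis power_zero_numeral zero_neq_one)
  show "\<not> open {x}"
  proof
    assume "open {x}"
    then obtain r where r: "r > 0" "ball x r \<subseteq> {x}" by (meson insertI1 open_contains_ball)
    have "x + (r / (2 * norm z)) *\<^sub>R z \<in> ball x r" using r z by (simp add: dist_norm)
    hence "(r / (2 * norm z)) *\<^sub>R z = 0" using r by auto
    thus False using r z by simp
  qed
qed

subsection \<open>Multiplication and translation operators\<close>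

text \<open>These are fields of linear maps that act pointwise as bounded operators. Measurability
  is phrased through composition with Borel functions, so no measurable structure on a space of maps
  is involved.\<close>

definition padm :: "(real^3 \<Rightarrow> 'v::euclidean_space \<Rightarrow> 'w::euclidean_space) \<Rightarrow> real \<Rightarrow> bool" where
  "padm b K \<longleftrightarrow> (\<forall>f\<in>borel_measurable borel. (\<lambda>x. b x (f x)) \<in> borel_measurable borel) \<and>
     (\<forall>x. linear (b x)) \<and> (\<forall>x v. norm (b x v) \<le> K * norm v)"

definition mop :: "(real^3 \<Rightarrow> 'v::euclidean_space \<Rightarrow> 'w::euclidean_space) \<Rightarrow> 'v l2 \<Rightarrow> 'w l2" where
  "mop b u = cls (\<lambda>x. b x (fn u x))"

lemma L2_padm: assumes b: "padm b K" and f: "L2 f" shows "L2 (\<lambda>x. b x (f x))"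
proof (rule L2_mult_bound[OF _ f])
  show "(\<lambda>x. b x (f x)) \<in> borel_measurable borel" using b L2_measurable[OF f] unfolding padm_def by blast
  show "AE x in lborel. norm (b x (f x)) \<le> K * norm (f x)" using b unfolding padm_def by (intro AE_I2) blast
qed

lemma fn_mop: "padm b K \<Longrightarrow> AE x in lborel. fn (mop b u) x = b x (fn u x)"
  unfolding mop_def by (rule fn_cls[OF L2_padm[OF _ L2_fn]])

lemma mop_cls: assumes "padm b K" "L2 f" shows "mop b (cls f) = cls (\<lambda>x. b x (f x))"
  unfolding mop_def
proof (rule cls_cong)
  show "AE x in lborel. b x (fn (cls f) x) = b x (f x)" using fn_cls[OF assms(2)] by eventually_elim simp
qed (intro L2_padm[OF assms(1)] L2_fn assms)+

lemma bounded_linear_mop: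
  fixes b :: "real^3 \<Rightarrow> 'v::euclidean_space \<Rightarrow> 'w::euclidean_space"
  assumes b: "padm b K" shows "bounded_linear (mop b)"
proof (rule bounded_linear_intro[where K = "\<bar>K\<bar>"])
  fix u v :: "'v l2" and r :: real
  have lin: "linear (b x)" for x using b by (simp add: padm_def)
  show "mop b (u + v) = mop b u + mop b v"
    by (rule l2_eqI) (use fn_mop[OF b, of "u + v"] fn_mop[OF b, of u] fn_mop[OF b, of v] fn_add[of u v] fn_add[of "mop b u" "mop b v"]
      in \<open>eventually_elim, simp add: linear_add[OF lin]\<close>)
  show "mop b (r *\<^sub>R u) = r *\<^sub>R mop b u"
    by (rule l2_eqI) (use fn_mop[OF b, of "r *\<^sub>R u"] fn_mop[OF b, of u] fn_scaleR[of r u] fn_scaleR[of r "mop b u"]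
      in \<open>eventually_elim, simp add: linear_scale[OF lin]\<close>)
  have L: "L2 (\<lambda>x. b x (fn u x))" by (rule L2_padm[OF b L2_fn])
  have "(norm (mop b u))\<^sup>2 \<le> (norm u * \<bar>K\<bar>)\<^sup>2"
  proof -
    have "(norm (mop b u))\<^sup>2 = (LINT x|lborel. (norm (b x (fn u x)))\<^sup>2)"
      unfolding mop_def power2_norm_eq_inner inner_cls[OF L L] ..
    also have "\<dots> \<le> (LINT x|lborel. K\<^sup>2 * (norm (fn u x))\<^sup>2)"
    proof (rule integral_mono[OF L2_integrable[OF L]])
      show "integrable lborel (\<lambda>x. K\<^sup>2 * (norm (fn u x))\<^sup>2)" using L2_integrable[OF L2_fn[of u]] by simp
      show "(norm (b x (fn u x)))\<^sup>2 \<le> K\<^sup>2 * (norm (fn u x))\<^sup>2" for x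
        using b unfolding padm_def power_mult_distrib[symmetric] by (intro power_mono) auto
    qed
    also have "\<dots> = K\<^sup>2 * (norm u)\<^sup>2" by (simp add: power2_norm_eq_inner inner_l2_def)
    finally show ?thesis by (simp add: power_mult_distrib mult.commute)
  qed
  thus "norm (mop b u) \<le> norm u * \<bar>K\<bar>" by (rule power2_le_imp_le) simp
qed

lemma AE_lborel_shift:
  fixes P :: "'a::euclidean_space \<Rightarrow> bool"
  assumes "AE x in lborel. P x" shows "AE x in lborel. P (x + h)"
proof -
  have "AE x in distr lborel borel ((+) h). P x" unfolding lborel_distr_plus by (rule assms)
  thus ?thesis by (subst add.commute) (rule AE_distrD[rotated], auto)
qed

lemma integral_lborel_shift:
  fixes g :: "'a::euclidean_space \<Rightarrow> 'b::{banach,second_countable_topology}"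
  assumes "g \<in> borel_measurable borel"
  shows "(LINT x|lborel. g (x + h)) = (LINT x|lborel. g x)"
    and "integrable lborel (\<lambda>x. g (x + h)) \<longleftrightarrow> integrable lborel g"
  using integral_distr[of "(+) h" lborel borel g] integrable_distr_eq[of "(+) h" lborel borel g] assms
  by (simp_all add: lborel_distr_plus add.commute)

lemma L2_shift: "L2 f \<Longrightarrow> L2 (\<lambda>x. f (x + h))"
  unfolding L2_def using integral_lborel_shift(2)[of "\<lambda>x. (norm (f x))\<^sup>2" h] by auto

definition tr :: "real^3 \<Rightarrow> 'v::euclidean_space l2 \<Rightarrow> 'v l2" where
  "tr h u = cls (\<lambda>x. fn u (x + h))"

lemma fn_tr: "AE x in lborel. fn (tr h u) x = fn u (x + h)"
  unfolding tr_def by (intro fn_cls L2_shift L2_fn)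

lemma tr_cls: assumes "L2 f" shows "tr h (cls f) = cls (\<lambda>x. f (x + h))"
  unfolding tr_def by (rule cls_cong[OF AE_lborel_shift[OF fn_cls[OF assms]]]) (intro L2_shift L2_fn assms)+

lemma tr_tr: "tr h (tr k u) = tr (h + k) u"
  by (rule l2_eqI) (use fn_tr[of h "tr k u"] AE_lborel_shift[OF fn_tr[of k u], of h] fn_tr[of "h + k" u]
      in \<open>eventually_elim, simp add: add.assoc\<close>)

lemma inner_tr: "tr h u \<bullet> v = u \<bullet> tr (- h) v"
proof -
  have "tr h u \<bullet> v = (LINT x|lborel. fn u (x + h) \<bullet> fn v x)"
    using inner_cls[OF L2_shift[OF L2_fn[of u], of h] L2_fn[of v]] by (simp add: tr_def)
  also have "\<dots> = (LINT x|lborel. fn u x \<bullet> fn v (x + - h))"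
    using integral_lborel_shift(1)[of "\<lambda>x. fn u x \<bullet> fn v (x + - h)" h] by simp
  also have "\<dots> = u \<bullet> tr (- h) v"
    using inner_cls[OF L2_fn[of u] L2_shift[OF L2_fn[of v], of "- h"]] by (simp add: tr_def)
  finally show ?thesis .
qed

lemma bounded_linear_tr: "bounded_linear (tr h)"
proof (rule bounded_linear_intro[where K = 1])
  fix u v :: "'a l2" and r :: real
  show "tr h (u + v) = tr h u + tr h v"
    by (rule l2_eqI) (use fn_tr[of h "u + v"] fn_tr[of h u] fn_tr[of h v] AE_lborel_shift[OF fn_add[of u v], of h] fn_add[of "tr h u" "tr h v"]
      in \<open>eventually_elim, simp\<close>)
  show "tr h (r *\<^sub>R u) = r *\<^sub>R tr h u"
    by (rule l2_eqI) (use fn_tr[of h "r *\<^sub>R u"] fn_tr[of h u] AE_lborel_shift[OF fn_scaleR[of r u], of h] fn_scaleR[of r "tr h u"]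
      in \<open>eventually_elim, simp\<close>)
  have "(norm (tr h u))\<^sup>2 = u \<bullet> tr (- h) (tr h u)" by (simp add: power2_norm_eq_inner inner_tr)
  also have "tr (- h) (tr h u) = u" unfolding tr_tr by (simp add: tr_def)
  finally have "(norm (tr h u))\<^sup>2 = (norm u)\<^sup>2" by (simp add: power2_norm_eq_inner)
  hence "norm (tr h u) = norm u" by (rule power2_eq_imp_eq) auto
  thus "norm (tr h u) \<le> norm u * 1" by simp
qed

lemma mop_const_tr:
  assumes b: "padm (\<lambda>_. b) K" shows "mop (\<lambda>_. b) (tr h u) = tr h (mop (\<lambda>_. b) u)"
  by (rule l2_eqI) (use fn_mop[OF b, of "tr h u"] fn_tr[of h u] fn_tr[of h "mop (\<lambda>_. b) u"] AE_lborel_shift[OF fn_mop[OF b, of u], of h]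
      in \<open>eventually_elim, simp\<close>)

lemma inner_mop:
  assumes b: "padm b K" and c: "padm c K'" and adj: "\<And>x v w. b x v \<bullet> w = v \<bullet> c x w"
  shows "mop b u \<bullet> v = u \<bullet> mop c v"
  using inner_cls[OF L2_padm[OF b L2_fn[of u]] L2_fn[of v]] inner_cls[OF L2_fn[of u] L2_padm[OF c L2_fn[of v]]]
  by (simp add: mop_def adj)

subsection \<open>Smooth functions\<close>

text \<open>The whole sequence of derivatives is the witness, so closure properties can be checked
  term by term.\<close>

definition smooth1 :: "(real \<Rightarrow> real) \<Rightarrow> bool" where
  "smooth1 g \<longleftrightarrow> (\<exists>d::nat \<Rightarrow> real \<Rightarrow> real. d 0 = g \<and> (\<forall>n x. (d n has_real_derivative d (Suc n) x) (at x)))"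

lemma smooth1_deriv:
  assumes "smooth1 g"
  shows "(g has_real_derivative deriv g x) (at x)" "smooth1 (deriv g)"
proof -
  obtain d where d: "d 0 = g" "\<And>n x. (d n has_real_derivative d (Suc n) x) (at x)"
    using assms unfolding smooth1_def by blast
  have e: "deriv g = d 1" using DERIV_imp_deriv[OF d(2)[of 0]] d(1) by auto
  show "(g has_real_derivative deriv g x) (at x)" using d(2)[of 0 x] d(1) e by simp
  show "smooth1 (deriv g)" unfolding smooth1_def e by (rule exI[of _ "\<lambda>n. d (Suc n)"]) (simp add: d)
qed

lemma smooth1_diff: assumes "smooth1 f" "smooth1 g" shows "smooth1 (\<lambda>x. f x - g x)"
proof -
  obtain d where d: "d 0 = f" "\<And>n x. (d n has_real_derivative d (Suc n) x) (at x)"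
    using assms(1) unfolding smooth1_def by blast
  obtain d' where d': "d' 0 = g" "\<And>n x. (d' n has_real_derivative d' (Suc n) x) (at x)"
    using assms(2) unfolding smooth1_def by blast
  show ?thesis unfolding smooth1_def
    by (rule exI[of _ "\<lambda>n x. d n x - d' n x"]) (auto simp: d(1) d'(1) intro!: DERIV_diff d(2) d'(2))
qed

lemma smooth1_scale: assumes "smooth1 f" shows "smooth1 (\<lambda>x. c * f x)"
proof -
  obtain d where d: "d 0 = f" "\<And>n x. (d n has_real_derivative d (Suc n) x) (at x)"
    using assms(1) unfolding smooth1_def by blast
  show ?thesis unfolding smooth1_def
    by (rule exI[of _ "\<lambda>n x. c * d n x"]) (auto simp: d(1) intro!: DERIV_cmult d(2))
qed

lemma smooth1_shift: assumes "smooth1 f" shows "smooth1 (\<lambda>x. f (x + h))"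
proof -
  obtain d where d: "d 0 = f" "\<And>n x. (d n has_real_derivative d (Suc n) x) (at x)"
    using assms(1) unfolding smooth1_def by blast
  show ?thesis unfolding smooth1_def
    by (rule exI[of _ "\<lambda>n x. d n (x + h)"]) (auto simp: d(1) DERIV_shift[symmetric] intro: d(2))
qed

lemma smooth1_primitive:
  assumes "smooth1 g" "\<And>x. (f has_real_derivative g x) (at x)" shows "smooth1 f"
proof -
  obtain d where d: "d 0 = g" "\<And>n x. (d n has_real_derivative d (Suc n) x) (at x)"
    using assms(1) unfolding smooth1_def by blast
  have "((case_nat f d) n has_real_derivative (case_nat f d) (Suc n) x) (at x)" for n x
    by (cases n) (auto simp: d(1) assms(2) d(2))
  thus ?thesis unfolding smooth1_def by (intro exI[of _ "case_nat f d"]) auto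
qed

definition cc :: "(real \<Rightarrow> real) \<Rightarrow> bool" where
  "cc g \<longleftrightarrow> smooth1 g \<and> (\<exists>M. \<forall>x. \<bar>x\<bar> > M \<longrightarrow> g x = 0)"

lemma cc_deriv: assumes "cc g" shows "(g has_real_derivative deriv g x) (at x)" "cc (deriv g)"
proof -
  obtain M where M: "\<And>x. \<bar>x\<bar> > M \<Longrightarrow> g x = 0" using assms by (auto simp: cc_def)
  show "(g has_real_derivative deriv g x) (at x)" using assms smooth1_deriv by (auto simp: cc_def)
  have "deriv g x = 0" if x: "\<bar>x\<bar> > M" for x
  proof -
    have "((\<lambda>x. 0) has_real_derivative 0) (at x)" by simp
    moreover have "open {x. \<bar>x\<bar> > M}" by (intro open_Collect_less continuous_intros)
    ultimately have "(g has_real_derivative 0) (at x)"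
      by (rule has_field_derivative_transform_within_open) (use x M in auto)
    thus ?thesis by (rule DERIV_imp_deriv)
  qed
  thus "cc (deriv g)" using assms smooth1_deriv by (auto simp: cc_def)
qed

lemma cc_continuous: assumes "cc g" shows "continuous_on S g"
  using cc_deriv(1)[OF assms] by (intro DERIV_atLeastAtMost_imp_continuous_on continuous_at_imp_continuous_on ballI DERIV_isCont)

lemma cc_measurable: "cc g \<Longrightarrow> g \<in> borel_measurable borel"
  by (intro borel_measurable_continuous_onI cc_continuous)

lemma cc_shift: "cc g \<Longrightarrow> cc (\<lambda>x. g (x + h))"
proof -
  assume "cc g"
  then obtain M where "smooth1 g" "\<And>x. \<bar>x\<bar> > M \<Longrightarrow> g x = 0" by (auto simp: cc_def)
  thus ?thesis unfolding cc_def by (intro conjI smooth1_shift exI[of _ "M + \<bar>h\<bar>"]) auto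
qed

lemma cc_scale: "cc g \<Longrightarrow> cc (\<lambda>x. c * g x)"
  unfolding cc_def by (auto intro!: smooth1_scale)

lemma cc_diff: "cc f \<Longrightarrow> cc g \<Longrightarrow> cc (\<lambda>x. f x - g x)"
proof -
  assume "cc f" "cc g"
  then obtain M N where "smooth1 f" "\<And>x. \<bar>x\<bar> > M \<Longrightarrow> f x = 0" "smooth1 g" "\<And>x. \<bar>x\<bar> > N \<Longrightarrow> g x = 0"
    by (auto simp: cc_def)
  thus ?thesis unfolding cc_def by (intro conjI smooth1_diff exI[of _ "max M N"]) auto
qed

lemma cc_bounded: assumes "cc g" obtains C where "C > 0" "\<And>x. \<bar>g x\<bar> \<le> C"
proof -
  obtain M where M: "\<And>x. \<bar>x\<bar> > M \<Longrightarrow> g x = 0" using assms by (auto simp: cc_def)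
  have "bounded (g ` {- M..M})" by (intro compact_imp_bounded compact_continuous_image cc_continuous assms) auto
  then obtain C where C: "C > 0" "\<And>x. x \<in> {- M..M} \<Longrightarrow> \<bar>g x\<bar> \<le> C" unfolding bounded_pos by auto
  have "\<bar>g x\<bar> \<le> C" for x using C M[of x] by (cases "\<bar>x\<bar> > M") (auto simp: abs_le_iff not_less)
  thus thesis using that C by blast
qed

text \<open>A single term of the exponential series is a lower bound for
  \<open>exp (c * w)\<close>.\<close>

lemma pow_exp_bound:
  fixes c w :: real assumes "c > 0" "w \<ge> 0"
  shows "w ^ n * exp (- c * w) \<le> fact n / c ^ n"
proof -
  have "(\<Sum>k<Suc n. (c * w) ^ k /\<^sub>R fact k) \<le> exp (c * w)"
    unfolding exp_def by (rule sum_le_suminf[OF summable_exp_generic]) (use assms in auto)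
  moreover have "(c * w) ^ n / fact n \<le> (\<Sum>k<Suc n. (c * w) ^ k /\<^sub>R fact k)"
    using assms by (simp add: sum_nonneg divide_inverse mult.commute)
  ultimately have "(c * w) ^ n / fact n \<le> exp (c * w)" by linarith
  thus ?thesis using assms by (simp add: exp_minus field_simps power_mult_distrib)
qed

text \<open>With w = 1 / ((x - a) (b - x)), the functions of the form polynomial times w^n exp (- c
  w), extended by 0, are closed under differentiation. Smoothness follows without explicit formulas
  for the higher derivatives.\<close>

locale bump_interval =
  fixes a b c :: real
  assumes ab: "a < b" and c: "c > 0"
begin

definition P :: "real poly" where "P = [:- a * b, a + b, -1:]"

lemma poly_P: "poly P x = (x - a) * (b - x)"
  by (simp add: P_def algebra_simps)

definition f :: "real poly \<Rightarrow> nat \<Rightarrow> real \<Rightarrow> real" where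
  "f p n x = (if a < x \<and> x < b then poly p x * (1 / poly P x) ^ n * exp (- c * (1 / poly P x)) else 0)"

text \<open>Since w has derivative - P' w^2 and the factor P w = 1 can be inserted at will, this is
  the numerator of the derivative once the exponent of w is raised by 2.\<close>

definition p' :: "real poly \<Rightarrow> nat \<Rightarrow> real poly" where
  "p' p n = pderiv p * P * P - smult (real n) (p * pderiv P * P) + smult c (p * pderiv P)"

text \<open>The exponential absorbs two more powers of w than are present, and 1 / w is at most (b -
  a) times the distance to either end point. Quadratic vanishing then gives derivative 0
  there.\<close>

lemma f_quadratic:
  obtains C where "\<And>x e. e = a \<or> e = b \<Longrightarrow> \<bar>f p n x\<bar> \<le> C * (x - e)\<^sup>2"
proof -
  have "bounded (poly p ` {a..b})" by (intro compact_imp_bounded compact_continuous_image continuous_intros) auto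
  then obtain Cp where Cp: "Cp > 0" "\<And>x. x \<in> {a..b} \<Longrightarrow> \<bar>poly p x\<bar> \<le> Cp" unfolding bounded_pos by auto
  define K where "K = fact (n + 2) / c ^ (n + 2)"
  have K: "K \<ge> 0" using c by (simp add: K_def)
  have "\<bar>f p n x\<bar> \<le> Cp * K * (b - a)\<^sup>2 * (x - e)\<^sup>2" if e: "e = a \<or> e = b" for x e
  proof (cases "a < x \<and> x < b")
    case True
    define w where "w = 1 / poly P x"
    have Ppos: "poly P x > 0" using True by (simp add: poly_P)
    hence w: "w > 0" by (simp add: w_def)
    have "w ^ n * exp (- c * w) * w\<^sup>2 \<le> K"
      using pow_exp_bound[OF c, of w "n + 2"] w by (simp add: K_def power_add power2_eq_square mult_ac)
    hence "w ^ n * exp (- c * w) \<le> K * (poly P x)\<^sup>2"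
      using Ppos by (simp add: w_def field_simps power_divide)
    also have "(poly P x)\<^sup>2 \<le> ((b - a) * \<bar>x - e\<bar>)\<^sup>2"
    proof (rule power_mono)
      show "poly P x \<le> (b - a) * \<bar>x - e\<bar>"
        using e
      proof
        assume "e = a"
        thus ?thesis using True unfolding poly_P by (subst mult.commute) (intro mult_mono, auto)
      next
        assume "e = b"
        thus ?thesis using True unfolding poly_P by (intro mult_mono) auto
      qed
    qed (use Ppos in simp)
    finally have 1: "w ^ n * exp (- c * w) \<le> K * ((b - a)\<^sup>2 * (x - e)\<^sup>2)"
      using K by (simp add: power_mult_distrib mult_left_mono)
    have "\<bar>f p n x\<bar> = \<bar>poly p x\<bar> * (w ^ n * exp (- c * w))"
      using True w by (simp add: f_def w_def[symmetric] abs_mult)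
    also have "\<dots> \<le> Cp * (K * ((b - a)\<^sup>2 * (x - e)\<^sup>2))"
      using Cp True w by (intro mult_mono[OF _ 1]) auto
    finally show ?thesis by (simp add: mult_ac)
  next
    case False
    thus ?thesis using Cp K by (auto simp: f_def)
  qed
  thus thesis using that by blast
qed

lemma f_deriv: "(f p n has_real_derivative f (p' p n) (n + 2) x) (at x)"
proof -
  consider "a < x \<and> x < b" | "x = a \<or> x = b" | "x < a \<or> b < x" by linarith
  thus ?thesis
  proof cases
    case 1
    hence Ppos: "poly P x > 0" by (simp add: poly_P)
    define w where "w = 1 / poly P x"
    have Pw: "poly P x * w = 1" using Ppos by (simp add: w_def)
    have dw: "((\<lambda>x. 1 / poly P x) has_real_derivative - poly (pderiv P) x * w\<^sup>2) (at x)"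
      using Ppos by (auto intro!: derivative_eq_intros poly_DERIV simp: w_def power2_eq_square field_simps)
    have "((\<lambda>x. poly p x * (1 / poly P x) ^ n * exp (- c * (1 / poly P x))) has_real_derivative
       (poly (pderiv p) x * w ^ n + (real n * ((- poly (pderiv P) x * w\<^sup>2) * w ^ (n - Suc 0))) * poly p x) * exp (- c * w)
        + (exp (- c * w) * (- c * (- poly (pderiv P) x * w\<^sup>2))) * (poly p x * w ^ n)) (at x)"
      unfolding w_def by (intro DERIV_mult poly_DERIV DERIV_fun_exp DERIV_cmult DERIV_power dw[unfolded w_def])
    moreover have "(poly (pderiv p) x * w ^ n + (real n * ((- poly (pderiv P) x * w\<^sup>2) * w ^ (n - Suc 0))) * poly p x) * exp (- c * w)
        + (exp (- c * w) * (- c * (- poly (pderiv P) x * w\<^sup>2))) * (poly p x * w ^ n) = f (p' p n) (n + 2) x"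
    proof -
      have a1: "poly (pderiv p) x * w ^ n = poly (pderiv p) x * (poly P x * w) ^ 2 * w ^ n" by (simp add: Pw)
      have a2: "real n * w ^ (n - 1) * w\<^sup>2 = real n * (poly P x * w) * w ^ n * w"
        by (cases n) (simp_all add: Pw power2_eq_square)
      have "f (p' p n) (n + 2) x = (poly (pderiv p) x * (poly P x * w) ^ 2 * w ^ n
          - poly p x * poly (pderiv P) x * (real n * (poly P x * w) * w ^ n * w) + c * poly p x * poly (pderiv P) x * w\<^sup>2 * w ^ n) * exp (- c * w)"
        using 1 by (simp add: f_def p'_def w_def[symmetric] power_add power2_eq_square algebra_simps)
      also have "\<dots> = (poly (pderiv p) x * w ^ n
          - poly p x * poly (pderiv P) x * (real n * w ^ (n - 1) * w\<^sup>2) + c * poly p x * poly (pderiv P) x * w\<^sup>2 * w ^ n) * exp (- c * w)"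
        unfolding a2 using a1 by simp
      finally show ?thesis by (simp add: algebra_simps)
    qed
    ultimately have "((\<lambda>x. poly p x * (1 / poly P x) ^ n * exp (- c * (1 / poly P x))) has_real_derivative f (p' p n) (n + 2) x) (at x)" by simp
    thus ?thesis
      by (rule has_field_derivative_transform_within_open[where S = "{a<..<b}"]) (use 1 in \<open>auto simp: f_def\<close>)
  next
    case 2
    \<comment> \<open>At an end point the difference quotient is bounded by a multiple of the
      distance, because f vanishes quadratically.\<close>
    obtain C where C: "\<And>y e. e = a \<or> e = b \<Longrightarrow> \<bar>f p n y\<bar> \<le> C * (y - e)\<^sup>2" using f_quadratic by blast
    have "((\<lambda>y. (f p n y - f p n x) / (y - x)) \<longlongrightarrow> 0) (at x)"
    proof (rule Lim_null_comparison)
      have "norm ((f p n y - f p n x) / (y - x)) \<le> C * \<bar>y - x\<bar>" if "y \<noteq> x" for y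
      proof -
        have "f p n x = 0" using 2 by (auto simp: f_def)
        hence "norm ((f p n y - f p n x) / (y - x)) = \<bar>f p n y\<bar> / \<bar>y - x\<bar>" by simp
        also have "\<dots> \<le> C * (y - x)\<^sup>2 / \<bar>y - x\<bar>" by (intro divide_right_mono C 2) simp
        also have "\<dots> = C * \<bar>y - x\<bar>"
        proof -
          have sq: "(y - x)\<^sup>2 = \<bar>y - x\<bar> * \<bar>y - x\<bar>" by (simp add: power2_eq_square)
          have ne: "\<bar>y - x\<bar> \<noteq> 0" using that by simp
          show ?thesis unfolding sq mult.assoc[symmetric] by (rule nonzero_mult_div_cancel_right[OF ne])
        qed
        finally show ?thesis .
      qed
      thus "\<forall>\<^sub>F y in at x. norm ((f p n y - f p n x) / (y - x)) \<le> C * \<bar>y - x\<bar>"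
        by (simp add: eventually_at_filter)
      show "((\<lambda>y. C * \<bar>y - x\<bar>) \<longlongrightarrow> 0) (at x)" by (auto intro!: tendsto_eq_intros)
    qed
    moreover have "f (p' p n) (n + 2) x = 0" using 2 by (auto simp: f_def)
    ultimately show ?thesis by (simp add: has_field_derivative_iff)
  next
    case 3
    have "((\<lambda>x. 0) has_real_derivative f (p' p n) (n + 2) x) (at x)" using 3 by (auto simp: f_def)
    thus ?thesis
      by (rule has_field_derivative_transform_within_open[where S = "{..<a} \<union> {b<..}"]) (use 3 in \<open>auto simp: f_def\<close>)
  qed
qed

lemma smooth1_f: "smooth1 (f p n)"
proof -
  define q where "q = rec_nat (p, n) (\<lambda>_ (p, n). (p' p n, n + 2))"
  have "f (fst (q (Suc k))) (snd (q (Suc k))) = f (p' (fst (q k)) (snd (q k))) (snd (q k) + 2)" for k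
    by (simp add: q_def case_prod_beta')
  hence "(f (fst (q k)) (snd (q k)) has_real_derivative f (fst (q (Suc k))) (snd (q (Suc k))) x) (at x)" for k x
    using f_deriv[of "fst (q k)" "snd (q k)" x] by simp
  thus ?thesis unfolding smooth1_def
    by (intro exI[of _ "\<lambda>k. f (fst (q k)) (snd (q k))"]) (auto simp: q_def)
qed

end

text \<open>The parameter c is kept because the bumps tend to the indicator of the open interval as
  c tends to 0.\<close>

definition bump :: "real \<Rightarrow> real \<Rightarrow> real \<Rightarrow> real \<Rightarrow> real" where
  "bump a b c x = (if a < x \<and> x < b then exp (- c * (1 / ((x - a) * (b - x)))) else 0)"

lemma cc_bump: assumes "c > 0" shows "cc (bump a b c)"
proof (cases "a < b")
  case True
  interpret bump_interval a b c by unfold_locales (use True assms in auto)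
  have "bump a b c = f 1 0" by (auto simp: fun_eq_iff bump_def f_def poly_P)
  hence "smooth1 (bump a b c)" using smooth1_f[of 1 0] by simp
  thus ?thesis unfolding cc_def
    by (auto intro!: exI[of _ "max \<bar>a\<bar> \<bar>b\<bar>"] simp: bump_def)
next
  case False
  hence "bump a b c = (\<lambda>_. 0)" by (auto simp: fun_eq_iff bump_def)
  thus ?thesis unfolding cc_def smooth1_def by (auto intro!: exI[of _ "\<lambda>_ _. 0"])
qed

lemma bump_bounds: "c > 0 \<Longrightarrow> 0 \<le> bump a b c x" "c > 0 \<Longrightarrow> bump a b c x \<le> indicator {a<..<b} x"
  by (auto simp: bump_def indicator_def divide_nonneg_nonneg)

lemma bump_tendsto: "(\<lambda>n. bump a b (1 / real (Suc n)) x) \<longlonglongrightarrow> indicator {a<..<b} x"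
proof (cases "a < x \<and> x < b")
  case True
  have "(\<lambda>n. exp (- (1 / real (Suc n)) * (1 / ((x - a) * (b - x))))) \<longlonglongrightarrow> exp (- 0 * (1 / ((x - a) * (b - x))))"
    by (intro tendsto_intros LIMSEQ_Suc[OF lim_1_over_n])
  thus ?thesis using True by (simp add: bump_def)
next
  case False
  thus ?thesis by (auto simp: bump_def)
qed

text \<open>Test functions approximating the indicator of \<open>[s, t]\<close> with derivatives approximating
  \<open>\<delta>\<^sub>s - \<delta>\<^sub>t\<close> turn a distributional derivative into a classical one.\<close>

lemma cc_step:
  assumes st: "s < t" and \<epsilon>: "\<epsilon> > 0" "\<epsilon> < t - s"
  obtains \<theta> \<beta> where "cc \<theta>" "\<And>x. 0 \<le> \<theta> x" "\<And>x. \<theta> x \<le> 1" "\<And>x. x \<notin> {s..t+\<epsilon>} \<Longrightarrow> \<theta> x = 0"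
    "\<And>x. x \<in> {s+\<epsilon>..t} \<Longrightarrow> \<theta> x = 1"
    "\<And>x. deriv \<theta> x = \<beta> (x - s) - \<beta> (x - t)" "continuous_on UNIV \<beta>" "\<And>x. \<beta> x \<ge> 0" "\<And>x. x \<notin> {0..\<epsilon>} \<Longrightarrow> \<beta> x = 0"
    "integ 0 \<epsilon> \<beta> = 1"
proof -
  define b0 where "b0 = bump 0 \<epsilon> 1"
  have b0: "cc b0" unfolding b0_def by (rule cc_bump) simp
  have b0_pos: "b0 x \<ge> 0" for x unfolding b0_def by (rule bump_bounds) simp
  have b0_out: "x \<notin> {0..\<epsilon>} \<Longrightarrow> b0 x = 0" for x by (auto simp: b0_def bump_def)
  define c0 where "c0 = integral {0..\<epsilon>} b0"
  have "c0 \<ge> 0" unfolding c0_def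
    by (intro Henstock_Kurzweil_Integration.integral_nonneg integrable_continuous_interval cc_continuous b0 b0_pos)
  moreover have "c0 \<noteq> 0"
  proof
    assume "c0 = 0"
    hence "\<forall>x\<in>{0..\<epsilon>}. b0 x = 0" unfolding c0_def using integral_eq_0_iff[OF cc_continuous[OF b0] \<epsilon>(1)] b0_pos by blast
    hence "b0 (\<epsilon> / 2) = 0" using \<epsilon> by simp
    thus False using \<epsilon> by (simp add: b0_def bump_def)
  qed
  ultimately have c0: "c0 > 0" by simp
  define \<beta> where "\<beta> x = (1 / c0) * b0 x" for x
  have \<beta>: "cc \<beta>" unfolding \<beta>_def by (rule cc_scale[OF b0])
  have \<beta>_pos: "\<beta> x \<ge> 0" for x using b0_pos c0 by (simp add: \<beta>_def)
  have \<beta>_out: "x \<notin> {0..\<epsilon>} \<Longrightarrow> \<beta> x = 0" for x using b0_out by (simp add: \<beta>_def)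
  have \<beta>_c: "continuous_on S \<beta>" for S by (rule cc_continuous[OF \<beta>])
  have \<beta>_int: "integ 0 \<epsilon> \<beta> = 1"
    using set_borel_integral_eq_integral(2)[OF continuous_integable[OF \<beta>_c[of "{0..\<epsilon>}"]]] c0
    by (simp add: \<beta>_def[abs_def] c0_def)
  \<comment> \<open>The start -1 lies to the left of the support of \<beta>, which leaves room for a
    two-sided derivative at 0.\<close>
  define J where "J x = integral {-1..x} \<beta>" for x
  have J_int: "\<beta> integrable_on {u..v}" for u v by (intro integrable_continuous_interval \<beta>_c)
  have J0: "J x = 0" if "x \<le> 0" for x
  proof -
    have "J x = integral {-1..x} (\<lambda>_. 0)" unfolding J_def
      by (rule integral_spike[of "{0}"]) (use that \<beta>_out in auto)
    thus ?thesis by simp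
  qed
  have J1: "J x = 1" if "x \<ge> \<epsilon>" for x
  proof -
    have "J x = J 0 + integral {0..x} \<beta>" unfolding J_def
      by (rule Henstock_Kurzweil_Integration.integral_combine[symmetric]) (use that \<epsilon> J_int in auto)
    also have "integral {0..x} \<beta> = integral {0..\<epsilon>} \<beta> + integral {\<epsilon>..x} \<beta>"
      by (rule Henstock_Kurzweil_Integration.integral_combine[symmetric]) (use that \<epsilon> J_int in auto)
    also have "integral {\<epsilon>..x} \<beta> = integral {\<epsilon>..x} (\<lambda>_. 0)"
      by (rule integral_spike[of "{\<epsilon>}"]) (use \<beta>_out in auto)
    finally show ?thesis using J0[of 0] \<beta>_int
        set_borel_integral_eq_integral(2)[OF continuous_integable[OF \<beta>_c[of "{0..\<epsilon>}"]]] by simp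
  qed
  have Jd: "(J has_real_derivative \<beta> x) (at x)" for x
  proof (cases "x > -1")
    case True
    have "((\<lambda>u. integral {-1..u} \<beta>) has_vector_derivative \<beta> x) (at x within {-1..x+1})"
      by (rule integral_has_vector_derivative[OF \<beta>_c]) (use True in auto)
    moreover have "at x within {-1..x+1} = at x" using True by (intro at_within_Icc_at) auto
    ultimately show ?thesis by (simp add: J_def[abs_def] has_real_derivative_iff_has_vector_derivative)
  next
    case False
    have "((\<lambda>_. 0) has_real_derivative \<beta> x) (at x)" using False \<beta>_out[of x] by simp
    thus ?thesis
      by (rule has_field_derivative_transform_within_open[where S = "{..<0}"]) (use False J0 in auto)
  qed
  have Jmono: "mono J"
    by (rule monoI, rule DERIV_nonneg_imp_nondecreasing) (use Jd \<beta>_pos in blast)+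
  have Jb: "0 \<le> J x" "J x \<le> 1" for x
    using monoD[OF Jmono, of "min x 0" x] J0[of "min x 0"] monoD[OF Jmono, of x "max x \<epsilon>"] J1[of "max x \<epsilon>"] by auto
  \<comment> \<open>The first term rises on [s, s + \<epsilon>], and subtracting the second produces
    the descent on [t, t + \<epsilon>].\<close>
  define \<theta> where "\<theta> x = J (x - s) - J (x - t)" for x
  have \<theta>d: "(\<theta> has_real_derivative \<beta> (x - s) - \<beta> (x - t)) (at x)" for x
    unfolding \<theta>_def using DERIV_shift[of J "\<beta> (x - s)" x "- s"] DERIV_shift[of J "\<beta> (x - t)" x "- t"] Jd
    by (intro DERIV_diff) auto
  have s\<beta>: "smooth1 (\<lambda>x. \<beta> (x - u))" for u
    using smooth1_shift[of \<beta> "- u"] \<beta> by (simp add: cc_def)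
  have "smooth1 \<theta>" by (rule smooth1_primitive[OF smooth1_diff[OF s\<beta>[of s] s\<beta>[of t]] \<theta>d])
  moreover have out: "\<theta> x = 0" if "x \<notin> {s..t+\<epsilon>}" for x
    using that J0[of "x - s"] J0[of "x - t"] J1[of "x - s"] J1[of "x - t"] st by (auto simp: \<theta>_def not_le)
  ultimately have "cc \<theta>" unfolding cc_def
    by (intro conjI exI[of _ "\<bar>s\<bar> + \<bar>t\<bar> + \<epsilon>"] allI impI out) (use \<epsilon> in \<open>auto simp: abs_if split: if_splits\<close>)
  moreover have "\<theta> x = 1" if "x \<in> {s+\<epsilon>..t}" for x
    using that J0[of "x - t"] J1[of "x - s"] by (auto simp: \<theta>_def)
  moreover have "0 \<le> \<theta> x" "\<theta> x \<le> 1" for x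
    using monoD[OF Jmono, of "x - t" "x - s"] Jb[of "x - s"] Jb[of "x - t"] st by (auto simp: \<theta>_def)
  moreover have "deriv \<theta> x = \<beta> (x - s) - \<beta> (x - t)" for x by (rule DERIV_imp_deriv[OF \<theta>d])
  ultimately show thesis using that[of \<theta> \<beta>] out \<beta>_c \<beta>_pos \<beta>_out \<beta>_int by blast
qed

subsection \<open>Test functions\<close>

lemma C_k_SucD:
  assumes "C_k (Suc k) f"
  shows "f differentiable (at z)" "C_k k (\<lambda>z. frechet_derivative f (at z) v)"
  using assms unfolding C_k.simps by blast+

lemma C_k_SucI:
  assumes "\<And>z. f differentiable (at z)" "\<And>v. C_k k (\<lambda>z. frechet_derivative f (at z) v)"
  shows "C_k (Suc k) f"
  using assms unfolding C_k.simps by blast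

lemma C_k_add: "C_k k f \<Longrightarrow> C_k k g \<Longrightarrow> C_k k (\<lambda>z. f z + g z)"
proof (induction k arbitrary: f g)
  case 0 thus ?case by (simp add: continuous_on_add)
next
  case (Suc k)
  have d: "f differentiable (at z)" "g differentiable (at z)" for z using Suc.prems C_k_SucD(1) by blast+
  have "frechet_derivative (\<lambda>z. f z + g z) (at z) = (\<lambda>v. frechet_derivative f (at z) v + frechet_derivative g (at z) v)" for z
    by (rule frechet_derivative_at[symmetric]) (intro has_derivative_add frechet_derivative_works[THEN iffD1] d)
  thus ?case using Suc.IH[OF C_k_SucD(2)[OF Suc.prems(1)] C_k_SucD(2)[OF Suc.prems(2)]] d
    by (intro C_k_SucI differentiable_add) auto
qed

lemma C_k_scale: "C_k k f \<Longrightarrow> C_k k (\<lambda>z. c * f z)"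
proof (induction k arbitrary: f)
  case 0 thus ?case by (simp add: continuous_on_mult_left)
next
  case (Suc k)
  have d: "f differentiable (at z)" for z using C_k_SucD(1)[OF Suc.prems] .
  have "((\<lambda>z. c * f z) has_derivative (\<lambda>v. c * frechet_derivative f (at z) v)) (at z)" for z
    by (intro has_derivative_mult_right frechet_derivative_works[THEN iffD1] d)
  hence "frechet_derivative (\<lambda>z. c * f z) (at z) = (\<lambda>v. c * frechet_derivative f (at z) v)" 
    "(\<lambda>z. c * f z) differentiable (at z)" for z
    using frechet_derivative_at differentiableI by metis+
  thus ?case using Suc.IH[OF C_k_SucD(2)[OF Suc.prems]] by (intro C_k_SucI) auto
qed

lemma C_k_0: "C_k k (\<lambda>z. 0)"
proof (induction k)
  case (Suc k)
  show ?case by (rule C_k_SucI) (simp_all add: Suc)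
qed simp

lemma C_k_sum: "finite I \<Longrightarrow> (\<And>i. i \<in> I \<Longrightarrow> C_k k (f i)) \<Longrightarrow> C_k k (\<lambda>z. \<Sum>i\<in>I. f i z)"
  by (induction I rule: finite_induct) (auto intro: C_k_add C_k_0)

text \<open>The derivative is again a combination of such products, each with one factor
  differentiated. This form carries the induction over the order of differentiability.\<close>

lemma has_derivative_tensor:
  fixes L :: "'i \<Rightarrow> 'z::real_normed_vector \<Rightarrow> real"
  assumes "finite I" "\<And>i. bounded_linear (L i)" "\<And>i. smooth1 (h i)"
  shows "((\<lambda>z. \<Prod>i\<in>I. h i (L i z)) has_derivative (\<lambda>v. \<Sum>i\<in>I. L i v * (\<Prod>j\<in>I. (h(i := deriv (h i))) j (L j z)))) (at z)"
proof -
  have 1: "((\<lambda>z. h i (L i z)) has_derivative (\<lambda>v. deriv (h i) (L i z) * L i v)) (at z)" for i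
    using has_derivative_compose[OF bounded_linear.has_derivative[OF assms(2)[of i] has_derivative_ident]
        smooth1_deriv(1)[OF assms(3)[of i], unfolded has_field_derivative_def]] by simp
  have "((\<lambda>z. \<Prod>i\<in>I. h i (L i z)) has_derivative (\<lambda>v. \<Sum>i\<in>I. (deriv (h i) (L i z) * L i v) * (\<Prod>j\<in>I - {i}. h j (L j z)))) (at z)"
    by (rule has_derivative_prod) (rule 1)
  moreover have "(deriv (h i) (L i z) * L i v) * (\<Prod>j\<in>I - {i}. h j (L j z)) = L i v * (\<Prod>j\<in>I. (h(i := deriv (h i))) j (L j z))"
    if "i \<in> I" for i v
  proof -
    have "(\<Prod>j\<in>I. (h(i := deriv (h i))) j (L j z)) = deriv (h i) (L i z) * (\<Prod>j\<in>I - {i}. (h(i := deriv (h i))) j (L j z))"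
      using prod.remove[OF assms(1) that, of "\<lambda>j. (h(i := deriv (h i))) j (L j z)"] by simp
    also have "(\<Prod>j\<in>I - {i}. (h(i := deriv (h i))) j (L j z)) = (\<Prod>j\<in>I - {i}. h j (L j z))"
      by (rule prod.cong) auto
    finally show ?thesis by simp
  qed
  ultimately show ?thesis by (simp cong: sum.cong)
qed

lemma C_k_tensor:
  fixes L :: "'i \<Rightarrow> real \<times> (real^3) \<Rightarrow> real"
  assumes "finite I" "\<And>i. bounded_linear (L i)"
  shows "(\<And>i. smooth1 (h i)) \<Longrightarrow> C_k k (\<lambda>z. \<Prod>i\<in>I. h i (L i z))"
proof (induction k arbitrary: h)
  case 0
  have "continuous_on UNIV (\<lambda>z. h i (L i z))" for i
  proof -
    have "continuous_on UNIV (h i)"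
      using smooth1_deriv(1)[OF 0[of i]] by (intro continuous_at_imp_continuous_on ballI DERIV_isCont)
    thus ?thesis by (rule continuous_on_compose2) (auto intro: bounded_linear.continuous_on[OF assms(2)] continuous_on_id)
  qed
  thus ?case by (simp add: continuous_on_prod)
next
  case (Suc k)
  note d = has_derivative_tensor[of I L h, OF assms Suc.prems]
  have fd: "frechet_derivative (\<lambda>z. \<Prod>i\<in>I. h i (L i z)) (at z) = (\<lambda>v. \<Sum>i\<in>I. L i v * (\<Prod>j\<in>I. (h(i := deriv (h i))) j (L j z)))" for z
    using frechet_derivative_at[OF d] by simp
  have Ck: "C_k k (\<lambda>z. \<Sum>i\<in>I. L i v * (\<Prod>j\<in>I. (h(i := deriv (h i))) j (L j z)))" for v
    by (intro C_k_sum assms(1) C_k_scale Suc.IH) (auto simp: Suc.prems smooth1_deriv)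
  show ?case
  proof (rule C_k_SucI)
    show "(\<lambda>z. \<Prod>i\<in>I. h i (L i z)) differentiable (at z)" for z by (rule differentiableI[OF d])
    show "C_k k (\<lambda>z. frechet_derivative (\<lambda>z. \<Prod>i\<in>I. h i (L i z)) (at z) v)" for v
      unfolding fd by (rule Ck)
  qed
qed

definition ten :: "(3 \<Rightarrow> real \<Rightarrow> real) \<Rightarrow> real^3 \<Rightarrow> real" where
  "ten g x = (\<Prod>j\<in>UNIV. g j (x $ j))"

lemma tensor_test_function:
  assumes \<theta>: "cc \<theta>" and g: "\<And>j. cc (g j)" and sub: "\<And>t. \<theta> t \<noteq> 0 \<Longrightarrow> t \<in> S" "closed S" "S \<times> UNIV \<subseteq> \<Omega>"
  shows "(\<lambda>z. \<theta> (fst z) * ten g (snd z)) \<in> test_functions \<Omega>"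
    and "frechet_derivative (\<lambda>z. \<theta> (fst z) * ten g (snd z)) (at z) (1, 0) = deriv \<theta> (fst z) * ten g (snd z)"
    and "frechet_derivative (\<lambda>z. \<theta> (fst z) * ten g (snd z)) (at z) (0, axis j 1) =
           \<theta> (fst z) * ten (g(j := deriv (g j))) (snd z)"
proof -
  \<comment> \<open>The index \<open>None\<close> is time and \<open>Some j\<close> is the space
    coordinate j, so a tensor product in space-time is a single product over
    \<open>3 option\<close>.\<close>
  define L where "L i z = (case i of None \<Rightarrow> fst z | Some j \<Rightarrow> snd z $ j)" for i :: "3 option" and z :: "real \<times> (real^3)"
  define h where "h i = (case i of None \<Rightarrow> \<theta> | Some j \<Rightarrow> g j)" for i :: "3 option"
  have L: "bounded_linear (L i)" for i
    unfolding L_def by (cases i) (auto intro: bounded_linear_fst bounded_linear_compose[OF bounded_linear_vec_nth bounded_linear_snd])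
  have h: "smooth1 (h i)" for i unfolding h_def using \<theta> g by (cases i) (auto simp: cc_def)
  have eq: "(\<Prod>i\<in>UNIV. h' i (L i z)) = h' None (fst z) * ten (\<lambda>j. h' (Some j)) (snd z)" for h' z
    unfolding UNIV_option_conv ten_def by (subst prod.insert) (auto simp: prod.reindex L_def)
  have f: "(\<lambda>z. \<theta> (fst z) * ten g (snd z)) = (\<lambda>z. \<Prod>i\<in>UNIV. h i (L i z))"
    unfolding eq by (simp add: h_def)
  have Ck: "C_k k (\<lambda>z. \<theta> (fst z) * ten g (snd z))" for k
    unfolding f by (rule C_k_tensor[OF _ L h]) simp
  obtain M where M: "\<And>x. \<bar>x\<bar> > M \<Longrightarrow> \<theta> x = 0" using \<theta> by (auto simp: cc_def)
  have "\<exists>N. \<forall>j x. \<bar>x\<bar> > N j \<longrightarrow> g j x = 0" using g unfolding cc_def by metis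
  then obtain N where N: "\<And>j x. \<bar>x\<bar> > N j \<Longrightarrow> g j x = 0" by blast
  have supp: "{z. \<theta> (fst z) * ten g (snd z) \<noteq> 0} \<subseteq> {- M..M} \<times> cbox (\<chi> j. - N j) (\<chi> j. N j)"
  proof
    fix z assume "z \<in> {z. \<theta> (fst z) * ten g (snd z) \<noteq> 0}"
    hence "\<theta> (fst z) \<noteq> 0" "\<And>j. g j (snd z $ j) \<noteq> 0" by (auto simp: ten_def)
    hence "\<bar>fst z\<bar> \<le> M" "\<And>j. \<bar>snd z $ j\<bar> \<le> N j" using M N by (metis not_le)+
    thus "z \<in> {- M..M} \<times> cbox (\<chi> j. - N j) (\<chi> j. N j)"
      by (cases z) (auto simp: mem_box_cart abs_le_iff, metis minus_le_iff)
  qed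
  have cl: "closure {z. \<theta> (fst z) * ten g (snd z) \<noteq> 0} \<subseteq> {- M..M} \<times> cbox (\<chi> j. - N j) (\<chi> j. N j)"
    by (rule closure_minimal[OF supp]) (intro closed_Times closed_cbox closed_atLeastAtMost)
  have "compact (closure {z. \<theta> (fst z) * ten g (snd z) \<noteq> 0})"
    by (rule compact_Int_closed[OF _ closed_closure, of "{- M..M} \<times> cbox (\<chi> j. - N j) (\<chi> j. N j)", THEN back_subst[of compact]])
       (use cl in \<open>auto intro!: compact_Times\<close>)
  moreover have "closure {z. \<theta> (fst z) * ten g (snd z) \<noteq> 0} \<subseteq> S \<times> UNIV"
    by (rule closure_minimal) (use sub in \<open>auto intro: closed_Times\<close>)
  ultimately show "(\<lambda>z. \<theta> (fst z) * ten g (snd z)) \<in> test_functions \<Omega>"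
    unfolding test_functions_def using Ck sub(3) by blast
  have fd: "frechet_derivative (\<lambda>z. \<theta> (fst z) * ten g (snd z)) (at z) v =
      (\<Sum>i\<in>UNIV. L i v * (\<Prod>j\<in>UNIV. (h(i := deriv (h i))) j (L j z)))" for v
    unfolding f by (rule fun_cong[OF frechet_derivative_at[OF has_derivative_tensor[OF finite L h], symmetric]])
  have sp: "(\<Sum>i\<in>UNIV. F i) = F None + (\<Sum>j\<in>UNIV. F (Some j))" for F :: "3 option \<Rightarrow> real"
    unfolding UNIV_option_conv by (subst sum.insert) (auto simp: sum.reindex)
  show "frechet_derivative (\<lambda>z. \<theta> (fst z) * ten g (snd z)) (at z) (1, 0) = deriv \<theta> (fst z) * ten g (snd z)"
    unfolding fd sp eq by (simp add: L_def h_def)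
  have "(\<Sum>k\<in>UNIV. L (Some k) (0, axis j 1) * F k) = F j" for F :: "3 \<Rightarrow> real"
  proof -
    have "(\<Sum>k\<in>UNIV. L (Some k) (0, axis j 1) * F k) = (\<Sum>k\<in>UNIV. if k = j then F k else 0)"
      by (rule sum.cong) (auto simp: L_def axis_def)
    thus ?thesis by simp
  qed
  moreover have "(\<lambda>k. (h(Some j := deriv (h (Some j)))) (Some k)) = g(j := deriv (g j))"
    by (auto simp: h_def fun_eq_iff)
  ultimately show "frechet_derivative (\<lambda>z. \<theta> (fst z) * ten g (snd z)) (at z) (0, axis j 1) =
           \<theta> (fst z) * ten (g(j := deriv (g j))) (snd z)"
    unfolding fd sp eq by (simp add: L_def h_def)
qed

lemma test_function_props:
  assumes \<phi>: "\<phi> \<in> test_functions \<Omega>"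
  shows "continuous_on UNIV \<phi>" and "(\<phi> has_derivative frechet_derivative \<phi> (at z)) (at z)"
    and "(\<lambda>z. frechet_derivative \<phi> (at z) v) \<in> test_functions \<Omega>"
    and "\<exists>R. \<forall>z. norm z > R \<longrightarrow> \<phi> z = 0" and "\<phi> z \<noteq> 0 \<Longrightarrow> z \<in> \<Omega>"
proof -
  have Ck: "C_k k \<phi>" for k using \<phi> by (simp add: test_functions_def)
  show "continuous_on UNIV \<phi>" using Ck[of 0] by simp
  have d: "\<phi> differentiable (at z)" for z using C_k_SucD(1)[OF Ck[of "Suc 0"]] .
  show "(\<phi> has_derivative frechet_derivative \<phi> (at z)) (at z)" using d frechet_derivative_works by blast
  have "bounded {z. \<phi> z \<noteq> 0}"
    using \<phi> closure_subset by (auto simp: test_functions_def intro: bounded_subset dest: compact_imp_bounded)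
  then obtain R where "\<And>z. \<phi> z \<noteq> 0 \<Longrightarrow> norm z \<le> R" unfolding bounded_iff by auto
  thus "\<exists>R. \<forall>z. norm z > R \<longrightarrow> \<phi> z = 0" by (metis not_le)
  show "\<phi> z \<noteq> 0 \<Longrightarrow> z \<in> \<Omega>" 
    using \<phi> closure_subset[of "{z. \<phi> z \<noteq> 0}"] unfolding test_functions_def by blast
  \<comment> \<open>Off the closed support \<phi> is locally 0, and so is its derivative.\<close>
  have sub: "{z. frechet_derivative \<phi> (at z) v \<noteq> 0} \<subseteq> closure {z. \<phi> z \<noteq> 0}"
  proof clarify
    fix z assume nz: "frechet_derivative \<phi> (at z) v \<noteq> 0"
    show "z \<in> closure {z. \<phi> z \<noteq> 0}"
    proof (rule ccontr)
      assume z: "z \<notin> closure {z. \<phi> z \<noteq> 0}"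
      have "((\<lambda>z. 0) has_derivative (\<lambda>v. 0)) (at z)" by simp
      hence "(\<phi> has_derivative (\<lambda>v. 0)) (at z)"
        by (rule has_derivative_transform_within_open[of _ _ _ _ "- closure {z. \<phi> z \<noteq> 0}"])
           (use z closure_subset[of "{z. \<phi> z \<noteq> 0}"] in \<open>auto simp del: closure_subset\<close>)
      hence "frechet_derivative \<phi> (at z) = (\<lambda>v. 0)" by (rule frechet_derivative_at[symmetric])
      thus False using nz by simp
    qed
  qed
  hence cl: "closure {z. frechet_derivative \<phi> (at z) v \<noteq> 0} \<subseteq> closure {z. \<phi> z \<noteq> 0}"
    by (rule closure_minimal) simp
  have "compact (closure {z. \<phi> z \<noteq> 0} \<inter> closure {z. frechet_derivative \<phi> (at z) v \<noteq> 0})"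
    using \<phi> by (intro compact_Int_closed) (auto simp: test_functions_def)
  moreover have "closure {z. \<phi> z \<noteq> 0} \<inter> closure {z. frechet_derivative \<phi> (at z) v \<noteq> 0} = closure {z. frechet_derivative \<phi> (at z) v \<noteq> 0}"
    using cl by blast
  moreover have "C_k k (\<lambda>z. frechet_derivative \<phi> (at z) v)" for k by (rule C_k_SucD(2)[OF Ck])
  ultimately show "(\<lambda>z. frechet_derivative \<phi> (at z) v) \<in> test_functions \<Omega>"
    using \<phi> cl unfolding test_functions_def by auto
qed

subsection \<open>Central differences of test functions\<close>

lemma continuous_compact_support_bounded:
  fixes f :: "'a::euclidean_space \<Rightarrow> real"
  assumes c: "continuous_on UNIV f" and z: "\<And>x. norm x > R \<Longrightarrow> f x = 0"
  shows "\<exists>C>0. \<forall>x. \<bar>f x\<bar> \<le> C"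
proof -
  have "bounded (f ` cball 0 R)"
    by (intro compact_imp_bounded compact_continuous_image continuous_on_subset[OF c]) auto
  then obtain C where C: "C > 0" "\<And>x. x \<in> cball 0 R \<Longrightarrow> \<bar>f x\<bar> \<le> C" unfolding bounded_pos by auto
  have "\<bar>f x\<bar> \<le> C" for x using C z[of x] by (cases "norm x > R") auto
  thus ?thesis using C by blast
qed

lemma integrable_indicator_cball: "integrable lborel (\<lambda>x::'a::euclidean_space. indicator (cball 0 R) x * (C::real))"
  by (intro integrable_mult_left integrable_real_indicator)
     (auto simp: emeasure_bounded_finite[OF bounded_cball, unfolded infinity_ennreal_def])

lemma L2_compact_support:
  assumes c: "continuous_on UNIV f" and z: "\<And>x. norm x > R \<Longrightarrow> f x = 0"
  shows "L2 (\<lambda>x. f x *\<^sub>R e)"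
proof -
  obtain C where C: "C > 0" "\<And>x. \<bar>f x\<bar> \<le> C" using continuous_compact_support_bounded[OF c z] by blast
  show ?thesis
  proof (rule L2_bound[OF _ integrable_indicator_cball[of R "(C * norm e)\<^sup>2"]])
    have [measurable]: "f \<in> borel_measurable borel" by (rule borel_measurable_continuous_onI[OF c])
    show "(\<lambda>x. f x *\<^sub>R e) \<in> borel_measurable borel" by measurable
    have "(norm (f x *\<^sub>R e))\<^sup>2 \<le> indicator (cball 0 R) x * (C * norm e)\<^sup>2" for x
    proof (cases "norm x > R")
      case False
      have "(norm (f x *\<^sub>R e))\<^sup>2 \<le> (C * norm e)\<^sup>2" unfolding norm_scaleR real_norm_def
        using C by (intro power_mono mult_right_mono) auto
      thus ?thesis using False by simp
    qed (simp add: z)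
    thus "AE x in lborel. (norm (f x *\<^sub>R e))\<^sup>2 \<le> indicator (cball 0 R) x * (C * norm e)\<^sup>2" by simp
  qed
qed

text \<open>The adjoint of a translation is the opposite translation, which makes the central
  quotient exactly skew.\<close>

definition cdiff :: "nat \<Rightarrow> 3 \<Rightarrow> 'v::euclidean_space l2 \<Rightarrow> 'v l2" where
  "cdiff n j u = (real (Suc n) / 2) *\<^sub>R (tr ((1 / real (Suc n)) *\<^sub>R axis j 1) u - tr (- ((1 / real (Suc n)) *\<^sub>R axis j 1)) u)"

lemma cdiff_cls:
  assumes f: "L2 f"
  shows "cdiff n j (cls f) = cls (\<lambda>x. (real (Suc n) / 2) *\<^sub>R
     (f (x + (1 / real (Suc n)) *\<^sub>R axis j 1) - f (x - (1 / real (Suc n)) *\<^sub>R axis j 1)))"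
  using L2_shift[OF f, of "(1 / real (Suc n)) *\<^sub>R axis j 1"] L2_shift[OF f, of "- ((1 / real (Suc n)) *\<^sub>R axis j 1)"]
  unfolding cdiff_def tr_cls[OF f] by (subst cls_scaleR, simp add: L2_diff, subst cls_diff, simp_all)

lemma bounded_linear_cdiff: "bounded_linear (cdiff n j)"
  unfolding cdiff_def
  by (intro bounded_linear_const_scaleR bounded_linear_sub bounded_linear_tr)

text \<open>The mean value theorem bounds the quotients by the supremum of f', and step widths of at
  most 1 enlarge the support by at most 1, so dominated convergence applies.\<close>

lemma cdiff_tendsto:
  assumes c: "continuous_on UNIV f" "continuous_on UNIV f'" and z: "\<And>x. norm x > R \<Longrightarrow> f x = 0" "\<And>x. norm x > R \<Longrightarrow> f' x = 0"
    and d: "\<And>x. ((\<lambda>s. f (x + s *\<^sub>R axis j 1)) has_real_derivative f' x) (at 0)"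
  shows "(\<lambda>n. cdiff n j (cls (\<lambda>x. f x *\<^sub>R e))) \<longlonglongrightarrow> cls (\<lambda>x. f' x *\<^sub>R (e :: 'v::euclidean_space))"
proof -
  define \<epsilon> where "\<epsilon> n = 1 / real (Suc n)" for n
  have \<epsilon>: "0 < \<epsilon> n" "\<epsilon> n \<le> 1" for n by (auto simp: \<epsilon>_def)
  define v :: "real^3" where "v = axis j 1"
  have nv: "norm v = 1" by (simp add: v_def)
  define q where "q n x = (f (x + \<epsilon> n *\<^sub>R v) - f (x - \<epsilon> n *\<^sub>R v)) / (2 * \<epsilon> n)" for n x
  have line: "((\<lambda>s. f (x + s *\<^sub>R v)) has_real_derivative f' (x + t *\<^sub>R v)) (at t)" for x t
    using d[of "x + t *\<^sub>R v"] DERIV_shift[of "\<lambda>s. f (x + s *\<^sub>R v)" "f' (x + t *\<^sub>R v)" 0 t]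
    by (simp add: v_def algebra_simps)
  obtain C where C: "C > 0" "\<And>x. \<bar>f' x\<bar> \<le> C" using continuous_compact_support_bounded[OF c(2) z(2)] by blast
  have q_bd: "\<bar>q n x\<bar> \<le> C" for n x
  proof -
    have "\<exists>\<xi>. - \<epsilon> n < \<xi> \<and> \<xi> < \<epsilon> n \<and> f (x + \<epsilon> n *\<^sub>R v) - f (x + (- \<epsilon> n) *\<^sub>R v) = (\<epsilon> n - - \<epsilon> n) * f' (x + \<xi> *\<^sub>R v)"
      by (rule MVT2) (use \<epsilon>[of n] line in auto)
    then obtain \<xi> where "f (x + \<epsilon> n *\<^sub>R v) - f (x - \<epsilon> n *\<^sub>R v) = (2 * \<epsilon> n) * f' (x + \<xi> *\<^sub>R v)" by auto
    hence "q n x = f' (x + \<xi> *\<^sub>R v)" using \<epsilon>(1)[of n] by (simp add: q_def)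
    thus ?thesis using C by simp
  qed
  have q_out: "q n x = 0" if "norm x > R + 1" for n x
  proof -
    have ne: "norm (\<epsilon> n *\<^sub>R v) \<le> 1" using \<epsilon>[of n] nv by simp
    have "norm x \<le> norm (x + \<epsilon> n *\<^sub>R v) + norm (\<epsilon> n *\<^sub>R v)" "norm x \<le> norm (x - \<epsilon> n *\<^sub>R v) + norm (\<epsilon> n *\<^sub>R v)"
      using norm_triangle_ineq4[of "x + \<epsilon> n *\<^sub>R v" "\<epsilon> n *\<^sub>R v"] norm_triangle_ineq[of "x - \<epsilon> n *\<^sub>R v" "\<epsilon> n *\<^sub>R v"] by simp_all
    hence "norm (x + \<epsilon> n *\<^sub>R v) > R" "norm (x - \<epsilon> n *\<^sub>R v) > R" using ne that by linarith+
    thus ?thesis by (simp add: q_def z)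
  qed
  have q_lim: "(\<lambda>n. q n x) \<longlonglongrightarrow> f' x" for x
  proof -
    have d0: "((\<lambda>s. (f (x + s *\<^sub>R v) - f x) / s) \<longlongrightarrow> f' x) (at 0)"
      using d[of x] by (simp add: has_field_derivative_iff v_def)
    have "filterlim \<epsilon> (at 0) sequentially" "filterlim (\<lambda>n. - \<epsilon> n) (at 0) sequentially"
      unfolding filterlim_at using \<epsilon>(1) LIMSEQ_Suc[OF lim_1_over_n[where ?'a = real]] tendsto_minus[OF LIMSEQ_Suc[OF lim_1_over_n[where ?'a = real]]]
      by (auto simp: \<epsilon>_def[abs_def] less_imp_neq)
    from filterlim_compose[OF d0 this(1)] filterlim_compose[OF d0 this(2)]
    have "(\<lambda>n. ((f (x + \<epsilon> n *\<^sub>R v) - f x) / \<epsilon> n + (f (x + (- \<epsilon> n) *\<^sub>R v) - f x) / (- \<epsilon> n)) / 2) \<longlonglongrightarrow> (f' x + f' x) / 2"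
      by (intro tendsto_intros) auto
    moreover have "((f (x + \<epsilon> n *\<^sub>R v) - f x) / \<epsilon> n + (f (x + (- \<epsilon> n) *\<^sub>R v) - f x) / (- \<epsilon> n)) / 2 = q n x" for n
      using \<epsilon>(1)[of n] by (simp add: q_def field_simps)
    ultimately show ?thesis by simp
  qed
  have fm: "f \<in> borel_measurable borel" "f' \<in> borel_measurable borel" by (intro borel_measurable_continuous_onI c)+
  have qc: "continuous_on UNIV (q n)" for n
  proof -
    have "continuous_on UNIV (\<lambda>x. f (x + \<epsilon> n *\<^sub>R v))" "continuous_on UNIV (\<lambda>x. f (x - \<epsilon> n *\<^sub>R v))"
      by (intro continuous_on_compose2[OF c(1)] continuous_intros; simp)+
    thus ?thesis unfolding q_def[abs_def] using \<epsilon>(1)[of n] by (intro continuous_intros) auto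
  qed
  have "(\<lambda>n. cls (\<lambda>x. q n x *\<^sub>R e)) \<longlonglongrightarrow> cls (\<lambda>x. f' x *\<^sub>R e)"
  proof (rule L2_tendsto(2)[OF L2_compact_support[OF qc q_out] _ integrable_indicator_cball[of "R + 1" "(C * norm e)\<^sup>2"]])
    show "(\<lambda>x. f' x *\<^sub>R e) \<in> borel_measurable borel" using fm by measurable
    show "AE x in lborel. (\<lambda>n. q n x *\<^sub>R e) \<longlonglongrightarrow> f' x *\<^sub>R e"
      by (intro AE_I2 tendsto_scaleR q_lim tendsto_const)
    have "(norm (q n x *\<^sub>R e))\<^sup>2 \<le> indicator (cball 0 (R + 1)) x * (C * norm e)\<^sup>2" for n x
    proof (cases "norm x > R + 1")
      case False
      have "(norm (q n x *\<^sub>R e))\<^sup>2 \<le> (C * norm e)\<^sup>2" unfolding norm_scaleR real_norm_def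
        using q_bd by (intro power_mono mult_right_mono) auto
      thus ?thesis using False by simp
    qed (simp add: q_out)
    thus "AE x in lborel. (norm (q n x *\<^sub>R e))\<^sup>2 \<le> indicator (cball 0 (R + 1)) x * (C * norm e)\<^sup>2" for n by simp
  qed
  moreover have "cdiff n j (cls (\<lambda>x. f x *\<^sub>R e)) = cls (\<lambda>x. q n x *\<^sub>R e)" for n
  proof -
    have "cdiff n j (cls (\<lambda>x. f x *\<^sub>R e)) = cls (\<lambda>x. (real (Suc n) / 2) *\<^sub>R
       (f (x + (1 / real (Suc n)) *\<^sub>R axis j 1) *\<^sub>R e - f (x - (1 / real (Suc n)) *\<^sub>R axis j 1) *\<^sub>R e))"
      by (rule cdiff_cls[OF L2_compact_support[OF c(1) z(1)]])
    also have "\<dots> = cls (\<lambda>x. q n x *\<^sub>R e)"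
    proof (rule arg_cong[of _ _ cls], rule ext)
      fix x
      have "q n x = real (Suc n) / 2 * (f (x + (1 / real (Suc n)) *\<^sub>R axis j 1) - f (x - (1 / real (Suc n)) *\<^sub>R axis j 1))"
        by (simp add: q_def \<epsilon>_def v_def)
      thus "(real (Suc n) / 2) *\<^sub>R (f (x + (1 / real (Suc n)) *\<^sub>R axis j 1) *\<^sub>R e - f (x - (1 / real (Suc n)) *\<^sub>R axis j 1) *\<^sub>R e)
          = q n x *\<^sub>R e" by (simp only: scaleR_diff_left[symmetric] scaleR_scaleR)
    qed
    finally show ?thesis .
  qed
  ultimately show ?thesis by simp
qed

subsection \<open>Products of one-variable test functions\<close>

lemma ten_split: "ten g x = g j (x $ j) * (\<Prod>i\<in>UNIV - {j}. g i (x $ i))"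
  unfolding ten_def by (rule prod.remove) auto

lemma ten_upd: "ten (g(j := h)) x = h (x $ j) * (\<Prod>i\<in>UNIV - {j}. g i (x $ i))"
proof -
  have "(\<Prod>i\<in>UNIV - {j}. (g(j := h)) i (x $ i)) = (\<Prod>i\<in>UNIV - {j}. g i (x $ i))" by (rule prod.cong) auto
  thus ?thesis by (simp add: ten_split[of "g(j := h)" x j])
qed

lemma ten_shift: "ten g (x + s *\<^sub>R axis j 1) = ten (g(j := \<lambda>t. g j (t + s))) x"
proof -
  have "(\<Prod>i\<in>UNIV - {j}. g i ((x + s *\<^sub>R axis j 1) $ i)) = (\<Prod>i\<in>UNIV - {j}. g i (x $ i))"
    by (rule prod.cong) (auto simp: axis_def)
  thus ?thesis unfolding ten_upd ten_split[of g _ j] by (simp add: axis_def)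
qed

lemma ten_continuous: "(\<forall>j. cc (g j)) \<Longrightarrow> continuous_on UNIV (ten g)"
  unfolding ten_def[abs_def]
  by (intro continuous_on_prod continuous_on_compose2[OF cc_continuous[of _ UNIV] continuous_on_component[OF continuous_on_id]])
     auto

lemma ten_support: assumes "\<forall>j. cc (g j)" shows "\<exists>R. \<forall>x. norm x > R \<longrightarrow> ten g x = 0"
proof -
  have "\<exists>N. \<forall>j x. \<bar>x\<bar> > N j \<longrightarrow> g j x = 0" using assms unfolding cc_def by metis
  then obtain N where N: "\<And>j x. \<bar>x\<bar> > N j \<Longrightarrow> g j x = 0" by blast
  have "ten g x = 0" if "norm x > (\<Sum>j\<in>UNIV. N j)" for x
  proof -
    have "norm x \<le> (\<Sum>j\<in>UNIV. \<bar>x $ j\<bar>)" by (rule norm_le_l1_cart)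
    hence "(\<Sum>j\<in>UNIV. N j) < (\<Sum>j\<in>UNIV. \<bar>x $ j\<bar>)" using that by linarith
    then obtain j where "\<bar>x $ j\<bar> > N j" by (meson not_le sum_mono)
    thus ?thesis using N ten_split[of g x j] by simp
  qed
  thus ?thesis by blast
qed

lemma L2_ten: assumes "\<forall>j. cc (g j)" shows "L2 (\<lambda>x. ten g x *\<^sub>R e)"
proof -
  obtain R where "\<And>x. norm x > R \<Longrightarrow> ten g x = 0" using ten_support[OF assms] by blast
  thus ?thesis by (rule L2_compact_support[OF ten_continuous[OF assms]])
qed

lemma ten_has_derivative:
  assumes "\<forall>j. cc (g j)"
  shows "((\<lambda>s. ten g (x + s *\<^sub>R axis j 1)) has_real_derivative ten (g(j := deriv (g j))) x) (at 0)"
proof -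
  have "((\<lambda>s. g j (x $ j + s)) has_real_derivative deriv (g j) (x $ j)) (at 0)"
    using cc_deriv(1)[OF spec[OF assms, of j], of "x $ j"] DERIV_shift[of "g j" "deriv (g j) (x $ j)" 0 "x $ j"] by (simp add: add.commute)
  from DERIV_cmult_right[OF this] show ?thesis unfolding ten_shift ten_upd .
qed

lemma cdiff_ten:
  assumes g: "\<forall>j. cc (g j)"
  shows "(\<lambda>n. cdiff n j (cls (\<lambda>x. ten g x *\<^sub>R e))) \<longlonglongrightarrow> cls (\<lambda>x. ten (g(j := deriv (g j))) x *\<^sub>R e)"
proof -
  have g': "\<forall>i. cc ((g(j := deriv (g j))) i)" using g cc_deriv(2) by simp
  obtain R where R: "\<And>x. norm x > R \<Longrightarrow> ten g x = 0" using ten_support[OF g] by blast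
  obtain R' where R': "\<And>x. norm x > R' \<Longrightarrow> ten (g(j := deriv (g j))) x = 0" using ten_support[OF g'] by blast
  show ?thesis
    by (rule cdiff_tendsto[where R = "max R R'", OF ten_continuous[OF g] ten_continuous[OF g'] _ _ ten_has_derivative[OF g]])
       (auto intro: R R')
qed

definition tens :: "'v::euclidean_space l2 set" where
  "tens = {cls (\<lambda>x. ten g x *\<^sub>R e) | g e. \<forall>j. cc (g j)}"

lemma cdiff_tens: assumes "u \<in> tens" shows "cdiff n j u \<in> tens"
proof -
  obtain g e where u: "u = cls (\<lambda>x. ten g x *\<^sub>R e)" and g: "\<forall>j. cc (g j)" using assms by (auto simp: tens_def)
  define h where "h t = (real (Suc n) / 2) * (g j (t + 1 / real (Suc n)) - g j (t + - (1 / real (Suc n))))" for t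
  have h: "cc h" unfolding h_def by (intro cc_scale cc_diff cc_shift spec[OF g])
  have "cdiff n j u = cls (\<lambda>x. ten (g(j := h)) x *\<^sub>R e)"
    unfolding u cdiff_cls[OF L2_ten[OF g]]
  proof (rule arg_cong[of _ _ cls], rule ext)
    fix x :: "real^3"
    have "x - (1 / real (Suc n)) *\<^sub>R axis j 1 = x + (- (1 / real (Suc n))) *\<^sub>R axis j 1" by simp
    thus "(real (Suc n) / 2) *\<^sub>R (ten g (x + (1 / real (Suc n)) *\<^sub>R axis j 1) *\<^sub>R e - ten g (x - (1 / real (Suc n)) *\<^sub>R axis j 1) *\<^sub>R e)
        = ten (g(j := h)) x *\<^sub>R e"
      by (simp only: ten_shift ten_upd h_def scaleR_diff_left[symmetric] scaleR_scaleR left_diff_distrib[symmetric] mult.assoc)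
  qed
  thus ?thesis unfolding tens_def using g h by (auto intro!: exI[of _ "g(j := h)"])
qed

lemma span_linear_image:
  assumes "linear f" "\<And>x. x \<in> S \<Longrightarrow> f x \<in> span S" "x \<in> span S"
  shows "f x \<in> span S"
  using assms(3)
proof (induction rule: span_induct_alt)
  case base thus ?case using linear_0[OF assms(1)] span_zero by simp
next
  case (step c x y)
  thus ?case using assms(2) by (simp add: linear_add[OF assms(1)] linear_scale[OF assms(1)] span_add span_scale)
qed

text \<open>Products of bumps with parameter tending to 0 stay below the indicator of a box and
  converge to it.\<close>

lemma closure_span_tens: "closure (span tens) = (UNIV :: 'v::euclidean_space l2 set)"
proof (rule closed_subspace_UNIV[OF subspace_closure[OF subspace_span] closed_closure])
  fix a b :: "real^3" and e :: 'v assume "e \<in> Basis"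
  define g where "g n = (\<lambda>j. bump (a $ j) (b $ j) (1 / real (Suc n)))" for n :: nat
  have g: "\<forall>j. cc (g n j)" for n unfolding g_def by (intro allI cc_bump) simp
  have ind: "(\<Prod>j\<in>UNIV. indicator {a $ j<..<b $ j} (x $ j)) = (indicator (box a b) x :: real)" for x
    by (auto simp: indicator_def mem_box_cart prod_zero_iff)
  have mem: "cls (\<lambda>x. ten (g n) x *\<^sub>R e) \<in> closure (span tens)" for n
    by (intro subsetD[OF closure_subset] span_base) (auto simp: tens_def intro!: exI[of _ "g n"] g)
  have "(\<lambda>n. cls (\<lambda>x. ten (g n) x *\<^sub>R e)) \<longlonglongrightarrow> cls (\<lambda>x. indicator (box a b) x *\<^sub>R e)"
  proof (rule L2_tendsto(2)[OF L2_ten[OF g] _ L2_integrable[OF L2_box[of a b e]]])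
    show "(\<lambda>x. indicator (box a b) x *\<^sub>R e) \<in> borel_measurable borel" by (rule L2_measurable[OF L2_box])
    show "AE x in lborel. (\<lambda>n. ten (g n) x *\<^sub>R e) \<longlonglongrightarrow> indicator (box a b) x *\<^sub>R e"
    proof (rule AE_I2)
      fix x
      have "(\<lambda>n. ten (g n) x) \<longlonglongrightarrow> (\<Prod>j\<in>UNIV. indicator {a $ j<..<b $ j} (x $ j))"
        unfolding ten_def g_def by (intro tendsto_prod bump_tendsto)
      thus "(\<lambda>n. ten (g n) x *\<^sub>R e) \<longlonglongrightarrow> indicator (box a b) x *\<^sub>R e"
        unfolding ind by (intro tendsto_scaleR tendsto_const)
    qed
    have "0 \<le> ten (g n) x \<and> ten (g n) x \<le> indicator (box a b) x" for n x
      unfolding ind[symmetric] ten_def g_def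
      by (intro conjI prod_nonneg prod_mono ballI bump_bounds) auto
    hence "(norm (ten (g n) x *\<^sub>R e))\<^sup>2 \<le> (norm (indicator (box a b) x *\<^sub>R e))\<^sup>2" for n x
      unfolding norm_scaleR by (intro power_mono mult_right_mono) auto
    thus "AE x in lborel. (norm (ten (g n) x *\<^sub>R e))\<^sup>2 \<le> (norm (indicator (box a b) x *\<^sub>R e))\<^sup>2" for n by simp
  qed
  thus "cls (\<lambda>x. indicator (box a b) x *\<^sub>R e) \<in> closure (span tens)"
    using closed_sequentially[OF closed_closure, of "\<lambda>n. cls (\<lambda>x. ten (g n) x *\<^sub>R e)"] mem by blast
qed

lemma padm_const: assumes "linear b" shows "\<exists>K. padm (\<lambda>_. b) K"
proof -
  obtain K where K: "\<And>v. norm (b v) \<le> K * norm v" using linear_bounded[OF assms] by blast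
  have "b \<in> borel_measurable borel"
    by (intro borel_measurable_continuous_onI linear_continuous_on linear_conv_bounded_linear[THEN iffD1] assms)
  hence "padm (\<lambda>_. b) K" unfolding padm_def using K assms measurable_compose[of _ borel borel b borel] by blast
  thus ?thesis by blast
qed

subsection \<open>Symmetric hyperbolic systems with constant coefficients\<close>

locale sym_hyp =
  fixes a :: "3 \<Rightarrow> 'v::euclidean_space \<Rightarrow> 'v"
  assumes lin_coeff: "linear (a j)" and sym_coeff: "a j v \<bullet> w = v \<bullet> a j w"
begin

lemma bounded_linear_mop_a: "bounded_linear (mop (\<lambda>_. a j))"
proof -
  obtain K where "padm (\<lambda>_. a j) K" using padm_const[OF lin_coeff[of j]] by blast
  thus ?thesis by (rule bounded_linear_mop)
qed

text \<open>Translations commute with each other and with constant coefficients. Differences act on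
  one scalar factor of a tensor product and coefficients on its vector factor, so both leave the
  core invariant.\<close>

sublocale skew_approx "\<lambda>n j. op (cdiff n j)" "\<lambda>j. op (mop (\<lambda>_. a j))" "span tens"
proof
  fix n m :: nat and j k :: 3 and x y :: "'v l2"
  note bl = bounded_linear_cdiff bounded_linear_mop_a
  obtain K where K: "padm (\<lambda>_. a j) K" using padm_const[OF lin_coeff[of j]] by blast
  note trl = linear_simps[OF bounded_linear_tr]
  show "op (cdiff n j) * op (cdiff m k) = op (cdiff m k) * op (cdiff n j)"
    by (rule endo_eqI) (simp add: bl cdiff_def trl tr_tr algebra_simps)
  show "op (mop (\<lambda>_. a j)) * op (cdiff n k) = op (cdiff n k) * op (mop (\<lambda>_. a j))"
    by (rule endo_eqI)
       (simp add: bl cdiff_def linear_simps[OF bounded_linear_mop_a[of j]] mop_const_tr[OF K])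
  show "ap (op (cdiff n j)) x \<bullet> y = - (x \<bullet> ap (op (cdiff n j)) y)"
    by (simp add: bl cdiff_def inner_diff_left inner_diff_right inner_tr algebra_simps)
  show "ap (op (mop (\<lambda>_. a j))) x \<bullet> y = x \<bullet> ap (op (mop (\<lambda>_. a j))) y"
    by (simp add: bl inner_mop[OF K K] sym_coeff)
  show "subspace (span tens :: 'v l2 set)" by (rule subspace_span)
  show "closure (span tens) = (UNIV :: 'v l2 set)" by (rule closure_span_tens)
  show "ap (op (cdiff n j)) x \<in> span tens" if "x \<in> span tens"
    unfolding ap_op[OF bounded_linear_cdiff]
    by (rule span_linear_image[OF bounded_linear.linear[OF bounded_linear_cdiff] _ that]) (intro span_base cdiff_tens)
  show "ap (op (mop (\<lambda>_. a j))) x \<in> span tens" if "x \<in> span tens"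
    unfolding ap_op[OF bounded_linear_mop_a]
  proof (rule span_linear_image[OF bounded_linear.linear[OF bounded_linear_mop_a] _ that])
    fix u :: "'v l2" assume "u \<in> tens"
    then obtain g e where u: "u = cls (\<lambda>x. ten g x *\<^sub>R e)" and g: "\<forall>j. cc (g j)" by (auto simp: tens_def)
    have "mop (\<lambda>_. a j) u = cls (\<lambda>x. ten g x *\<^sub>R a j e)"
      unfolding u mop_cls[OF K L2_ten[OF g]] by (simp add: linear_scale[OF lin_coeff])
    thus "mop (\<lambda>_. a j) u \<in> span tens" using g by (intro span_base) (auto simp: tens_def)
  qed
  show "convergent (\<lambda>n. ap (op (cdiff n j)) x)" if "x \<in> span tens"
    using that unfolding ap_op[OF bounded_linear_cdiff]
  proof (induction rule: span_induct_alt)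
    case base thus ?case by (simp add: linear_simps[OF bounded_linear_cdiff] convergent_const)
  next
    case (step c u v)
    then obtain g e where u: "u = cls (\<lambda>x. ten g x *\<^sub>R e)" and g: "\<forall>j. cc (g j)" by (auto simp: tens_def)
    have "convergent (\<lambda>n. cdiff n j u)" unfolding u by (rule convergentI[OF cdiff_ten[OF g]])
    then obtain l where "(\<lambda>n. cdiff n j u) \<longlonglongrightarrow> l" unfolding convergent_def by blast
    moreover obtain l' where "(\<lambda>n. cdiff n j v) \<longlonglongrightarrow> l'" using step unfolding convergent_def by blast
    ultimately have "(\<lambda>n. c *\<^sub>R cdiff n j u + cdiff n j v) \<longlonglongrightarrow> c *\<^sub>R l + l'" by (intro tendsto_intros)
    thus ?case by (simp add: linear_simps[OF bounded_linear_cdiff] convergentI)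
  qed
qed

lemma mop_a_cls: assumes "L2 f" shows "mop (\<lambda>_. a j) (cls f) = cls (\<lambda>x. a j (f x))"
proof -
  obtain K where "padm (\<lambda>_. a j) K" using padm_const[OF lin_coeff[of j]] by blast
  thus ?thesis using assms by (rule mop_cls)
qed

lemma A0_eqI:
  assumes d: "\<And>j. (\<lambda>n. cdiff n j (cls (\<lambda>x. f x *\<^sub>R e))) \<longlonglongrightarrow> cls (\<lambda>x. f' j x *\<^sub>R e)" and L: "\<And>j (e :: 'v). L2 (\<lambda>x. f' j x *\<^sub>R e)"
  shows "cls (\<lambda>x. f x *\<^sub>R e) \<in> dom" "A0 (cls (\<lambda>x. f x *\<^sub>R e)) = - (\<Sum>j\<in>UNIV. cls (\<lambda>x. f' j x *\<^sub>R a j e))"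
proof -
  have d': "(\<lambda>n. ap (op (cdiff n j)) (cls (\<lambda>x. f x *\<^sub>R e))) \<longlonglongrightarrow> cls (\<lambda>x. f' j x *\<^sub>R e)" for j
    using d by (simp add: bounded_linear_cdiff)
  show "cls (\<lambda>x. f x *\<^sub>R e) \<in> dom" by (rule domI[OF d'])
  show "A0 (cls (\<lambda>x. f x *\<^sub>R e)) = - (\<Sum>j\<in>UNIV. cls (\<lambda>x. f' j x *\<^sub>R a j e))"
    by (simp add: A0_def dI[OF d'] bounded_linear_mop_a mop_a_cls[OF L] linear_scale[OF lin_coeff])
qed

lemma A0_ten:
  assumes g: "\<forall>j. cc (g j)"
  shows "A0 (cls (\<lambda>x. ten g x *\<^sub>R e)) = - (\<Sum>j\<in>UNIV. cls (\<lambda>x. ten (g(j := deriv (g j))) x *\<^sub>R a j e))"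
  by (rule A0_eqI(2)[OF cdiff_ten[OF g]], rule L2_ten) (use g cc_deriv(2) in auto)

end

subsection \<open>Test functions as curves in the Hilbert space\<close>

text \<open>Test functions are scalar, so a direction e is supplied separately; ranging over all e
  recovers the vector equation.\<close>

definition TF :: "(real \<times> (real^3) \<Rightarrow> real) \<Rightarrow> 'v::euclidean_space \<Rightarrow> real \<Rightarrow> 'v l2" where
  "TF \<phi> e t = cls (\<lambda>x. \<phi> (t, x) *\<^sub>R e)"

abbreviation pt :: "(real \<times> (real^3) \<Rightarrow> real) \<Rightarrow> real \<times> (real^3) \<Rightarrow> real" where
  "pt \<phi> \<equiv> \<lambda>z. frechet_derivative \<phi> (at z) (1, 0)"

abbreviation px :: "3 \<Rightarrow> (real \<times> (real^3) \<Rightarrow> real) \<Rightarrow> real \<times> (real^3) \<Rightarrow> real" where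
  "px j \<phi> \<equiv> \<lambda>z. frechet_derivative \<phi> (at z) (0, axis j 1)"

context
  fixes \<phi> :: "real \<times> (real^3) \<Rightarrow> real" and \<Omega> assumes \<phi>: "\<phi> \<in> test_functions \<Omega>"
begin

lemma test_section:
  "\<exists>R. (\<forall>t. continuous_on UNIV (\<lambda>x. \<phi> (t, x))) \<and> (\<forall>t x. norm x > R \<longrightarrow> \<phi> (t, x) = 0) \<and> (\<forall>t x. \<bar>t\<bar> > R \<longrightarrow> \<phi> (t, x) = 0)"
proof -
  obtain R where R: "\<And>z. norm z > R \<Longrightarrow> \<phi> z = 0" using test_function_props(4)[OF \<phi>] by blast
  have "continuous_on UNIV (\<lambda>x. \<phi> (t, x))" for t
    by (rule continuous_on_compose2[OF test_function_props(1)[OF \<phi>]]) (auto intro!: continuous_intros)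
  moreover have "norm x \<le> norm (t, x)" "\<bar>t\<bar> \<le> norm (t, x)" for t :: real and x :: "real^3"
    using norm_snd_le[of x t] norm_fst_le[of t x] by simp_all
  ultimately show ?thesis using R by (meson less_le_trans)
qed

lemma TF_L2: "L2 (\<lambda>x. \<phi> (t, x) *\<^sub>R e)"
proof -
  obtain R where "\<And>t. continuous_on UNIV (\<lambda>x. \<phi> (t, x))" "\<And>t x. norm x > R \<Longrightarrow> \<phi> (t, x) = 0" using test_section by blast
  thus ?thesis by (rule L2_compact_support)
qed

lemma test_bounded: "\<exists>C>0. \<forall>z. \<bar>\<phi> z\<bar> \<le> C"
proof -
  obtain R where R: "\<And>z. norm z > R \<Longrightarrow> \<phi> z = 0" using test_function_props(4)[OF \<phi>] by blast
  from continuous_compact_support_bounded[OF test_function_props(1)[OF \<phi>] this] show ?thesis .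
qed

lemma test_deriv_t: "((\<lambda>s. \<phi> (s, x)) has_real_derivative pt \<phi> (t, x)) (at t)"
proof -
  have "((\<lambda>s. (s, x)) has_derivative (\<lambda>h. (h, 0))) (at t)" by (intro has_derivative_Pair has_derivative_ident has_derivative_const)
  from has_derivative_compose[OF this test_function_props(2)[OF \<phi>]]
  have d: "((\<lambda>s. \<phi> (s, x)) has_derivative (\<lambda>h. frechet_derivative \<phi> (at (t, x)) (h, 0))) (at t)" .
  have s: "frechet_derivative \<phi> (at (t, x)) (h, 0) = pt \<phi> (t, x) * h" for h
    using linear_scale[OF has_derivative_linear[OF test_function_props(2)[OF \<phi>]], of "(t, x)" h "(1, 0)"] by simp
  have "(\<lambda>h. frechet_derivative \<phi> (at (t, x)) (h, 0)) = (*) (pt \<phi> (t, x))" by (rule ext) (rule s)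
  thus ?thesis using d by (simp only: has_field_derivative_def)
qed

lemma test_deriv_x: "((\<lambda>s. \<phi> (t, x + s *\<^sub>R axis j 1)) has_real_derivative px j \<phi> (t, x)) (at 0)"
proof -
  have "((\<lambda>s. (t, x + s *\<^sub>R axis j 1)) has_derivative (\<lambda>h. (0, h *\<^sub>R axis j 1))) (at 0)"
    by (auto intro!: derivative_eq_intros)
  from has_derivative_compose[OF this, of \<phi>] test_function_props(2)[OF \<phi>]
  have d: "((\<lambda>s. \<phi> (t, x + s *\<^sub>R axis j 1)) has_derivative (\<lambda>h. frechet_derivative \<phi> (at (t, x)) (0, h *\<^sub>R axis j 1))) (at 0)" by simp
  have s: "frechet_derivative \<phi> (at (t, x)) (0, h *\<^sub>R axis j 1) = px j \<phi> (t, x) * h" for h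
    using linear_scale[OF has_derivative_linear[OF test_function_props(2)[OF \<phi>]], of "(t, x)" h "(0, axis j 1)"] by simp
  have "(\<lambda>h. frechet_derivative \<phi> (at (t, x)) (0, h *\<^sub>R axis j 1)) = (*) (px j \<phi> (t, x))" by (rule ext) (rule s)
  thus ?thesis using d by (simp only: has_field_derivative_def)
qed

end

text \<open>Difference quotients in time are bounded by the supremum of the time derivative and
  supported in a common ball, so they converge in norm and not only pointwise.\<close>

lemma TF_deriv:
  assumes \<phi>: "\<phi> \<in> test_functions \<Omega>"
  shows "(TF \<phi> e has_vector_derivative TF (pt \<phi>) e t) (at t)"
  unfolding vector_derivative_quotient tendsto_at_iff_sequentially
proof (intro allI impI)
  fix X :: "nat \<Rightarrow> real" assume X: "\<forall>i. X i \<in> UNIV - {t}" "X \<longlonglongrightarrow> t"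
  note \<phi>t = test_function_props(3)[OF \<phi>, of "(1, 0)"]
  obtain R where R: "\<And>t x. norm x > R \<Longrightarrow> \<phi> (t, x) = 0" using test_section[OF \<phi>] by blast
  obtain C where C: "C > 0" "\<And>z. \<bar>pt \<phi> z\<bar> \<le> C" using test_bounded[OF \<phi>t] by blast
  define q where "q n x = (\<phi> (X n, x) - \<phi> (t, x)) / (X n - t)" for n x
  have Xt: "X n \<noteq> t" for n using X(1) by auto
  have q_eq: "(TF \<phi> e (X n) - TF \<phi> e t) /\<^sub>R (X n - t) = cls (\<lambda>x. q n x *\<^sub>R e)" and q_L2: "L2 (\<lambda>x. q n x *\<^sub>R e)" for n
  proof -
    have L: "L2 (\<lambda>x. \<phi> (X n, x) *\<^sub>R e - \<phi> (t, x) *\<^sub>R e)" by (intro L2_diff TF_L2[OF \<phi>])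
    have eq: "(\<lambda>x. q n x *\<^sub>R e) = (\<lambda>x. inverse (X n - t) *\<^sub>R (\<phi> (X n, x) *\<^sub>R e - \<phi> (t, x) *\<^sub>R e))"
      by (simp add: q_def fun_eq_iff scaleR_diff_left[symmetric] divide_inverse mult.commute)
    show "L2 (\<lambda>x. q n x *\<^sub>R e)" unfolding eq by (rule L2_scaleR[OF L])
    show "(TF \<phi> e (X n) - TF \<phi> e t) /\<^sub>R (X n - t) = cls (\<lambda>x. q n x *\<^sub>R e)"
      unfolding eq TF_def by (simp add: cls_scaleR[OF L] cls_diff TF_L2[OF \<phi>])
  qed
  have "(\<lambda>n. cls (\<lambda>x. q n x *\<^sub>R e)) \<longlonglongrightarrow> cls (\<lambda>x. pt \<phi> (t, x) *\<^sub>R e)"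
  proof (rule L2_tendsto(2)[OF q_L2 _ integrable_indicator_cball[of R "(C * norm e)\<^sup>2"]])
    show "(\<lambda>x. pt \<phi> (t, x) *\<^sub>R e) \<in> borel_measurable borel" by (rule L2_measurable[OF TF_L2[OF \<phi>t]])
    show "AE x in lborel. (\<lambda>n. q n x *\<^sub>R e) \<longlonglongrightarrow> pt \<phi> (t, x) *\<^sub>R e"
    proof (rule AE_I2)
      fix x
      have "((\<lambda>s. (\<phi> (s, x) - \<phi> (t, x)) / (s - t)) \<longlongrightarrow> pt \<phi> (t, x)) (at t)"
        using test_deriv_t[OF \<phi>, of x t] by (simp add: has_field_derivative_iff)
      hence "((\<lambda>s. (\<phi> (s, x) - \<phi> (t, x)) / (s - t)) \<circ> X) \<longlonglongrightarrow> pt \<phi> (t, x)"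
        using X unfolding tendsto_at_iff_sequentially by blast
      thus "(\<lambda>n. q n x *\<^sub>R e) \<longlonglongrightarrow> pt \<phi> (t, x) *\<^sub>R e" by (intro tendsto_scaleR tendsto_const) (simp add: o_def q_def)
    qed
    have q_bd: "\<bar>q n x\<bar> \<le> C" for n x
    proof -
      have "norm (\<phi> (X n, x) - \<phi> (t, x)) \<le> C * norm (X n - t)"
        by (rule differentiable_bound[of UNIV "\<lambda>s. \<phi> (s, x)" "\<lambda>s h. pt \<phi> (s, x) * h"])
           (use test_deriv_t[OF \<phi>] C in \<open>auto simp: has_field_derivative_def intro!: onorm_bound mult_right_mono simp: abs_mult\<close>)
      thus ?thesis using Xt[of n] by (simp add: q_def divide_le_eq)
    qed
    have "(norm (q n x *\<^sub>R e))\<^sup>2 \<le> indicator (cball 0 R) x * (C * norm e)\<^sup>2" for n x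
    proof (cases "norm x > R")
      case False
      have "(norm (q n x *\<^sub>R e))\<^sup>2 \<le> (C * norm e)\<^sup>2" unfolding norm_scaleR real_norm_def
        using q_bd by (intro power_mono mult_right_mono) auto
      thus ?thesis using False by simp
    qed (simp add: q_def R)
    thus "AE x in lborel. (norm (q n x *\<^sub>R e))\<^sup>2 \<le> indicator (cball 0 R) x * (C * norm e)\<^sup>2" for n by simp
  qed
  thus "((\<lambda>s. (TF \<phi> e s - TF \<phi> e t) /\<^sub>R (s - t)) \<circ> X) \<longlonglongrightarrow> TF (pt \<phi>) e t"
    by (simp add: o_def q_eq) (simp add: TF_def)
qed

lemma TF_continuous: "\<phi> \<in> test_functions \<Omega> \<Longrightarrow> continuous_on S (TF \<phi> e)"
  by (rule continuous_at_imp_continuous_on) (blast intro: has_vector_derivative_continuous[OF TF_deriv])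

context sym_hyp
begin

lemma A0_TF:
  assumes \<phi>: "\<phi> \<in> test_functions \<Omega>"
  shows "TF \<phi> e t \<in> dom" "A0 (TF \<phi> e t) = - (\<Sum>j\<in>UNIV. TF (px j \<phi>) (a j e) t)"
proof -
  have \<phi>x: "px j \<phi> \<in> test_functions \<Omega>" for j by (rule test_function_props(3)[OF \<phi>])
  obtain R where R: "\<And>t. continuous_on UNIV (\<lambda>x. \<phi> (t, x))" "\<And>t x. norm x > R \<Longrightarrow> \<phi> (t, x) = 0" using test_section[OF \<phi>] by blast
  have d: "(\<lambda>n. cdiff n j (cls (\<lambda>x. \<phi> (t, x) *\<^sub>R e))) \<longlonglongrightarrow> cls (\<lambda>x. px j \<phi> (t, x) *\<^sub>R e)" for j
  proof -
    obtain R' where R': "\<And>t. continuous_on UNIV (\<lambda>x. px j \<phi> (t, x))" "\<And>t x. norm x > R' \<Longrightarrow> px j \<phi> (t, x) = 0"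
      using test_section[OF \<phi>x[of j]] by blast
    show ?thesis
      by (rule cdiff_tendsto[where R = "max R R'", OF R(1) R'(1) _ _ test_deriv_x[OF \<phi>]]) (auto intro: R R')
  qed
  show "TF \<phi> e t \<in> dom" "A0 (TF \<phi> e t) = - (\<Sum>j\<in>UNIV. TF (px j \<phi>) (a j e) t)"
    unfolding TF_def by (rule A0_eqI[OF d TF_L2[OF \<phi>x]])+
qed

end

subsection \<open>Curves of functions and curves in the Hilbert space\<close>

lemma L2_continuous_on_iff:
  "L2_continuous_on J u \<longleftrightarrow> (\<forall>t\<in>J. L2 (u t)) \<and> continuous_on J (\<lambda>t. cls (u t))"
proof -
  have "((\<lambda>s. L2_norm (\<lambda>x. u s x - u t x)) \<longlongrightarrow> 0) (at t within J) \<longleftrightarrow> ((\<lambda>s. cls (u s)) \<longlongrightarrow> cls (u t)) (at t within J)"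
    if L: "\<forall>t\<in>J. L2 (u t)" and t: "t \<in> J" for t
  proof -
    have "((\<lambda>s. L2_norm (\<lambda>x. u s x - u t x)) \<longlongrightarrow> 0) (at t within J) \<longleftrightarrow>
        ((\<lambda>s. norm (cls (u s) - cls (u t))) \<longlongrightarrow> 0) (at t within J)"
    proof (rule filterlim_cong[OF refl refl])
      show "\<forall>\<^sub>F s in at t within J. L2_norm (\<lambda>x. u s x - u t x) = norm (cls (u s) - cls (u t))"
        unfolding eventually_at_filter
      proof (intro always_eventually allI impI)
        fix s assume "s \<in> J"
        hence "L2 (u s)" "L2 (u t)" using L t by auto
        thus "L2_norm (\<lambda>x. u s x - u t x) = norm (cls (u s) - cls (u t))"
          by (simp only: cls_diff[symmetric] norm_cls L2_diff)
      qed
    qed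
    thus ?thesis by (simp only: tendsto_norm_zero_iff LIM_zero_iff)
  qed
  thus ?thesis unfolding L2_continuous_on_def continuous_on_def by blast
qed

text \<open>In a second countable metric space every open set is a countable union of balls.\<close>

lemma borel_measurable_dist:
  fixes f :: "'a \<Rightarrow> 'b::{metric_space,second_countable_topology}"
  assumes d: "\<And>y. (\<lambda>x. dist (f x) y) \<in> borel_measurable M"
  shows "f \<in> borel_measurable M"
proof (rule borel_measurableI)
  fix S :: "'b set" assume S: "open S"
  have "\<forall>y\<in>S. \<exists>e>0. ball y e \<subseteq> S" using S open_contains_ball by blast
  then obtain e where e: "\<And>y. y \<in> S \<Longrightarrow> e y > 0 \<and> ball y (e y) \<subseteq> S" by metis
  obtain \<F>' where \<F>': "\<F>' \<subseteq> (\<lambda>y. ball y (e y)) ` S" "countable \<F>'" "\<Union>\<F>' = \<Union>((\<lambda>y. ball y (e y)) ` S)"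
    using Lindelof[of "(\<lambda>y. ball y (e y)) ` S"] by (metis (no_types, lifting) image_iff open_ball)
  have "S = \<Union>\<F>'" unfolding \<F>'(3) using e by force
  hence "f -` S \<inter> space M = (\<Union>B\<in>\<F>'. f -` B \<inter> space M)" by auto
  also have "\<dots> \<in> sets M"
  proof (rule sets.countable_UN''[OF \<F>'(2)])
    fix B assume "B \<in> \<F>'"
    then obtain y r where B: "B = ball y r" using \<F>'(1) by blast
    have "f -` B \<inter> space M = {x \<in> space M. dist (f x) y < r}" by (auto simp: B dist_commute)
    also have "\<dots> \<in> sets M" using d[of y] by measurable
    finally show "f -` B \<inter> space M \<in> sets M" .
  qed
  finally show "f -` S \<inter> space M \<in> sets M" .
qed

text \<open>Distances to a fixed class are integrals over space and hence measurable in time by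
  Tonelli. The times at which a section is not square integrable form a measurable set, on which
  \<open>cls\<close> takes its default 0.\<close>

lemma cls_measurable:
  fixes F :: "real \<Rightarrow> real^3 \<Rightarrow> 'v::euclidean_space"
  assumes m: "(\<lambda>(t, x). F t x) \<in> borel_measurable borel"
  shows "(\<lambda>t. cls (F t)) \<in> borel_measurable borel"
proof (rule borel_measurable_dist)
  fix v :: "'v l2"
  have m'[measurable]: "(\<lambda>z. F (fst z) (snd z)) \<in> borel_measurable (borel \<Otimes>\<^sub>M borel)"
    using m by (simp add: case_prod_beta' borel_prod)
  have sec: "F t \<in> borel_measurable borel" for t
    using measurable_compose[OF measurable_Pair1'[of t borel borel] m'] by simp
  define N where "N t = (\<integral>\<^sup>+x. ennreal ((norm (F t x))\<^sup>2) \<partial>lborel)" for t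
  define D where "D t = (\<integral>\<^sup>+x. ennreal ((norm (F t x - fn v x))\<^sup>2) \<partial>lborel)" for t
  have Nm: "N \<in> borel_measurable borel" unfolding N_def by (rule lborel.borel_measurable_nn_integral) measurable
  have Dm: "D \<in> borel_measurable borel" unfolding D_def by (rule lborel.borel_measurable_nn_integral) measurable
  have L2_iff: "L2 (F t) \<longleftrightarrow> N t < \<infinity>" for t
    unfolding L2_def N_def integrable_iff_bounded using sec[of t] by simp
  have eq: "dist (cls (F t)) v = (if N t < \<infinity> then sqrt (enn2real (D t)) else norm v)" for t
  proof (cases "L2 (F t)")
    case True
    have "ennreal ((norm (cls (F t) - v))\<^sup>2) = D t"
      unfolding norm_l2_nn D_def
      by (rule nn_integral_cong_AE) (use fn_diff[of "cls (F t)" v] fn_cls[OF True] in \<open>eventually_elim, simp\<close>)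
    hence "enn2real (D t) = (norm (cls (F t) - v))\<^sup>2" by (metis enn2real_ennreal zero_le_power2)
    thus ?thesis using True L2_iff[of t] by (simp add: dist_norm)
  next
    case False
    hence "cls (F t) = 0" by (simp add: cls_def zero_l2_def)
    thus ?thesis using False L2_iff[of t] by (simp add: dist_norm)
  qed
  show "(\<lambda>t. dist (cls (F t)) v) \<in> borel_measurable borel"
    unfolding eq using Nm Dm by measurable
qed

lemma L1_loc_L2_integable:
  assumes F: "L1_loc_L2 F" shows "integable a b (\<lambda>t. cls (F t))"
  unfolding set_integrable_def
proof (rule Bochner_Integration.integrable_bound)
  show "integrable lborel (\<lambda>t. indicator {a..b} t *\<^sub>R L2_norm (F t))"
    using F by (simp add: L1_loc_L2_def set_integrable_def)
  have [measurable]: "(\<lambda>t. cls (F t)) \<in> borel_measurable borel" using F by (intro cls_measurable) (simp add: L1_loc_L2_def)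
  show "(\<lambda>t. indicator {a..b} t *\<^sub>R cls (F t)) \<in> borel_measurable lborel" by measurable
  have "AE t in lborel. L2 (F t)" using F by (simp add: L1_loc_L2_def)
  thus "AE t in lborel. norm (indicator {a..b} t *\<^sub>R cls (F t)) \<le> norm (indicator {a..b} t *\<^sub>R L2_norm (F t))"
    by eventually_elim (simp flip: norm_cls)
qed

subsection \<open>Distributions tested through the inner product\<close>

lemma integrable_componentwise:
  fixes f :: "'a \<Rightarrow> 'b::euclidean_space"
  assumes "\<And>e. e \<in> Basis \<Longrightarrow> integrable M (\<lambda>x. f x \<bullet> e)" shows "integrable M f"
proof -
  have "integrable M (\<lambda>x. \<Sum>e\<in>Basis. (f x \<bullet> e) *\<^sub>R e)"
    by (intro Bochner_Integration.integrable_sum integrable_scaleR_left assms)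
  thus ?thesis by (simp add: euclidean_representation)
qed

lemma test_zero_off:
  assumes \<phi>: "\<phi> \<in> test_functions \<Omega>"
  obtains R where "R > 0" "\<And>t. \<bar>t\<bar> > R \<Longrightarrow> TF \<phi> e t = 0"
proof -
  obtain R where R: "\<And>t x. \<bar>t\<bar> > R \<Longrightarrow> \<phi> (t, x) = 0" using test_section[OF \<phi>] by blast
  show thesis by (rule that[of "\<bar>R\<bar> + 1"]) (auto simp: TF_def R cls_0)
qed

lemma pairing_integrable:
  fixes U :: "real \<Rightarrow> 'v::euclidean_space l2"
  assumes U: "continuous_on J U" and J: "closed J" and \<phi>: "\<phi> \<in> test_functions \<Omega>" and off: "\<And>t x. \<phi> (t, x) \<noteq> 0 \<Longrightarrow> t \<in> J"
  shows "integrable lborel (\<lambda>t. U t \<bullet> TF \<phi> e t)"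
proof -
  obtain R where R: "\<And>t. \<bar>t\<bar> > R \<Longrightarrow> TF \<phi> e t = 0" by (rule test_zero_off[OF \<phi>, of e]) blast
  have i: "integrable lborel (\<lambda>t. indicator (J \<inter> {- R..R}) t *\<^sub>R (U t \<bullet> TF \<phi> e t))"
    by (intro borel_integrable_compact continuous_intros continuous_on_subset[OF U] TF_continuous[OF \<phi>])
       (auto intro: closed_Int_compact J)
  have eq: "indicator (J \<inter> {- R..R}) t *\<^sub>R (U t \<bullet> TF \<phi> e t) = U t \<bullet> TF \<phi> e t" for t
  proof (cases "t \<in> J \<inter> {- R..R}")
    case False
    have "TF \<phi> e t = 0"
    proof (cases "t \<in> J")
      case True
      thus ?thesis using False by (intro R) auto
    next
      case False
      hence "\<phi> (t, x) = 0" for x using off by blast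
      thus ?thesis by (simp add: TF_def cls_0)
    qed
    thus ?thesis by simp
  qed simp
  show ?thesis using i unfolding eq .
qed

text \<open>The alternative that \<phi> vanishes at time t covers the times at which y is not known
  to be square integrable.\<close>

lemma section_inner:
  fixes y :: "real \<Rightarrow> real^3 \<Rightarrow> 'v::euclidean_space"
  assumes \<phi>: "\<phi> \<in> test_functions \<Omega>" and y: "L2 (y t) \<or> (\<forall>x. \<phi> (t, x) = 0)"
  shows "(LINT x|lborel. \<phi> (t, x) *\<^sub>R y t x) \<bullet> e = cls (y t) \<bullet> TF \<phi> e t"
  using y
proof
  assume L: "L2 (y t)"
  have 1: "cls (y t) \<bullet> TF \<phi> e t = (LINT x|lborel. y t x \<bullet> (\<phi> (t, x) *\<^sub>R e))" and 2: "integrable lborel (\<lambda>x. y t x \<bullet> (\<phi> (t, x) *\<^sub>R e))" for e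
    unfolding TF_def using inner_cls[OF L TF_L2[OF \<phi>]] L2_inner[OF L TF_L2[OF \<phi>]] by auto
  have "integrable lborel (\<lambda>x. \<phi> (t, x) *\<^sub>R y t x)"
    by (rule integrable_componentwise) (use 2 in simp)
  hence "(LINT x|lborel. \<phi> (t, x) *\<^sub>R y t x) \<bullet> e = (LINT x|lborel. (\<phi> (t, x) *\<^sub>R y t x) \<bullet> e)"
    by (intro integral_inner_left[symmetric])
  thus ?thesis unfolding 1 by simp
next
  assume "\<forall>x. \<phi> (t, x) = 0"
  thus ?thesis by (simp add: TF_def cls_0)
qed

text \<open>The component along each e turns the inner integral into a Hilbert space pairing that is
  continuous in time on J; integrability of the vector-valued integrand is drawn from these
  components.\<close>

lemma distr_of_continuous:
  fixes y :: "real \<Rightarrow> real^3 \<Rightarrow> complex^3"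
  assumes y: "L2_continuous_on J y" and J: "closed J" and \<phi>: "\<phi> \<in> test_functions \<Omega>" and off: "\<And>t x. \<phi> (t, x) \<noteq> 0 \<Longrightarrow> t \<in> J"
  shows "distr_of y \<phi> \<bullet> e = (LINT t|lborel. cls (y t) \<bullet> TF \<phi> e t)"
proof -
  have yc: "\<And>t. t \<in> J \<Longrightarrow> L2 (y t)" "continuous_on J (\<lambda>t. cls (y t))" using y unfolding L2_continuous_on_iff by auto
  have s: "(LINT x|lborel. \<phi> (t, x) *\<^sub>R y t x) \<bullet> e = cls (y t) \<bullet> TF \<phi> e t" for t e
    by (rule section_inner[OF \<phi>]) (use yc(1) off in blast)
  have i: "integrable lborel (\<lambda>t. (LINT x|lborel. \<phi> (t, x) *\<^sub>R y t x) \<bullet> e)" for e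
    unfolding s by (rule pairing_integrable[OF yc(2) J \<phi> off])
  have "integrable lborel (\<lambda>t. LINT x|lborel. \<phi> (t, x) *\<^sub>R y t x)" by (rule integrable_componentwise) (rule i)
  hence "distr_of y \<phi> \<bullet> e = (LINT t|lborel. (LINT x|lborel. \<phi> (t, x) *\<^sub>R y t x) \<bullet> e)"
    unfolding distr_of_def by (intro integral_inner_left[symmetric])
  thus ?thesis unfolding s .
qed

lemma pairing_integrable_L1:
  fixes f :: "real \<Rightarrow> 'v::euclidean_space l2"
  assumes f: "\<And>a b. integable a b f" and \<phi>: "\<phi> \<in> test_functions \<Omega>"
  shows "integrable lborel (\<lambda>t. f t \<bullet> TF \<phi> e t)"
proof -
  obtain R where R: "\<And>t. \<bar>t\<bar> > R \<Longrightarrow> TF \<phi> e t = 0" by (rule test_zero_off[OF \<phi>, of e]) blast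
  have c: "continuous_on S (TF \<phi> e)" for S by (rule TF_continuous[OF \<phi>])
  obtain C where C: "\<And>t. t \<in> {- R..R} \<Longrightarrow> norm (TF \<phi> e t) \<le> C"
    using compact_imp_bounded[OF compact_continuous_image[OF c compact_Icc]] unfolding bounded_iff by (meson imageI)
  have i: "integrable lborel (\<lambda>t. indicator {- R..R} t *\<^sub>R f t)" using f by (simp add: set_integrable_def)
  hence [measurable]: "(\<lambda>t. indicator {- R..R} t *\<^sub>R f t) \<in> borel_measurable borel" by auto
  have [measurable]: "TF \<phi> e \<in> borel_measurable borel" by (rule borel_measurable_continuous_onI[OF c])
  have eq: "f t \<bullet> TF \<phi> e t = (indicator {- R..R} t *\<^sub>R f t) \<bullet> TF \<phi> e t" for t
    using R[of t] by (cases "t \<in> {- R..R}") (auto simp: abs_le_iff not_le)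
  show ?thesis
  proof (rule Bochner_Integration.integrable_bound)
    show "integrable lborel (\<lambda>t. C * norm (indicator {- R..R} t *\<^sub>R f t))" by (intro integrable_mult_right integrable_norm i)
    show "(\<lambda>t. f t \<bullet> TF \<phi> e t) \<in> borel_measurable lborel" unfolding eq by measurable
    show "AE t in lborel. norm (f t \<bullet> TF \<phi> e t) \<le> norm (C * norm (indicator {- R..R} t *\<^sub>R f t))"
    proof (rule AE_I2)
      fix t
      show "norm (f t \<bullet> TF \<phi> e t) \<le> norm (C * norm (indicator {- R..R} t *\<^sub>R f t))"
      proof (cases "t \<in> {- R..R}")
        case True
        have "\<bar>f t \<bullet> TF \<phi> e t\<bar> \<le> norm (f t) * norm (TF \<phi> e t)" by (rule Cauchy_Schwarz_ineq2)
        also have "\<dots> \<le> norm (f t) * \<bar>C\<bar>" by (intro mult_left_mono order_trans[OF C[OF True] abs_ge_self]) simp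
        finally show ?thesis using True by (simp add: abs_mult mult.commute)
      next
        case False
        thus ?thesis unfolding eq by simp
      qed
    qed
  qed
qed

lemma distr_of_L1_loc:
  fixes F :: "real \<Rightarrow> real^3 \<Rightarrow> complex^3"
  assumes F: "L1_loc_L2 F" and \<phi>: "\<phi> \<in> test_functions \<Omega>"
  shows "distr_of F \<phi> \<bullet> e = (LINT t|lborel. cls (F t) \<bullet> TF \<phi> e t)"
proof -
  have [measurable]: "(\<lambda>z. F (fst z) (snd z)) \<in> borel_measurable (borel \<Otimes>\<^sub>M borel)"
    using F by (simp add: L1_loc_L2_def case_prod_beta' borel_prod)
  have [measurable]: "\<phi> \<in> borel_measurable (borel \<Otimes>\<^sub>M borel)"
    unfolding borel_prod by (rule borel_measurable_continuous_onI[OF test_function_props(1)[OF \<phi>]])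
  have [measurable]: "(\<lambda>t. LINT x|lborel. \<phi> (t, x) *\<^sub>R F t x) \<in> borel_measurable borel"
    by (rule lborel.borel_measurable_lebesgue_integral) measurable
  have [measurable]: "(\<lambda>t. cls (F t)) \<in> borel_measurable borel" using F by (intro cls_measurable) (simp add: L1_loc_L2_def)
  have [measurable]: "TF \<phi> e \<in> borel_measurable borel" for e :: "complex^3"
    by (rule borel_measurable_continuous_onI[OF TF_continuous[OF \<phi>]])
  have "AE t in lborel. L2 (F t)" using F by (simp add: L1_loc_L2_def)
  hence s: "AE t in lborel. (LINT x|lborel. \<phi> (t, x) *\<^sub>R F t x) \<bullet> e = cls (F t) \<bullet> TF \<phi> e t" for e
    by eventually_elim (rule section_inner[OF \<phi>], simp)
  have i: "integrable lborel (\<lambda>t. (LINT x|lborel. \<phi> (t, x) *\<^sub>R F t x) \<bullet> e)" for e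
  proof (rule integrable_cong_AE_imp[OF pairing_integrable_L1[OF L1_loc_L2_integable[OF F] \<phi>, of e]])
    show "(\<lambda>t. (LINT x|lborel. \<phi> (t, x) *\<^sub>R F t x) \<bullet> e) \<in> borel_measurable lborel" by measurable
    show "AE t in lborel. cls (F t) \<bullet> TF \<phi> e t = (LINT x|lborel. \<phi> (t, x) *\<^sub>R F t x) \<bullet> e"
      using s[of e] by eventually_elim simp
  qed
  have "integrable lborel (\<lambda>t. LINT x|lborel. \<phi> (t, x) *\<^sub>R F t x)" by (rule integrable_componentwise) (rule i)
  hence "distr_of F \<phi> \<bullet> e = (LINT t|lborel. (LINT x|lborel. \<phi> (t, x) *\<^sub>R F t x) \<bullet> e)"
    unfolding distr_of_def by (intro integral_inner_left[symmetric])
  also have "\<dots> = (LINT t|lborel. cls (F t) \<bullet> TF \<phi> e t)"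
    by (rule integral_cong_AE) (measurable, rule s)
  finally show ?thesis .
qed

subsection \<open>Weak and mild solutions\<close>

context sym_hyp
begin

text \<open>This is the equation U' = A0 U + B U + F with all derivatives moved to the test
  function; skewness accounts for the sign of \<open>A0\<close>.\<close>

definition weak :: "(real \<times> (real^3)) set \<Rightarrow> 'v l2 endo \<Rightarrow> (real \<Rightarrow> 'v l2) \<Rightarrow> (real \<Rightarrow> 'v l2) \<Rightarrow> bool" where
  "weak \<Omega> B U F \<longleftrightarrow> (\<forall>\<phi>\<in>test_functions \<Omega>. \<forall>e.
     (LINT t|lborel. U t \<bullet> (TF (pt \<phi>) e t - A0 (TF \<phi> e t))) + (LINT t|lborel. (ap B (U t) + F t) \<bullet> TF \<phi> e t) = 0)"

lemma A0_TF_continuous: "\<phi> \<in> test_functions \<Omega> \<Longrightarrow> continuous_on S (\<lambda>t. A0 (TF \<phi> e t))"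
  unfolding A0_TF(2) by (intro continuous_intros TF_continuous test_function_props(3))

text \<open>The initial term of \<open>mild_test\<close> vanishes in either case: for initial value
  0, or because the tests are supported in positive times.\<close>

lemma mild_weak:
  assumes u: "\<And>T. mild B F u0 T U" and F: "\<And>T. integable 0 T F"
    and U0: "\<And>t. t < 0 \<Longrightarrow> U' t = 0" "\<And>t. t \<ge> 0 \<Longrightarrow> U' t = U t" and F0: "\<And>t. t < 0 \<Longrightarrow> F' t = 0" "\<And>t. t \<ge> 0 \<Longrightarrow> F' t = F t"
    and \<Omega>: "u0 = 0 \<or> \<Omega> \<subseteq> {0<..} \<times> UNIV"
  shows "weak \<Omega> B U' F'"
  unfolding weak_def
proof (intro ballI allI)
  fix \<phi> and e :: 'v assume \<phi>: "\<phi> \<in> test_functions \<Omega>"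
  note \<phi>t = test_function_props(3)[OF \<phi>, of "(1, 0)"]
  obtain R1 where R1: "\<And>t. \<bar>t\<bar> > R1 \<Longrightarrow> TF \<phi> e t = 0" by (rule test_zero_off[OF \<phi>, of e]) blast
  obtain R2 where R2: "\<And>t. \<bar>t\<bar> > R2 \<Longrightarrow> TF (pt \<phi>) e t = 0" by (rule test_zero_off[OF \<phi>t, of e]) blast
  define T where "T = max 0 (max R1 R2) + 1"
  have T: "T > 0" "\<And>t. t \<ge> T \<Longrightarrow> TF \<phi> e t = 0" "\<And>t. t \<ge> T \<Longrightarrow> TF (pt \<phi>) e t = 0" by (auto simp: T_def intro!: R1 R2)
  have A00: "A0 0 = 0" using A0_scale[OF A0_TF(1)[OF \<phi>, of e 0], of 0] by simp
  have "(LINT t|lborel. U' t \<bullet> (TF (pt \<phi>) e t - A0 (TF \<phi> e t))) = integ 0 T (\<lambda>t. U t \<bullet> (TF (pt \<phi>) e t - A0 (TF \<phi> e t)))"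
    unfolding set_lebesgue_integral_def
  proof (rule Bochner_Integration.integral_cong[OF refl])
    fix t show "U' t \<bullet> (TF (pt \<phi>) e t - A0 (TF \<phi> e t)) = indicator {0..T} t *\<^sub>R (U t \<bullet> (TF (pt \<phi>) e t - A0 (TF \<phi> e t)))"
      using U0[of t] T(2,3)[of t] A00 by (cases "t < 0"; cases "t > T") (auto simp: indicator_def)
  qed
  also have "\<dots> = U T \<bullet> TF \<phi> e T - u0 \<bullet> TF \<phi> e 0 - integ 0 T (\<lambda>s. (ap B (U s) + F s) \<bullet> TF \<phi> e s)"
  proof (rule mild_test)
    show "U t = G t (u0 + integ 0 t (\<lambda>s. G (- s) (ap B (U s) + F s)))" if "0 \<le> t" "t \<le> T" for t
      using u[of T] that unfolding mild_def by auto
    show "integable 0 T (\<lambda>s. ap B (U s) + F s)" by (rule mild_integable[OF u F])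
  qed (use T in \<open>auto intro: TF_deriv[OF \<phi>] A0_TF(1)[OF \<phi>] TF_continuous[OF \<phi>t] A0_TF_continuous[OF \<phi>]\<close>)
  also have "U T \<bullet> TF \<phi> e T = 0" using T(2)[of T] by simp
  also have "u0 \<bullet> TF \<phi> e 0 = 0"
  proof (cases "u0 = 0")
    case False
    hence "\<phi> (0, x) = 0" for x using \<Omega> test_function_props(5)[OF \<phi>, of "(0, x)"] by blast
    thus ?thesis by (simp add: TF_def cls_0)
  qed simp
  also have "integ 0 T (\<lambda>s. (ap B (U s) + F s) \<bullet> TF \<phi> e s) = (LINT t|lborel. (ap B (U' t) + F' t) \<bullet> TF \<phi> e t)"
    unfolding set_lebesgue_integral_def
  proof (rule Bochner_Integration.integral_cong[OF refl])
    fix t show "indicator {0..T} t *\<^sub>R ((ap B (U t) + F t) \<bullet> TF \<phi> e t) = (ap B (U' t) + F' t) \<bullet> TF \<phi> e t"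
      using U0[of t] F0[of t] T(2)[of t] by (cases "t < 0"; cases "t > T") (auto simp: indicator_def linear_simps[OF bounded_linear_ap])
  qed
  finally show "(LINT t|lborel. U' t \<bullet> (TF (pt \<phi>) e t - A0 (TF \<phi> e t))) + (LINT t|lborel. (ap B (U' t) + F' t) \<bullet> TF \<phi> e t) = 0" by simp
qed

end

text \<open>For the smoothed indicator of \<open>cc_step\<close>, the term with
  \<open>deriv \<theta>\<close> averages q near s and near t, and the other term is close to the
  integral of m. Each of these three errors is kept below \<eta>.\<close>

lemma weak_derivative_identity:
  fixes q m :: "real \<Rightarrow> real"
  assumes q: "continuous_on {0..} q" and m: "continuous_on {0..} m" and st: "0 < s" "s < t"
    and eq: "\<And>\<theta>. cc \<theta> \<Longrightarrow> (\<And>x. x \<notin> {s..t+1} \<Longrightarrow> \<theta> x = 0) \<Longrightarrow>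
        (LINT x|lborel. deriv \<theta> x * q x) + (LINT x|lborel. \<theta> x * m x) = 0"
  shows "q t - q s = integ s t m"
proof -
  have "\<bar>q t - q s - integ s t m\<bar> \<le> 3 * \<eta>" if \<eta>: "\<eta> > 0" for \<eta>
  proof -
    have loc: "\<exists>d>0. \<forall>x. r \<le> x \<and> x \<le> r + d \<longrightarrow> \<bar>q x - q r\<bar> \<le> \<eta>" if "r > 0" for r
    proof -
      obtain d where "d > 0" "\<And>x. x \<in> {0..} \<Longrightarrow> dist x r < d \<Longrightarrow> dist (q x) (q r) < \<eta>"
        using q \<eta> \<open>r > 0\<close> unfolding continuous_on_iff by (metis atLeast_iff less_imp_le)
      thus ?thesis using \<open>r > 0\<close> by (intro exI[of _ "d/2"]) (auto simp: dist_real_def less_imp_le)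
    qed
    obtain d1 where d1: "d1 > 0" "\<And>x. s \<le> x \<Longrightarrow> x \<le> s + d1 \<Longrightarrow> \<bar>q x - q s\<bar> \<le> \<eta>" using loc[OF st(1)] by blast
    obtain d2 where d2: "d2 > 0" "\<And>x. t \<le> x \<Longrightarrow> x \<le> t + d2 \<Longrightarrow> \<bar>q x - q t\<bar> \<le> \<eta>" using loc[of t] st by auto
    have mc: "continuous_on {s..t+1} m" by (rule continuous_on_subset[OF m]) (use st in auto)
    have "bounded (m ` {s..t+1})" by (intro compact_imp_bounded compact_continuous_image mc) auto
    then obtain C where C: "C > 0" "\<And>x. x \<in> {s..t+1} \<Longrightarrow> \<bar>m x\<bar> \<le> C" unfolding bounded_pos by auto
    \<comment> \<open>d1 and d2 are continuity radii of q at s and t, 1 keeps the support in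
      \<open>{s..t+1}\<close>, \<open>(t - s) / 2\<close> separates the two ramps, and the last
      entry controls the integrals over the ramps, each of length \<epsilon> with integrand at most
      C.\<close>
    define \<epsilon> where "\<epsilon> = Min {d1, d2, 1, (t - s) / 2, \<eta> / (2 * C)}"
    have \<epsilon>: "0 < \<epsilon>" "\<epsilon> \<le> d1" "\<epsilon> \<le> d2" "\<epsilon> \<le> 1" "\<epsilon> < t - s" "\<epsilon> \<le> \<eta> / (2 * C)"
      using d1(1) d2(1) st \<eta> C(1) by (auto simp: \<epsilon>_def min_less_iff_disj)
    show ?thesis
    proof (rule cc_step[OF st(2) \<epsilon>(1,5)])
      fix \<theta> \<beta> assume \<theta>: "cc \<theta>" "\<And>x. 0 \<le> \<theta> x" "\<And>x. \<theta> x \<le> 1" "\<And>x. x \<notin> {s..t+\<epsilon>} \<Longrightarrow> \<theta> x = 0" "\<And>x. x \<in> {s+\<epsilon>..t} \<Longrightarrow> \<theta> x = 1"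
        and \<theta>': "\<And>x. deriv \<theta> x = \<beta> (x - s) - \<beta> (x - t)"
        and \<beta>: "continuous_on UNIV \<beta>" "\<And>x. \<beta> x \<ge> 0" "\<And>x. x \<notin> {0..\<epsilon>} \<Longrightarrow> \<beta> x = 0" "integ 0 \<epsilon> \<beta> = 1"
      have \<beta>m: "\<beta> \<in> borel_measurable borel" by (rule borel_measurable_continuous_onI[OF \<beta>(1)])
      have \<beta>eq: "indicator {0..\<epsilon>} x *\<^sub>R \<beta> x = \<beta> x" for x using \<beta>(3) by (auto simp: indicator_def)
      have \<beta>i: "integrable lborel \<beta>" "(LINT x|lborel. \<beta> x) = 1"
        using continuous_integable[OF continuous_on_subset[OF \<beta>(1)], of 0 \<epsilon>] \<beta>(4)
        unfolding set_integrable_def set_lebesgue_integral_def \<beta>eq by auto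
      have near: "integrable lborel (\<lambda>x. \<beta> (x - r) * q x) \<and> \<bar>(LINT x|lborel. \<beta> (x - r) * q x) - q r\<bar> \<le> \<eta>"
        if r: "r > 0" and qr: "\<And>x. r \<le> x \<Longrightarrow> x \<le> r + \<epsilon> \<Longrightarrow> \<bar>q x - q r\<bar> \<le> \<eta>" for r
      proof -
        have \<beta>r: "integrable lborel (\<lambda>x. \<beta> (x - r))" "(LINT x|lborel. \<beta> (x - r)) = 1"
          using integral_lborel_shift[of \<beta> "- r", OF \<beta>m] \<beta>i by auto
        have c: "continuous_on {r..r+\<epsilon>} (\<lambda>x. \<beta> (x - r) * q x)"
          by (intro continuous_intros continuous_on_compose2[OF \<beta>(1)] continuous_on_subset[OF q]) (use r in auto)
        have eq: "indicator {r..r+\<epsilon>} x *\<^sub>R (\<beta> (x - r) * q x) = \<beta> (x - r) * q x" for x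
        proof (cases "x \<in> {r..r+\<epsilon>}")
          case False
          hence "\<beta> (x - r) = 0" by (intro \<beta>(3)) auto
          thus ?thesis by simp
        qed simp
        have i: "integrable lborel (\<lambda>x. \<beta> (x - r) * q x)"
          using continuous_integable[OF c] unfolding set_integrable_def eq .
        have "(LINT x|lborel. \<beta> (x - r) * q x) - q r = (LINT x|lborel. \<beta> (x - r) * q x - \<beta> (x - r) * q r)"
          using i \<beta>r by (subst Bochner_Integration.integral_diff) auto
        also have "\<bar>\<dots>\<bar> \<le> (LINT x|lborel. \<beta> (x - r) * \<eta>)"
        proof (rule integral_abs_bound_integral)
          show "integrable lborel (\<lambda>x. \<beta> (x - r) * q x - \<beta> (x - r) * q r)" using i \<beta>r by (intro Bochner_Integration.integrable_diff) auto
          show "integrable lborel (\<lambda>x. \<beta> (x - r) * \<eta>)" using \<beta>r by simp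
          fix x
          show "\<bar>\<beta> (x - r) * q x - \<beta> (x - r) * q r\<bar> \<le> \<beta> (x - r) * \<eta>"
          proof (cases "x - r \<in> {0..\<epsilon>}")
            case True
            hence "\<bar>q x - q r\<bar> \<le> \<eta>" by (intro qr) auto
            hence "\<beta> (x - r) * \<bar>q x - q r\<bar> \<le> \<beta> (x - r) * \<eta>" using \<beta>(2) by (intro mult_left_mono)
            moreover have "\<bar>\<beta> (x - r) * q x - \<beta> (x - r) * q r\<bar> = \<beta> (x - r) * \<bar>q x - q r\<bar>"
              using \<beta>(2)[of "x - r"] by (simp add: abs_mult flip: right_diff_distrib)
            ultimately show ?thesis by simp
          qed (simp add: \<beta>(3))
        qed
        also have "\<dots> = \<eta>" using \<beta>r by simp
        finally show ?thesis using i by simp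
      qed
      have n1: "integrable lborel (\<lambda>x. \<beta> (x - s) * q x)" "\<bar>(LINT x|lborel. \<beta> (x - s) * q x) - q s\<bar> \<le> \<eta>"
        using near[of s] d1 \<epsilon> st by auto
      have n2: "integrable lborel (\<lambda>x. \<beta> (x - t) * q x)" "\<bar>(LINT x|lborel. \<beta> (x - t) * q x) - q t\<bar> \<le> \<eta>"
        using near[of t] d2 \<epsilon> st by auto
      have "(LINT x|lborel. deriv \<theta> x * q x) = (LINT x|lborel. \<beta> (x - s) * q x) - (LINT x|lborel. \<beta> (x - t) * q x)"
        unfolding \<theta>' left_diff_distrib by (rule Bochner_Integration.integral_diff[OF n1(1) n2(1)])
      moreover have "(LINT x|lborel. deriv \<theta> x * q x) + (LINT x|lborel. \<theta> x * m x) = 0"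
        by (rule eq[OF \<theta>(1)]) (use \<theta>(4) \<epsilon> in auto)
      moreover have "\<bar>(LINT x|lborel. \<theta> x * m x) - integ s t m\<bar> \<le> \<eta>"
      proof -
        have tm: "indicator {s..t+\<epsilon>} x *\<^sub>R (\<theta> x * m x) = \<theta> x * m x" for x using \<theta>(4)[of x] by (auto simp: indicator_def)
        have c: "continuous_on {s..t+\<epsilon>} (\<lambda>x. \<theta> x * m x)"
          by (intro continuous_intros cc_continuous[OF \<theta>(1)] continuous_on_subset[OF mc]) (use \<epsilon> in auto)
        have i: "integrable lborel (\<lambda>x. \<theta> x * m x)"
          using continuous_integable[OF c] unfolding set_integrable_def tm .
        have i2: "integrable lborel (\<lambda>x. indicator {s..t} x *\<^sub>R m x)"
          using continuous_integable[OF continuous_on_subset[OF mc], of s t] unfolding set_integrable_def by auto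
        have i3: "integrable lborel (\<lambda>x. indicator {s..s+\<epsilon>} x * C)" "integrable lborel (\<lambda>x. indicator {t..t+\<epsilon>} x * C)"
          by (auto intro!: integrable_mult_left integrable_real_indicator simp: emeasure_lborel_Icc_eq)
        have "(LINT x|lborel. \<theta> x * m x) - integ s t m = (LINT x|lborel. \<theta> x * m x - indicator {s..t} x *\<^sub>R m x)"
          unfolding set_lebesgue_integral_def by (rule Bochner_Integration.integral_diff[OF i i2, symmetric])
        also have "\<bar>\<dots>\<bar> \<le> (LINT x|lborel. indicator {s..s+\<epsilon>} x * C + indicator {t..t+\<epsilon>} x * C)"
        proof (rule integral_abs_bound_integral)
          show "integrable lborel (\<lambda>x. \<theta> x * m x - indicator {s..t} x *\<^sub>R m x)" by (rule Bochner_Integration.integrable_diff[OF i i2])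
          show "integrable lborel (\<lambda>x. indicator {s..s+\<epsilon>} x * C + indicator {t..t+\<epsilon>} x * C)" by (rule Bochner_Integration.integrable_add[OF i3])
          fix x
          consider "x \<notin> {s..t+\<epsilon>}" | "x \<in> {s..s+\<epsilon>}" | "x \<in> {s+\<epsilon>..t}" | "x > t" "x \<le> t + \<epsilon>" by fastforce
          thus "\<bar>\<theta> x * m x - indicator {s..t} x *\<^sub>R m x\<bar> \<le> indicator {s..s+\<epsilon>} x * C + indicator {t..t+\<epsilon>} x * C"
          proof cases
            case 1 thus ?thesis using \<theta>(4)[OF 1] C(1) \<epsilon> by (auto simp: indicator_def)
          next
            case 2
            hence "\<bar>(\<theta> x - 1) * m x\<bar> \<le> 1 * C" unfolding abs_mult using \<theta>(2)[of x] \<theta>(3)[of x] C \<epsilon> st by (intro mult_mono) auto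
            thus ?thesis using 2 \<epsilon> C(1) by (auto simp: indicator_def algebra_simps)
          next
            case 3 thus ?thesis using \<theta>(5)[OF 3] C(1) \<epsilon> by (auto simp: indicator_def)
          next
            case 4
            hence "\<bar>\<theta> x * m x\<bar> \<le> 1 * C" unfolding abs_mult using \<theta>(2)[of x] \<theta>(3)[of x] C \<epsilon> st by (intro mult_mono) auto
            thus ?thesis using 4 \<epsilon> C(1) by (auto simp: indicator_def)
          qed
        qed
        also have "\<dots> = 2 * \<epsilon> * C" using i3 \<epsilon>(1) by (subst Bochner_Integration.integral_add) auto
        also have "\<dots> \<le> \<eta>" using \<epsilon>(6) C(1) by (simp add: field_simps)
        finally show ?thesis .
      qed
      ultimately show ?thesis using n1(2) n2(2) by linarith
    qed
  qed
  note b = this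
  have "\<bar>q t - q s - integ s t m\<bar> \<le> 0 + e" if "e > 0" for e using b[of "e / 3"] that by simp
  hence "\<bar>q t - q s - integ s t m\<bar> \<le> 0" by (rule field_le_epsilon)
  thus ?thesis by simp
qed

context sym_hyp
begin

text \<open>Testing with a time factor \<theta> times a tensor product gives a scalar distributional
  equation for \<open>U t \<bullet> \<psi>\<close> in positive times, hence a classical one;
  linearity extends it to the core, where \<open>weak_imp_mild\<close> takes over.\<close>

lemma weak_mild:
  assumes U: "continuous_on {0..} U" and w: "weak ({0<..} \<times> UNIV) B U (\<lambda>_. 0)"
  shows "mild B (\<lambda>_. 0) (U 0) T U"
  unfolding mild_def
proof (intro conjI ballI)
  show "continuous_on {0..T} U" by (rule continuous_on_subset[OF U]) auto
  fix t assume "t \<in> {0..T}"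
  hence t: "t \<ge> 0" by simp
  define f where "f s = ap B (U s)" for s
  have f: "continuous_on {0..} f" unfolding f_def by (rule bounded_linear.continuous_on[OF bounded_linear_ap U])
  have der_tens: "((\<lambda>t. U t \<bullet> \<psi>) has_real_derivative (f t \<bullet> \<psi> - U t \<bullet> A0 \<psi>)) (at t)" if \<psi>: "\<psi> \<in> tens" and t: "t > 0" for \<psi> t
  proof -
    obtain g e where \<psi>_def: "\<psi> = cls (\<lambda>x. ten g x *\<^sub>R e)" and g: "\<forall>j. cc (g j)" using \<psi> by (auto simp: tens_def)
    define q where "q t = U t \<bullet> \<psi>" for t
    define m where "m t = f t \<bullet> \<psi> - U t \<bullet> A0 \<psi>" for t
    have qc: "continuous_on {0..} q" and mc: "continuous_on {0..} m"
      unfolding q_def m_def by (intro continuous_intros U f)+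
    have id: "q t - q s = integ s t m" if st: "0 < s" "s < t" for s t
    proof (rule weak_derivative_identity[OF qc mc st])
      fix \<theta> assume \<theta>: "cc \<theta>" "\<And>x. x \<notin> {s..t+1} \<Longrightarrow> \<theta> x = 0"
      define \<phi> where "\<phi> z = \<theta> (fst z) * ten g (snd z)" for z :: "real \<times> (real^3)"
      have sub: "\<And>x. \<theta> x \<noteq> 0 \<Longrightarrow> x \<in> {s..t+1}" using \<theta>(2) by blast
      have \<Omega>: "{s..t+1} \<times> UNIV \<subseteq> {0<..} \<times> (UNIV :: (real^3) set)" using st by auto
      note tt = tensor_test_function[of \<theta> g "{s..t+1}" "{0<..} \<times> UNIV", OF \<theta>(1) spec[OF g] sub closed_atLeastAtMost \<Omega>, folded \<phi>_def[abs_def]]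
      have \<phi>: "\<phi> \<in> test_functions ({0<..} \<times> UNIV)" using tt(1) by (simp add: \<phi>_def[abs_def])
      have TF\<phi>: "TF \<phi> e x = \<theta> x *\<^sub>R \<psi>" for x
        unfolding TF_def \<phi>_def \<psi>_def by (simp add: cls_scaleR[OF L2_ten[OF g], symmetric])
      have TF\<phi>t: "TF (pt \<phi>) e x = deriv \<theta> x *\<^sub>R \<psi>" for x
        using tt(2) unfolding TF_def \<psi>_def \<phi>_def by (simp add: cls_scaleR[OF L2_ten[OF g], symmetric])
      have A: "A0 (\<theta> x *\<^sub>R \<psi>) = \<theta> x *\<^sub>R A0 \<psi>" for x
        by (rule A0_scale[OF core_dom[OF span_base[OF \<psi>]]])
      have "(LINT x|lborel. U x \<bullet> (TF (pt \<phi>) e x - A0 (TF \<phi> e x))) + (LINT x|lborel. (ap B (U x) + 0) \<bullet> TF \<phi> e x) = 0"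
        using w \<phi> unfolding weak_def by blast
      hence z: "(LINT x|lborel. deriv \<theta> x * q x - \<theta> x * (U x \<bullet> A0 \<psi>)) + (LINT x|lborel. \<theta> x * (f x \<bullet> \<psi>)) = 0"
        unfolding A TF\<phi> TF\<phi>t by (simp add: inner_diff_right q_def f_def)
      have comp: "integrable lborel (\<lambda>x. h x * k x)" if h: "cc h" "\<And>x. x \<notin> {s..t+1} \<Longrightarrow> h x = 0" and k: "continuous_on {0..} k" for h k :: "real \<Rightarrow> real"
      proof -
        have eq: "indicator {s..t+1} x *\<^sub>R (h x * k x) = h x * k x" for x using h(2)[of x] by (auto simp: indicator_def)
        have "continuous_on {s..t+1} (\<lambda>x. h x * k x)"
          by (intro continuous_intros cc_continuous[OF h(1)] continuous_on_subset[OF k]) (use st in auto)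
        from continuous_integable[OF this] show ?thesis unfolding set_integrable_def eq .
      qed
      have d\<theta>: "deriv \<theta> x = 0" if "x \<notin> {s..t+1}" for x
      proof -
        have "((\<lambda>x. 0) has_real_derivative 0) (at x)" by simp
        hence "(\<theta> has_real_derivative 0) (at x)"
          by (rule has_field_derivative_transform_within_open[where S = "- {s..t+1}"]) (use that \<theta>(2) in auto)
        thus ?thesis by (rule DERIV_imp_deriv)
      qed
      have i1: "integrable lborel (\<lambda>x. deriv \<theta> x * q x)" by (rule comp[OF cc_deriv(2)[OF \<theta>(1)] d\<theta> qc])
      have i2: "integrable lborel (\<lambda>x. \<theta> x * (U x \<bullet> A0 \<psi>))" by (rule comp[OF \<theta>]) (auto intro!: continuous_intros U)
      have i3: "integrable lborel (\<lambda>x. \<theta> x * (f x \<bullet> \<psi>))" by (rule comp[OF \<theta>]) (auto intro!: continuous_intros f)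
      have "(LINT x|lborel. \<theta> x * m x) = (LINT x|lborel. \<theta> x * (f x \<bullet> \<psi>)) - (LINT x|lborel. \<theta> x * (U x \<bullet> A0 \<psi>))"
        unfolding m_def right_diff_distrib by (rule Bochner_Integration.integral_diff[OF i3 i2])
      moreover have "(LINT x|lborel. deriv \<theta> x * q x - \<theta> x * (U x \<bullet> A0 \<psi>)) = (LINT x|lborel. deriv \<theta> x * q x) - (LINT x|lborel. \<theta> x * (U x \<bullet> A0 \<psi>))"
        by (rule Bochner_Integration.integral_diff[OF i1 i2])
      ultimately show "(LINT x|lborel. deriv \<theta> x * q x) + (LINT x|lborel. \<theta> x * m x) = 0" using z by linarith
    qed
    \<comment> \<open>Starting the integral at t / 2 exhibits the pairing as a primitive near t
      without leaving positive times.\<close>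
    have "((\<lambda>x. q (t/2) + integ (t/2) x m) has_real_derivative 0 + m t) (at t)"
      by (intro DERIV_add DERIV_const integ_deriv[of "t/2" "t+1"] continuous_on_subset[OF mc]) (use t in auto)
    hence "((\<lambda>x. q (t/2) + integ (t/2) x m) has_real_derivative m t) (at t)" by simp
    hence "(q has_real_derivative m t) (at t)"
    proof (rule has_field_derivative_transform_within_open[where S = "{t/2<..<t+1}"])
      fix x assume "x \<in> {t/2<..<t+1}"
      thus "q (t/2) + integ (t/2) x m = q x" using id[of "t/2" x] t by simp
    qed (use t in auto)
    thus ?thesis by (simp add: q_def[abs_def] m_def)
  qed
  show "U t = G t (U 0 + integ 0 t (\<lambda>s. G (- s) (ap B (U s) + 0)))"
    unfolding add_0_right f_def[symmetric]
  proof (rule weak_imp_mild[OF U f _ t])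
    fix \<psi> :: "'v l2" and t :: real assume \<psi>: "\<psi> \<in> span tens" and t: "t > 0"
    from \<psi> have "\<psi> \<in> span tens \<and> ((\<lambda>t. U t \<bullet> \<psi>) has_real_derivative (f t \<bullet> \<psi> - U t \<bullet> A0 \<psi>)) (at t)"
    proof (induction rule: span_induct_alt)
      case base
      have "A0 0 = 0" using A0_scale[OF core_dom[OF \<psi>], of 0] by simp
      thus ?case by (simp add: span_zero)
    next
      case (step c x y)
      have x: "x \<in> dom" "y \<in> dom" using step by (auto intro: core_dom span_base)
      have cx: "c *\<^sub>R x \<in> span tens" using step(1) by (intro span_scale span_base)
      have "((\<lambda>t. c * (U t \<bullet> x) + U t \<bullet> y) has_real_derivative c * (f t \<bullet> x - U t \<bullet> A0 x) + (f t \<bullet> y - U t \<bullet> A0 y)) (at t)"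
        using step(2) by (intro DERIV_add DERIV_cmult der_tens[OF step(1) t]) auto
      moreover have "f t \<bullet> (c *\<^sub>R x + y) - U t \<bullet> A0 (c *\<^sub>R x + y) = c * (f t \<bullet> x - U t \<bullet> A0 x) + (f t \<bullet> y - U t \<bullet> A0 y)"
        unfolding A0_add[OF core_dom[OF cx] x(2)] A0_scale[OF x(1)] by (simp add: inner_add_right algebra_simps)
      moreover have "c *\<^sub>R x + y \<in> span tens" using step(2) cx by (simp add: span_add)
      ultimately show ?case by (simp only: inner_add_right inner_scaleR_right simp_thms)
    qed
    thus "((\<lambda>t. U t \<bullet> \<psi>) has_real_derivative (f t \<bullet> \<psi> - U t \<bullet> A0 \<psi>)) (at t)" by blast
  qed
qed

end

subsection \<open>Integrals of products over three-dimensional space\<close>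

lemma Basis_vec_real: "(Basis :: (real^3) set) = range (\<lambda>j. axis j 1)"
  by (auto simp: Basis_vec_def)

lemma prod_Basis_vec: "(\<Prod>b\<in>(Basis :: (real^3) set). F b) = (\<Prod>j\<in>UNIV. F (axis j 1))"
  unfolding Basis_vec_real by (subst prod.reindex) (auto simp: inj_on_def axis_eq_axis)

lemma nn_integral_prod:
  fixes f :: "3 \<Rightarrow> real \<Rightarrow> ennreal"
  assumes [measurable]: "\<And>j. f j \<in> borel_measurable borel"
  shows "(\<integral>\<^sup>+x. (\<Prod>j\<in>UNIV. f j (x $ j)) \<partial>lborel) = (\<Prod>j\<in>UNIV. (\<integral>\<^sup>+s. f j s \<partial>lborel))"
proof -
  \<comment> \<open>The product formula is indexed by basis vectors, tensor products by coordinates;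
    F translates between the two.\<close>
  define F where "F b = f (THE j. b = axis j (1 :: real))" for b
  have F: "F (axis j 1) = f j" for j unfolding F_def by (simp add: axis_eq_axis)
  have "(\<integral>\<^sup>+x. (\<Prod>b\<in>Basis. F b (x \<bullet> b)) \<partial>lborel) = (\<Prod>b\<in>(Basis :: (real^3) set). (\<integral>\<^sup>+s. F b s \<partial>lborel))"
    by (rule nn_integral_lborel_prod) (auto simp: F_def)
  thus ?thesis unfolding prod_Basis_vec F by (simp add: inner_axis)
qed

text \<open>Lebesgue measure on vectors is the image of a product measure under the sum over basis
  vectors; Fubini for products is applied before taking the image.\<close>

lemma integral_ten:
  assumes h: "\<And>j. integrable lborel (h j)"
  shows "integrable lborel (ten h)" "(LINT x|lborel. ten h x) = (\<Prod>j\<in>UNIV. LINT s|lborel. h j s)"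
proof -
  interpret product_sigma_finite "\<lambda>b::real^3. lborel :: real measure" by standard
  define H where "H b = h (THE j. b = axis j (1 :: real))" for b :: "real^3"
  have H: "H (axis j 1) = h j" for j unfolding H_def by (simp add: axis_eq_axis)
  have [measurable]: "h j \<in> borel_measurable borel" for j using borel_measurable_integrable[OF h] by simp
  have [measurable]: "ten h \<in> borel_measurable borel" unfolding ten_def[abs_def] by measurable
  have c: "(\<Sum>b\<in>Basis. f b *\<^sub>R b) $ j = f (axis j 1)" for f and j :: 3
    using inner_sum_left_Basis[of "axis j 1 :: real^3" f] by (simp add: inner_axis Basis_vec_real)
  have t: "ten h (\<Sum>b\<in>Basis. f b *\<^sub>R b) = (\<Prod>b\<in>Basis. H b (f b))" for f
    unfolding prod_Basis_vec H ten_def c ..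
  have i: "integrable lborel (H b)" for b unfolding H_def by (rule h)
  have m: "(\<lambda>f. \<Sum>b\<in>Basis. f b *\<^sub>R b) \<in> measurable (\<Pi>\<^sub>M b\<in>(Basis :: (real^3) set). lborel) borel" by measurable
  show "integrable lborel (ten h)"
    unfolding lborel_eq[where 'a = "real^3"] by (subst integrable_distr_eq[OF m]) (use product_integrable_prod[OF finite_Basis i] in \<open>simp_all add: t\<close>)
  have "(LINT x|lborel. ten h x) = (\<Prod>b\<in>(Basis :: (real^3) set). LINT s|lborel. H b s)"
    unfolding lborel_eq[where 'a = "real^3"] by (subst integral_distr[OF m]) (simp_all add: t product_integral_prod[OF finite_Basis i])
  thus "(LINT x|lborel. ten h x) = (\<Prod>j\<in>UNIV. LINT s|lborel. h j s)" unfolding prod_Basis_vec H .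
qed

text \<open>The preimage of a null set under a coordinate is a product set with one factor of
  measure 0.\<close>

lemma AE_component:
  assumes "AE s in lborel. P s" shows "AE x in lborel. P ((x :: real^3) $ j)"
proof -
  obtain N where N: "{s. \<not> P s} \<subseteq> N" "N \<in> sets borel" "emeasure lborel N = 0"
    using assms by (auto elim!: AE_E)
  define f :: "3 \<Rightarrow> real \<Rightarrow> ennreal" where "f i = (if i = j then indicator N else (\<lambda>_. 1))" for i
  have [measurable]: "f i \<in> borel_measurable borel" for i using N(2) by (simp add: f_def)
  have [measurable]: "N \<in> sets borel" by (rule N)
  have S: "{x::real^3. x $ j \<in> N} \<in> sets borel" by measurable
  have "indicator {x::real^3. x $ j \<in> N} x = (\<Prod>i\<in>UNIV. f i (x $ i))" for x
  proof -
    have "(\<Prod>i\<in>UNIV. f i (x $ i)) = (\<Prod>i\<in>UNIV. if i = j then indicator N (x $ j) else 1)"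
      by (rule prod.cong) (auto simp: f_def)
    thus ?thesis by (simp add: indicator_def)
  qed
  hence "emeasure lborel {x::real^3. x $ j \<in> N} = (\<Prod>i\<in>UNIV. (\<integral>\<^sup>+s. f i s \<partial>lborel))"
    using S by (subst nn_integral_prod[symmetric]) (auto simp flip: nn_integral_indicator)
  also have "\<dots> = 0"
    by (intro prod_zero bexI[of _ j]) (use N in \<open>auto simp: f_def\<close>)
  finally show ?thesis
    by (intro AE_I[of _ _ "{x::real^3. x $ j \<in> N}"]) (use N S in auto)
qed

subsection \<open>Dilations\<close>

text \<open>The integral has to be signed, while \<open>integ\<close> over a reversed interval is
  0.\<close>

definition stretch :: "(real \<Rightarrow> real) \<Rightarrow> real \<Rightarrow> real" where
  "stretch \<rho> x = (if 0 \<le> x then integ 0 x \<rho> else - integ x 0 \<rho>)"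

text \<open>The lower bound 1 makes the stretching injective and composition with it bounded on
  square integrable functions; the upper bound makes it Lipschitz; \<rho> = 1 on [-r, r] makes it
  the identity there.\<close>

locale dilation =
  fixes \<rho> :: "real \<Rightarrow> real" and C r :: real
  assumes \<rho>m: "\<rho> \<in> borel_measurable borel" and \<rho>1: "1 \<le> \<rho> x" and \<rho>C: "\<rho> x \<le> C"
    and \<rho>r: "\<bar>x\<bar> \<le> r \<Longrightarrow> \<rho> x = 1" and r: "0 \<le> r"
begin

abbreviation "X \<equiv> stretch \<rho>"

lemma rho_abs: "\<bar>\<rho> x\<bar> \<le> C"
  using \<rho>1[of x] \<rho>C[of x] by linarith

lemma integable_bounded:
  assumes "f \<in> borel_measurable borel" "\<And>x. \<bar>f x\<bar> \<le> (K :: real)" shows "integable a b f"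
proof -
  have i: "integrable lborel (\<lambda>x. indicator {a..b} x *\<^sub>R K)" using continuous_integable[of a b "\<lambda>_. K"] unfolding set_integrable_def by simp
  show ?thesis unfolding set_integrable_def
    by (rule Bochner_Integration.integrable_bound[OF i]) (use assms in \<open>auto simp: indicator_def intro: order_trans[OF _ abs_ge_self]\<close>)
qed

lemma integable_rho: "integable a b \<rho>"
  by (rule integable_bounded[OF \<rho>m rho_abs])

lemma X_diff: assumes "a \<le> b" shows "X b - X a = integ a b \<rho>"
proof -
  consider "0 \<le> a" | "b < 0" | "a < 0" "0 \<le> b" by linarith
  thus ?thesis
  proof cases
    case 1 thus ?thesis using assms integ_split[OF integable_rho, of 0 a b] by (simp add: stretch_def)
  next
    case 2 thus ?thesis using assms integ_split[OF integable_rho, of a b 0] by (simp add: stretch_def)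
  next
    case 3 thus ?thesis using integ_split[OF integable_rho, of a 0 b] by (simp add: stretch_def)
  qed
qed

lemma X_bounds: assumes "a \<le> b" shows "b - a \<le> X b - X a" "X b - X a \<le> C * (b - a)"
proof -
  have c: "integ a b (\<lambda>_. K) = K * (b - a)" "integable a b (\<lambda>_. K)" for K :: real
    using assms continuous_integable[of a b "\<lambda>_. K"] by (auto simp: set_lebesgue_integral_def)
  show "b - a \<le> X b - X a" unfolding X_diff[OF assms]
    using set_integral_mono[OF c(2)[of 1] integable_rho \<rho>1] by (simp add: c(1))
  show "X b - X a \<le> C * (b - a)" unfolding X_diff[OF assms]
    using set_integral_mono[OF integable_rho c(2)[of C] \<rho>C] by (simp add: c(1))
qed

lemma X_less_iff: "X a < X b \<longleftrightarrow> a < b"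
  using X_bounds(1)[of a b] X_bounds(1)[of b a] by (cases "a < b") auto

lemma X_0: "X 0 = 0"
  using integ_refl[of 0 \<rho>] by (simp add: stretch_def)

lemma X_id: assumes x: "\<bar>x\<bar> \<le> r" shows "X x = x"
proof -
  have 1: "integ a b \<rho> = b - a" if "a \<le> b" "- r \<le> a" "b \<le> r" for a b
  proof -
    have "integ a b \<rho> = integ a b (\<lambda>_. 1)"
      by (rule set_lebesgue_integral_cong) (use that in \<open>auto intro!: \<rho>r\<close>)
    thus ?thesis using that by (simp add: set_lebesgue_integral_def)
  qed
  show ?thesis using 1[of 0 x] 1[of x 0] x r by (auto simp: stretch_def)
qed

lemma X_abs_le_iff: "\<bar>X x\<bar> \<le> r \<longleftrightarrow> \<bar>x\<bar> \<le> r"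
  using X_less_iff[of r x] X_less_iff[of x "- r"] X_id[of r] X_id[of "- r"] r by (auto simp: abs_le_iff)

lemma X_continuous: "continuous_on UNIV X"
proof -
  have "C \<ge> 1" using \<rho>1[of 0] \<rho>C[of 0] by linarith
  have "dist (X a) (X b) \<le> C * dist a b" for a b
    using X_bounds[of a b] X_bounds[of b a] by (cases "a \<le> b") (auto simp: dist_real_def)
  hence "C-lipschitz_on UNIV X" using \<open>C \<ge> 1\<close> by (intro lipschitz_onI) auto
  thus ?thesis by (rule lipschitz_on_continuous_on)
qed

lemma X_measurable [measurable]: "X \<in> borel_measurable borel"
  by (rule borel_measurable_continuous_onI[OF X_continuous])

lemma X_surj: "\<exists>x. X x = y"
proof -
  have c: "continuous_on {- \<bar>y\<bar>..\<bar>y\<bar>} X" by (rule continuous_on_subset[OF X_continuous]) auto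
  have "X (- \<bar>y\<bar>) \<le> y" "y \<le> X \<bar>y\<bar>" using X_bounds(1)[of "- \<bar>y\<bar>" 0] X_bounds(1)[of 0 "\<bar>y\<bar>"] X_0 by auto
  thus ?thesis using IVT'[of X "- \<bar>y\<bar>" y "\<bar>y\<bar>", OF _ _ _ c] by auto
qed

lemma nn_integral_rho:
  assumes "l \<le> u"
  shows "(\<integral>\<^sup>+s. ennreal (\<rho> s) * indicator {l<..<u} (X s) \<partial>lborel) = ennreal (u - l)"
proof -
  obtain a b where ab: "X a = l" "X b = u" using X_surj by metis
  have "a \<le> b" using assms X_less_iff[of b a] ab by simp
  have i: "integrable lborel (\<lambda>s. indicator {a..b} s *\<^sub>R \<rho> s)" using integable_rho unfolding set_integrable_def .
  have "(\<integral>\<^sup>+s. ennreal (\<rho> s) * indicator {l<..<u} (X s) \<partial>lborel) = (\<integral>\<^sup>+s. ennreal (indicator {a..b} s *\<^sub>R \<rho> s) \<partial>lborel)"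
  proof (rule nn_integral_cong_AE)
    show "AE s in lborel. ennreal (\<rho> s) * indicator {l<..<u} (X s) = ennreal (indicator {a..b} s *\<^sub>R \<rho> s)"
      using AE_lborel_singleton[of a] AE_lborel_singleton[of b]
    proof eventually_elim
      case (elim s)
      have "X s \<in> {l<..<u} \<longleftrightarrow> s \<in> {a..b}" using X_less_iff[of a s] X_less_iff[of s b] ab elim by auto
      thus ?case by (simp add: indicator_def)
    qed
  qed
  also have "\<dots> = ennreal (integ a b \<rho>)"
    unfolding set_lebesgue_integral_def
    by (rule nn_integral_eq_integral[OF i]) (use \<rho>1 in \<open>auto simp: indicator_def intro: order_trans[OF zero_le_one]\<close>)
  also have "\<dots> = ennreal (u - l)" using X_diff[OF \<open>a \<le> b\<close>] ab by simp
  finally show ?thesis .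
qed

text \<open>As \<rho> is only measurable and bounded, no differentiability of X is used: the image
  of the measure with density \<rho> gives each interval its length, which characterizes Lebesgue
  measure.\<close>

lemma lborel_X: "lborel = distr (density lborel (\<lambda>s. ennreal (\<rho> s))) borel X"
proof (rule lborel_eqI)
  fix l u :: real assume "\<And>b. b \<in> Basis \<Longrightarrow> l \<bullet> b \<le> u \<bullet> b"
  hence lu: "l \<le> u" by simp
  have [measurable]: "\<rho> \<in> borel_measurable borel" by (rule \<rho>m)
  have "emeasure (distr (density lborel (\<lambda>s. ennreal (\<rho> s))) borel X) {l<..<u} = (\<integral>\<^sup>+s. ennreal (\<rho> s) * indicator (X -` {l<..<u}) s \<partial>lborel)"
    using measurable_sets[OF X_measurable, of "{l<..<u}"] by (simp add: emeasure_distr emeasure_density)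
  also have "\<dots> = (\<integral>\<^sup>+s. ennreal (\<rho> s) * indicator {l<..<u} (X s) \<partial>lborel)" by (simp add: indicator_def)
  finally show "emeasure (distr (density lborel (\<lambda>s. ennreal (\<rho> s))) borel X) (box l u) = (\<Prod>b\<in>Basis. (u - l) \<bullet> b)"
    unfolding nn_integral_rho[OF lu] by simp
qed simp

text \<open>The fundamental theorem for f between X a and X b, followed by the change of variables;
  pointwise derivatives of X do not occur.\<close>

lemma X_chain:
  assumes f: "cc f" and ab: "a \<le> b"
  shows "f (X b) - f (X a) = integ a b (\<lambda>s. deriv f (X s) * \<rho> s)"
proof -
  have [measurable]: "\<rho> \<in> borel_measurable borel" "deriv f \<in> borel_measurable borel"
    by (auto intro: \<rho>m cc_measurable cc_deriv f)
  have le: "X a \<le> X b" using X_bounds(1)[OF ab] ab by linarith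
  have "f (X b) - f (X a) = integ (X a) (X b) (deriv f)"
    by (rule integ_FTC[symmetric]) (use f le in \<open>auto intro: cc_continuous cc_deriv\<close>)
  also have "\<dots> = (LINT s|lborel. \<rho> s *\<^sub>R (indicator {X a..X b} (X s) *\<^sub>R deriv f (X s)))"
    unfolding set_lebesgue_integral_def
    by (subst lborel_X, subst integral_distr, measurable, subst integral_density)
       (measurable, use \<rho>1 in \<open>auto intro: order_trans[OF zero_le_one]\<close>)
  also have "\<dots> = integ a b (\<lambda>s. deriv f (X s) * \<rho> s)"
    unfolding set_lebesgue_integral_def
  proof (rule Bochner_Integration.integral_cong[OF refl])
    fix s
    have "X s \<in> {X a..X b} \<longleftrightarrow> s \<in> {a..b}" using X_less_iff[of s a] X_less_iff[of b s] by auto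
    thus "\<rho> s *\<^sub>R (indicator {X a..X b} (X s) *\<^sub>R deriv f (X s)) = indicator {a..b} s *\<^sub>R (deriv f (X s) * \<rho> s)"
      by (simp add: indicator_def)
  qed
  finally show ?thesis .
qed

lemma integrable_cc_mult:
  assumes g: "cc g" and k: "k \<in> borel_measurable borel" "\<And>s. \<bar>k s\<bar> \<le> K"
  shows "integrable lborel (\<lambda>s. k s * g s :: real)"
proof -
  obtain M where M: "\<And>s. \<bar>s\<bar> > M \<Longrightarrow> g s = 0" using g by (auto simp: cc_def)
  obtain C' where C': "\<And>s. \<bar>g s\<bar> \<le> C'" using cc_bounded[OF g] by blast
  have [measurable]: "g \<in> borel_measurable borel" by (rule cc_measurable[OF g])
  note k(1)[measurable]
  have i: "integable (- M) M (\<lambda>s. k s * g s)"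
  proof (rule integable_bounded)
    show "\<bar>k s * g s\<bar> \<le> K * C'" for s unfolding abs_mult by (intro mult_mono k C') (use order_trans[OF abs_ge_zero k(2)] in auto)
  qed measurable
  have eq: "indicator {- M..M} s *\<^sub>R (k s * g s) = k s * g s" for s using M[of s] by (cases "\<bar>s\<bar> > M") (auto simp: indicator_def abs_le_iff not_less)
  show ?thesis using i unfolding set_integrable_def eq .
qed

text \<open>The composition of f with X is a primitive of the bounded function
  \<open>deriv f (X s) * \<rho> s\<close>, which is what \<open>integ_by_parts\<close> asks of its
  nonsmooth factor.\<close>

lemma X_by_parts:
  assumes f: "cc f" and g: "cc g"
  shows "(LINT s|lborel. f (X s) * deriv g s) = - (LINT s|lborel. deriv f (X s) * \<rho> s * g s)"
proof -
  have [measurable]: "\<rho> \<in> borel_measurable borel" "deriv f \<in> borel_measurable borel" "f \<in> borel_measurable borel" "g \<in> borel_measurable borel" "deriv g \<in> borel_measurable borel"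
    by (auto intro: \<rho>m cc_measurable cc_deriv f g)
  obtain M0 where M0: "\<And>s. \<bar>s\<bar> > M0 \<Longrightarrow> g s = 0" using g by (auto simp: cc_def)
  obtain M1 where M1: "\<And>s. \<bar>s\<bar> > M1 \<Longrightarrow> deriv g s = 0" using cc_deriv(2)[OF g] by (auto simp: cc_def)
  define M where "M = max 0 (max M0 M1) + 1"
  have M: "M > 0" "\<And>s. \<bar>s\<bar> \<ge> M \<Longrightarrow> g s = 0" "\<And>s. \<bar>s\<bar> \<ge> M \<Longrightarrow> deriv g s = 0" by (auto simp: M_def intro!: M0 M1)
  obtain C' where C': "\<And>s. \<bar>deriv f s\<bar> \<le> C'" using cc_bounded[OF cc_deriv(2)[OF f]] by blast
  \<comment> \<open>Translation by M moves the support of g into [0, 2 M], because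
    \<open>integ_by_parts\<close> starts at 0.\<close>
  define k where "k t = deriv f (X (t - M)) * \<rho> (t - M)" for t
  have [measurable]: "k \<in> borel_measurable borel" unfolding k_def[abs_def] by measurable
  have sh: "(LINT s|lborel. h s) = integ 0 (2 * M) (\<lambda>t. h (t - M))" if "\<And>s. \<bar>s\<bar> > M \<Longrightarrow> h s = 0" "h \<in> borel_measurable borel" for h :: "real \<Rightarrow> real"
  proof -
    have "(LINT s|lborel. h s) = (LINT t|lborel. h (t + - M))" by (rule integral_lborel_shift(1)[OF that(2), symmetric])
    also have "\<dots> = integ 0 (2 * M) (\<lambda>t. h (t - M))"
      unfolding set_lebesgue_integral_def
    proof (rule Bochner_Integration.integral_cong[OF refl])
      fix t show "h (t + - M) = indicator {0..2 * M} t *\<^sub>R h (t - M)"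
        using that(1)[of "t - M"] by (cases "t \<in> {0..2*M}") (auto simp: abs_if split: if_splits)
    qed
    finally show ?thesis .
  qed
  have d: "((\<lambda>t. g (t - M)) has_vector_derivative deriv g (t - M)) (at t)" for t
    using DERIV_shift[of g "deriv g (t - M)" t "- M"] cc_deriv(1)[OF g, of "t - M"]
    by (simp add: has_real_derivative_iff_has_vector_derivative)
  have "integ 0 (2 * M) (\<lambda>t. f (X (t - M)) \<bullet> deriv g (t - M)) =
      f (X (2 * M - M)) \<bullet> g (2 * M - M) - f (X (0 - M)) \<bullet> g (0 - M) - integ 0 (2 * M) (\<lambda>s. k s \<bullet> g (s - M))"
  proof (rule integ_by_parts)
    show "0 \<le> 2 * M" using M by simp
    show "integable 0 (2 * M) k"
    proof (rule integable_bounded)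
      show "\<bar>k s\<bar> \<le> C' * C" for s unfolding k_def abs_mult
        by (intro mult_mono C' rho_abs) (use order_trans[OF abs_ge_zero C'] in auto)
    qed measurable
    show "continuous_on {0..2 * M} (\<lambda>t. deriv g (t - M))"
      by (rule continuous_on_compose2[OF cc_continuous[OF cc_deriv(2)[OF g], of UNIV]]) (auto intro: continuous_intros)
    fix t :: real assume t: "0 \<le> t"
    have "f (X (t - M)) - f (X (0 - M)) = integ (0 - M) (t - M) (\<lambda>s. deriv f (X s) * \<rho> s)" using t by (intro X_chain[OF f]) simp
    also have "\<dots> = (LINT s|lborel. indicator {0 - M..t - M} (s + - M) *\<^sub>R (deriv f (X (s + - M)) * \<rho> (s + - M)))"
      unfolding set_lebesgue_integral_def by (rule integral_lborel_shift(1)[symmetric]) measurable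
    also have "\<dots> = integ 0 t k" unfolding set_lebesgue_integral_def k_def
      by (rule Bochner_Integration.integral_cong) (auto simp: indicator_def)
    finally show "f (X (t - M)) = f (X (0 - M)) + integ 0 t k" by simp
  qed (rule d)
  hence "integ 0 (2 * M) (\<lambda>t. f (X (t - M)) * deriv g (t - M)) = - integ 0 (2 * M) (\<lambda>t. deriv f (X (t - M)) * \<rho> (t - M) * g (t - M))"
    using M(2)[of M] M(2)[of "- M"] M(1) by (simp add: k_def)
  thus ?thesis
    by (subst (1 2) sh) (use M in auto)
qed

end

locale dilation3 =
  fixes \<rho> :: "3 \<Rightarrow> real \<Rightarrow> real" and C :: real and r :: "3 \<Rightarrow> real"
  assumes dil: "dilation (\<rho> j) C (r j)"
begin

sublocale dilation "\<rho> j" C "r j" for j by (rule dil)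

definition X3 :: "real^3 \<Rightarrow> real^3" where "X3 x = (\<chi> j. stretch (\<rho> j) (x $ j))"

lemma X3_nth [simp]: "X3 x $ j = stretch (\<rho> j) (x $ j)"
  by (simp add: X3_def)

lemma X3_measurable [measurable]: "X3 \<in> borel_measurable borel"
proof -
  have "continuous_on UNIV X3"
    unfolding X3_def[abs_def] by (intro continuous_on_vec_lambda continuous_on_compose2[OF X_continuous]) (auto intro: continuous_intros)
  thus ?thesis by (rule borel_measurable_continuous_onI)
qed

definition J :: "real^3 \<Rightarrow> real" where "J x = (\<Prod>j\<in>UNIV. \<rho> j (x $ j))"

lemma J_measurable [measurable]: "J \<in> borel_measurable borel"
  unfolding J_def[abs_def] using \<rho>m by measurable

lemma J_ge_1: "1 \<le> J x"
  unfolding J_def by (rule prod_ge_1) (rule \<rho>1)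

text \<open>Density and indicator of a box both factor over the coordinates, so the one-variable
  computation yields the volume of every box.\<close>

lemma lborel_X3: "lborel = distr (density lborel (\<lambda>x. ennreal (J x))) borel X3"
proof (rule lborel_eqI)
  fix l u :: "real^3" assume B: "\<And>b. b \<in> Basis \<Longrightarrow> l \<bullet> b \<le> u \<bullet> b"
  hence lu: "l $ j \<le> u $ j" for j using B[of "axis j 1"] by (simp add: Basis_vec_real inner_axis)
  have [measurable]: "\<rho> j \<in> borel_measurable borel" for j by (rule \<rho>m)
  have "emeasure (distr (density lborel (\<lambda>x. ennreal (J x))) borel X3) (box l u) = (\<integral>\<^sup>+x. ennreal (J x) * indicator (X3 -` box l u) x \<partial>lborel)"
    using measurable_sets[OF X3_measurable, of "box l u"] by (simp add: emeasure_distr emeasure_density)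
  also have "\<dots> = (\<integral>\<^sup>+x. (\<Prod>j\<in>UNIV. ennreal (\<rho> j (x $ j)) * indicator {l $ j<..<u $ j} (stretch (\<rho> j) (x $ j))) \<partial>lborel)"
  proof (rule nn_integral_cong)
    fix x
    have "ennreal (J x) = (\<Prod>j\<in>UNIV. ennreal (\<rho> j (x $ j)))"
      unfolding J_def by (rule prod_ennreal[symmetric]) (rule order_trans[OF zero_le_one \<rho>1])
    moreover have "indicator (X3 -` box l u) x = (\<Prod>j\<in>UNIV. indicator {l $ j<..<u $ j} (stretch (\<rho> j) (x $ j)) :: ennreal)"
      by (auto simp: mem_box_cart indicator_def)
    ultimately show "ennreal (J x) * indicator (X3 -` box l u) x = (\<Prod>j\<in>UNIV. ennreal (\<rho> j (x $ j)) * indicator {l $ j<..<u $ j} (stretch (\<rho> j) (x $ j)))"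
      by (simp add: prod.distrib)
  qed
  also have "\<dots> = (\<Prod>j\<in>UNIV. ennreal (u $ j - l $ j))"
    by (subst nn_integral_prod) (auto simp: nn_integral_rho lu)
  also have "\<dots> = ennreal (\<Prod>b\<in>Basis. (u - l) \<bullet> b)"
    unfolding prod_Basis_vec by (simp add: prod_ennreal lu inner_axis)
  finally show "emeasure (distr (density lborel (\<lambda>x. ennreal (J x))) borel X3) (box l u) = (\<Prod>b\<in>Basis. (u - l) \<bullet> b)" .
qed simp

text \<open>The Jacobian J is at least 1, so dropping it can only decrease the integral. Hence
  composition with \<open>X3\<close> is a contraction on square integrable functions and respects
  equality almost everywhere.\<close>

lemma nn_integral_X3:
  assumes [measurable]: "f \<in> borel_measurable borel"
  shows "(\<integral>\<^sup>+x. f (X3 x) \<partial>lborel) \<le> (\<integral>\<^sup>+x. f x \<partial>lborel)"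
proof -
  have "(\<integral>\<^sup>+x. f (X3 x) \<partial>lborel) \<le> (\<integral>\<^sup>+x. ennreal (J x) * f (X3 x) \<partial>lborel)"
  proof (rule nn_integral_mono)
    fix x
    have "1 * f (X3 x) \<le> ennreal (J x) * f (X3 x)" by (intro mult_right_mono) (use J_ge_1[of x] in \<open>auto simp: ennreal_1[symmetric] simp del: ennreal_1\<close>)
    thus "f (X3 x) \<le> ennreal (J x) * f (X3 x)" by simp
  qed
  also have "\<dots> = (\<integral>\<^sup>+x. f x \<partial>lborel)"
    by (subst (2) lborel_X3, subst nn_integral_distr, measurable, subst nn_integral_density) measurable
  finally show ?thesis .
qed

lemma AE_X3:
  assumes "AE y in lborel. P y" shows "AE x in lborel. P (X3 x)"
proof -
  obtain N where N: "{s. \<not> P s} \<subseteq> N" "N \<in> sets borel" "emeasure lborel N = 0"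
    using assms by (auto elim!: AE_E)
  have [measurable]: "N \<in> sets borel" by (rule N)
  have "(\<integral>\<^sup>+x. indicator N (X3 x) \<partial>lborel) \<le> (\<integral>\<^sup>+x. indicator N x \<partial>lborel)" by (rule nn_integral_X3) measurable
  also have "\<dots> = 0" using N by simp
  finally have "AE x in lborel. indicator N (X3 x) = (0 :: ennreal)" by (subst nn_integral_0_iff_AE[symmetric]) auto
  thus ?thesis by eventually_elim (use N(1) in \<open>auto simp: indicator_def split: if_splits\<close>)
qed

lemma L2_X3: assumes f: "L2 f" shows "L2 (\<lambda>x. f (X3 x))" "norm (cls (\<lambda>x. f (X3 x))) \<le> norm (cls f)"
proof -
  have [measurable]: "f \<in> borel_measurable borel" using f by (rule L2_measurable)
  have le: "(\<integral>\<^sup>+x. ennreal ((norm (f (X3 x)))\<^sup>2) \<partial>lborel) \<le> (\<integral>\<^sup>+x. ennreal ((norm (f x))\<^sup>2) \<partial>lborel)" by (rule nn_integral_X3) measurable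
  have fin: "(\<integral>\<^sup>+x. ennreal ((norm (f x))\<^sup>2) \<partial>lborel) = ennreal (LINT x|lborel. (norm (f x))\<^sup>2)"
    by (rule nn_integral_eq_integral[OF L2_integrable[OF f]]) simp
  have i: "integrable lborel (\<lambda>x. (norm (f (X3 x)))\<^sup>2)"
    by (rule integrableI_bounded) (use le fin in \<open>auto simp: less_top[symmetric] top_unique\<close>)
  thus L: "L2 (\<lambda>x. f (X3 x))" unfolding L2_def by simp
  have "ennreal (LINT x|lborel. (norm (f (X3 x)))\<^sup>2) \<le> ennreal (LINT x|lborel. (norm (f x))\<^sup>2)"
    using le unfolding fin by (subst (asm) nn_integral_eq_integral[OF i]) auto
  hence "(LINT x|lborel. (norm (f (X3 x)))\<^sup>2) \<le> (LINT x|lborel. (norm (f x))\<^sup>2)"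
    by (subst (asm) ennreal_le_iff) (auto intro!: Bochner_Integration.integral_nonneg)
  thus "norm (cls (\<lambda>x. f (X3 x))) \<le> norm (cls f)" by (simp add: norm_cls[OF f] norm_cls[OF L] L2_norm_def)
qed

definition K3 :: "'v::euclidean_space l2 \<Rightarrow> 'v l2" where "K3 u = cls (\<lambda>x. fn u (X3 x))"

lemma K3_cls: assumes f: "L2 f" shows "K3 (cls f) = cls (\<lambda>x. f (X3 x))"
  unfolding K3_def by (rule cls_cong[OF AE_X3[OF fn_cls[OF f]]]) (intro L2_X3 L2_fn f)+

lemma bounded_linear_K3: "bounded_linear K3"
proof (rule bounded_linear_intro[where K = 1])
  fix u v :: "'a l2" and c :: real
  have "K3 (u + v) = K3 (cls (\<lambda>x. fn u x + fn v x))" by (simp add: cls_add)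
  also have "\<dots> = K3 u + K3 v" by (subst K3_cls[OF L2_add]) (simp_all add: K3_def cls_add L2_X3)
  finally show "K3 (u + v) = K3 u + K3 v" .
  have "K3 (c *\<^sub>R u) = K3 (cls (\<lambda>x. c *\<^sub>R fn u x))" by (simp add: cls_scaleR)
  also have "\<dots> = c *\<^sub>R K3 u" by (subst K3_cls[OF L2_scaleR]) (simp_all add: K3_def cls_scaleR L2_X3)
  finally show "K3 (c *\<^sub>R u) = c *\<^sub>R K3 u" .
  show "norm (K3 u) \<le> norm u * 1" using L2_X3(2)[of "fn u"] by (simp add: K3_def)
qed

lemma X3_region: "(\<forall>j. \<bar>x $ j\<bar> \<le> r j) \<Longrightarrow> X3 x = x"
  by (simp add: vec_eq_iff X_id)

lemma X3_region_iff: "(\<forall>j. \<bar>X3 x $ j\<bar> \<le> r j) \<longleftrightarrow> (\<forall>j. \<bar>x $ j\<bar> \<le> r j)"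
  by (simp add: X_abs_le_iff)

text \<open>For distinct i, j, k the weight over l \<noteq> i is \<rho> j times \<rho> k. The factor
  \<rho> j is consumed by the one-variable integration by parts in direction j, and \<rho> k
  remains.\<close>

lemma ten_by_parts:
  assumes f: "\<forall>j. cc (f j)" and g: "\<forall>j. cc (g j)" and d: "i \<noteq> j" "j \<noteq> k" "i \<noteq> k"
  shows "integrable lborel (\<lambda>x. ten (f(j := deriv (f j))) (X3 x) * ten g x * (\<Prod>l\<in>UNIV - {i}. \<rho> l (x $ l)))"
    and "integrable lborel (\<lambda>x. ten f (X3 x) * ten (g(j := deriv (g j))) x * \<rho> k (x $ k))"
    and "(LINT x|lborel. ten (f(j := deriv (f j))) (X3 x) * ten g x * (\<Prod>l\<in>UNIV - {i}. \<rho> l (x $ l))) =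
       - (LINT x|lborel. ten f (X3 x) * ten (g(j := deriv (g j))) x * \<rho> k (x $ k))"
proof -
  have U: "UNIV = {i, j, k}"
  proof (rule card_subset_eq[symmetric])
    show "card {i, j, k} = card (UNIV :: 3 set)" using d by simp
  qed auto
  have P: "(\<Prod>l\<in>UNIV. F l) = F i * F j * F k" for F :: "3 \<Rightarrow> real"
    unfolding U using d by simp
  have Ui: "UNIV - {i} = {j, k}" unfolding U using d by auto
  have Q: "(\<Prod>l\<in>UNIV - {i}. F l) = F j * F k" for F :: "3 \<Rightarrow> real"
    unfolding Ui using d by simp
  have [measurable]: "\<rho> l \<in> borel_measurable borel" "f l \<in> borel_measurable borel" "deriv (f l) \<in> borel_measurable borel" for l
    using f by (auto intro: \<rho>m cc_measurable cc_deriv)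
  have "\<forall>l. \<exists>K. \<forall>s. \<bar>f l s\<bar> \<le> K" using f cc_bounded by blast
  then obtain F where "\<forall>l s. \<bar>f l s\<bar> \<le> F l" using choice[of "\<lambda>l K. \<forall>s. \<bar>f l s\<bar> \<le> K"] by blast
  hence F: "\<bar>f l s\<bar> \<le> F l" for l s by blast
  have "\<forall>l. \<exists>K. \<forall>s. \<bar>deriv (f l) s\<bar> \<le> K" using f cc_bounded cc_deriv(2) by blast
  then obtain F' where "\<forall>l s. \<bar>deriv (f l) s\<bar> \<le> F' l" using choice[of "\<lambda>l K. \<forall>s. \<bar>deriv (f l) s\<bar> \<le> K"] by blast
  hence F': "\<bar>deriv (f l) s\<bar> \<le> F' l" for l s by blast
  have pos: "0 \<le> F l" "0 \<le> F' l" for l using order_trans[OF abs_ge_zero F] order_trans[OF abs_ge_zero F'] by auto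
  \<comment> \<open>p collects the one-variable factors, including the surviving weight in direction
    k; q and q' replace it in direction j before and after the integration by parts.\<close>
  define p where "p l s = f l (stretch (\<rho> l) s) * (if l = k then \<rho> k s else 1) * g l s" for l s
  define q q' where "q s = deriv (f j) (stretch (\<rho> j) s) * \<rho> j s * g j s" and "q' s = f j (stretch (\<rho> j) s) * deriv (g j) s" for s
  have C1: "1 \<le> C" using \<rho>1[of j 0] \<rho>C[of j 0] by linarith
  have pi: "integrable lborel (p l)" for l
    unfolding p_def
  proof (rule integrable_cc_mult)
    show "\<bar>f l (stretch (\<rho> l) s) * (if l = k then \<rho> k s else 1)\<bar> \<le> F l * C" for s
      unfolding abs_mult by (intro mult_mono F pos) (use rho_abs C1 in auto)
  qed (use g in auto)
  have qi: "integrable lborel q"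
    unfolding q_def
  proof (rule integrable_cc_mult)
    show "\<bar>deriv (f j) (stretch (\<rho> j) s) * \<rho> j s\<bar> \<le> F' j * C" for s
      unfolding abs_mult by (intro mult_mono F' pos rho_abs) auto
  qed (use g in auto)
  have q'i: "integrable lborel q'"
    unfolding q'_def by (rule integrable_cc_mult[of _ _ "F j"]) (use g F in \<open>auto intro: cc_deriv\<close>)
  have i1: "integrable lborel ((p(j := q)) l)" and i2: "integrable lborel ((p(j := q')) l)" for l using pi qi q'i by auto
  have e1: "ten (f(j := deriv (f j))) (X3 x) * ten g x * (\<Prod>l\<in>UNIV - {i}. \<rho> l (x $ l)) = ten (p(j := q)) x" for x
    unfolding ten_def P Q using d by (simp add: p_def q_def)
  have e2: "ten f (X3 x) * ten (g(j := deriv (g j))) x * \<rho> k (x $ k) = ten (p(j := q')) x" for x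
    unfolding ten_def P using d by (simp add: p_def q'_def)
  show "integrable lborel (\<lambda>x. ten (f(j := deriv (f j))) (X3 x) * ten g x * (\<Prod>l\<in>UNIV - {i}. \<rho> l (x $ l)))"
    unfolding e1 by (rule integral_ten(1)[OF i1])
  show "integrable lborel (\<lambda>x. ten f (X3 x) * ten (g(j := deriv (g j))) x * \<rho> k (x $ k))"
    unfolding e2 by (rule integral_ten(1)[OF i2])
  have "(LINT s|lborel. q s) = - (LINT s|lborel. q' s)"
    using X_by_parts[of "f j" "g j" j] f g by (simp add: q_def q'_def)
  thus "(LINT x|lborel. ten (f(j := deriv (f j))) (X3 x) * ten g x * (\<Prod>l\<in>UNIV - {i}. \<rho> l (x $ l))) =
       - (LINT x|lborel. ten f (X3 x) * ten (g(j := deriv (g j))) x * \<rho> k (x $ k))"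
    unfolding e1 e2 integral_ten(2)[OF i1] integral_ten(2)[OF i2] P using d by simp
qed

end

subsection \<open>The Maxwell matrices\<close>

definition mx :: "3 \<Rightarrow> complex^3^3" where
  "mx j = (if j = 1 then A1 else if j = 2 then A2 else A3)"

definition dg :: "(3 \<Rightarrow> real) \<Rightarrow> complex^3 \<Rightarrow> complex^3" where
  "dg w v = (\<chi> k. w k *\<^sub>R v $ k)"

lemma mx_zero: "i = j \<or> j = k \<or> i = k \<Longrightarrow> mx j $ i $ k = 0"
proof -
  have "\<forall>j i k :: 3. i = j \<or> j = k \<or> i = k \<longrightarrow> mx j $ i $ k = 0"
    unfolding forall_3 by (simp add: mx_def A1_def A2_def A3_def)
  thus "i = j \<or> j = k \<or> i = k \<Longrightarrow> mx j $ i $ k = 0" by blast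
qed

lemma mx_cnj: "mx j $ k $ i = cnj (mx j $ i $ k)"
proof -
  have "\<forall>j i k :: 3. mx j $ k $ i = cnj (mx j $ i $ k)"
    unfolding forall_3 by (simp add: mx_def A1_def A2_def A3_def)
  thus ?thesis by blast
qed

text \<open>This is the contribution of one matrix entry to the pairing. Diagonal weights to the
  left or right of the matrix then show up as factors with the row or the column index.\<close>

definition mc :: "3 \<Rightarrow> complex^3 \<Rightarrow> complex^3 \<Rightarrow> 3 \<Rightarrow> 3 \<Rightarrow> real" where
  "mc j v w i k = (mx j $ i $ k * v $ k) \<bullet> w $ i"

lemma dg_inner: "dg d v \<bullet> w = (\<Sum>k\<in>UNIV. d k * (v $ k \<bullet> w $ k))"
  by (simp add: inner_vec_def dg_def)

lemma dg_1: "dg (\<lambda>_. 1) v = v"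
  by (simp add: dg_def)

lemma mx_inner1: "dg d (mx j *v v) \<bullet> w = (\<Sum>i\<in>UNIV. \<Sum>k\<in>UNIV. d i * mc j v w i k)"
  by (simp add: dg_inner matrix_vector_mult_def mc_def inner_sum_left sum_distrib_left)

text \<open>Hermitian symmetry of the matrices lets the same entries serve, now weighted by the
  column index.\<close>

lemma mx_inner2: "dg d v \<bullet> (mx j *v w) = (\<Sum>i\<in>UNIV. \<Sum>k\<in>UNIV. d k * mc j v w i k)"
proof -
  have "v $ k \<bullet> (mx j $ k $ i * w $ i) = mc j v w i k" for i k
    unfolding mc_def mx_cnj[of j k i] by (simp add: inner_complex_def algebra_simps)
  hence "dg d v \<bullet> (mx j *v w) = (\<Sum>k\<in>UNIV. \<Sum>i\<in>UNIV. d k * mc j v w i k)"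
    by (simp add: dg_inner matrix_vector_mult_def inner_sum_right sum_distrib_left)
  also have "\<dots> = (\<Sum>i\<in>UNIV. \<Sum>k\<in>UNIV. d k * mc j v w i k)" by (rule sum.swap)
  finally show ?thesis .
qed

lemma mx_sym: "(mx j *v v) \<bullet> w = v \<bullet> (mx j *v w)"
  using mx_inner1[of "\<lambda>_. 1" j v w] mx_inner2[of "\<lambda>_. 1" v j w] by (simp add: dg_1)

lemma mx_linear: "linear ((*v) (mx j))"
  by (rule linearI) (simp_all add: vec_eq_iff matrix_vector_mult_def scaleR_sum_right distrib_left sum.distrib)

lemma padm_sum:
  fixes M :: "'i \<Rightarrow> 'v::euclidean_space \<Rightarrow> 'w::euclidean_space"
  assumes fin: "finite I" and M: "\<And>i. i \<in> I \<Longrightarrow> linear (M i)"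
    and h: "\<And>i. i \<in> I \<Longrightarrow> h i \<in> borel_measurable borel" "\<And>i x. i \<in> I \<Longrightarrow> \<bar>h i x\<bar> \<le> c i"
  shows "\<exists>K. padm (\<lambda>x v. \<Sum>i\<in>I. h i x *\<^sub>R M i v) K"
proof -
  have bl: "bounded_linear (M i)" if "i \<in> I" for i using M[OF that] by (simp add: linear_conv_bounded_linear)
  show ?thesis
  proof (intro exI[of _ "\<Sum>i\<in>I. \<bar>c i\<bar> * onorm (M i)"], unfold padm_def, intro conjI ballI allI)
    fix f :: "real^3 \<Rightarrow> 'v" assume [measurable]: "f \<in> borel_measurable borel"
    show "(\<lambda>x. \<Sum>i\<in>I. h i x *\<^sub>R M i (f x)) \<in> borel_measurable borel"
    proof (rule borel_measurable_sum)
      fix i assume i: "i \<in> I"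
      have [measurable]: "h i \<in> borel_measurable borel" "M i \<in> borel_measurable borel"
        using h(1)[OF i] linear_continuous_on[OF bl[OF i]] by (auto intro: borel_measurable_continuous_onI)
      show "(\<lambda>x. h i x *\<^sub>R M i (f x)) \<in> borel_measurable borel" by measurable
    qed
  next
    fix x show "linear (\<lambda>v. \<Sum>i\<in>I. h i x *\<^sub>R M i v)"
      using M by (intro linear_compose_sum linear_compose_scale_right ballI) auto
  next
    fix x v
    have "norm (\<Sum>i\<in>I. h i x *\<^sub>R M i v) \<le> (\<Sum>i\<in>I. \<bar>c i\<bar> * onorm (M i) * norm v)"
    proof (rule sum_norm_le)
      fix i assume i: "i \<in> I"
      have "\<bar>h i x\<bar> * norm (M i v) \<le> \<bar>c i\<bar> * (onorm (M i) * norm v)"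
        by (intro mult_mono order_trans[OF h(2)[OF i] abs_ge_self] onorm[OF bl[OF i]]) auto
      thus "norm (h i x *\<^sub>R M i v) \<le> \<bar>c i\<bar> * onorm (M i) * norm v" by (simp add: mult.assoc)
    qed
    thus "norm (\<Sum>i\<in>I. h i x *\<^sub>R M i v) \<le> (\<Sum>i\<in>I. \<bar>c i\<bar> * onorm (M i)) * norm v" by (simp add: sum_distrib_right)
  qed
qed

text \<open>A diagonal multiplication is a sum of coordinate projections with scalar weights; M and
  N on either side place it in a block of the pair space.\<close>

lemma padm_dg:
  assumes "\<And>k. (\<lambda>x. w x k) \<in> borel_measurable borel" "\<And>x k. \<bar>w x k\<bar> \<le> c"
    and M: "linear M" and N: "linear N"
  shows "\<exists>K. padm (\<lambda>x v. M (dg (w x) (N v))) K"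
proof -
  have l: "linear (\<lambda>v. axis k (v $ k) :: complex^3)" for k
    by (rule linearI) (auto simp: vec_eq_iff axis_def)
  have L: "linear (\<lambda>v. M (axis k (N v $ k)))" for k
    using linear_compose[OF linear_compose[OF N l[of k]] M] by (simp add: o_def)
  have "dg (w x) v = (\<Sum>k\<in>UNIV. w x k *\<^sub>R axis k (v $ k))" for x v
    by (simp add: vec_eq_iff dg_def axis_def if_distrib cong: if_cong)
  hence eq: "M (dg (w x) (N v)) = (\<Sum>k\<in>UNIV. w x k *\<^sub>R M (axis k (N v $ k)))" for x v
    by (simp add: linear_sum[OF M] linear_cmul[OF M])
  show ?thesis unfolding eq by (rule padm_sum[of UNIV "\<lambda>k v. M (axis k (N v $ k))" "\<lambda>k x. w x k" "\<lambda>_. c"]) (use assms L in auto)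
qed

context dilation3
begin

text \<open>The dilation intertwines the Maxwell operator with its weighted version; the only algebra involved
  is that a matrix entry of \<open>mx j\<close> in position \<open>(i, k)\<close> vanishes unless \<open>i\<close>, \<open>j\<close>, \<open>k\<close> are distinct.\<close>

lemma Maxwell_by_parts:
  assumes f: "\<forall>j. cc (f j)" and g: "\<forall>j. cc (g j)"
  shows "(LINT x|lborel. ten (f(j := deriv (f j))) (X3 x) * ten g x * (dg (\<lambda>i. \<Prod>l\<in>UNIV - {i}. \<rho> l (x $ l)) (mx j *v v) \<bullet> w)) =
       - (LINT x|lborel. ten f (X3 x) * ten (g(j := deriv (g j))) x * (dg (\<lambda>k. \<rho> k (x $ k)) v \<bullet> (mx j *v w)))"
proof -
  define P where "P i x = ten (f(j := deriv (f j))) (X3 x) * ten g x * (\<Prod>l\<in>UNIV - {i}. \<rho> l (x $ l))" for i x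
  define Q where "Q k x = ten f (X3 x) * ten (g(j := deriv (g j))) x * \<rho> k (x $ k)" for k x
  have z: "mc j v w i k = 0" if "\<not> (i \<noteq> j \<and> j \<noteq> k \<and> i \<noteq> k)" for i k
    using mx_zero[of i j k] that by (auto simp: mc_def)
  have P: "integrable lborel (\<lambda>x. P i x * mc j v w i k)" and Q: "integrable lborel (\<lambda>x. Q k x * mc j v w i k)"
    and PQ: "(LINT x|lborel. P i x * mc j v w i k) = - (LINT x|lborel. Q k x * mc j v w i k)" for i k
  proof -
    have "integrable lborel (\<lambda>x. P i x * mc j v w i k) \<and> integrable lborel (\<lambda>x. Q k x * mc j v w i k)
      \<and> (LINT x|lborel. P i x * mc j v w i k) = - (LINT x|lborel. Q k x * mc j v w i k)"
    proof (cases "i \<noteq> j \<and> j \<noteq> k \<and> i \<noteq> k")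
      case True
      thus ?thesis using ten_by_parts[OF f g, of i j k] unfolding P_def Q_def by auto
    qed (simp add: z)
    thus "integrable lborel (\<lambda>x. P i x * mc j v w i k)" "integrable lborel (\<lambda>x. Q k x * mc j v w i k)"
      "(LINT x|lborel. P i x * mc j v w i k) = - (LINT x|lborel. Q k x * mc j v w i k)" by auto
  qed
  have "(LINT x|lborel. ten (f(j := deriv (f j))) (X3 x) * ten g x * (dg (\<lambda>i. \<Prod>l\<in>UNIV - {i}. \<rho> l (x $ l)) (mx j *v v) \<bullet> w)) =
      (LINT x|lborel. (\<Sum>i\<in>UNIV. \<Sum>k\<in>UNIV. P i x * mc j v w i k))"
    unfolding mx_inner1 P_def by (simp only: sum_distrib_left mult.assoc)
  also have "\<dots> = (\<Sum>i\<in>UNIV. \<Sum>k\<in>UNIV. LINT x|lborel. P i x * mc j v w i k)"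
    by (subst Bochner_Integration.integral_sum | intro Bochner_Integration.integrable_sum P sum.cong refl)+
  also have "\<dots> = - (\<Sum>i\<in>UNIV. \<Sum>k\<in>UNIV. LINT x|lborel. Q k x * mc j v w i k)"
    unfolding PQ by (simp only: sum_negf)
  also have "(\<Sum>i\<in>UNIV. \<Sum>k\<in>UNIV. LINT x|lborel. Q k x * mc j v w i k) = (LINT x|lborel. (\<Sum>i\<in>UNIV. \<Sum>k\<in>UNIV. Q k x * mc j v w i k))"
    by (subst Bochner_Integration.integral_sum | intro Bochner_Integration.integrable_sum Q sum.cong refl)+
  also have "\<dots> = (LINT x|lborel. ten f (X3 x) * ten (g(j := deriv (g j))) x * (dg (\<lambda>k. \<rho> k (x $ k)) v \<bullet> (mx j *v w)))"
    unfolding mx_inner2 Q_def by (simp only: sum_distrib_left mult.assoc)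
  finally show ?thesis .
qed

end

lemma padm_add: "padm b K \<Longrightarrow> padm c K' \<Longrightarrow> padm (\<lambda>x v. b x v + c x v) (K + K')"
  unfolding padm_def
  by (auto intro!: borel_measurable_add linear_compose_add order_trans[OF norm_triangle_ineq] add_mono simp: distrib_right)

lemma L2_continuous_on_padm:
  assumes b: "padm b K" and u: "L2_continuous_on J u"
  shows "L2_continuous_on J (\<lambda>t x. b x (u t x))"
proof -
  have u': "\<And>t. t \<in> J \<Longrightarrow> L2 (u t)" "continuous_on J (\<lambda>t. cls (u t))" using u unfolding L2_continuous_on_iff by auto
  have "continuous_on J (\<lambda>t. mop b (cls (u t)))" by (rule bounded_linear.continuous_on[OF bounded_linear_mop[OF b] u'(2)])
  hence "continuous_on J (\<lambda>t. cls (\<lambda>x. b x (u t x)))"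
    by (rule continuous_on_eq) (simp add: mop_cls[OF b u'(1)])
  thus ?thesis unfolding L2_continuous_on_iff using L2_padm[OF b] u' by auto
qed

text \<open>The pairing is an iterated integral, so equality almost everywhere in space at each
  relevant time is enough.\<close>

lemma distr_of_cong:
  assumes "\<And>t. t \<in> J \<Longrightarrow> AE x in lborel. y t x = y' t x"
    and "\<And>t. t \<in> J \<Longrightarrow> y t \<in> borel_measurable borel" "\<And>t. t \<in> J \<Longrightarrow> y' t \<in> borel_measurable borel"
    and \<phi>: "\<phi> \<in> test_functions \<Omega>" and off: "\<And>t x. \<phi> (t, x) \<noteq> 0 \<Longrightarrow> t \<in> J"
  shows "distr_of y \<phi> = distr_of y' \<phi>"
  unfolding distr_of_def
proof (rule Bochner_Integration.integral_cong[OF refl])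
  fix t
  show "(LINT x|lborel. \<phi> (t, x) *\<^sub>R y t x) = (LINT x|lborel. \<phi> (t, x) *\<^sub>R y' t x)"
  proof (cases "t \<in> J")
    case True
    have "continuous_on UNIV (\<lambda>x. \<phi> (t, x))" using test_section[OF \<phi>] by blast
    hence [measurable]: "(\<lambda>x. \<phi> (t, x)) \<in> borel_measurable borel" by (rule borel_measurable_continuous_onI)
    have [measurable]: "y t \<in> borel_measurable borel" "y' t \<in> borel_measurable borel" using True assms by auto
    show ?thesis
    proof (rule integral_cong_AE)
      show "AE x in lborel. \<phi> (t, x) *\<^sub>R y t x = \<phi> (t, x) *\<^sub>R y' t x" using assms(1)[OF True] by eventually_elim simp
    qed measurable
  next
    case False
    hence "\<phi> (t, x) = 0" for x using off by blast
    thus ?thesis by simp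
  qed
qed

section \<open>Maxwell's equations and the split system as symmetric hyperbolic systems\<close>

interpretation MX: sym_hyp "\<lambda>j v. mx j *v v"
  by (rule sym_hyp.intro) (rule mx_linear, rule mx_sym)

text \<open>W satisfies an ordinary differential equation in time, so its block has no spatial
  derivatives; the coupling of V and W is left to a bounded perturbation.\<close>

interpretation PM: sym_hyp "\<lambda>j (vw :: (complex^3) \<times> (complex^3)). (mx j *v fst vw, 0)"
proof (rule sym_hyp.intro)
  fix j and v w :: "(complex^3) \<times> (complex^3)"
  show "linear (\<lambda>vw :: (complex^3) \<times> (complex^3). (mx j *v fst vw, 0 :: complex^3))"
    by (rule linearI) (simp_all add: linear_add[OF mx_linear] linear_cmul[OF mx_linear])
  show "(mx j *v fst v, 0) \<bullet> w = v \<bullet> (mx j *v fst w, 0)" by (simp add: inner_prod_def mx_sym)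
qed

lemma Maxwell_op_eq: "Maxwell_op T \<phi> = dt T \<phi> + (\<Sum>j\<in>UNIV. mx j *v dx j T \<phi>)"
  by (simp add: Maxwell_op_def sum_3 mx_def add.assoc)

lemma Maxwell_op_inner:
  assumes y: "L2_continuous_on J y" and J: "closed J" and \<phi>: "\<phi> \<in> test_functions \<Omega>" and \<Omega>: "\<Omega> \<subseteq> J \<times> UNIV"
  shows "Maxwell_op (distr_of y) \<phi> \<bullet> e = - (LINT t|lborel. cls (y t) \<bullet> (TF (pt \<phi>) e t - MX.A0 (TF \<phi> e t)))"
proof -
  have off: "t \<in> J" if "\<theta> \<in> test_functions \<Omega>" "\<theta> (t, x) \<noteq> 0" for \<theta> t x
    using test_function_props(5)[OF that] \<Omega> by blast
  have yc: "continuous_on J (\<lambda>t. cls (y t))" using y unfolding L2_continuous_on_iff by auto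
  note p = test_function_props(3)[OF \<phi>]
  have d: "distr_of y (\<lambda>z. frechet_derivative \<phi> (at z) v) \<bullet> e = (LINT t|lborel. cls (y t) \<bullet> TF (\<lambda>z. frechet_derivative \<phi> (at z) v) e t)" for v e
    by (rule distr_of_continuous[OF y J p]) (rule off[OF p])
  have i: "integrable lborel (\<lambda>t. cls (y t) \<bullet> TF (\<lambda>z. frechet_derivative \<phi> (at z) v) e t)" for v and e :: "complex^3"
    by (rule pairing_integrable[OF yc J p]) (rule off[OF p])
  have "Maxwell_op (distr_of y) \<phi> \<bullet> e = - (LINT t|lborel. cls (y t) \<bullet> TF (pt \<phi>) e t) - (\<Sum>j\<in>UNIV. LINT t|lborel. cls (y t) \<bullet> TF (px j \<phi>) (mx j *v e) t)"
    by (simp add: Maxwell_op_eq inner_add_left inner_sum_left mx_sym dt_def dx_def d sum_negf linear_neg[OF mx_linear] inner_diff_left inner_minus_left)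
  also have "\<dots> = - (LINT t|lborel. cls (y t) \<bullet> TF (pt \<phi>) e t + (\<Sum>j\<in>UNIV. cls (y t) \<bullet> TF (px j \<phi>) (mx j *v e) t))"
  proof -
    have s: "integrable lborel (\<lambda>t. \<Sum>j\<in>UNIV. cls (y t) \<bullet> TF (px j \<phi>) (mx j *v e) t)" by (rule Bochner_Integration.integrable_sum) (rule i)
    have "(LINT t|lborel. (\<Sum>j\<in>UNIV. cls (y t) \<bullet> TF (px j \<phi>) (mx j *v e) t)) = (\<Sum>j\<in>UNIV. LINT t|lborel. cls (y t) \<bullet> TF (px j \<phi>) (mx j *v e) t)"
      by (rule Bochner_Integration.integral_sum) (rule i)
    with Bochner_Integration.integral_add[OF i s, of "(1, 0)" e] show ?thesis by simp
  qed
  also have "(\<lambda>t. cls (y t) \<bullet> TF (pt \<phi>) e t + (\<Sum>j\<in>UNIV. cls (y t) \<bullet> TF (px j \<phi>) (mx j *v e) t)) = (\<lambda>t. cls (y t) \<bullet> (TF (pt \<phi>) e t - MX.A0 (TF \<phi> e t)))"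
    unfolding MX.A0_TF(2)[OF \<phi>] by (simp add: inner_add_right inner_sum_right)
  finally show ?thesis .
qed

lemma solves_Maxwell_iff:
  assumes y: "L2_continuous_on J y" and J: "closed J" and \<Omega>: "\<Omega> \<subseteq> J \<times> UNIV" and F: "L1_loc_L2 F"
  shows "solves_Maxwell \<Omega> F y \<longleftrightarrow> MX.weak \<Omega> 0 (\<lambda>t. cls (y t)) (\<lambda>t. cls (F t))"
proof -
  have "(Maxwell_op (distr_of y) \<phi> = distr_of F \<phi>) \<longleftrightarrow>
     (\<forall>e. (LINT t|lborel. cls (y t) \<bullet> (TF (pt \<phi>) e t - MX.A0 (TF \<phi> e t))) + (LINT t|lborel. (ap 0 (cls (y t)) + cls (F t)) \<bullet> TF \<phi> e t) = 0)"
    if \<phi>: "\<phi> \<in> test_functions \<Omega>" for \<phi>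
    unfolding vector_eq_rdot[symmetric, of "Maxwell_op (distr_of y) \<phi>"] Maxwell_op_inner[OF y J \<phi> \<Omega>] distr_of_L1_loc[OF F \<phi>]
    by (intro iff_allI) (auto simp: ap_simps)
  thus ?thesis unfolding solves_Maxwell_def MX.weak_def by blast
qed

text \<open>Sources act on the equation for V only. The dummy position argument makes this a
  constant field in the sense of \<open>padm\<close>.\<close>

definition emb :: "real^3 \<Rightarrow> complex^3 \<Rightarrow> (complex^3) \<times> (complex^3)" where "emb x v = (v, 0)"

lemma padm_emb: "\<exists>K. padm emb K"
proof -
  have "linear (\<lambda>v :: complex^3. (v, 0 :: complex^3))" by (rule linearI) auto
  from padm_const[OF this] show ?thesis by (simp add: emb_def[abs_def])
qed

lemma padm_fst: "\<exists>K. padm (\<lambda>_. fst :: (complex^3) \<times> (complex^3) \<Rightarrow> complex^3) K"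
  by (rule padm_const) (rule bounded_linear.linear[OF bounded_linear_fst])

lemma padm_snd: "\<exists>K. padm (\<lambda>_. snd :: (complex^3) \<times> (complex^3) \<Rightarrow> complex^3) K"
  by (rule padm_const) (rule bounded_linear.linear[OF bounded_linear_snd])

lemma TF_zero: "(\<And>x. \<phi> (t, x) = 0) \<Longrightarrow> TF \<phi> e t = 0"
  by (simp add: TF_def cls_0)

lemma pair_inner:
  fixes y :: "real^3 \<Rightarrow> (complex^3) \<times> (complex^3)"
  assumes \<phi>: "\<phi> \<in> test_functions \<Omega>" and y: "L2 y \<or> (\<forall>x. \<phi> (t, x) = 0)"
  shows "cls y \<bullet> TF \<phi> (e, e') t = cls (\<lambda>x. fst (y x)) \<bullet> TF \<phi> e t + cls (\<lambda>x. snd (y x)) \<bullet> TF \<phi> e' t"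
  using y
proof
  assume L: "L2 y"
  obtain K K' where p: "padm (\<lambda>_. fst :: (complex^3) \<times> (complex^3) \<Rightarrow> complex^3) K" "padm (\<lambda>_. snd :: (complex^3) \<times> (complex^3) \<Rightarrow> complex^3) K'"
    using padm_fst padm_snd by blast
  note L' = L2_padm[OF p(1) L] L2_padm[OF p(2) L] and T = TF_L2[OF \<phi>]
  show ?thesis
    unfolding TF_def inner_cls[OF L T] inner_cls[OF L'(1) T] inner_cls[OF L'(2) T]
    by (subst Bochner_Integration.integral_add[symmetric, OF L2_inner[OF L'(1) T] L2_inner[OF L'(2) T]]) (simp add: inner_prod_def)
next
  assume "\<forall>x. \<phi> (t, x) = 0"
  hence "\<phi> (t, x) = 0" for x by blast
  thus ?thesis by (simp add: TF_zero)
qed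

lemma diag3_dg: "diag3 (w 1) (w 2) (w 3) *v v = dg w v"
  by (simp add: vec_eq_iff forall_3 diag3_def dg_def matrix_vector_mult_def sum_3 scaleR_conv_of_real)

definition sig1 :: "(3 \<Rightarrow> real) \<Rightarrow> 3 \<Rightarrow> real" where "sig1 s k = (\<Sum>i\<in>UNIV. s i) - 2 * s k"

definition sig2 :: "(3 \<Rightarrow> real) \<Rightarrow> 3 \<Rightarrow> real" where "sig2 s k = (\<Prod>i\<in>UNIV - {k}. s k - s i)"

lemma UNIV_minus_3: "UNIV - {1 :: 3} = {2, 3}" "UNIV - {2 :: 3} = {1, 3}" "UNIV - {3 :: 3} = {1, 2}"
  unfolding set_eq_iff forall_3 by simp_all

lemma Sigma_dg:
  "Sigma_mat \<sigma> x *v v = dg (\<lambda>k. \<sigma> k (x $ k)) v"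
  "Sigma1_mat \<sigma> x *v v = dg (sig1 (\<lambda>k. \<sigma> k (x $ k))) v"
  "Sigma2_mat \<sigma> x *v v = dg (sig2 (\<lambda>k. \<sigma> k (x $ k))) v"
proof -
  let ?s = "\<lambda>k. \<sigma> k (x $ k)"
  have 1: "sig1 ?s 1 = ?s 2 + ?s 3 - ?s 1" "sig1 ?s 2 = ?s 3 + ?s 1 - ?s 2" "sig1 ?s 3 = ?s 1 + ?s 2 - ?s 3"
    by (simp_all add: sig1_def sum_3)
  have 2: "sig2 ?s 1 = (?s 1 - ?s 2) * (?s 1 - ?s 3)" "sig2 ?s 2 = (?s 2 - ?s 1) * (?s 2 - ?s 3)"
      "sig2 ?s 3 = (?s 3 - ?s 1) * (?s 3 - ?s 2)"
    by (simp_all add: sig2_def UNIV_minus_3)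
  show "Sigma_mat \<sigma> x *v v = dg ?s v"
    unfolding Sigma_mat_def by (rule diag3_dg[of ?s])
  show "Sigma1_mat \<sigma> x *v v = dg (sig1 ?s) v" "Sigma2_mat \<sigma> x *v v = dg (sig2 ?s) v"
    using diag3_dg[of "sig1 ?s" v] diag3_dg[of "sig2 ?s" v] unfolding Sigma1_mat_def Sigma2_mat_def Let_def 1 2 by blast+
qed

text \<open>The sign, the bound and the vanishing of \<sigma> hold almost everywhere only; s is a
  representative with these properties at every point, as the pointwise coordinate stretching
  demands.\<close>

locale absorption =
  fixes \<sigma> s :: "3 \<Rightarrow> real \<Rightarrow> real" and C :: real and L :: "3 \<Rightarrow> real"
  assumes \<sigma>m: "\<sigma> j \<in> borel_measurable borel" and \<sigma>s: "AE t in lborel. \<sigma> j t = s j t"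
    and sm: "s j \<in> borel_measurable borel" and s0: "0 \<le> s j t" and sC: "s j t \<le> C"
    and sL: "\<bar>t\<bar> \<le> L j \<Longrightarrow> s j t = 0" and L0: "0 < L j"
begin

abbreviation "S x \<equiv> \<lambda>k. s k (x $ k)"

lemma AE_S: "AE x in lborel. (\<lambda>k. \<sigma> k (x $ k)) = S x"
proof -
  have "AE x in lborel. \<forall>k. \<sigma> k (x $ k) = s k (x $ k)"
    using AE_component[OF \<sigma>s] by (simp add: AE_all_countable)
  thus ?thesis by (simp add: fun_eq_iff)
qed

lemma C0: "0 \<le> C" using s0[of undefined undefined] sC[of undefined undefined] by linarith

lemma S_meas [measurable]: "(\<lambda>x. S x k) \<in> borel_measurable borel"
  using sm by measurable

lemma sig_meas [measurable]: "(\<lambda>x. sig1 (S x) k) \<in> borel_measurable borel" "(\<lambda>x. sig2 (S x) k) \<in> borel_measurable borel"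
  unfolding sig1_def sig2_def by measurable

lemma sig_bounds: "\<bar>S x k\<bar> \<le> C" "\<bar>sig1 (S x) k\<bar> \<le> 5 * C" "\<bar>sig2 (S x) k\<bar> \<le> C\<^sup>2"
proof -
  show "\<bar>S x k\<bar> \<le> C" using s0 sC by (simp add: abs_le_iff order_trans[OF _ s0])
  have b: "0 \<le> S x i" "S x i \<le> C" for i using s0 sC by auto
  show "\<bar>sig1 (S x) k\<bar> \<le> 5 * C"
    using b[of 1] b[of 2] b[of 3] b[of k] unfolding sig1_def sum_3 by linarith
  have "\<bar>sig2 (S x) k\<bar> = (\<Prod>i\<in>UNIV - {k}. \<bar>S x k - S x i\<bar>)" unfolding sig2_def by (rule abs_prod)
  also have "\<dots> \<le> (\<Prod>i\<in>UNIV - {k}. C)"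
  proof (rule prod_mono)
    fix i show "0 \<le> \<bar>S x k - S x i\<bar> \<and> \<bar>S x k - S x i\<bar> \<le> C" using b[of i] b[of k] by linarith
  qed
  also have "\<dots> = C\<^sup>2" by (simp add: card_Diff_subset)
  finally show "\<bar>sig2 (S x) k\<bar> \<le> C\<^sup>2" .
qed

text \<open>The terms of order zero stand on the right-hand side of the evolution equation, which
  explains the signs.\<close>

definition bP :: "real^3 \<Rightarrow> (complex^3) \<times> (complex^3) \<Rightarrow> (complex^3) \<times> (complex^3)" where
  "bP x vw = (- dg (sig1 (S x)) (fst vw) - dg (sig2 (S x)) (snd vw), fst vw - dg (S x) (snd vw))"

lemma linear_pair:
  "linear (\<lambda>v :: complex^3. (- v, 0 :: complex^3))" "linear (\<lambda>v :: complex^3. (0 :: complex^3, v))" "linear (\<lambda>v :: complex^3. (0 :: complex^3, - v))"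
  "linear (fst :: (complex^3) \<times> (complex^3) \<Rightarrow> complex^3)" "linear (snd :: (complex^3) \<times> (complex^3) \<Rightarrow> complex^3)" "linear (\<lambda>v :: complex^3. v)"
  by (auto intro!: linearI)

lemma padm_Sigma:
  "\<exists>K. padm (\<lambda>x vw :: (complex^3) \<times> (complex^3). dg (sig1 (S x)) (fst vw)) K"
  "\<exists>K. padm (\<lambda>x vw :: (complex^3) \<times> (complex^3). dg (sig2 (S x)) (snd vw)) K"
  "\<exists>K. padm (\<lambda>x vw :: (complex^3) \<times> (complex^3). dg (S x) (snd vw)) K"
  by (rule padm_dg[OF sig_meas(1) sig_bounds(2) linear_pair(6,4)], rule padm_dg[OF sig_meas(2) sig_bounds(3) linear_pair(6,5)],
      rule padm_dg[of S, OF S_meas sig_bounds(1) linear_pair(6,5)])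

lemma padm_bP: "\<exists>K. padm bP K"
proof -
  obtain K1 K2 K3 K4 where
    "padm (\<lambda>x vw :: (complex^3) \<times> (complex^3). (- dg (sig1 (S x)) (fst vw), 0 :: complex^3)) K1"
    "padm (\<lambda>x vw :: (complex^3) \<times> (complex^3). (- dg (sig2 (S x)) (snd vw), 0 :: complex^3)) K2"
    "padm (\<lambda>x vw :: (complex^3) \<times> (complex^3). (0 :: complex^3, dg (\<lambda>_. 1) (fst vw))) K3"
    "padm (\<lambda>x vw :: (complex^3) \<times> (complex^3). (0 :: complex^3, - dg (S x) (snd vw))) K4"
    using padm_dg[of "\<lambda>x. sig1 (S x)", OF sig_meas(1) sig_bounds(2) linear_pair(1,4)]
      padm_dg[of "\<lambda>x. sig2 (S x)", OF sig_meas(2) sig_bounds(3) linear_pair(1,5)]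
      padm_dg[of "\<lambda>_ _. 1" 1, OF _ _ linear_pair(2,4)]
      padm_dg[of S, OF S_meas sig_bounds(1) linear_pair(3,5)] by auto
  from padm_add[OF padm_add[OF this(1,2)] padm_add[OF this(3,4)]]
  have "padm bP (K1 + K2 + (K3 + K4))" by (simp add: bP_def[abs_def] dg_1)
  thus ?thesis ..
qed

definition B where "B = op (mop bP)"

lemma ap_B: "ap B = mop bP"
  unfolding B_def using padm_bP bounded_linear_mop by (metis ap_op)

text \<open>Testing with a pair (e, e') adds the two equations; the choices e' = 0 and e = 0
  separate them again. Exchanging \<sigma> for s alters the products on null sets only.\<close>

lemma solves_PML_iff:
  assumes u: "L2_continuous_on J u" and J: "closed J" and \<Omega>: "\<Omega> \<subseteq> J \<times> UNIV" and F: "L1_loc_L2 F"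
  shows "solves_PML \<sigma> \<Omega> F u \<longleftrightarrow> PM.weak \<Omega> B (\<lambda>t. cls (u t)) (\<lambda>t. mop emb (cls (F t)))"
proof -
  define V where "V t x = fst (u t x)" for t x
  define W where "W t x = snd (u t x)" for t x
  define Y1 where "Y1 t x = dg (sig1 (S x)) (V t x)" for t x
  define Y2 where "Y2 t x = dg (sig2 (S x)) (W t x)" for t x
  define Y3 where "Y3 t x = dg (S x) (W t x)" for t x
  have V: "L2_continuous_on J V" and W: "L2_continuous_on J W" and Y1: "L2_continuous_on J Y1"
    and Y2: "L2_continuous_on J Y2" and Y3: "L2_continuous_on J Y3"
    using padm_fst padm_snd padm_Sigma L2_continuous_on_padm[OF _ u]
    unfolding V_def[abs_def] W_def[abs_def] Y1_def[abs_def] Y2_def[abs_def] Y3_def[abs_def] by blast+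
  have L: "\<And>t. t \<in> J \<Longrightarrow> L2 (u t)" "\<And>t. t \<in> J \<Longrightarrow> L2 (V t)" "\<And>t. t \<in> J \<Longrightarrow> L2 (W t)" "\<And>t. t \<in> J \<Longrightarrow> L2 (Y1 t)" "\<And>t. t \<in> J \<Longrightarrow> L2 (Y2 t)" "\<And>t. t \<in> J \<Longrightarrow> L2 (Y3 t)"
    using u V W Y1 Y2 Y3 unfolding L2_continuous_on_def by auto
  have Jc: "continuous_on J (\<lambda>t. cls (y t))" if "L2_continuous_on J y" for y :: "real \<Rightarrow> real^3 \<Rightarrow> complex^3"
    using that unfolding L2_continuous_on_iff by auto
  obtain K where K: "padm bP K" using padm_bP by blast
  obtain Ke where Ke: "padm emb Ke" using padm_emb by blast
  have main: "(Maxwell_op (distr_of V) \<phi> + distr_of (\<lambda>t x. Sigma1_mat \<sigma> x *v V t x) \<phi> + distr_of (\<lambda>t x. Sigma2_mat \<sigma> x *v W t x) \<phi> = distr_of F \<phi> \<and>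
        dt (distr_of W) \<phi> + distr_of (\<lambda>t x. Sigma_mat \<sigma> x *v W t x) \<phi> - distr_of V \<phi> = 0) \<longleftrightarrow>
     (\<forall>e. (LINT t|lborel. cls (u t) \<bullet> (TF (pt \<phi>) e t - PM.A0 (TF \<phi> e t))) + (LINT t|lborel. (ap B (cls (u t)) + mop emb (cls (F t))) \<bullet> TF \<phi> e t) = 0)"
    if \<phi>: "\<phi> \<in> test_functions \<Omega>" for \<phi>
  proof -
    have off: "t \<in> J" if "\<theta> \<in> test_functions \<Omega>" "\<theta> (t, x) \<noteq> 0" for \<theta> t x
      using test_function_props(5)[OF that] \<Omega> by blast
    note p = test_function_props(3)[OF \<phi>]
    have m: "(\<lambda>x. Sigma1_mat \<sigma> x *v V t x) \<in> borel_measurable borel" "(\<lambda>x. Sigma2_mat \<sigma> x *v W t x) \<in> borel_measurable borel"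
        "(\<lambda>x. Sigma_mat \<sigma> x *v W t x) \<in> borel_measurable borel" if t: "t \<in> J" for t
    proof -
      have [measurable]: "V t \<in> borel_measurable borel" "W t \<in> borel_measurable borel" "\<sigma> k \<in> borel_measurable borel" for k
        using L t \<sigma>m by (auto intro: L2_measurable)
      have comp: "(\<lambda>x. f x) \<in> borel_measurable borel" if "\<And>i. (\<lambda>x. f x $ i) \<in> borel_measurable borel" for f :: "real^3 \<Rightarrow> complex^3"
        by (subst borel_measurable_euclidean_space) (use that in \<open>auto simp: Basis_vec_def inner_axis\<close>)
      have c: "(\<lambda>x. h x $ i) \<in> borel_measurable borel" if "h \<in> borel_measurable borel" for h :: "real^3 \<Rightarrow> complex^3" and i
        by (rule measurable_compose[OF that]) (intro borel_measurable_continuous_onI continuous_intros)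
      have [measurable]: "(\<lambda>x. V t x $ i) \<in> borel_measurable borel" "(\<lambda>x. W t x $ i) \<in> borel_measurable borel" for i by (rule c, measurable)+
      show "(\<lambda>x. Sigma1_mat \<sigma> x *v V t x) \<in> borel_measurable borel" "(\<lambda>x. Sigma2_mat \<sigma> x *v W t x) \<in> borel_measurable borel"
        "(\<lambda>x. Sigma_mat \<sigma> x *v W t x) \<in> borel_measurable borel"
        unfolding Sigma_dg dg_def sig1_def sig2_def by (rule comp, simp only: vec_lambda_beta, measurable)+
    qed
    have e1: "distr_of (\<lambda>t x. Sigma1_mat \<sigma> x *v V t x) \<phi> = distr_of Y1 \<phi>"
      by (rule distr_of_cong[OF _ m(1) L2_measurable[OF L(4)] \<phi> off[OF \<phi>]])
        (use AE_S in \<open>auto elim!: eventually_mono simp: Sigma_dg Y1_def\<close>)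
    have e2: "distr_of (\<lambda>t x. Sigma2_mat \<sigma> x *v W t x) \<phi> = distr_of Y2 \<phi>"
      by (rule distr_of_cong[OF _ m(2) L2_measurable[OF L(5)] \<phi> off[OF \<phi>]])
        (use AE_S in \<open>auto elim!: eventually_mono simp: Sigma_dg Y2_def\<close>)
    have e3: "distr_of (\<lambda>t x. Sigma_mat \<sigma> x *v W t x) \<phi> = distr_of Y3 \<phi>"
      by (rule distr_of_cong[OF _ m(3) L2_measurable[OF L(6)] \<phi> off[OF \<phi>]])
        (use AE_S in \<open>auto elim!: eventually_mono simp: Sigma_dg Y3_def\<close>)
    define I where "I y \<theta> e = (LINT t|lborel. cls (y t) \<bullet> TF \<theta> e t)" for y :: "real \<Rightarrow> real^3 \<Rightarrow> complex^3" and \<theta> e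
    have d: "distr_of y \<theta> \<bullet> e = I y \<theta> e" and i: "integrable lborel (\<lambda>t. cls (y t) \<bullet> TF \<theta> e t)"
      if "L2_continuous_on J y" "\<theta> \<in> test_functions \<Omega>" for y \<theta> e
      using distr_of_continuous[OF that(1) J that(2) off[OF that(2)]] pairing_integrable[OF Jc[OF that(1)] J that(2) off[OF that(2)]]
      unfolding I_def by auto
    define G where "G e = (LINT t|lborel. cls (F t) \<bullet> TF \<phi> e t)" for e
    have iF: "integrable lborel (\<lambda>t. cls (F t) \<bullet> TF \<phi> e t)" for e by (rule pairing_integrable_L1[OF L1_loc_L2_integable[OF F] \<phi>])
    have split: "L2 (u t) \<or> (\<forall>x. \<theta> (t, x) = 0)" if "\<theta> \<in> test_functions \<Omega>" for \<theta> t
      using off[OF that] L(1) by blast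
    have A: "(LINT t|lborel. cls (u t) \<bullet> (TF (pt \<phi>) (e, e') t - PM.A0 (TF \<phi> (e, e') t))) =
        - (Maxwell_op (distr_of V) \<phi> \<bullet> e) + I W (pt \<phi>) e'" for e e'
    proof -
      have A0: "PM.A0 (TF \<phi> (e, e') t) = - (\<Sum>j\<in>UNIV. TF (px j \<phi>) (mx j *v e, 0) t)" for t
        unfolding PM.A0_TF(2)[OF \<phi>] by simp
      have z: "TF \<theta> 0 t = 0" for \<theta> and t by (simp add: TF_def cls_0)
      have "cls (u t) \<bullet> (TF (pt \<phi>) (e, e') t - PM.A0 (TF \<phi> (e, e') t)) =
          cls (V t) \<bullet> (TF (pt \<phi>) e t - MX.A0 (TF \<phi> e t)) + cls (W t) \<bullet> TF (pt \<phi>) e' t" for t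
        unfolding A0 MX.A0_TF(2)[OF \<phi>] V_def[abs_def] W_def[abs_def]
        by (simp add: inner_add_right inner_sum_right pair_inner[OF p split[OF p]] z)
      moreover have "integrable lborel (\<lambda>t. cls (V t) \<bullet> (TF (pt \<phi>) e t - MX.A0 (TF \<phi> e t)))"
        unfolding MX.A0_TF(2)[OF \<phi>]
        by (simp add: inner_add_right inner_sum_right) (intro Bochner_Integration.integrable_add Bochner_Integration.integrable_sum i[OF V p])
      ultimately show ?thesis unfolding Maxwell_op_inner[OF V J \<phi> \<Omega>] I_def by (simp add: i[OF W p])
    qed
    have Bt: "(ap B (cls (u t)) + mop emb (cls (F t))) \<bullet> TF \<phi> (e, e') t =
       - (cls (Y1 t) \<bullet> TF \<phi> e t) - (cls (Y2 t) \<bullet> TF \<phi> e t) + cls (F t) \<bullet> TF \<phi> e t + cls (V t) \<bullet> TF \<phi> e' t - cls (Y3 t) \<bullet> TF \<phi> e' t" for e e' t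
    proof -
      have Fp: "mop emb (cls (F t)) \<bullet> TF \<phi> (e, e') t = cls (F t) \<bullet> TF \<phi> e t"
        using pair_inner[OF \<phi>, of "\<lambda>x. (fn (cls (F t)) x, 0)" t e e'] L2_padm[OF Ke L2_fn[of "cls (F t)"]]
        by (simp add: mop_def emb_def cls_0)
      show ?thesis
      proof (cases "t \<in> J")
        case True
        have "ap B (cls (u t)) = cls (\<lambda>x. bP x (u t x))" unfolding ap_B by (rule mop_cls[OF K L(1)[OF True]])
        also have "\<dots> \<bullet> TF \<phi> (e, e') t = cls (\<lambda>x. - Y1 t x - Y2 t x) \<bullet> TF \<phi> e t + cls (\<lambda>x. V t x - Y3 t x) \<bullet> TF \<phi> e' t"
          by (subst pair_inner[OF \<phi>]) (use L2_padm[OF K L(1)[OF True]] in \<open>auto simp: bP_def Y1_def Y2_def Y3_def V_def W_def\<close>)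
        also have "cls (\<lambda>x. - Y1 t x - Y2 t x) = - cls (Y1 t) - cls (Y2 t)"
          using cls_diff[OF L2_scaleR[OF L(4)[OF True], of "-1"] L(5)[OF True]] cls_scaleR[OF L(4)[OF True], of "-1"] by simp
        also have "cls (\<lambda>x. V t x - Y3 t x) = cls (V t) - cls (Y3 t)" by (rule cls_diff[OF L(2,6)[OF True]])
        finally show ?thesis unfolding inner_add_left Fp by (simp add: inner_diff_left inner_add_left)
      next
        case False
        hence "\<phi> (t, x) = 0" for x using off[OF \<phi>] by blast
        thus ?thesis by (simp add: TF_zero)
      qed
    qed
    have Bi: "(LINT t|lborel. (ap B (cls (u t)) + mop emb (cls (F t))) \<bullet> TF \<phi> (e, e') t) =
       - I Y1 \<phi> e - I Y2 \<phi> e + G e + I V \<phi> e' - I Y3 \<phi> e'" for e e'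
    proof -
      have lin: "(LINT t|lborel. - a t - b t + c t + d t - k t) = - (LINT t|lborel. a t) - (LINT t|lborel. b t) + (LINT t|lborel. c t) + (LINT t|lborel. d t) - (LINT t|lborel. k t)"
        if "integrable lborel a" "integrable lborel b" "integrable lborel c" "integrable lborel d" "integrable lborel k" for a b c d k :: "real \<Rightarrow> real"
        using that by simp
      show ?thesis unfolding Bt I_def G_def by (rule lin[OF i[OF Y1 \<phi>] i[OF Y2 \<phi>] iF i[OF V \<phi>] i[OF Y3 \<phi>]])
    qed
    define P where "P e \<longleftrightarrow> Maxwell_op (distr_of V) \<phi> \<bullet> e + I Y1 \<phi> e + I Y2 \<phi> e = G e" for e
    define Q where "Q e \<longleftrightarrow> - I W (pt \<phi>) e + I Y3 \<phi> e - I V \<phi> e = 0" for e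
    have 1: "(Maxwell_op (distr_of V) \<phi> + distr_of Y1 \<phi> + distr_of Y2 \<phi> = distr_of F \<phi>) \<longleftrightarrow> (\<forall>e. P e)"
      unfolding vector_eq_rdot[symmetric, of _ "distr_of F \<phi>"] inner_add_left d[OF Y1 \<phi>] d[OF Y2 \<phi>] distr_of_L1_loc[OF F \<phi>] P_def G_def ..
    have 2: "(dt (distr_of W) \<phi> + distr_of Y3 \<phi> - distr_of V \<phi> = 0) \<longleftrightarrow> (\<forall>e. Q e)"
    proof -
      define X where "X = dt (distr_of W) \<phi> + distr_of Y3 \<phi> - distr_of V \<phi>"
      have "X = 0 \<longleftrightarrow> (\<forall>e. X \<bullet> e = 0)" using vector_eq_rdot[of X 0] by simp
      thus ?thesis
        unfolding X_def inner_add_left inner_diff_left dt_def inner_minus_left d[OF W p] d[OF Y3 \<phi>] d[OF V \<phi>] Q_def .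
    qed
    have z: "TF \<theta> (0 :: complex^3) t = 0" for \<theta> t by (simp add: TF_def cls_0)
    have I0: "I y \<theta> 0 = 0" "G 0 = 0" for y \<theta> unfolding I_def G_def z by simp_all
    have 3: "(\<forall>e. P e) \<and> (\<forall>e. Q e) \<longleftrightarrow> (\<forall>e e'. - (Maxwell_op (distr_of V) \<phi> \<bullet> e) + I W (pt \<phi>) e' + (- I Y1 \<phi> e - I Y2 \<phi> e + G e + I V \<phi> e' - I Y3 \<phi> e') = 0)"
      (is "?l \<longleftrightarrow> ?r")
    proof
      assume ?l
      thus ?r unfolding P_def Q_def by (auto simp: algebra_simps)
    next
      assume r: ?r
      have "P e" for e using spec[OF spec[OF r, of e], of 0] by (simp add: P_def I0)
      moreover have "Q e" for e using spec[OF spec[OF r, of 0], of e] by (simp add: Q_def I0)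
      ultimately show ?l by blast
    qed
    show ?thesis unfolding e1 e2 e3 1 2 3 split_paired_All A Bi ..
  qed
  show ?thesis
    unfolding solves_PML_def Let_def PM.weak_def using main unfolding V_def[abs_def] W_def[abs_def] by blast
qed

end

lemma test_functions_mono: "\<Omega> \<subseteq> \<Omega>' \<Longrightarrow> test_functions \<Omega> \<subseteq> test_functions \<Omega>'"
  by (auto simp: test_functions_def)

section \<open>Existence and uniqueness of causal weak solutions\<close>

context sym_hyp
begin

lemma stationary_span:
  assumes t: "\<And>\<psi>. \<psi> \<in> tens \<Longrightarrow> \<tau> * (y \<bullet> \<psi>) = z \<bullet> \<psi> - y \<bullet> A0 \<psi>" and \<psi>: "\<psi> \<in> span tens"
  shows "\<tau> * (y \<bullet> \<psi>) = z \<bullet> \<psi> - y \<bullet> A0 \<psi>"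
proof -
  have "\<psi> \<in> span tens \<and> \<tau> * (y \<bullet> \<psi>) = z \<bullet> \<psi> - y \<bullet> A0 \<psi>"
    using \<psi>
  proof (induction rule: span_induct_alt)
    case base
    have "A0 0 = 0" using A0_scale[OF core_dom[OF \<psi>], of 0] by simp
    thus ?case by (simp add: span_zero)
  next
    case (step c x w)
    have x: "x \<in> dom" "w \<in> dom" using step by (auto intro: core_dom span_base)
    have cx: "c *\<^sub>R x \<in> span tens" using step(1) by (intro span_scale span_base)
    have e: "A0 (c *\<^sub>R x + w) = c *\<^sub>R A0 x + A0 w"
      unfolding A0_add[OF core_dom[OF cx] x(2)] A0_scale[OF x(1)] ..
    have "\<tau> * (y \<bullet> (c *\<^sub>R x + w)) = c * (\<tau> * (y \<bullet> x)) + \<tau> * (y \<bullet> w)" by (simp add: inner_add_right distrib_left)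
    also have "\<dots> = c * (z \<bullet> x - y \<bullet> A0 x) + (z \<bullet> w - y \<bullet> A0 w)" using t[OF step(1)] step(2) by simp
    also have "\<dots> = z \<bullet> (c *\<^sub>R x + w) - y \<bullet> A0 (c *\<^sub>R x + w)" unfolding e inner_add_right inner_scaleR_right right_diff_distrib by linarith
    finally have "\<tau> * (y \<bullet> (c *\<^sub>R x + w)) = z \<bullet> (c *\<^sub>R x + w) - y \<bullet> A0 (c *\<^sub>R x + w)" .
    moreover have "c *\<^sub>R x + w \<in> span tens" by (rule span_add[OF cx conjunct1[OF step(2)]])
    ultimately show ?case by (rule conjI[rotated])
  qed
  thus ?thesis by blast
qed

lemma weak_mono: "weak \<Omega> B U F \<Longrightarrow> \<Omega>' \<subseteq> \<Omega> \<Longrightarrow> weak \<Omega>' B U F"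
  unfolding weak_def using test_functions_mono[of \<Omega>' \<Omega>] by blast

lemma weak_integrable:
  assumes U: "continuous_on J U" and J: "closed J" and \<Omega>: "\<Omega> \<subseteq> J \<times> UNIV" and F: "\<And>a b. integable a b F" and \<phi>: "\<phi> \<in> test_functions \<Omega>"
  shows "integrable lborel (\<lambda>t. U t \<bullet> (TF (pt \<phi>) e t - A0 (TF \<phi> e t)))" "integrable lborel (\<lambda>t. (ap B (U t) + F t) \<bullet> TF \<phi> e t)"
proof -
  have off: "t \<in> J" if "\<theta> \<in> test_functions \<Omega>" "\<theta> (t, x) \<noteq> 0" for \<theta> t x
    using test_function_props(5)[OF that] \<Omega> by blast
  note p = test_function_props(3)[OF \<phi>]
  have "integrable lborel (\<lambda>t. U t \<bullet> TF (pt \<phi>) e t + (\<Sum>j\<in>UNIV. U t \<bullet> TF (px j \<phi>) (a j e) t))"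
    by (intro Bochner_Integration.integrable_add Bochner_Integration.integrable_sum pairing_integrable[OF U J p off[OF p]])
  thus "integrable lborel (\<lambda>t. U t \<bullet> (TF (pt \<phi>) e t - A0 (TF \<phi> e t)))"
    unfolding A0_TF(2)[OF \<phi>] by (simp add: inner_add_right inner_sum_right)
  have c: "continuous_on J (\<lambda>t. ap B (U t))" by (rule bounded_linear.continuous_on[OF bounded_linear_ap U])
  show "integrable lborel (\<lambda>t. (ap B (U t) + F t) \<bullet> TF \<phi> e t)"
    unfolding inner_add_left
    by (intro Bochner_Integration.integrable_add pairing_integrable[OF c J \<phi> off[OF \<phi>]] pairing_integrable_L1[OF F \<phi>])
qed

lemma weak_diff:
  assumes U: "continuous_on J U" "continuous_on J U'" and J: "closed J" and \<Omega>: "\<Omega> \<subseteq> J \<times> UNIV" and F: "\<And>a b. integable a b F"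
    and w: "weak \<Omega> B U F" "weak \<Omega> B U' F"
  shows "weak \<Omega> B (\<lambda>t. U t - U' t) (\<lambda>_. 0)"
  unfolding weak_def
proof (intro ballI allI)
  fix \<phi> and e :: 'v assume \<phi>: "\<phi> \<in> test_functions \<Omega>"
  note i = weak_integrable[OF U(1) J \<Omega> F \<phi>] and i' = weak_integrable[OF U(2) J \<Omega> F \<phi>]
  have "(LINT t|lborel. (U t - U' t) \<bullet> (TF (pt \<phi>) e t - A0 (TF \<phi> e t))) =
     (LINT t|lborel. U t \<bullet> (TF (pt \<phi>) e t - A0 (TF \<phi> e t))) - (LINT t|lborel. U' t \<bullet> (TF (pt \<phi>) e t - A0 (TF \<phi> e t)))"
    unfolding inner_diff_left by (rule Bochner_Integration.integral_diff[OF i(1) i'(1)])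
  moreover have "(LINT t|lborel. (ap B (U t - U' t) + 0) \<bullet> TF \<phi> e t) =
     (LINT t|lborel. (ap B (U t) + F t) \<bullet> TF \<phi> e t) - (LINT t|lborel. (ap B (U' t) + F t) \<bullet> TF \<phi> e t)"
    unfolding Bochner_Integration.integral_diff[OF i(2) i'(2), symmetric]
    unfolding inner_diff_left[symmetric] linear_simps(2)[OF bounded_linear_ap] by simp
  moreover have "(LINT t|lborel. U t \<bullet> (TF (pt \<phi>) e t - A0 (TF \<phi> e t))) + (LINT t|lborel. (ap B (U t) + F t) \<bullet> TF \<phi> e t) = 0"
      "(LINT t|lborel. U' t \<bullet> (TF (pt \<phi>) e t - A0 (TF \<phi> e t))) + (LINT t|lborel. (ap B (U' t) + F t) \<bullet> TF \<phi> e t) = 0"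
    using w \<phi> unfolding weak_def by blast+
  ultimately show "(LINT t|lborel. (U t - U' t) \<bullet> (TF (pt \<phi>) e t - A0 (TF \<phi> e t))) + (LINT t|lborel. (ap B (U t - U' t) + 0) \<bullet> TF \<phi> e t) = 0"
    by linarith
qed

lemma weak_cong_AE:
  assumes U: "continuous_on J U" and J: "closed J" and \<Omega>: "\<Omega> \<subseteq> J \<times> UNIV" and F: "\<And>a b. integable a b F" "\<And>a b. integable a b F'"
    and eq: "AE t in lborel. F t = F' t" and w: "weak \<Omega> B U F"
  shows "weak \<Omega> B U F'"
  unfolding weak_def
proof (intro ballI allI)
  fix \<phi> and e :: 'v assume \<phi>: "\<phi> \<in> test_functions \<Omega>"
  have "(LINT t|lborel. (ap B (U t) + F t) \<bullet> TF \<phi> e t) = (LINT t|lborel. (ap B (U t) + F' t) \<bullet> TF \<phi> e t)"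
  proof (rule integral_cong_AE)
    show "(\<lambda>t. (ap B (U t) + F t) \<bullet> TF \<phi> e t) \<in> borel_measurable lborel"
      by (rule borel_measurable_integrable[OF weak_integrable(2)[OF U J \<Omega> F(1) \<phi>]])
    show "(\<lambda>t. (ap B (U t) + F' t) \<bullet> TF \<phi> e t) \<in> borel_measurable lborel"
      by (rule borel_measurable_integrable[OF weak_integrable(2)[OF U J \<Omega> F(2) \<phi>]])
    show "AE t in lborel. (ap B (U t) + F t) \<bullet> TF \<phi> e t = (ap B (U t) + F' t) \<bullet> TF \<phi> e t"
      using eq by (rule eventually_mono) (rule arg_cong[where f = "\<lambda>f. (ap B (U _) + f) \<bullet> TF \<phi> e _"])
  qed
  moreover have "(LINT t|lborel. U t \<bullet> (TF (pt \<phi>) e t - A0 (TF \<phi> e t))) + (LINT t|lborel. (ap B (U t) + F t) \<bullet> TF \<phi> e t) = 0"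
    using w \<phi> unfolding weak_def by blast
  ultimately show "(LINT t|lborel. U t \<bullet> (TF (pt \<phi>) e t - A0 (TF \<phi> e t))) + (LINT t|lborel. (ap B (U t) + F' t) \<bullet> TF \<phi> e t) = 0"
    by (simp only:)
qed

lemma integable_0: "integable p q (\<lambda>_. 0 :: 'v l2)"
  by (simp add: set_integrable_def)

lemma weak_unique:
  assumes U: "continuous_on {0..} U" "continuous_on {0..} U'" and F: "\<And>a b. integable a b F"
    and w: "weak ({0<..} \<times> UNIV) B U F" "weak ({0<..} \<times> UNIV) B U' F" and 0: "U 0 = U' 0" and t: "t \<ge> 0"
  shows "U t = U' t"
proof -
  have "weak ({0<..} \<times> UNIV) B (\<lambda>t. U t - U' t) (\<lambda>_. 0)"
    by (rule weak_diff[OF U _ _ F w]) auto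
  hence "mild B (\<lambda>_. 0) (U 0 - U' 0) t (\<lambda>t. U t - U' t)" by (intro weak_mild continuous_intros U)
  from mild_bound[OF this integable_0 t order_refl] have "norm (U t - U' t) \<le> 0"
    by (simp add: 0 set_lebesgue_integral_def)
  thus ?thesis by simp
qed

definition causal :: "'v l2 endo \<Rightarrow> (real \<Rightarrow> 'v l2) \<Rightarrow> (real \<Rightarrow> 'v l2) \<Rightarrow> bool" where
  "causal B F U \<longleftrightarrow> continuous_on UNIV U \<and> weak UNIV B U F \<and> (\<forall>t<0. U t = 0)"

text \<open>Continuity carries the value 0 from negative times to t = 0, which supplies the initial
  condition for uniqueness.\<close>

lemma causal_0: assumes "causal B F U" shows "U 0 = 0"
proof -
  have "closed {t \<in> UNIV. U t = 0}" using assms by (intro continuous_closed_preimage_constant) (auto simp: causal_def)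
  moreover have "{..<0} \<subseteq> {t \<in> UNIV. U t = 0}" using assms by (auto simp: causal_def)
  ultimately have "closure {..<0} \<subseteq> {t \<in> UNIV. U t = 0}" by (intro closure_minimal)
  thus ?thesis by auto
qed

lemma causal_unique:
  assumes F: "\<And>a b. integable a b F" and c: "causal B F U" "causal B F U'"
  shows "U t = U' t"
proof (cases "t < 0")
  case False
  have sub: "continuous_on {0..} V" "weak ({0<..} \<times> UNIV) B V F" if "causal B F V" for V
    using that unfolding causal_def by (auto intro: continuous_on_subset weak_mono)
  show ?thesis
    by (rule weak_unique[OF sub(1)[OF c(1)] sub(1)[OF c(2)] F sub(2)[OF c(1)] sub(2)[OF c(2)]])
       (use False causal_0[OF c(1)] causal_0[OF c(2)] in auto)
qed (use c in \<open>auto simp: causal_def\<close>)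

text \<open>The mild solution with initial value 0 is extended by 0 to negative times; the vanishing
  initial value makes the extension continuous and the weak equation valid across t = 0.\<close>

lemma causal_exists:
  assumes F: "\<And>a b. integable a b F" and F0: "\<And>t. t < 0 \<Longrightarrow> F t = 0"
  shows "\<exists>U. causal B F U \<and> (\<forall>T. mild B F 0 T U)"
proof -
  obtain u where u: "continuous_on {0..} u" "\<And>T. mild B F 0 T u" by (rule mild_exists[where F = F and B = B and ?u0.0 = 0, OF F]) blast
  define U where "U t = (if t < 0 then 0 else u t)" for t
  have u0: "u 0 = 0" by (rule mild_0[OF u(2) order_refl])
  have c1: "continuous_on {..0} U"
    by (rule continuous_on_eq[of _ "\<lambda>_. 0"]) (use u0 in \<open>auto simp: U_def\<close>)
  have c2: "continuous_on {0..} U"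
    by (rule continuous_on_eq[OF u(1)]) (auto simp: U_def)
  have "continuous_on ({..0} \<union> {0..}) U" by (intro continuous_on_closed_Un c1 c2) auto
  moreover have "{..0} \<union> {0..} = (UNIV :: real set)" by auto
  ultimately have c: "continuous_on UNIV U" by metis
  have "weak UNIV B U F"
    by (rule mild_weak[OF u(2) F]) (use F0 in \<open>auto simp: U_def\<close>)
  moreover have "mild B F 0 T U" for T
    unfolding mild_def
  proof (intro conjI ballI)
    show "continuous_on {0..T} U" by (rule continuous_on_subset[OF c]) auto
    fix t assume t: "t \<in> {0..T}"
    hence "U t = u t" by (simp add: U_def)
    also have "\<dots> = G t (0 + integ 0 t (\<lambda>s. G (- s) (ap B (u s) + F s)))" using u(2)[of T] t unfolding mild_def by blast
    also have "integ 0 t (\<lambda>s. G (- s) (ap B (u s) + F s)) = integ 0 t (\<lambda>s. G (- s) (ap B (U s) + F s))"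
      by (rule set_lebesgue_integral_cong) (auto simp: U_def)
    finally show "U t = G t (0 + integ 0 t (\<lambda>s. G (- s) (ap B (U s) + F s)))" .
  qed
  ultimately show ?thesis using c unfolding causal_def U_def by auto
qed

text \<open>F is the source as given, F' a representative that vanishes at every negative time.
  \<open>Sol\<close> is left abstract so that both systems are covered.\<close>

lemma the_causal_solution:
  assumes Sol: "\<And>u. L2_continuous_on UNIV u \<Longrightarrow> Sol u \<longleftrightarrow> weak UNIV B (\<lambda>t. cls (u t)) F"
    and F: "\<And>a b. integable a b F" "\<And>a b. integable a b F'" and eq: "AE t in lborel. F t = F' t" and F0: "\<And>t. t < 0 \<Longrightarrow> F' t = 0"
  shows "\<exists>u. is_the_causal_solution Sol u"
    and "causal_solution Sol u \<Longrightarrow> mild B F' 0 T (\<lambda>t. cls (u t))"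
proof -
  have iff: "causal_solution Sol u \<longleftrightarrow> (\<forall>t. L2 (u t)) \<and> causal B F' (\<lambda>t. cls (u t))" for u
  proof (cases "L2_continuous_on UNIV u")
    case True
    hence u: "\<And>t. L2 (u t)" "continuous_on UNIV (\<lambda>t. cls (u t))" unfolding L2_continuous_on_iff by auto
    have "AE t in lborel. F' t = F t" using eq by eventually_elim simp
    hence "weak UNIV B (\<lambda>t. cls (u t)) F \<longleftrightarrow> weak UNIV B (\<lambda>t. cls (u t)) F'"
      using weak_cong_AE[OF u(2) closed_UNIV _ F eq] weak_cong_AE[OF u(2) closed_UNIV _ F(2,1)] by auto
    moreover have "(AE x in lborel. u t x = 0) \<longleftrightarrow> cls (u t) = 0" for t
      using cls_eq_iff[OF u(1)[of t] L2_0] by (simp add: cls_0)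
    ultimately show ?thesis using True u unfolding causal_solution_def causal_def Sol[OF True] by simp
  next
    case False
    thus ?thesis unfolding causal_solution_def causal_def L2_continuous_on_iff by blast
  qed
  obtain U where U: "causal B F' U" "\<And>T. mild B F' 0 T U" using causal_exists[OF F(2) F0] by blast
  have uniq: "cls (u t) = U t" if "causal_solution Sol u" for u t
    using causal_unique[OF F(2) _ U(1), of "\<lambda>t. cls (u t)"] that unfolding iff by blast
  have "is_the_causal_solution Sol (\<lambda>t. fn (U t))"
    unfolding is_the_causal_solution_def
  proof (intro conjI allI impI)
    show "causal_solution Sol (\<lambda>t. fn (U t))" unfolding iff using U(1) by simp
    fix v t assume v: "causal_solution Sol v"
    hence "L2 (v t)" unfolding iff by blast
    thus "AE x in lborel. v t x = fn (U t) x" using uniq[OF v, of t] cls_eq_iff[of "v t" "fn (U t)"] by simp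
  qed
  thus "\<exists>u. is_the_causal_solution Sol u" by (rule exI[of _ "\<lambda>t. fn (U t)"])
  assume "causal_solution Sol u"
  hence "(\<lambda>t. cls (u t)) = U" using uniq by blast
  thus "mild B F' 0 T (\<lambda>t. cls (u t))" using U(2) by simp
qed

end

context dilation3
begin

lemma weighted_ten_inner:
  assumes b: "padm b K" and f: "\<forall>j. cc (f j)" and g: "\<forall>j. cc (g j)"
  shows "mop b (K3 (cls (\<lambda>x. ten f x *\<^sub>R e))) \<bullet> cls (\<lambda>x. ten g x *\<^sub>R e') = (LINT x|lborel. ten f (X3 x) * ten g x * (b x e \<bullet> e'))"
proof -
  have L: "L2 (\<lambda>x. ten f (X3 x) *\<^sub>R e)" by (rule L2_X3(1)[OF L2_ten[OF f]])
  have lin: "linear (b x)" for x using b by (simp add: padm_def)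
  show ?thesis
    unfolding K3_cls[OF L2_ten[OF f]] mop_cls[OF b L] inner_cls[OF L2_padm[OF b L] L2_ten[OF g]]
    by (simp add: linear_scale[OF lin] mult.assoc mult.left_commute)
qed

end

section \<open>Stretched coordinates and the stationary split system\<close>

context absorption
begin

definition R :: "(real^3) set" where "R = {x. \<forall>j. \<bar>x $ j\<bar> \<le> L j}"

lemma R_borel [measurable]: "R \<in> sets borel"
  unfolding R_def by measurable

lemma S_R: "x \<in> R \<Longrightarrow> S x k = 0"
  using sL by (simp add: R_def)

definition onR :: "real^3 \<Rightarrow> complex^3 \<Rightarrow> complex^3" where "onR x v = dg (\<lambda>_. indicator R x) v"
definition offR :: "real^3 \<Rightarrow> complex^3 \<Rightarrow> complex^3" where "offR x v = dg (\<lambda>_. indicator (- R) x) v"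
definition fstR :: "real^3 \<Rightarrow> (complex^3) \<times> (complex^3) \<Rightarrow> complex^3" where "fstR x vw = dg (\<lambda>_. indicator R x) (fst vw)"

lemma padm_R: "\<exists>K. padm onR K" "\<exists>K. padm offR K" "\<exists>K. padm fstR K"
  unfolding onR_def[abs_def] offR_def[abs_def] fstR_def[abs_def]
  by (rule padm_dg[of "\<lambda>x _. indicator R x" 1, OF _ _ linear_pair(6,6)] padm_dg[of "\<lambda>x _. indicator (- R) x" 1, OF _ _ linear_pair(6,6)]
        padm_dg[of "\<lambda>x _. indicator R x" 1, OF _ _ linear_pair(6,4)]; simp add: indicator_def)+

definition rho :: "real \<Rightarrow> 3 \<Rightarrow> real \<Rightarrow> real" where "rho \<tau> j t = (\<tau> + s j t) / \<tau>"

lemma dilation3_rho: assumes \<tau>: "\<tau> > 0" shows "dilation3 (rho \<tau>) ((\<tau> + C) / \<tau>) L"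
proof (rule dilation3.intro, rule dilation.intro)
  fix j t
  show "rho \<tau> j \<in> borel_measurable borel" unfolding rho_def[abs_def] using sm by measurable
  show "1 \<le> rho \<tau> j t" "rho \<tau> j t \<le> (\<tau> + C) / \<tau>" using \<tau> s0[of j t] sC[of j t] by (auto simp: rho_def field_simps)
  show "rho \<tau> j t = 1" if "\<bar>t\<bar> \<le> L j" using sL[OF that] \<tau> by (simp add: rho_def)
  show "0 \<le> L j" using L0[of j] by simp
qed

abbreviation dd :: "real \<Rightarrow> real^3 \<Rightarrow> 3 \<Rightarrow> real" where "dd \<tau> x k \<equiv> rho \<tau> k (x $ k)"
abbreviation nn :: "real \<Rightarrow> real^3 \<Rightarrow> 3 \<Rightarrow> real" where "nn \<tau> x i \<equiv> \<Prod>l\<in>UNIV - {i}. rho \<tau> l (x $ l)"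

definition yy :: "real \<Rightarrow> real^3 \<Rightarrow> complex^3 \<Rightarrow> (complex^3) \<times> (complex^3)" where
  "yy \<tau> x v = (dg (dd \<tau> x) v, dg (\<lambda>_. 1 / \<tau>) v)"

text \<open>Row k of the stretched Maxwell equation carries the product of the two other factors,
  that is, the cofactor of the diagonal Jacobian.\<close>

definition nf :: "real \<Rightarrow> real^3 \<Rightarrow> complex^3 \<Rightarrow> (complex^3) \<times> (complex^3)" where
  "nf \<tau> x v = (dg (nn \<tau> x) v, 0)"

lemma linear_in1: "linear (\<lambda>v :: complex^3. (v, 0 :: complex^3))"
  by (auto intro!: linearI)

lemma padm_yn: assumes \<tau>: "\<tau> > 0" shows "\<exists>K. padm (yy \<tau>) K" "\<exists>K. padm (nf \<tau>) K"
proof -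
  interpret D: dilation3 "rho \<tau>" "(\<tau> + C) / \<tau>" L by (rule dilation3_rho[OF \<tau>])
  have m: "(\<lambda>x. dd \<tau> x k) \<in> borel_measurable borel" "(\<lambda>x. nn \<tau> x k) \<in> borel_measurable borel" for k
    using D.\<rho>m by measurable
  have b: "\<bar>nn \<tau> x k\<bar> \<le> ((\<tau> + C) / \<tau>)\<^sup>2" for x k
  proof -
    have "\<bar>nn \<tau> x k\<bar> = (\<Prod>l\<in>UNIV - {k}. \<bar>rho \<tau> l (x $ l)\<bar>)" by (rule abs_prod)
    also have "\<dots> \<le> (\<Prod>l\<in>UNIV - {k}. (\<tau> + C) / \<tau>)" by (rule prod_mono) (simp add: D.rho_abs)
    also have "\<dots> = ((\<tau> + C) / \<tau>)\<^sup>2" by (simp add: card_Diff_subset)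
    finally show ?thesis .
  qed
  obtain K1 K2 where "padm (\<lambda>x v. (dg (dd \<tau> x) v, 0 :: complex^3)) K1" "padm (\<lambda>x v. (0 :: complex^3, dg (\<lambda>_. 1 / \<tau>) v)) K2"
    using padm_dg[of "dd \<tau>", OF m(1) D.rho_abs linear_in1 linear_pair(6)]
      padm_dg[of "\<lambda>_ _. 1 / \<tau>" "1 / \<tau>", OF _ _ linear_pair(2,6)] \<tau> by auto
  from padm_add[OF this] show "\<exists>K. padm (yy \<tau>) K" unfolding yy_def[abs_def] by auto
  show "\<exists>K. padm (nf \<tau>) K" unfolding nf_def[abs_def]
    by (rule padm_dg[of "nn \<tau>", OF m(2) b linear_in1 linear_pair(6)])
qed

text \<open>Multiplied by \<tau>, both sides are the product of \<tau> + s over the two indices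
  other than k. This algebra dictates \<Sigma>1 and \<Sigma>2: for W = V / (\<tau> + \<Sigma>), the
  terms \<Sigma>1 V + \<Sigma>2 W complete \<tau> V to the cofactor weight that the stretched
  Maxwell equation requires.\<close>

lemma Sigma_identity:
  assumes \<tau>: "\<tau> > 0"
  shows "\<tau> * dd \<tau> x k + sig1 (S x) k * dd \<tau> x k + sig2 (S x) k / \<tau> = \<tau> * nn \<tau> x k"
proof -
  have "\<forall>k. \<tau> * dd \<tau> x k + sig1 (S x) k * dd \<tau> x k + sig2 (S x) k / \<tau> = \<tau> * nn \<tau> x k"
    unfolding forall_3 sig1_def sig2_def rho_def UNIV_minus_3 sum_3 using \<tau>
    by (simp add: field_simps power2_eq_square)
  thus ?thesis by blast
qed

text \<open>The first component is \<open>Sigma_identity\<close>; the second says that (\<tau> +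
  \<Sigma>) W = V for the stretched pair.\<close>

lemma yy_identity:
  assumes \<tau>: "\<tau> > 0" shows "\<tau> *\<^sub>R yy \<tau> x v = bP x (yy \<tau> x v) + \<tau> *\<^sub>R nf \<tau> x v"
proof -
  have 1: "\<tau> * dd \<tau> x k = - sig1 (S x) k * dd \<tau> x k - sig2 (S x) k / \<tau> + \<tau> * nn \<tau> x k" for k
    using Sigma_identity[OF \<tau>, where x = x and k = k] by linarith
  have 2: "1 = dd \<tau> x k - S x k / \<tau>" for k using \<tau> by (simp add: rho_def field_simps)
  have "\<tau> *\<^sub>R dg (dd \<tau> x) v = - dg (sig1 (S x)) (dg (dd \<tau> x) v) - dg (sig2 (S x)) (dg (\<lambda>_. 1 / \<tau>) v) + \<tau> *\<^sub>R dg (nn \<tau> x) v"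
    unfolding vec_eq_iff
  proof
    fix k
    have "(\<tau> *\<^sub>R dg (dd \<tau> x) v) $ k = (\<tau> * dd \<tau> x k) *\<^sub>R v $ k" by (simp add: dg_def)
    also have "\<dots> = (- sig1 (S x) k * dd \<tau> x k - sig2 (S x) k / \<tau> + \<tau> * nn \<tau> x k) *\<^sub>R v $ k" by (rule arg_cong[OF 1])
    also have "\<dots> = (- dg (sig1 (S x)) (dg (dd \<tau> x) v) - dg (sig2 (S x)) (dg (\<lambda>_. 1 / \<tau>) v) + \<tau> *\<^sub>R dg (nn \<tau> x) v) $ k"
      by (simp add: dg_def scaleR_left_diff_distrib scaleR_left_distrib)
    finally show "(\<tau> *\<^sub>R dg (dd \<tau> x) v) $ k = (- dg (sig1 (S x)) (dg (dd \<tau> x) v) - dg (sig2 (S x)) (dg (\<lambda>_. 1 / \<tau>) v) + \<tau> *\<^sub>R dg (nn \<tau> x) v) $ k" .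
  qed
  moreover have "\<tau> *\<^sub>R dg (\<lambda>_. 1 / \<tau>) v = dg (dd \<tau> x) v - dg (S x) (dg (\<lambda>_. 1 / \<tau>) v)"
    unfolding vec_eq_iff
  proof
    fix k
    have "(\<tau> *\<^sub>R dg (\<lambda>_. 1 / \<tau>) v) $ k = 1 *\<^sub>R v $ k" using \<tau> by (simp add: dg_def)
    also have "\<dots> = (dd \<tau> x k - S x k / \<tau>) *\<^sub>R v $ k" by (rule arg_cong[OF 2])
    also have "\<dots> = (dg (dd \<tau> x) v - dg (S x) (dg (\<lambda>_. 1 / \<tau>) v)) $ k" by (simp add: dg_def scaleR_left_diff_distrib)
    finally show "(\<tau> *\<^sub>R dg (\<lambda>_. 1 / \<tau>) v) $ k = (dg (dd \<tau> x) v - dg (S x) (dg (\<lambda>_. 1 / \<tau>) v)) $ k" .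
  qed
  ultimately show ?thesis unfolding yy_def bP_def nf_def by simp
qed

text \<open>The stretched field Y U solves the stationary split system with source N F. Since F
  lives on R, where X is the identity and all weights are 1, N F is the original source; so u = Y U
  by uniqueness, and on R its first component is U.\<close>

lemma stationary_matching:
  assumes \<tau>: "\<tau> > 0" "\<tau> > norm B"
    and M: "\<And>\<psi>. \<psi> \<in> span tens \<Longrightarrow> \<tau> * (U \<bullet> \<psi>) = F \<bullet> \<psi> - U \<bullet> MX.A0 \<psi>"
    and P: "\<And>\<psi>. \<psi> \<in> span tens \<Longrightarrow> \<tau> * (u \<bullet> \<psi>) = (ap B u + mop emb F) \<bullet> \<psi> - u \<bullet> PM.A0 \<psi>"
    and F: "mop offR F = 0"
  shows "mop fstR u = mop onR U"
proof -
  interpret D: dilation3 "rho \<tau>" "(\<tau> + C) / \<tau>" L by (rule dilation3_rho[OF \<tau>(1)])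
  obtain Ky Kn where K: "padm (yy \<tau>) Ky" "padm (nf \<tau>) Kn" using padm_yn[OF \<tau>(1)] by blast
  obtain Kb where Kb: "padm bP Kb" using padm_bP by blast
  define Y where "Y \<psi> = mop (yy \<tau>) (D.K3 \<psi>)" for \<psi>
  define N where "N \<psi> = mop (nf \<tau>) (D.K3 \<psi>)" for \<psi>
  have Y: "bounded_linear Y" and N: "bounded_linear N"
    unfolding Y_def[abs_def] N_def[abs_def]
    by (intro bounded_linear_compose[OF bounded_linear_mop[OF K(1)] D.bounded_linear_K3] bounded_linear_compose[OF bounded_linear_mop[OF K(2)] D.bounded_linear_K3])+
  have YN: "\<tau> *\<^sub>R Y \<psi> = ap B (Y \<psi>) + \<tau> *\<^sub>R N \<psi>" for \<psi>
  proof (rule l2_eqI)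
    show "AE x in lborel. fn (\<tau> *\<^sub>R Y \<psi>) x = fn (ap B (Y \<psi>) + \<tau> *\<^sub>R N \<psi>) x"
      using fn_scaleR[of \<tau> "Y \<psi>"] fn_scaleR[of \<tau> "N \<psi>"] fn_add[of "ap B (Y \<psi>)" "\<tau> *\<^sub>R N \<psi>"] fn_mop[OF Kb, of "Y \<psi>"]
        fn_mop[OF K(1), of "D.K3 \<psi>"] fn_mop[OF K(2), of "D.K3 \<psi>"]
      unfolding ap_B Y_def[symmetric] N_def[symmetric]
      by eventually_elim (simp add: yy_identity[OF \<tau>(1)])
  qed
  \<comment> \<open>Duality between the two generators is proved first for products, where
    \<open>Maxwell_by_parts\<close> applies.\<close>
  have tens: "N (MX.A0 \<psi>) \<bullet> \<eta> = - (Y \<psi> \<bullet> PM.A0 \<eta>)" if p: "\<psi> \<in> tens" and q: "\<eta> \<in> tens" for \<psi> \<eta>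
  proof -
    obtain f e where \<psi>: "\<psi> = cls (\<lambda>x. ten f x *\<^sub>R e)" and f: "\<forall>j. cc (f j)" using p by (auto simp: tens_def)
    obtain g e' where \<eta>: "\<eta> = cls (\<lambda>x. ten g x *\<^sub>R e')" and g: "\<forall>j. cc (g j)" using q by (auto simp: tens_def)
    have fj: "\<forall>i. cc ((f(j := deriv (f j))) i)" "\<forall>i. cc ((g(j := deriv (g j))) i)" for j
      using f g by (auto intro: cc_deriv)
    have "N (MX.A0 \<psi>) \<bullet> \<eta> = - (\<Sum>j\<in>UNIV. N (cls (\<lambda>x. ten (f(j := deriv (f j))) x *\<^sub>R (mx j *v e))) \<bullet> \<eta>)"
      unfolding \<psi> MX.A0_ten[OF f] linear_neg[OF bounded_linear.linear[OF N]] linear_sum[OF bounded_linear.linear[OF N]]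
      by (simp add: inner_sum_left)
    also have "\<dots> = - (\<Sum>j\<in>UNIV. LINT x|lborel. ten (f(j := deriv (f j))) (D.X3 x) * ten g x * (dg (nn \<tau> x) (mx j *v e) \<bullet> fst e'))"
      unfolding N_def \<eta> D.weighted_ten_inner[OF K(2) fj(1) g] by (simp add: nf_def inner_prod_def)
    also have "\<dots> = (\<Sum>j\<in>UNIV. LINT x|lborel. ten f (D.X3 x) * ten (g(j := deriv (g j))) x * (dg (dd \<tau> x) e \<bullet> (mx j *v fst e')))"
      unfolding D.Maxwell_by_parts[OF f g] by (simp add: sum_negf)
    also have "\<dots> = (\<Sum>j\<in>UNIV. Y \<psi> \<bullet> cls (\<lambda>x. ten (g(j := deriv (g j))) x *\<^sub>R (mx j *v fst e', 0)))"
      unfolding Y_def \<psi> D.weighted_ten_inner[OF K(1) f fj(2)] by (simp add: yy_def inner_prod_def)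
    also have "\<dots> = - (Y \<psi> \<bullet> PM.A0 \<eta>)"
      unfolding \<eta> PM.A0_ten[OF g] by (simp add: inner_sum_right)
    finally show ?thesis .
  qed
  have span: "N (MX.A0 \<psi>) \<bullet> \<eta> = - (Y \<psi> \<bullet> PM.A0 \<eta>)" if \<psi>: "\<psi> \<in> span tens" and \<eta>: "\<eta> \<in> tens" for \<psi> \<eta>
  proof -
    have "\<psi> \<in> span tens \<and> N (MX.A0 \<psi>) \<bullet> \<eta> = - (Y \<psi> \<bullet> PM.A0 \<eta>)"
      using \<psi>
    proof (induction rule: span_induct_alt)
      case base
      have "MX.A0 0 = 0" using MX.A0_scale[OF MX.core_dom[OF \<psi>], of 0] by simp
      thus ?case by (simp add: span_zero linear_simps(3)[OF N] linear_simps(3)[OF Y])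
    next
      case (step c x w)
      have x: "x \<in> MX.dom" "w \<in> MX.dom" using step by (auto intro: MX.core_dom span_base)
      have cx: "c *\<^sub>R x \<in> span tens" using step(1) by (intro span_scale span_base)
      have "N (MX.A0 (c *\<^sub>R x + w)) \<bullet> \<eta> = c * (N (MX.A0 x) \<bullet> \<eta>) + N (MX.A0 w) \<bullet> \<eta>"
        unfolding MX.A0_add[OF MX.core_dom[OF cx] x(2)] MX.A0_scale[OF x(1)] linear_simps(1,5)[OF N] by (simp add: inner_add_left)
      also have "\<dots> = - (Y (c *\<^sub>R x + w) \<bullet> PM.A0 \<eta>)"
        unfolding tens[OF step(1) \<eta>] conjunct2[OF step(2)] linear_simps(1,5)[OF Y] by (simp add: inner_add_left)
      finally have "N (MX.A0 (c *\<^sub>R x + w)) \<bullet> \<eta> = - (Y (c *\<^sub>R x + w) \<bullet> PM.A0 \<eta>)" .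
      moreover have "c *\<^sub>R x + w \<in> span tens" by (rule span_add[OF cx conjunct1[OF step(2)]])
      ultimately show ?case by (rule conjI[rotated])
    qed
    thus ?thesis by blast
  qed
  \<comment> \<open>U is only a weak solution, so the identity reaches it through core elements
    \<psi> n for which both \<psi> n and \<tau> \<psi> n - \<open>MX.A0 (\<psi> n)\<close>
    converge.\<close>
  have YU: "\<tau> * (N U \<bullet> \<eta>) - N F \<bullet> \<eta> = - (Y U \<bullet> PM.A0 \<eta>)" if \<eta>: "\<eta> \<in> tens" for \<eta>
  proof -
    obtain \<psi> where \<psi>: "\<And>n. \<psi> n \<in> span tens" "\<psi> \<longlonglongrightarrow> U" "(\<lambda>n. \<tau> *\<^sub>R \<psi> n - MX.A0 (\<psi> n)) \<longlonglongrightarrow> F"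
      by (rule MX.stationary_approx[OF \<tau>(1) M]) blast+
    have 1: "(\<lambda>n. \<tau> * (N (\<psi> n) \<bullet> \<eta>) - N (\<tau> *\<^sub>R \<psi> n - MX.A0 (\<psi> n)) \<bullet> \<eta>) \<longlonglongrightarrow> \<tau> * (N U \<bullet> \<eta>) - N F \<bullet> \<eta>"
      by (intro tendsto_intros bounded_linear.tendsto[OF N] \<psi>(2,3))
    have "\<tau> * (N (\<psi> n) \<bullet> \<eta>) - N (\<tau> *\<^sub>R \<psi> n - MX.A0 (\<psi> n)) \<bullet> \<eta> = - (Y (\<psi> n) \<bullet> PM.A0 \<eta>)" for n
      unfolding span[OF \<psi>(1) \<eta>, symmetric] linear_simps(2,5)[OF N] by (simp add: inner_diff_left)
    with 1 have "(\<lambda>n. - (Y (\<psi> n) \<bullet> PM.A0 \<eta>)) \<longlonglongrightarrow> \<tau> * (N U \<bullet> \<eta>) - N F \<bullet> \<eta>" by simp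
    moreover have "(\<lambda>n. - (Y (\<psi> n) \<bullet> PM.A0 \<eta>)) \<longlonglongrightarrow> - (Y U \<bullet> PM.A0 \<eta>)"
      by (intro tendsto_intros bounded_linear.tendsto[OF Y] \<psi>(2))
    ultimately show ?thesis by (rule LIMSEQ_unique)
  qed
  obtain Ko Ke K1 Kf where Ko: "padm offR Ko" "padm onR K1" "padm fstR Kf" "padm emb Ke" using padm_R padm_emb by blast
  have inR: "D.X3 x \<in> R \<longleftrightarrow> x \<in> R" "x \<in> R \<Longrightarrow> D.X3 x = x" for x
    using D.X3_region_iff[of x] D.X3_region[of x] by (auto simp: R_def)
  have rR: "rho \<tau> k (x $ k) = 1" if "x \<in> R" for x k using S_R[OF that, of k] \<tau> by (simp add: rho_def)
  have F0: "AE x in lborel. x \<notin> R \<longrightarrow> fn F x = 0"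
    using fn_mop[OF Ko(1), of F] fn_zero[where 'a = "complex^3"] unfolding F by eventually_elim (auto simp: offR_def dg_1)
  \<comment> \<open>A point outside R is mapped outside R by \<open>X3\<close>, so both sides vanish
    there; on R the weights are 1 and points are fixed.\<close>
  have NF: "N F = mop emb F"
  proof (rule l2_eqI)
    have K3: "AE x in lborel. fn (D.K3 F) x = fn F (D.X3 x)" unfolding D.K3_def by (rule fn_cls[OF D.L2_X3(1)[OF L2_fn[of F]]])
    show "AE x in lborel. fn (N F) x = fn (mop emb F) x"
      using fn_mop[OF K(2), of "D.K3 F"] fn_mop[OF Ko(4), of F] K3 F0 D.AE_X3[OF F0] unfolding N_def[symmetric]
    proof eventually_elim
      case (elim x)
      show ?case
      proof (cases "x \<in> R")
        case True
        thus ?thesis using elim inR[of x] by (simp add: nf_def emb_def rR dg_1)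
      next
        case False
        thus ?thesis using elim inR[of x] by (simp add: nf_def emb_def dg_def vec_eq_iff)
      qed
    qed
  qed
  have "u - Y U = 0"
  proof (rule PM.stationary_unique[OF _ \<tau>(2)])
    have d: "\<tau> * (Y U \<bullet> \<eta>) = (ap B (Y U) + mop emb F) \<bullet> \<eta> - Y U \<bullet> PM.A0 \<eta>" if "\<eta> \<in> span tens" for \<eta>
    proof (rule PM.stationary_span[OF _ that])
      fix \<eta> :: "((complex^3) \<times> (complex^3)) l2" assume \<eta>: "\<eta> \<in> tens"
      have "\<tau> * (Y U \<bullet> \<eta>) = (\<tau> *\<^sub>R Y U) \<bullet> \<eta>" by simp
      also have "\<dots> = ap B (Y U) \<bullet> \<eta> + \<tau> * (N U \<bullet> \<eta>)" unfolding YN by (simp add: inner_add_left)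
      finally show "\<tau> * (Y U \<bullet> \<eta>) = (ap B (Y U) + mop emb F) \<bullet> \<eta> - Y U \<bullet> PM.A0 \<eta>"
        using YU[OF \<eta>] unfolding NF inner_add_left by linarith
    qed
    fix \<eta> :: "((complex^3) \<times> (complex^3)) l2" assume \<eta>: "\<eta> \<in> span tens"
    show "\<tau> * ((u - Y U) \<bullet> \<eta>) = ap B (u - Y U) \<bullet> \<eta> - (u - Y U) \<bullet> PM.A0 \<eta>"
      using d[OF \<eta>] P[OF \<eta>] unfolding linear_simps(2)[OF bounded_linear_ap] inner_diff_left inner_add_left right_diff_distrib by linarith
  qed
  hence u: "u = Y U" by simp
  show ?thesis
  proof (rule l2_eqI)
    have K3: "AE x in lborel. fn (D.K3 U) x = fn U (D.X3 x)" unfolding D.K3_def by (rule fn_cls[OF D.L2_X3(1)[OF L2_fn[of U]]])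
    show "AE x in lborel. fn (mop fstR u) x = fn (mop onR U) x"
      using fn_mop[OF Ko(3), of u] fn_mop[OF Ko(2), of U] fn_mop[OF K(1), of "D.K3 U"] K3 unfolding Y_def[symmetric] u[symmetric]
    proof eventually_elim
      case (elim x)
      show ?case
      proof (cases "x \<in> R")
        case True
        thus ?thesis using elim inR[of x] by (simp add: fstR_def onR_def yy_def rR dg_1)
      next
        case False
        thus ?thesis using elim by (simp add: fstR_def onR_def dg_def)
      qed
    qed
  qed
qed

end

lemma integable_bounded_linear:
  assumes g: "bounded_linear g" and f: "integable p q f" shows "integable p q (\<lambda>t. g (f t))"
  using integrable_bounded_linear[OF g f[unfolded set_integrable_def]]
  unfolding set_integrable_def linear_simps(5)[OF g] .

lemma integable_restrict:
  assumes A: "A \<in> sets borel" and f: "integable p q f" and h: "\<And>t. t \<in> A \<Longrightarrow> h t = f t" "\<And>t. t \<notin> A \<Longrightarrow> h t = 0"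
  shows "integable p q h"
proof -
  have "indicator {p..q} t *\<^sub>R h t = indicator A t *\<^sub>R (indicator {p..q} t *\<^sub>R f t)" for t
    using h[of t] by (cases "t \<in> A") auto
  thus ?thesis using integrable_mult_indicator[OF _ f[unfolded set_integrable_def], of A] A unfolding set_integrable_def by simp
qed

section \<open>From the stationary problem to the evolution\<close>

context absorption
begin

text \<open>For every \<tau> > \<open>norm B\<close> the stationary problem shows that the
  transforms agree on R. Both restricted solutions grow at most exponentially, so injectivity of the
  transform applies to their difference.\<close>

lemma matching:
  assumes f: "\<And>p q. integable p q f" and off: "AE t in lborel. mop offR (f t) = 0"
    and u: "\<And>T. PM.mild B (\<lambda>t. mop emb (f t)) 0 T u" and U: "\<And>T. MX.mild 0 f 0 T U" and t0: "t0 \<ge> 0"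
  shows "mop fstR (u t0) = mop onR (U t0)"
proof -
  obtain Ko K1 Kf Ke where K: "padm offR Ko" "padm onR K1" "padm fstR Kf" "padm emb Ke" using padm_R padm_emb by blast
  note bl = K[THEN bounded_linear_mop]
  \<comment> \<open>Cutting the source off after t0 makes its transform exist and gives the
    exponential bounds; up to t0 the solutions are unchanged.\<close>
  define h where "h t = (if t0 < t then 0 else f t)" for t
  have h: "integable p q h" for p q by (rule integable_restrict[of "{..t0}", OF _ f]) (auto simp: h_def)
  have eh: "integable p q (\<lambda>t. mop emb (h t))" for p q by (rule integable_bounded_linear[OF bl(4) h])
  have ef: "integable p q (\<lambda>t. mop emb (f t))" for p q by (rule integable_bounded_linear[OF bl(4) f])
  have h0: "h t = 0" "mop emb (h t) = 0" if "t > t0" for t using that by (simp_all add: h_def linear_simps(3)[OF bl(4)])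
  obtain u1 where u1: "continuous_on {0..} u1" "\<And>T. PM.mild B (\<lambda>t. mop emb (h t)) 0 T u1"
    by (rule PM.mild_exists[where F = "\<lambda>t. mop emb (h t)" and B = B and ?u0.0 = 0, OF eh]) blast
  obtain U1 where U1: "continuous_on {0..} U1" "\<And>T. MX.mild 0 h 0 T U1"
    by (rule MX.mild_exists[where F = h and B = 0 and ?u0.0 = 0, OF h]) blast
  have eu: "u t0 = u1 t0"
    by (rule PM.mild_unique[OF u ef u1(2) eh _ t0 order_refl]) (simp add: h_def)
  have eU: "U t0 = U1 t0"
    by (rule MX.mild_unique[OF U f U1(2) h _ t0 order_refl]) (simp add: h_def)
  define c1 where "c1 = integ 0 t0 (\<lambda>t. norm (mop emb (h t)))"
  define c2 where "c2 = integ 0 t0 (\<lambda>t. norm (h t))"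
  have g1: "norm (u1 t) \<le> c1 * exp (norm B * t)" if "t \<ge> 0" for t
    unfolding c1_def by (rule PM.mild_growth[OF u1(2) eh h0(2) t0 that])
  have g2: "norm (U1 t) \<le> c2 * exp (0 * t)" if "t \<ge> 0" for t
    using MX.mild_growth[OF U1(2) h h0(1) t0 that] unfolding c2_def by simp
  have c: "c1 \<ge> 0" "c2 \<ge> 0" using order_trans[OF norm_ge_zero g1[OF order_refl]] order_trans[OF norm_ge_zero g2[OF order_refl]] by auto
  obtain b1 where b1: "b1 \<ge> 0" "\<And>v. norm (mop fstR v) \<le> norm v * b1" using bounded_linear.nonneg_bounded[OF bl(3)] by blast
  obtain b2 where b2: "b2 \<ge> 0" "\<And>v. norm (mop onR v) \<le> norm v * b2" using bounded_linear.nonneg_bounded[OF bl(2)] by blast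
  define z where "z t = mop fstR (u1 t) - mop onR (U1 t)" for t
  have "z t0 = 0"
  proof (rule laplace_injective[where z = z and K = "norm B" and C = "c1 * b1 + c2 * b2" and ?\<tau>0.0 = "norm B"])
    show "continuous_on {0..} z" unfolding z_def
      by (intro continuous_intros bounded_linear.continuous_on[OF bl(3) u1(1)] bounded_linear.continuous_on[OF bl(2) U1(1)])
    show "norm (z t) \<le> (c1 * b1 + c2 * b2) * exp (norm B * t)" if t: "t \<ge> 0" for t
    proof -
      have "norm (z t) \<le> norm (mop fstR (u1 t)) + norm (mop onR (U1 t))" unfolding z_def by (rule norm_triangle_ineq4)
      also have "\<dots> \<le> norm (u1 t) * b1 + norm (U1 t) * b2" by (intro add_mono b1 b2)
      also have "\<dots> \<le> c1 * exp (norm B * t) * b1 + c2 * exp (norm B * t) * b2"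
      proof (intro add_mono mult_right_mono b1(1) b2(1) g1[OF t])
        have "c2 * exp (0 * t) \<le> c2 * exp (norm B * t)" using t c by (intro mult_left_mono) auto
        thus "norm (U1 t) \<le> c2 * exp (norm B * t)" using g2[OF t] by linarith
      qed
      finally show ?thesis by (simp add: algebra_simps)
    qed
    fix \<tau> assume \<tau>: "\<tau> > norm B"
    hence \<tau>0: "\<tau> > 0" using norm_ge_zero[of B] by linarith
    have lu: "laplaceable \<tau> u1" by (rule laplaceable_continuous[OF u1(1) g1 \<tau>])
    have lU: "laplaceable \<tau> U1" by (rule laplaceable_continuous[OF U1(1) g2 \<tau>0])
    have lh: "laplaceable \<tau> h"
      unfolding set_integrable_def
    proof (rule Bochner_Integration.integrable_bound[OF h[of 0 t0, unfolded set_integrable_def]])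
      have [measurable]: "(\<lambda>t. indicator {0..t0} t *\<^sub>R h t) \<in> borel_measurable borel"
        using borel_measurable_integrable[OF h[of 0 t0, unfolded set_integrable_def]] by simp
      have eq: "indicator {0..} t *\<^sub>R (exp (- \<tau> * t) *\<^sub>R h t) = exp (- \<tau> * t) *\<^sub>R (indicator {0..t0} t *\<^sub>R h t)" for t
        using h0(1)[of t] by (cases "t0 < t") (auto simp: indicator_def)
      show "(\<lambda>t. indicator {0..} t *\<^sub>R (exp (- \<tau> * t) *\<^sub>R h t)) \<in> borel_measurable lborel"
        unfolding eq by measurable
      show "AE t in lborel. norm (indicator {0..} t *\<^sub>R (exp (- \<tau> * t) *\<^sub>R h t)) \<le> norm (indicator {0..t0} t *\<^sub>R h t)"
      proof (rule AE_I2)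
        fix t
        show "norm (indicator {0..} t *\<^sub>R (exp (- \<tau> * t) *\<^sub>R h t)) \<le> norm (indicator {0..t0} t *\<^sub>R h t)"
        proof (cases "t \<in> {0..t0}")
          case True
          have "exp (- \<tau> * t) * norm (h t) \<le> 1 * norm (h t)"
            by (rule mult_right_mono) (use True \<tau>0 in auto)
          thus ?thesis using True by simp
        next
          case False
          thus ?thesis unfolding eq by simp
        qed
      qed
    qed
    have "mop fstR (laplace \<tau> u1) = mop onR (laplace \<tau> U1)"
    proof (rule stationary_matching[OF \<tau>0 \<tau>])
      show "\<tau> * (laplace \<tau> U1 \<bullet> \<psi>) = laplace \<tau> h \<bullet> \<psi> - laplace \<tau> U1 \<bullet> MX.A0 \<psi>" if "\<psi> \<in> span tens" for \<psi>
        using MX.laplace_mild[OF U1(2) h h0(1) t0 _ MX.core_dom[OF that], of \<tau>] \<tau>0 by simp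
      show "\<tau> * (laplace \<tau> u1 \<bullet> \<psi>) = (ap B (laplace \<tau> u1) + mop emb (laplace \<tau> h)) \<bullet> \<psi> - laplace \<tau> u1 \<bullet> PM.A0 \<psi>" if "\<psi> \<in> span tens" for \<psi>
        using PM.laplace_mild[OF u1(2) eh h0(2) t0 \<tau> PM.core_dom[OF that]]
        unfolding laplace_bounded_linear(1)[OF bl(4) lh] .
      have "mop offR (laplace \<tau> h) = laplace \<tau> (\<lambda>t. mop offR (h t))" by (rule laplace_bounded_linear(1)[OF bl(1) lh, symmetric])
      also have "\<dots> = 0"
        unfolding laplace_def set_lebesgue_integral_def
      proof (rule integral_eq_zero_AE)
        show "AE t in lborel. indicator {0..} t *\<^sub>R (exp (- \<tau> * t) *\<^sub>R mop offR (h t)) = 0"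
          using off by eventually_elim (simp add: h_def linear_simps(3)[OF bl(1)])
      qed
      finally show "mop offR (laplace \<tau> h) = 0" .
    qed
    thus "laplace \<tau> z = 0"
      unfolding z_def[abs_def] laplace_diff[OF laplace_bounded_linear(2)[OF bl(3) lu] laplace_bounded_linear(2)[OF bl(2) lU]]
        laplace_bounded_linear(1)[OF bl(3) lu] laplace_bounded_linear(1)[OF bl(2) lU] by simp
  qed (rule t0)
  thus ?thesis unfolding eu eU z_def by simp
qed

lemma well_posed: "strongly_well_posed_L2 (solves_PML \<sigma> ({0<..} \<times> UNIV) (\<lambda>_ _. 0))"
  unfolding strongly_well_posed_L2_def
\<comment> \<open>The constants come from Gronwall's inequality: the unperturbed group is isometric,
  and B contributes the rate \<open>norm B\<close>.\<close>
proof (rule exI[of _ 1], rule exI[of _ "norm B"], intro allI impI)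
  fix u0 :: "real^3 \<Rightarrow> (complex^3) \<times> (complex^3)" assume u0: "L2 u0"
  obtain Ke where Ke: "padm emb Ke" using padm_emb by blast
  have F0: "L1_loc_L2 (\<lambda>_ _. 0 :: complex^3)"
    by (auto simp: L1_loc_L2_def L2_norm_def set_integrable_def)
  have sub: "{0 :: real<..} \<times> UNIV \<subseteq> {0..} \<times> (UNIV :: (real^3) set)" by auto
  have iff: "solves_PML \<sigma> ({0<..} \<times> UNIV) (\<lambda>_ _. 0) u \<longleftrightarrow> PM.weak ({0<..} \<times> UNIV) B (\<lambda>t. cls (u t)) (\<lambda>_. 0)"
    if "L2_continuous_on {0..} u" for u
    unfolding solves_PML_iff[OF that closed_atLeast sub F0] by (simp only: cls_0 linear_simps(3)[OF bounded_linear_mop[OF Ke]])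
  have z: "integable p q (\<lambda>_. 0 :: ((complex^3) \<times> (complex^3)) l2)" for p q by (rule PM.integable_0)
  obtain U where U: "continuous_on {0..} U" "\<And>T. PM.mild B (\<lambda>_. 0) (cls u0) T U"
    by (rule PM.mild_exists[where F = "\<lambda>_. 0" and B = B and ?u0.0 = "cls u0", OF z]) blast
  \<comment> \<open>\<open>mild_weak\<close> works with the continuation by 0 to negative
    times.\<close>
  define V where "V t = (if t < 0 then 0 else U t)" for t
  have V: "continuous_on {0..} V" by (rule continuous_on_eq[OF U(1)]) (auto simp: V_def)
  have V0: "V 0 = cls u0" using PM.mild_0[OF U(2) order_refl] by (simp add: V_def)
  have w: "PM.weak ({0<..} \<times> UNIV) B V (\<lambda>_. 0)"
    by (rule PM.mild_weak[OF U(2) z]) (auto simp: V_def)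
  define u where "u t = fn (V t)" for t
  have u: "L2_continuous_on {0..} u" unfolding L2_continuous_on_iff u_def using V by simp
  have AE: "(AE x in lborel. v 0 x = u0 x) \<longleftrightarrow> cls (v 0) = V 0" if "L2_continuous_on {0..} v" for v
    using cls_eq_iff[OF _ u0, of "v 0"] that unfolding V0 L2_continuous_on_iff by auto
  show "\<exists>u. L2_continuous_on {0..} u \<and> solves_PML \<sigma> ({0<..} \<times> UNIV) (\<lambda>_ _. 0) u \<and> (AE x in lborel. u 0 x = u0 x) \<and>
      (\<forall>t\<ge>0. L2_norm (u t) \<le> 1 * exp (norm B * t) * L2_norm (u 0)) \<and>
      (\<forall>v. L2_continuous_on {0..} v \<and> solves_PML \<sigma> ({0<..} \<times> UNIV) (\<lambda>_ _. 0) v \<and> (AE x in lborel. v 0 x = u0 x) \<longrightarrow>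
           (\<forall>t\<ge>0. AE x in lborel. v t x = u t x))"
  proof (intro exI[of _ u] conjI allI impI)
    show "L2_continuous_on {0..} u" by (rule u)
    show "solves_PML \<sigma> ({0<..} \<times> UNIV) (\<lambda>_ _. 0) u" unfolding iff[OF u] u_def using w by simp
    show "AE x in lborel. u 0 x = u0 x" unfolding AE[OF u] by (simp add: u_def)
    fix t :: real assume t: "0 \<le> t"
    have n: "L2_norm (u s) = norm (V s)" for s unfolding u_def using norm_cls[OF L2_fn[of "V s"]] by simp
    have "norm (U t) \<le> norm (cls u0) * exp (norm B * t)"
      using PM.mild_bound[OF U(2) z t order_refl] by (simp add: set_lebesgue_integral_def)
    thus "L2_norm (u t) \<le> 1 * exp (norm B * t) * L2_norm (u 0)"
      unfolding n V0 using t by (simp add: V_def mult.commute)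
  next
    fix v and t :: real assume v: "L2_continuous_on {0..} v \<and> solves_PML \<sigma> ({0<..} \<times> UNIV) (\<lambda>_ _. 0) v \<and> (AE x in lborel. v 0 x = u0 x)" and t: "0 \<le> t"
    have vc: "L2_continuous_on {0..} v" using v by blast
    have "cls (v t) = V t"
    proof (rule PM.weak_unique[OF _ V z _ w _ t])
      show "continuous_on {0..} (\<lambda>t. cls (v t))" using vc unfolding L2_continuous_on_iff by blast
      show "PM.weak ({0<..} \<times> UNIV) B (\<lambda>t. cls (v t)) (\<lambda>_. 0)" using v iff[OF vc] by blast
      show "cls (v 0) = V 0" using v AE[OF vc] by blast
    qed
    moreover have "L2 (v t)" using vc t unfolding L2_continuous_on_def by auto
    ultimately show "AE x in lborel. v t x = u t x" using cls_eq_iff[of "v t" "u t"] by (simp add: u_def)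
  qed
qed

lemma perfect_matching: "perfectly_matched \<sigma> L"
  unfolding perfectly_matched_def
proof (intro allI impI)
  fix F assume "L1_loc_L2 F \<and> supported_in ({0..} \<times> region_R L) F"
  hence F: "L1_loc_L2 F" and supp: "AE z in lborel. z \<notin> {0..} \<times> R \<longrightarrow> F (fst z) (snd z) = 0"
    by (auto simp: supported_in_def region_R_def R_def)
  obtain Ko K1 Kf Ke where K: "padm offR Ko" "padm onR K1" "padm fstR Kf" "padm emb Ke" using padm_R padm_emb by blast
  note bl = K[THEN bounded_linear_mop]
  have sec: "AE t in lborel. AE x in lborel. (t, x) \<notin> {0..} \<times> R \<longrightarrow> F t x = 0"
    using lborel_pair.AE_pair[OF supp[unfolded lborel_prod[symmetric]]] by simp
  have L2F: "AE t in lborel. L2 (F t)" using F by (simp add: L1_loc_L2_def)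
  \<comment> \<open>At almost every negative time the section of the source vanishes; this
    representative vanishes at every negative time.\<close>
  define f where "f t = (if t < 0 then 0 else cls (F t))" for t
  have F_int: "integable p q (\<lambda>t. cls (F t))" for p q by (rule L1_loc_L2_integable[OF F])
  have f_int: "integable p q f" for p q by (rule integable_restrict[of "{0..}", OF _ F_int]) (auto simp: f_def)
  have eq: "AE t in lborel. cls (F t) = f t"
    using sec L2F
  proof eventually_elim
    case (elim t)
    have "cls (F t) = cls (\<lambda>_. 0)" if "t < 0"
    proof (rule cls_cong[OF _ elim(2) L2_0])
      show "AE x in lborel. F t x = 0" using elim(1) by eventually_elim (use that in auto)
    qed
    thus ?case by (auto simp: f_def cls_0)
  qed
  have off: "AE t in lborel. mop offR (f t) = 0"
    using sec L2F
  proof eventually_elim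
    case (elim t)
    have "mop offR (cls (F t)) = cls (\<lambda>_. 0)" if "t \<ge> 0"
      unfolding mop_cls[OF K(1) elim(2)]
    proof (rule cls_cong[OF _ L2_padm[OF K(1) elim(2)] L2_0])
      show "AE x in lborel. offR x (F t x) = 0"
        using elim(1) by eventually_elim (auto simp: offR_def dg_def vec_eq_iff indicator_def)
    qed
    thus ?case by (auto simp: f_def cls_0 linear_simps(3)[OF bl(1)] not_less)
  qed
  have PML: "solves_PML \<sigma> UNIV F u \<longleftrightarrow> PM.weak UNIV B (\<lambda>t. cls (u t)) (\<lambda>t. mop emb (cls (F t)))" if "L2_continuous_on UNIV u" for u
    by (rule solves_PML_iff[OF that closed_UNIV _ F]) simp
  have Max: "solves_Maxwell UNIV F U \<longleftrightarrow> MX.weak UNIV 0 (\<lambda>t. cls (U t)) (\<lambda>t. cls (F t))" if "L2_continuous_on UNIV U" for U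
    by (rule solves_Maxwell_iff[OF that closed_UNIV _ F]) simp
  have e1: "integable p q (\<lambda>t. mop emb (cls (F t)))" and e2: "integable p q (\<lambda>t. mop emb (f t))" for p q
    by (rule integable_bounded_linear[OF bl(4) F_int], rule integable_bounded_linear[OF bl(4) f_int])
  have e3: "AE t in lborel. mop emb (cls (F t)) = mop emb (f t)" using eq by eventually_elim simp
  have f0: "f t = 0" "mop emb (f t) = 0" if "t < 0" for t using that by (simp_all add: f_def linear_simps(3)[OF bl(4)])
  note P = PM.the_causal_solution[of "solves_PML \<sigma> UNIV F" B "\<lambda>t. mop emb (cls (F t))" "\<lambda>t. mop emb (f t)", OF PML e1 e2 e3 f0(2)]
  note M = MX.the_causal_solution[of "solves_Maxwell UNIV F" 0 "\<lambda>t. cls (F t)" f, OF Max F_int f_int eq f0(1)]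
  have P2: "PM.mild B (\<lambda>t. mop emb (f t)) 0 T (\<lambda>t. cls (u t))" if "causal_solution (solves_PML \<sigma> UNIV F) u" for u T
    by (rule P(2)[OF _ _ that])
  have M2: "MX.mild 0 f 0 T (\<lambda>t. cls (U t))" if "causal_solution (solves_Maxwell UNIV F) U" for U T
    by (rule M(2)[OF _ _ that])
  show "(\<exists>u. is_the_causal_solution (solves_PML \<sigma> UNIV F) u) \<and> (\<exists>U. is_the_causal_solution (solves_Maxwell UNIV F) U) \<and>
      (\<forall>u U. is_the_causal_solution (solves_PML \<sigma> UNIV F) u \<and> is_the_causal_solution (solves_Maxwell UNIV F) U \<longrightarrow>
         (\<forall>t. AE x in lborel. x \<in> region_R L \<longrightarrow> fst (u t x) - Sigma_mat \<sigma> x *v snd (u t x) = U t x))"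
  proof (intro conjI allI impI)
    show "\<exists>u. is_the_causal_solution (solves_PML \<sigma> UNIV F) u" by (rule P(1))
    show "\<exists>U. is_the_causal_solution (solves_Maxwell UNIV F) U" by (rule M(1))
    fix u U t assume "is_the_causal_solution (solves_PML \<sigma> UNIV F) u \<and> is_the_causal_solution (solves_Maxwell UNIV F) U"
    hence u: "causal_solution (solves_PML \<sigma> UNIV F) u" and U: "causal_solution (solves_Maxwell UNIV F) U"
      by (auto simp: is_the_causal_solution_def)
    have uL: "L2 (u t)" and UL: "L2 (U t)" using u U by (auto simp: causal_solution_def L2_continuous_on_def)
    \<comment> \<open>On R the absorption vanishes almost everywhere, so V - \<Sigma> W reduces to V
      and only V has to be compared.\<close>
    have "AE x in lborel. x \<in> R \<longrightarrow> fst (u t x) = U t x"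
    proof (cases "t < 0")
      case True
      hence "AE x in lborel. u t x = 0" "AE x in lborel. U t x = 0" using u U by (auto simp: causal_solution_def)
      thus ?thesis by eventually_elim simp
    next
      case False
      have "mop fstR (cls (u t)) = mop onR (cls (U t))"
        by (rule matching[OF f_int off P2[OF u] M2[OF U]]) (use False in simp)
      hence "AE x in lborel. fstR x (u t x) = onR x (U t x)"
        unfolding mop_cls[OF K(3) uL] mop_cls[OF K(2) UL] cls_eq_iff[OF L2_padm[OF K(3) uL] L2_padm[OF K(2) UL]] .
      thus ?thesis by eventually_elim (auto simp: fstR_def onR_def dg_1)
    qed
    with AE_S show "AE x in lborel. x \<in> region_R L \<longrightarrow> fst (u t x) - Sigma_mat \<sigma> x *v snd (u t x) = U t x"
    proof eventually_elim
      case (elim x)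
      show ?case
      proof
        assume "x \<in> region_R L"
        hence x: "x \<in> R" by (simp add: region_R_def R_def)
        have "Sigma_mat \<sigma> x *v snd (u t x) = dg (S x) (snd (u t x))" unfolding Sigma_dg(1) elim(1) ..
        also have "\<dots> = 0" using S_R[OF x] by (simp add: dg_def vec_eq_iff)
        finally show "fst (u t x) - Sigma_mat \<sigma> x *v snd (u t x) = U t x" using elim(2) x by simp
      qed
    qed
  qed
qed

end

theorem theorem3p6:
  fixes \<sigma> :: "3 \<Rightarrow> real \<Rightarrow> real" and L :: "3 \<Rightarrow> real"
  assumes "\<And>j. L j > 0"
    and "\<And>j. Linfty (\<sigma> j)"
    and "\<And>j. AE s in lborel. \<sigma> j s \<ge> 0"
    and "\<And>j. AE s in lborel. \<bar>s\<bar> \<le> L j \<longrightarrow> \<sigma> j s = 0"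
  shows "strongly_well_posed_L2 (solves_PML \<sigma> ({0<..} \<times> UNIV) (\<lambda>_ _. 0))
       \<and> perfectly_matched \<sigma> L"
proof -
  have "\<forall>j. \<exists>C. AE t in lborel. \<bar>\<sigma> j t\<bar> \<le> C" using assms(2) by (auto simp: Linfty_def)
  then obtain K where K: "AE t in lborel. \<bar>\<sigma> j t\<bar> \<le> K j" for j using choice[of "\<lambda>j C. AE t in lborel. \<bar>\<sigma> j t\<bar> \<le> C"] by blast
  \<comment> \<open>One bound for all three coefficients.\<close>
  define C where "C = (\<Sum>j\<in>UNIV. \<bar>K j\<bar>)"
  have C: "K j \<le> C" for j unfolding C_def using member_le_sum[of j UNIV "\<lambda>j. \<bar>K j\<bar>"] by simp
  have C0: "0 \<le> C" unfolding C_def by (simp add: sum_nonneg)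
  have [measurable]: "\<sigma> j \<in> borel_measurable borel" for j using assms(2) by (simp add: Linfty_def)
  \<comment> \<open>Clipping to [0, C] and setting the value 0 for \<bar>t\<bar> \<le>
    \<open>L j\<close> changes \<open>\<sigma> j\<close> on a null set only.\<close>
  define s where "s j t = (if \<bar>t\<bar> \<le> L j then 0 else max 0 (min C (\<sigma> j t)))" for j t
  interpret absorption \<sigma> s C L
  proof
    fix j t
    show "\<sigma> j \<in> borel_measurable borel" by measurable
    show "s j \<in> borel_measurable borel" unfolding s_def[abs_def] by measurable
    show "0 \<le> s j t" "s j t \<le> C" using C0 by (auto simp: s_def)
    show "s j t = 0" if "\<bar>t\<bar> \<le> L j" using that by (simp add: s_def)
    show "0 < L j" by (rule assms(1))
    show "AE t in lborel. \<sigma> j t = s j t" using assms(3)[of j] assms(4)[of j] K[of j]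
    proof eventually_elim
      case (elim t)
      show ?case using elim C[of j] by (auto simp: s_def)
    qed
  qed
  show ?thesis using well_posed perfect_matching by blast
qed

end
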